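(* Consider the hybrid system $\mathcal H$ described in the context (with state $\xi=(z,e,\epsilon,\widehat w,\tau,\eta)\in\mathbb X$ and input $\nu=(v,w)\in\mathbb V$, $\nu\in\mathcal L_\infty$), and suppose that assumptions (A1)-(A4) written out in the context hold. For each $i\in\mathcal N$, $\xi\in\mathbb X$ and $\nu\in\mathbb V$, let the flow dynamics $\dot\eta_i\in\Psi_i$ of the trigger variable $\eta_i$ be given by $$\Psi_i:=\varrho_i(|q_i(z,e,w)|)-\omega_i(\tau_i)\,\overline\gamma_i\,\beta_i\,W_i^2(\widetilde\epsilon_i)-\sigma_i(\eta_i)+s_i,\qquad \widetilde\epsilon_i:=\epsilon_i+\widehat w_i-w_i,$$ where $\overline\gamma_i=2\gamma_i\lambda_iL_i+\gamma_i^2(1+\lambda_i^2)$, $\beta_i=2\overline\beta_i^2/\underline\beta_i^2$, $\sigma_i$ is any $\mathcal K_\infty$-function, $s_i\ge0$ is a tuning parameter, $\lambda_i\in(0,1)$ is the tuning parameter and $\omega_i$ the set-valued map described in the context, and $\varrho_i,q_i,L_i,\gamma_i,W_i,\underline\beta_i,\overline\beta_i$ come from (A3) and (A4). Let the reset value of $\eta_i$ at a transmission of node $i$ be $\eta_i^0:=0$. Then $\mathcal H$ is persistently flowing, and the set $\mathcal A:=\{\xi\in\mathbb X: e=0\land\epsilon=0\land\eta=0\}$ is input-to-state stable (ISS) if $s_i=0$ for all $i\in\mathcal N$. It is input-to-state practically stable (ISpS) if $s_i>0$ for some $i\in\mathcal N$.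
   Context: **Hybrid systems.** Hybrid systems with inputs are understood in the sense of Goebel–Sanfelice–Teel and Cai–Teel: $\dot\xi\in F(\xi,\nu)$ on the flow set $\mathcal C$ and $\xi^+\in G(\xi,\nu)$ on the jump set $\mathcal D$; in $\mathcal C\cap\mathcal D$ the system can either flow or jump, and flow is only allowed if it keeps the solution in $\mathcal C$. Solution pairs $(\xi,\nu)$, hybrid time domains, maximality and the $\mathcal L_\infty$-norm $\|\nu\|_\infty$ of hybrid signals are as in these references. For a closed nonempty set $\mathcal A$, $|\xi|_{\mathcal A}:=\min_{y\in\mathcal A}|\xi-y|$. *Persistently flowing.* Given a set $\mathcal V\subseteq\mathcal L_\infty$ of hybrid inputs, $\mathcal H$ is persistently flowing if every maximal solution pair $(\xi,\nu)$ with $\nu\in\mathcal V$ is complete in the $t$-direction, i.e. $\sup_t\operatorname{dom}\xi=\sup_t\operatorname{dom}\nu=\infty$. *ISpS and ISS.* When $\mathcal H$ is persistently flowing with $\mathcal V\subseteq\mathcal L_\infty$, a closed nonempty set $\mathcal A$ is ISpS if there exist $\gamma\in\mathcal K$, $\beta\in\mathcal{KL}$ and $d\in\mathbb R_{\ge0}$ such that for any solution pair $(\xi,\nu)$ with $\nu\in\mathcal V$, $|\xi(t,j)|_{\mathcal A}\le\beta(|\xi(0,0)|_{\mathcal A},t)+\gamma(\|\nu\|_\infty)+d$ for all $(t,j)\in\operatorname{dom}\xi$. It is ISS if this holds with $d=0$. Here $\mathcal V$ is the set of hybrid inputs $\nu=(v,w)\in\mathcal L_\infty$ with values in $\mathbb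 V$. **Plant, observer and data.** Let $N\in\mathbb N_{>0}$, $\mathcal N=\{1,\dots,N\}$, $m=\sum_{i\in\mathcal N} m_i$. The plant is $\dot x=f_p(x,v)$, $y_i=h_{p,i}(x)\in\mathbb R^{m_i}$, with measured outputs $\widetilde y_i=y_i+w_i$, $i\in\mathcal N$, where $x\in\mathbb R^n$, $v$ is a disturbance with values in $\mathbb R^p$ and $w=(w_1,\dots,w_N)$ is measurement noise, $w_i$ taking values in $\mathbb R^{m_i}$; $v$ and the $w_i$ are in $\mathcal L_\infty$. Here $f_p:\mathbb R^n\times\mathbb R^p\to\mathbb R^n$ and the $h_{p,i}:\mathbb R^n\to\mathbb R^{m_i}$ are continuously differentiable; $h_p:=(h_{p,1},\dots,h_{p,N})$ (continuous differentiability is assumed of the $h_{p,i}$ only). The plant is forward complete: for all $x(0)\in\mathbb R^n$ and all $v\in\mathcal L_\infty$ there is a unique solution $x$ for all $t\ge0$. The observer is $\dot z=f_o(z,\widehat{\widetilde y})$, $\chi=h_o(z)$, with $z\in\mathbb R^q$, $\chi\in\mathbb R^n$ the estimate of $x$, $f_o:\mathbb R^q\times\mathbb R^m\to\mathbb R^q$, $h_o:\mathbb R^q\to\mathbb R^n$, and $\widehat{\widetilde y}\in\mathbb R^m$ the held estimate of $\widetilde y=(\widetilde y_1,\dots,\widetilde y_N)$. Node $i$ broadcasts $\widetilde y_i$ at its transmission times $t^i_k$, $k\in\mathbb N$, at which $\widehat{\widetilde y}_i$ is reset to $\widetilde y_i$; between transmissions $\tfrac{d}{dt}\widehat{\widetilde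 y}_i=\frac{\partial h_{p,i}}{\partial x}(h_o(z))\,f_p(h_o(z),0)$. One writes $\widehat{\widetilde y}_i=\widehat y_i+\widehat w_i$, where $\widehat w_i$ is the sampled noise ($\widehat w_i((t^i_k)^+)=w_i(t^i_k)$, $\dot{\widehat w}_i=0$), $\epsilon_i=\widehat y_i-y_i$ and $e=\chi-x$. Then $\widehat{\widetilde y}=y+\epsilon+\widehat w$. The timer $\tau_i$ measures the time since the last transmission of node $i$. **The hybrid system $\mathcal H$.** The state is $\xi=(z,e,\epsilon,\widehat w,\tau,\eta)\in\mathbb X:=\mathbb R^q\times\mathbb R^n\times\mathbb R^m\times\mathbb R^m\times\mathbb R_{\ge0}^N\times\mathbb R_{\ge0}^N$ and the input is $\nu=(v,w)\in\mathbb V:=\mathbb R^p\times\mathbb R^m$, with $\tau=(\tau_1,\dots,\tau_N)$, $\eta=(\eta_1,\dots,\eta_N)$, $\epsilon=(\epsilon_1,\dots,\epsilon_N)$, $\widehat w=(\widehat w_1,\dots,\widehat w_N)$. Write $x:=h_o(z)-e$. Flow map: $F(\xi,\nu)=\big(f_z,\,f_e,\,g,\,\mathbf 0_m,\,\mathbf 1_N,\,\Psi\big)$, where $\Psi=(\Psi_1,\dots,\Psi_N)$ and - $f_z(z,e,\epsilon,\widehat w):=f_o\big(z,h_p(h_o(z)-e)+\epsilon+\widehat w\big)$, - $f_e(z,e,\epsilon,\widehat w,v):=\frac{\partial h_o(z)}{\partial z}\,f_z(z,e,\epsilon,\widehat w)-f_p(h_o(z)-e,v)$, - $g=(g_1,\dots,g_N)$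 with $g_i(z,e,\epsilon,\widehat w,v):=\frac{\partial h_{p,i}}{\partial x}(h_o(z))\,f_p(h_o(z),0)-\frac{\partial h_{p,i}}{\partial x}(x)\,f_p(x,v)$. Flow set: $\mathcal C=\bigcap_{i\in\mathcal N}\mathcal C_i$, $\mathcal C_i=\{\xi\in\mathbb X:\eta_i\ge0\}$. Jump set: $\mathcal D=\bigcup_{i\in\mathcal N}\mathcal D_i$, $\mathcal D_i=\{\xi\in\mathbb X:\tau_i\ge\underline\tau_i\}$ with constants $\underline\tau_i\in(0,\tau^i_{\rm MIET}]$ (no restriction on $\nu$ in either set). Jump map: $G(\xi,\nu)=\bigcup_{i:\,\xi\in\mathcal D_i}\{\overline G_i(\xi,\nu)\}$, where $\overline G_i(\xi,\nu)$ leaves $z$, $e$ and all components with index $\ne i$ unchanged and sets $\epsilon_i\mapsto0$, $\widehat w_i\mapsto w_i$, $\tau_i\mapsto0$, $\eta_i\mapsto\eta_i^0$. **(A1)** Each sensor $i\in\mathcal N$ runs a copy of the observer and of the held outputs, with states $z_i,\widehat{\widetilde y}^{\,i}$, and the remote observer has states $z_0,\widehat{\widetilde y}^{\,0}$; at $t=0$, $z_i(0)=z_j(0)$ and $\widehat{\widetilde y}^{\,i}(0)=\widehat{\widetilde y}^{\,j}(0)$ for all $i,j\in\mathcal N\cup\{0\}$. (Hence all copies coincide for all times and a single $z$ and $\widehat{\widetilde y}$ are used.) **(A2)** The observer is forward complete: for all $z(0)\in\mathbb R^q$ and all measurable signals $\widehat{\widetilde y}$, there exists a unique solution $z$ of $\dot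 z=f_o(z,\widehat{\widetilde y})$ for all $t\ge0$. **(A3)** For all $i\in\mathcal N$ there exist a locally Lipschitz function $W_i:\mathbb R^{m_i}\to\mathbb R_{\ge0}$ and constants $\underline\beta_i,\overline\beta_i>0$ with $\underline\beta_i|\epsilon_i|\le W_i(\epsilon_i)\le\overline\beta_i|\epsilon_i|$ for all $\epsilon_i\in\mathbb R^{m_i}$, and there exist a constant $L_i\ge0$ and a continuous function $H_i:\mathbb R^q\times\mathbb R^n\times\mathbb R^m\times\mathbb R^p\to\mathbb R_{\ge0}$ such that for almost all $\epsilon_i$ and all $v\in\mathbb R^p$, $z\in\mathbb R^q$, $e\in\mathbb R^n$, $\widehat w\in\mathbb R^m$, $$\Big\langle\frac{\partial W_i(\epsilon_i)}{\partial\epsilon_i},g_i(z,e,\epsilon,\widehat w,v)\Big\rangle\le L_iW_i(\epsilon_i)+H_i(z,e,\widehat w,v).$$ **(A4)** There exist a locally Lipschitz $V:\mathbb R^n\to\mathbb R_{\ge0}$, functions $\alpha,\underline\alpha,\overline\alpha,\zeta\in\mathcal K_\infty$ and, for all $i\in\mathcal N$, positive semi-definite functions $\varrho_i:\mathbb R_{\ge0}\to\mathbb R_{\ge0}$ and constants $\mu_i,\gamma_i>0$ such that $\underline\alpha(|e|)\le V(e)\le\overline\alpha(|e|)$ for all $e\in\mathbb R^n$, and for almost all $e\in\mathbb R^n$ and all $z\in\mathbb R^q$, $\nu=(v,w)\in\mathbb V$, $\epsilon,\widehat w\in\mathbb R^m$, $$\langle\nabla V(e),f_e(z,e,\epsilon,\widehat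 w,v)\rangle\le-\alpha(|e|)+\zeta(|\nu|)+\sum_{i\in\mathcal N}\Big(-\varrho_i(|q_i(z,e,w)|)-H_i^2(z,e,\widehat w,v)+(\gamma_i^2-\mu_i)W_i^2(\epsilon_i)\Big),$$ where $q_i(z,e,w):=h_{p,i}(h_o(z))-h_{p,i}(h_o(z)-e)-w_i$. **The constants $\tau^i_{\rm MIET}$ and the maps $\omega_i$.** For the tuning parameter $\lambda_i\in(0,1)$, $\tau^i_{\rm MIET}>0$ is the time at which the solution of $\dot{\bar\phi}_i=-2L_i\bar\phi_i-\gamma_i(\bar\phi_i^2+1)$, $\bar\phi_i(0)=\lambda_i^{-1}$, satisfies $\bar\phi_i(\tau^i_{\rm MIET})=\lambda_i$. The set-valued map $\omega_i:\mathbb R_{\ge0}\rightrightarrows[0,1]$ is $\omega_i(s)=\{0\}$ for $s\in[0,\tau^i_{\rm MIET})$, $\omega_i(\tau^i_{\rm MIET})=[0,1]$ and $\omega_i(s)=\{1\}$ for $s>\tau^i_{\rm MIET}$.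
   Formalization: The ISS and ISpS estimates are stated only for solution pairs whose initial sampled noise satisfies |ŵ_i(0,0)| ≤ ‖ν‖_∞ for every i; for arbitrary ŵ(0,0) they fail (e = 0, ν = 0, ŵ = −ε ≠ 0 keeps ε constant). h_o is assumed differentiable. *)

theory Defs
  imports "HOL-Analysis.Analysis"
begin

section \<open>Comparison functions\<close>

definition class_K :: "(real \<Rightarrow> real) \<Rightarrow> bool" where
  "class_K \<gamma> \<longleftrightarrow> continuous_on {0..} \<gamma> \<and> strict_mono_on {0..} \<gamma> \<and> \<gamma> 0 = 0"

definition class_K_inf :: "(real \<Rightarrow> real) \<Rightarrow> bool" where
  "class_K_inf \<gamma> \<longleftrightarrow> class_K \<gamma> \<and> filterlim \<gamma> at_top at_top"

definition class_KL :: "(real \<Rightarrow> real \<Rightarrow> real) \<Rightarrow> bool" where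
  "class_KL \<beta> \<longleftrightarrow>
     continuous_on ({0..} \<times> {0..}) (\<lambda>(r, t). \<beta> r t) \<and>
     (\<forall>t\<ge>0. class_K (\<lambda>r. \<beta> r t)) \<and>
     (\<forall>r\<ge>0. antimono_on {0..} (\<beta> r) \<and> (\<beta> r \<longlongrightarrow> 0) at_top)"

definition pos_semidef :: "(real \<Rightarrow> real) \<Rightarrow> bool" where
  "pos_semidef \<rho> \<longleftrightarrow> \<rho> 0 = 0 \<and> (\<forall>r\<ge>0. 0 \<le> \<rho> r)"


section \<open>Regularity and Caratheodory solutions\<close>

definition locally_lipschitz :: "('a::metric_space \<Rightarrow> 'b::metric_space) \<Rightarrow> bool" where
  "locally_lipschitz f \<longleftrightarrow> (\<forall>x. \<exists>u>0. \<exists>K. K-lipschitz_on (cball x u) f)"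

definition cont_differentiable ::
    "('a::real_normed_vector \<Rightarrow> 'b::real_normed_vector) \<Rightarrow> bool" where
  "cont_differentiable f \<longleftrightarrow>
     (\<exists>f' :: 'a \<Rightarrow> 'a \<Rightarrow>\<^sub>L 'b.
        (\<forall>x. (f has_derivative blinfun_apply (f' x)) (at x)) \<and> continuous_on UNIV f')"

text \<open>Members of a division of a subset of the line are non-overlapping compact
  intervals, so \<open>Inf K\<close> and \<open>Sup K\<close> are the end points of \<open>K\<close>.\<close>

definition abs_cont_on :: "(real \<Rightarrow> 'a::real_normed_vector) \<Rightarrow> real set \<Rightarrow> bool" where
  "abs_cont_on f S \<longleftrightarrow>
     (\<forall>\<epsilon>>0. \<exists>\<delta>>0. \<forall>\<D> T. \<D> division_of T \<and> T \<subseteq> S \<and> (\<Sum>K\<in>\<D>. Sup K - Inf K) < \<delta> \<longrightarrow>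
        (\<Sum>K\<in>\<D>. norm (f (Sup K) - f (Inf K))) < \<epsilon>)"

definition locally_abs_cont_on :: "(real \<Rightarrow> 'a::real_normed_vector) \<Rightarrow> real set \<Rightarrow> bool" where
  "locally_abs_cont_on f I \<longleftrightarrow> (\<forall>a b. {a..b} \<subseteq> I \<longrightarrow> abs_cont_on f {a..b})"

definition ode_solution ::
    "(real \<Rightarrow> 'a::real_normed_vector \<Rightarrow> 'a) \<Rightarrow> real set \<Rightarrow> (real \<Rightarrow> 'a) \<Rightarrow> bool" where
  "ode_solution f I x \<longleftrightarrow> locally_abs_cont_on x I \<and>
     (AE t in lebesgue. t \<in> I \<longrightarrow> (x has_vector_derivative f t (x t)) (at t within I))"

text \<open>A solution exists for all \<open>t \<ge> 0\<close>, and it is the only one: every solution from the same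
  initial value, on whatever initial interval it lives, is a restriction of it (so there is no
  finite escape time either).\<close>

definition unique_global_solution ::
    "(real \<Rightarrow> 'a::real_normed_vector \<Rightarrow> 'a) \<Rightarrow> 'a \<Rightarrow> bool" where
  "unique_global_solution f x0 \<longleftrightarrow>
     (\<exists>x. ode_solution f {0..} x \<and> x 0 = x0 \<and>
        (\<forall>T>0. \<forall>y. ode_solution f {0..<T} y \<and> y 0 = x0 \<longrightarrow> (\<forall>t\<in>{0..<T}. y t = x t)))"


section \<open>Hybrid systems with inputs\<close>

text \<open>A hybrid signal is a function of \<open>(t, j)\<close> together with its hybrid time domain \<open>E\<close>; its
  values outside \<open>E\<close> are irrelevant.  In a solution pair \<open>(\<xi>, \<nu>)\<close> the two domains coincide.\<close>

type_synonym 'a hsignal = "real \<Rightarrow> nat \<Rightarrow> 'a"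

record ('x, 'u) hybrid_system =
  flow_set :: "'x set"
  flow_map :: "'x \<Rightarrow> 'u \<Rightarrow> 'x set"
  jump_set :: "'x set"
  jump_map :: "'x \<Rightarrow> 'u \<Rightarrow> 'x set"

definition compact_hybrid_time_domain :: "(real \<times> nat) set \<Rightarrow> bool" where
  "compact_hybrid_time_domain E \<longleftrightarrow>
     (\<exists>(J::nat) t. t 0 = 0 \<and> (\<forall>j<J. t j \<le> t (Suc j)) \<and> E = (\<Union>j<J. {t j..t (Suc j)} \<times> {j}))"

definition hybrid_time_domain :: "(real \<times> nat) set \<Rightarrow> bool" where
  "hybrid_time_domain E \<longleftrightarrow> E \<noteq> {} \<and> E \<subseteq> {0..} \<times> UNIV \<and>
     (\<forall>(T, J)\<in>E. compact_hybrid_time_domain (E \<inter> ({0..T} \<times> {0..J})))"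

definition slice :: "(real \<times> nat) set \<Rightarrow> nat \<Rightarrow> real set" where
  "slice E j = {t. (t, j) \<in> E}"

definition jump_times :: "(real \<times> nat) set \<Rightarrow> (real \<times> nat) set" where
  "jump_times E = {(t, j). (t, j) \<in> E \<and> (t, Suc j) \<in> E}"

definition hybrid_arc :: "(real \<times> nat) set \<Rightarrow> 'a::real_normed_vector hsignal \<Rightarrow> bool" where
  "hybrid_arc E \<xi> \<longleftrightarrow> hybrid_time_domain E \<and>
     (\<forall>j. locally_abs_cont_on (\<lambda>t. \<xi> t j) (slice E j))"

definition hybrid_input :: "(real \<times> nat) set \<Rightarrow> 'u::euclidean_space hsignal \<Rightarrow> bool" where
  "hybrid_input E \<nu> \<longleftrightarrow> hybrid_time_domain E \<and>
     (\<forall>j. (\<lambda>t. \<nu> t j) \<in> borel_measurable (lebesgue_on (slice E j)) \<and>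
          (\<forall>a b. {a..b} \<subseteq> slice E j \<longrightarrow>
             (\<exists>c. AE t in lebesgue. t \<in> {a..b} \<longrightarrow> norm (\<nu> t j) \<le> c)))"

text \<open>The hybrid supremum norm is the larger of the essential supremum over the domain and the
  supremum over the points at which a jump takes place.\<close>

definition hybrid_bound :: "(real \<times> nat) set \<Rightarrow> 'u::euclidean_space hsignal \<Rightarrow> real \<Rightarrow> bool" where
  "hybrid_bound E \<nu> c \<longleftrightarrow>
     (\<forall>j. AE t in lebesgue. t \<in> slice E j \<longrightarrow> norm (\<nu> t j) \<le> c) \<and>
     (\<forall>(t, j)\<in>jump_times E. norm (\<nu> t j) \<le> c)"

definition hybrid_Linf :: "(real \<times> nat) set \<Rightarrow> 'u::euclidean_space hsignal \<Rightarrow> bool" where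
  "hybrid_Linf E \<nu> \<longleftrightarrow> hybrid_input E \<nu> \<and> (\<exists>c. hybrid_bound E \<nu> c)"

definition hybrid_norm :: "(real \<times> nat) set \<Rightarrow> 'u::euclidean_space hsignal \<Rightarrow> real" where
  "hybrid_norm E \<nu> = Inf {c. 0 \<le> c \<and> hybrid_bound E \<nu> c}"

definition solution_pair ::
    "('x::real_normed_vector, 'u::euclidean_space) hybrid_system \<Rightarrow>
     (real \<times> nat) set \<Rightarrow> 'x hsignal \<Rightarrow> 'u hsignal \<Rightarrow> bool" where
  "solution_pair \<H> E \<xi> \<nu> \<longleftrightarrow>
     hybrid_arc E \<xi> \<and> hybrid_input E \<nu> \<and>
     \<xi> 0 0 \<in> closure (flow_set \<H>) \<union> jump_set \<H> \<and>
     (\<forall>j. (\<forall>t \<in> interior (slice E j). \<xi> t j \<in> flow_set \<H>) \<and>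
          (AE t in lebesgue. t \<in> slice E j \<longrightarrow>
             (\<exists>d \<in> flow_map \<H> (\<xi> t j) (\<nu> t j).
                ((\<lambda>s. \<xi> s j) has_vector_derivative d) (at t within slice E j)))) \<and>
     (\<forall>(t, j)\<in>jump_times E.
        \<xi> t j \<in> jump_set \<H> \<and> \<xi> t (Suc j) \<in> jump_map \<H> (\<xi> t j) (\<nu> t j))"

definition maximal_solution_pair ::
    "('x::real_normed_vector, 'u::euclidean_space) hybrid_system \<Rightarrow>
     (real \<times> nat) set \<Rightarrow> 'x hsignal \<Rightarrow> 'u hsignal \<Rightarrow> bool" where
  "maximal_solution_pair \<H> E \<xi> \<nu> \<longleftrightarrow> solution_pair \<H> E \<xi> \<nu> \<and>
     \<not> (\<exists>E' \<xi>' \<nu>'. solution_pair \<H> E' \<xi>' \<nu>' \<and> E \<subset> E' \<and>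
          (\<forall>(t, j)\<in>E. \<xi>' t j = \<xi> t j \<and> \<nu>' t j = \<nu> t j))"

definition persistently_flowing ::
    "('x::real_normed_vector, 'u::euclidean_space) hybrid_system \<Rightarrow> bool" where
  "persistently_flowing \<H> \<longleftrightarrow>
     (\<forall>E \<xi> \<nu>. maximal_solution_pair \<H> E \<xi> \<nu> \<and> hybrid_Linf E \<nu> \<longrightarrow> \<not> bdd_above (fst ` E))"

text \<open>The predicate \<open>P\<close> selects the solution pairs under consideration.\<close>

definition ISpS_with ::
    "real \<Rightarrow> ('x::real_normed_vector, 'u::euclidean_space) hybrid_system \<Rightarrow>
     ((real \<times> nat) set \<Rightarrow> 'x hsignal \<Rightarrow> 'u hsignal \<Rightarrow> bool) \<Rightarrow> 'x set \<Rightarrow> bool" where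
  "ISpS_with d \<H> P A \<longleftrightarrow> closed A \<and> A \<noteq> {} \<and>
     (\<exists>\<gamma> \<beta>. class_K \<gamma> \<and> class_KL \<beta> \<and>
        (\<forall>E \<xi> \<nu>. solution_pair \<H> E \<xi> \<nu> \<and> hybrid_Linf E \<nu> \<and> P E \<xi> \<nu> \<longrightarrow>
           (\<forall>(t, j)\<in>E. infdist (\<xi> t j) A
              \<le> \<beta> (infdist (\<xi> 0 0) A) t + \<gamma> (hybrid_norm E \<nu>) + d)))"

definition ISpS ::
    "('x::real_normed_vector, 'u::euclidean_space) hybrid_system \<Rightarrow>
     ((real \<times> nat) set \<Rightarrow> 'x hsignal \<Rightarrow> 'u hsignal \<Rightarrow> bool) \<Rightarrow> 'x set \<Rightarrow> bool" where
  "ISpS \<H> P A \<longleftrightarrow> (\<exists>d\<ge>0. ISpS_with d \<H> P A)"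

definition ISS ::
    "('x::real_normed_vector, 'u::euclidean_space) hybrid_system \<Rightarrow>
     ((real \<times> nat) set \<Rightarrow> 'x hsignal \<Rightarrow> 'u hsignal \<Rightarrow> bool) \<Rightarrow> 'x set \<Rightarrow> bool" where
  "ISS \<H> P A \<longleftrightarrow> ISpS_with 0 \<H> P A"


section \<open>The event-triggered state estimation scheme\<close>

text \<open>The nodes are the elements of \<open>'N\<close>.  As the \<open>m\<^sub>i\<close> may differ, \<open>\<real>\<^sup>m\<close> is \<open>real^'m\<close> and the
  function \<open>node\<close> says which node each coordinate belongs to; \<open>m\<^sub>i\<close> is the number of coordinates
  of node \<open>i\<close>, and \<open>\<real>^m\<^sub>i\<close> is identified with the vectors that vanish off these coordinates.\<close>

record ('n, 'p, 'q, 'm, 'N) scheme =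
  node :: "'m \<Rightarrow> 'N"
  fp :: "real^'n \<Rightarrow> real^'p \<Rightarrow> real^'n"
  hp :: "real^'n \<Rightarrow> real^'m"
  fo :: "real^'q \<Rightarrow> real^'m \<Rightarrow> real^'q"
  ho :: "real^'q \<Rightarrow> real^'n"
  Wf :: "'N \<Rightarrow> real^'m \<Rightarrow> real"
  beta_lo :: "'N \<Rightarrow> real"
  beta_hi :: "'N \<Rightarrow> real"
  Lc :: "'N \<Rightarrow> real"
  Hf :: "'N \<Rightarrow> real^'q \<Rightarrow> real^'n \<Rightarrow> real^'m \<Rightarrow> real^'p \<Rightarrow> real"
  rho :: "'N \<Rightarrow> real \<Rightarrow> real"
  gam :: "'N \<Rightarrow> real"
  lam :: "'N \<Rightarrow> real"
  tau_miet :: "'N \<Rightarrow> real"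
  tau_lo :: "'N \<Rightarrow> real"
  sig :: "'N \<Rightarrow> real \<Rightarrow> real"
  space_reg :: "'N \<Rightarrow> real"  \<comment> \<open>the tuning parameters \<open>s\<^sub>i\<close>\<close>

type_synonym ('n, 'q, 'm, 'N) state =
  "(real^'q) \<times> (real^'n) \<times> (real^'m) \<times> (real^'m) \<times> (real^'N) \<times> (real^'N)"

type_synonym ('p, 'm) input = "(real^'p) \<times> (real^'m)"

definition blk :: "('n::finite, 'p::finite, 'q::finite, 'm::finite, 'N::finite) scheme \<Rightarrow>
    'N \<Rightarrow> real^'m \<Rightarrow> real^'m" where
  "blk S i y = (\<chi> k. if node S k = i then y $ k else 0)"

definition hpi :: "('n::finite, 'p::finite, 'q::finite, 'm::finite, 'N::finite) scheme \<Rightarrow>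
    'N \<Rightarrow> real^'n \<Rightarrow> real^'m" where
  "hpi S i x = blk S i (hp S x)"

definition f_z :: "('n::finite, 'p::finite, 'q::finite, 'm::finite, 'N::finite) scheme \<Rightarrow>
    real^'q \<Rightarrow> real^'n \<Rightarrow> real^'m \<Rightarrow> real^'m \<Rightarrow> real^'q" where
  "f_z S z e \<epsilon> wh = fo S z (hp S (ho S z - e) + \<epsilon> + wh)"

definition f_e :: "('n::finite, 'p::finite, 'q::finite, 'm::finite, 'N::finite) scheme \<Rightarrow>
    real^'q \<Rightarrow> real^'n \<Rightarrow> real^'m \<Rightarrow> real^'m \<Rightarrow> real^'p \<Rightarrow> real^'n" where
  "f_e S z e \<epsilon> wh v =
     frechet_derivative (ho S) (at z) (f_z S z e \<epsilon> wh) - fp S (ho S z - e) v"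

text \<open>Neither \<open>g\<^sub>i\<close> nor \<open>g\<close> depends on \<open>\<epsilon>\<close> and the held noise.\<close>

definition g_i :: "('n::finite, 'p::finite, 'q::finite, 'm::finite, 'N::finite) scheme \<Rightarrow>
    'N \<Rightarrow> real^'q \<Rightarrow> real^'n \<Rightarrow> real^'p \<Rightarrow> real^'m" where
  "g_i S i z e v =
     frechet_derivative (hpi S i) (at (ho S z)) (fp S (ho S z) 0)
     - frechet_derivative (hpi S i) (at (ho S z - e)) (fp S (ho S z - e) v)"

definition g_all :: "('n::finite, 'p::finite, 'q::finite, 'm::finite, 'N::finite) scheme \<Rightarrow>
    real^'q \<Rightarrow> real^'n \<Rightarrow> real^'p \<Rightarrow> real^'m" where
  "g_all S z e v = (\<chi> k. g_i S (node S k) z e v $ k)"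

definition q_i :: "('n::finite, 'p::finite, 'q::finite, 'm::finite, 'N::finite) scheme \<Rightarrow>
    'N \<Rightarrow> real^'q \<Rightarrow> real^'n \<Rightarrow> real^'m \<Rightarrow> real^'m" where
  "q_i S i z e w = hpi S i (ho S z) - hpi S i (ho S z - e) - blk S i w"


subsection \<open>Standing assumptions\<close>

definition plant_assms ::
    "('n::finite, 'p::finite, 'q::finite, 'm::finite, 'N::finite) scheme \<Rightarrow> bool" where
  "plant_assms S \<longleftrightarrow>
     cont_differentiable (\<lambda>(x, v). fp S x v) \<and> (\<forall>i. cont_differentiable (hpi S i)) \<and>
     (\<forall>x0 v. v \<in> borel_measurable (lebesgue_on {0..}) \<and>
             (\<exists>c. AE t in lebesgue. t \<in> {0..} \<longrightarrow> norm (v t) \<le> c) \<longrightarrow>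
        unique_global_solution (\<lambda>t x. fp S x (v t)) x0)"

text \<open>Differentiability of \<open>h\<^sub>o\<close> gives meaning to the Jacobian in the flow map.\<close>

definition observer_assms ::
    "('n::finite, 'p::finite, 'q::finite, 'm::finite, 'N::finite) scheme \<Rightarrow> bool" where
  "observer_assms S \<longleftrightarrow>
     (\<forall>z. ho S differentiable (at z)) \<and>
     (\<forall>z0 y. y \<in> borel_measurable (lebesgue_on {0..}) \<longrightarrow>
        unique_global_solution (\<lambda>t z. fo S z (y t)) z0)"

text \<open>\<open>W\<^sub>i\<close> is a function of the \<open>i\<close>-th block only, so (by Fubini) quantifying over almost all
  \<open>\<epsilon>\<close> in \<open>\<real>\<^sup>m\<close> is the same as quantifying over almost all \<open>\<epsilon>\<^sub>i\<close>.  The gradient exists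
  almost everywhere because \<open>W\<^sub>i\<close> is locally Lipschitz.\<close>

definition growth_assms ::
    "('n::finite, 'p::finite, 'q::finite, 'm::finite, 'N::finite) scheme \<Rightarrow> bool" where
  "growth_assms S \<longleftrightarrow> (\<forall>i.
     (\<forall>\<epsilon>. Wf S i \<epsilon> = Wf S i (blk S i \<epsilon>)) \<and>
     locally_lipschitz (Wf S i) \<and>
     0 < beta_lo S i \<and> 0 < beta_hi S i \<and>
     (\<forall>\<epsilon>. 0 \<le> Wf S i \<epsilon> \<and> beta_lo S i * norm (blk S i \<epsilon>) \<le> Wf S i \<epsilon> \<and>
          Wf S i \<epsilon> \<le> beta_hi S i * norm (blk S i \<epsilon>)) \<and>
     0 \<le> Lc S i \<and>
     continuous_on UNIV (\<lambda>(z, e, wh, v). Hf S i z e wh v) \<and>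
     (\<forall>z e wh v. 0 \<le> Hf S i z e wh v) \<and>
     (AE \<epsilon> in lebesgue. \<exists>D. GDERIV (Wf S i) \<epsilon> :> D \<and>
        (\<forall>z e wh v. D \<bullet> g_i S i z e v \<le> Lc S i * Wf S i \<epsilon> + Hf S i z e wh v)))"

definition dissipation_assms ::
    "('n::finite, 'p::finite, 'q::finite, 'm::finite, 'N::finite) scheme \<Rightarrow> bool" where
  "dissipation_assms S \<longleftrightarrow>
     (\<forall>i. pos_semidef (rho S i) \<and> 0 < gam S i) \<and>
     (\<exists>(V :: real^'n \<Rightarrow> real) \<alpha> \<alpha>lo \<alpha>hi \<zeta> \<mu>.
        locally_lipschitz V \<and> (\<forall>e. 0 \<le> V e) \<and>
        class_K_inf \<alpha> \<and> class_K_inf \<alpha>lo \<and> class_K_inf \<alpha>hi \<and> class_K_inf \<zeta> \<and>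
        (\<forall>i. 0 < \<mu> i) \<and>
        (\<forall>e. \<alpha>lo (norm e) \<le> V e \<and> V e \<le> \<alpha>hi (norm e)) \<and>
        (AE e in lebesgue. \<exists>D. GDERIV V e :> D \<and>
           (\<forall>z v w \<epsilon> wh.
              D \<bullet> f_e S z e \<epsilon> wh v \<le> - \<alpha> (norm e) + \<zeta> (norm (v, w)) +
                (\<Sum>i\<in>UNIV. - rho S i (norm (q_i S i z e w)) - (Hf S i z e wh v)\<^sup>2 +
                   ((gam S i)\<^sup>2 - \<mu> i) * (Wf S i \<epsilon>)\<^sup>2))))"

definition tuning_assms ::
    "('n::finite, 'p::finite, 'q::finite, 'm::finite, 'N::finite) scheme \<Rightarrow> bool" where
  "tuning_assms S \<longleftrightarrow> (\<forall>i.
     0 < lam S i \<and> lam S i < 1 \<and>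
     0 < tau_miet S i \<and>
     (\<exists>\<phi>. \<phi> 0 = 1 / lam S i \<and> \<phi> (tau_miet S i) = lam S i \<and>
        (\<forall>t\<in>{0..tau_miet S i}.
           (\<phi> has_real_derivative
              (- 2 * Lc S i * \<phi> t - gam S i * ((\<phi> t)\<^sup>2 + 1))) (at t within {0..tau_miet S i}))) \<and>
     0 < tau_lo S i \<and> tau_lo S i \<le> tau_miet S i \<and>
     class_K_inf (sig S i) \<and> 0 \<le> space_reg S i)"


subsection \<open>The hybrid system\<close>

definition state_space :: "('n::finite, 'q::finite, 'm::finite, 'N::finite) state set" where
  "state_space = {(z, e, \<epsilon>, wh, \<tau>, \<eta>). (\<forall>i. 0 \<le> \<tau> $ i) \<and> (\<forall>i. 0 \<le> \<eta> $ i)}"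

definition omega :: "('n::finite, 'p::finite, 'q::finite, 'm::finite, 'N::finite) scheme \<Rightarrow>
    'N \<Rightarrow> real \<Rightarrow> real set" where
  "omega S i r = (if r < tau_miet S i then {0} else if r = tau_miet S i then {0..1} else {1})"

definition gam_bar :: "('n::finite, 'p::finite, 'q::finite, 'm::finite, 'N::finite) scheme \<Rightarrow>
    'N \<Rightarrow> real" where
  "gam_bar S i = 2 * gam S i * lam S i * Lc S i + (gam S i)\<^sup>2 * (1 + (lam S i)\<^sup>2)"

definition beta_coeff :: "('n::finite, 'p::finite, 'q::finite, 'm::finite, 'N::finite) scheme \<Rightarrow>
    'N \<Rightarrow> real" where
  "beta_coeff S i = 2 * (beta_hi S i)\<^sup>2 / (beta_lo S i)\<^sup>2"

definition Psi :: "('n::finite, 'p::finite, 'q::finite, 'm::finite, 'N::finite) scheme \<Rightarrow>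
    'N \<Rightarrow> ('n, 'q, 'm, 'N) state \<Rightarrow> ('p, 'm) input \<Rightarrow> real set" where
  "Psi S i = (\<lambda>(z, e, \<epsilon>, wh, \<tau>, \<eta>) (v, w).
     {rho S i (norm (q_i S i z e w))
        - o\<^sub>i * gam_bar S i * beta_coeff S i * (Wf S i (\<epsilon> + wh - w))\<^sup>2
        - sig S i (\<eta> $ i) + space_reg S i | o\<^sub>i. o\<^sub>i \<in> omega S i (\<tau> $ i)})"

definition flow_F :: "('n::finite, 'p::finite, 'q::finite, 'm::finite, 'N::finite) scheme \<Rightarrow>
    ('n, 'q, 'm, 'N) state \<Rightarrow> ('p, 'm) input \<Rightarrow> ('n, 'q, 'm, 'N) state set" where
  "flow_F S = (\<lambda>(z, e, \<epsilon>, wh, \<tau>, \<eta>) (v, w).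
     {(f_z S z e \<epsilon> wh, f_e S z e \<epsilon> wh v, g_all S z e v, 0, 1, \<psi>) | \<psi>.
        \<forall>i. \<psi> $ i \<in> Psi S i (z, e, \<epsilon>, wh, \<tau>, \<eta>) (v, w)})"

definition flow_C_i :: "'N::finite \<Rightarrow> ('n::finite, 'q::finite, 'm::finite, 'N) state set" where
  "flow_C_i i = {(z, e, \<epsilon>, wh, \<tau>, \<eta>) \<in> state_space. 0 \<le> \<eta> $ i}"

definition jump_D_i :: "('n::finite, 'p::finite, 'q::finite, 'm::finite, 'N::finite) scheme \<Rightarrow>
    'N \<Rightarrow> ('n, 'q, 'm, 'N) state set" where
  "jump_D_i S i = {(z, e, \<epsilon>, wh, \<tau>, \<eta>) \<in> state_space. tau_lo S i \<le> \<tau> $ i}"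

definition upd :: "'a^'k::finite \<Rightarrow> 'k \<Rightarrow> 'a \<Rightarrow> 'a^'k" where
  "upd y i a = (\<chi> k. if k = i then a else y $ k)"

definition jump_G_i :: "('n::finite, 'p::finite, 'q::finite, 'm::finite, 'N::finite) scheme \<Rightarrow>
    ('N \<Rightarrow> real) \<Rightarrow> 'N \<Rightarrow> ('n, 'q, 'm, 'N) state \<Rightarrow> ('p, 'm) input \<Rightarrow> ('n, 'q, 'm, 'N) state" where
  "jump_G_i S \<eta>0 i = (\<lambda>(z, e, \<epsilon>, wh, \<tau>, \<eta>) (v, w).
     (z, e,
      (\<chi> k. if node S k = i then 0 else \<epsilon> $ k),
      (\<chi> k. if node S k = i then w $ k else wh $ k),
      upd \<tau> i 0, upd \<eta> i (\<eta>0 i)))"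

definition hybrid_model :: "('n::finite, 'p::finite, 'q::finite, 'm::finite, 'N::finite) scheme \<Rightarrow>
    ('N \<Rightarrow> real) \<Rightarrow> (('n, 'q, 'm, 'N) state, ('p, 'm) input) hybrid_system" where
  "hybrid_model S \<eta>0 =
     \<lparr>flow_set = (\<Inter>i. flow_C_i i),
      flow_map = flow_F S,
      jump_set = (\<Union>i. jump_D_i S i),
      jump_map = (\<lambda>\<xi> \<nu>. {jump_G_i S \<eta>0 i \<xi> \<nu> | i. \<xi> \<in> jump_D_i S i})\<rparr>"

definition target_set :: "('n::finite, 'q::finite, 'm::finite, 'N::finite) state set" where
  "target_set = {(z, e, \<epsilon>, wh, \<tau>, \<eta>) \<in> state_space. e = 0 \<and> \<epsilon> = 0 \<and> \<eta> = 0}"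

text \<open>The component \<open>wh\<close> is the sampled noise.  The jump map keeps it so after the first
  transmission of a node; before that it is the initial value, which has to be a possible
  sample too, i.e. within the bound of the noise.  Without this no stability bound can hold:
  with \<open>e = 0\<close>, zero input and \<open>wh = - \<epsilon>\<close> the trigger never sees the error \<open>\<epsilon> \<noteq> 0\<close>, which then
  stays constant, although the target set and the input norm do not involve \<open>wh\<close>.\<close>

definition held_noise_sampled ::
    "('n::finite, 'p::finite, 'q::finite, 'm::finite, 'N::finite) scheme \<Rightarrow> (real \<times> nat) set \<Rightarrow>
     ('n, 'q, 'm, 'N) state hsignal \<Rightarrow> ('p, 'm) input hsignal \<Rightarrow> bool" where
  "held_noise_sampled S E \<xi> \<nu> \<longleftrightarrow>
     (case \<xi> 0 0 of (z, e, \<epsilon>, wh, \<tau>, \<eta>) \<Rightarrow> \<forall>i. norm (blk S i wh) \<le> hybrid_norm E \<nu>)"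

end

theory Submission
  imports Defs
begin

text \<open>
  The function \<open>U = V(e) + \<Sum>\<^sub>i \<gamma>\<^sub>i \<phi>\<^sub>i(\<tau>\<^sub>i) W\<^sub>i(\<epsilon>\<^sub>i)\<^sup>2 + \<Sum>\<^sub>i \<eta>\<^sub>i\<close>, where \<open>\<phi>\<^sub>i\<close> solves the Riccati
  equation up to \<open>\<tau>\<^sub>M\<^sub>I\<^sub>E\<^sub>T\<close> and stays at \<open>\<lambda>\<^sub>i\<close> afterwards, does not increase at jumps, and along flows
  it decreases at a rate that is a class \<open>K\<^sub>\<infinity>\<close> function of \<open>U\<close>, up to a gain of the input and
  \<open>\<Sum>\<^sub>i s\<^sub>i\<close>: before \<open>\<tau>\<^sub>M\<^sub>I\<^sub>E\<^sub>T\<close> the Riccati term absorbs the growth of \<open>W\<^sub>i\<close>, afterwards the trigger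
  does.  As \<open>V\<close> and \<open>W\<^sub>i\<close> are differentiable only almost everywhere, while a solution may stay in
  the exceptional set, the gradient inequalities are first turned into bounds on increments by
  averaging over small balls.

  Solutions can be continued because (A4) forces the observer to be open loop: \<open>h\<^sub>o(z)\<close> solves the
  undisturbed plant equation, whatever is transmitted.  With \<open>v = 0\<close> and \<open>w = \<epsilon> + wh\<close> this decouples
  the flow into plant, observer and scalar equations for \<open>\<eta>\<^sub>i\<close>.  On a bounded time interval there
  are finitely many jumps, since each resets a timer that has reached \<open>\<tau>\<^sub>i \<ge> tau_lo\<close>, and at a missing
  end point \<open>z\<close> and \<open>x\<close> converge by forward completeness, and all other components are Lipschitz.
\<close>

section \<open>Absolutely continuous curves\<close>

text \<open>Maximality concerns pairs: a pair is not maximal as soon as some input lets it continue.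
  So the input may be chosen, and the continuation never has to jump; it only has to keep \<eta>
  nonnegative, which the trigger could prevent after \<open>tau_miet\<close> but does not once the
  input hides the error from it. No regularity of \<open>fo\<close> is assumed and \<open>ho\<close>
  is merely differentiable, so absolute continuity does not pass from \<open>z\<close> to
  \<open>ho S z\<close>. The mean value inequality therefore works for compositions that are
  Lipschitz only pointwise. What makes \<open>ho S z\<close> tractable is that its derivative no
  longer involves \<open>fo\<close>. The weights in the Lyapunov function are dictated by
  cancellation: (A4) and the \<eta>-dynamics carry \<open>rho\<close> with opposite signs, and
  completing the square trades the cross term of W and H for the H^2 of (A4). \<open>gam_bar\<close>
  is the total coefficient of W^2 left, apart from \<mu>, when \<phi> rests at \<lambda>;
  \<open>beta_coeff\<close> is the price for the trigger seeing \<epsilon> + wh - w instead of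
  \<epsilon>. The timer values 0 and \<open>tau_miet\<close>, where \<phi> has kinks and
  \<open>omega\<close> may be multivalued, are met only finitely often on each compact flow
  interval.\<close>

definition disjoint_intervals :: "real set \<Rightarrow> 'i set \<Rightarrow> ('i \<Rightarrow> real) \<Rightarrow> ('i \<Rightarrow> real) \<Rightarrow> bool" where
  "disjoint_intervals S I u v \<longleftrightarrow> finite I \<and> (\<forall>i\<in>I. u i \<le> v i \<and> {u i..v i} \<subseteq> S) \<and>
     (\<forall>i\<in>I. \<forall>j\<in>I. i \<noteq> j \<longrightarrow> {u i<..<v i} \<inter> {u j<..<v j} = {})"

lemma disjoint_intervalsD:
  assumes "disjoint_intervals S I u v" "i \<in> I"
  shows "u i \<le> v i" "u i \<in> S" "v i \<in> S" "{u i..v i} \<subseteq> S"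
  using assms by (force simp: disjoint_intervals_def)+

text \<open>Indexed families are more flexible than divisions: a monotone reparametrisation, or
  cutting intervals at a tag, can produce degenerate or coinciding members, which the index still
  tells apart.\<close>

lemma abs_cont_onD:
  assumes "abs_cont_on f S" "0 < \<epsilon>"
  shows "\<exists>\<delta>>0. \<forall>(I :: 'i set) u v. disjoint_intervals S I u v \<longrightarrow> (\<Sum>i\<in>I. v i - u i) < \<delta> \<longrightarrow>
    (\<Sum>i\<in>I. norm (f (v i) - f (u i))) < \<epsilon>"
proof -
  from assms have "\<exists>\<delta>>0. \<forall>\<D> T. \<D> division_of T \<and> T \<subseteq> S \<and> (\<Sum>K\<in>\<D>. Sup K - Inf K) < \<delta> \<longrightarrow>
        (\<Sum>K\<in>\<D>. norm (f (Sup K) - f (Inf K))) < \<epsilon>"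
    unfolding abs_cont_on_def by (elim allE impE)
  then obtain \<delta> where "0 < \<delta>" and \<delta>: "\<forall>\<D> T. \<D> division_of T \<and> T \<subseteq> S \<and> (\<Sum>K\<in>\<D>. Sup K - Inf K) < \<delta> \<longrightarrow>
        (\<Sum>K\<in>\<D>. norm (f (Sup K) - f (Inf K))) < \<epsilon>"
    by (elim exE conjE) (rule that)
  have "(\<Sum>i\<in>I. norm (f (v i) - f (u i))) < \<epsilon>"
    if D: "disjoint_intervals S I u v" and len: "(\<Sum>i\<in>I. v i - u i) < \<delta>" for I :: "'i set" and u v
  proof -
    have fin: "finite I" and disj: "\<And>i j. i \<in> I \<Longrightarrow> j \<in> I \<Longrightarrow> i \<noteq> j \<Longrightarrow> {u i<..<v i} \<inter> {u j<..<v j} = {}"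
      using D by (auto simp: disjoint_intervals_def)
    \<comment> \<open>Degenerate intervals add nothing to either sum but may coincide as sets; once
      they are dropped, disjoint interiors make \<open>K\<close> injective.\<close>
    define I' where "I' = {i \<in> I. u i < v i}"
    define K where "K = (\<lambda>i. {u i..v i})"
    have inj: "inj_on K I'"
    proof
      fix i j assume ij: "i \<in> I'" "j \<in> I'" "K i = K j"
      then have "u i = u j" "v i = v j" by (auto simp: K_def I'_def Icc_eq_Icc)
      then show "i = j" using ij disj[of i j] by (force simp: I'_def)
    qed
    have div: "(K ` I') division_of (\<Union>(K ` I'))"
    proof (rule division_ofI)
      fix K1 K2 assume "K1 \<in> K ` I'" "K2 \<in> K ` I'" "K1 \<noteq> K2"
      then show "interior K1 \<inter> interior K2 = {}"
        using disj by (force simp: K_def I'_def interior_atLeastAtMost_real)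
    next
      fix L assume "L \<in> K ` I'"
      then show "\<exists>a b. L = cbox a b" by (auto simp: K_def)
    qed (use fin in \<open>auto simp: K_def I'_def\<close>)
    have red: "(\<Sum>L\<in>K ` I'. g (Sup L) (Inf L)) = (\<Sum>i\<in>I. g (v i) (u i))"
      if "\<And>x. g x x = (0::real)" for g
    proof -
      have "(\<Sum>L\<in>K ` I'. g (Sup L) (Inf L)) = (\<Sum>i\<in>I'. g (v i) (u i))"
        by (subst sum.reindex[OF inj]) (auto simp: K_def I'_def intro!: sum.cong)
      also have "\<dots> = (\<Sum>i\<in>I. g (v i) (u i))"
        using fin that disjoint_intervalsD(1)[OF D] by (intro sum.mono_neutral_left) (force simp: I'_def)+
      finally show ?thesis .
    qed
    have "\<Union> (K ` I') \<subseteq> S" using disjoint_intervalsD(4)[OF D] by (auto simp: K_def I'_def)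
    then show ?thesis
      using \<delta>[rule_format, of "K ` I'" "\<Union>(K ` I')"] div
        red[of "\<lambda>x y. x - y"] red[of "\<lambda>x y. norm (f x - f y)"] len by simp
  qed
  then show ?thesis using \<open>0 < \<delta>\<close> by (intro exI[of _ \<delta>] conjI allI impI)
qed

lemma abs_cont_onI:
  assumes "\<And>\<epsilon>. 0 < \<epsilon> \<Longrightarrow> \<exists>\<delta>>0. \<forall>(I :: real set set) u v. disjoint_intervals S I u v \<longrightarrow>
    (\<Sum>i\<in>I. v i - u i) < \<delta> \<longrightarrow> (\<Sum>i\<in>I. norm (f (v i) - f (u i))) < \<epsilon>"
  shows "abs_cont_on f S"
  unfolding abs_cont_on_def
proof (intro allI impI)
  fix \<epsilon> :: real assume "0 < \<epsilon>"
  from assms[OF this] obtain \<delta> where "0 < \<delta>" and \<delta>: "\<forall>(I :: real set set) u v. disjoint_intervals S I u v \<longrightarrow>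
    (\<Sum>i\<in>I. v i - u i) < \<delta> \<longrightarrow> (\<Sum>i\<in>I. norm (f (v i) - f (u i))) < \<epsilon>"
    by (elim exE conjE) (rule that)
  show "\<exists>\<delta>>0. \<forall>\<D> T. \<D> division_of T \<and> T \<subseteq> S \<and> (\<Sum>K\<in>\<D>. Sup K - Inf K) < \<delta> \<longrightarrow>
        (\<Sum>K\<in>\<D>. norm (f (Sup K) - f (Inf K))) < \<epsilon>"
  proof (intro exI[of _ \<delta>] conjI allI impI \<open>0 < \<delta>\<close>)
    fix \<D> T assume *: "\<D> division_of T \<and> T \<subseteq> S \<and> (\<Sum>K\<in>\<D>. Sup K - Inf K) < \<delta>"
    have int: "\<exists>a b. a \<le> b \<and> K = {a..b}" if "K \<in> \<D>" for K
      using * that unfolding division_of_def by (metis box_real(2) atLeastatMost_empty_iff2)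
    have K: "Inf K \<le> Sup K \<and> {Inf K..Sup K} = K" if "K \<in> \<D>" for K
      using int[OF that] by auto
    have "{Inf i<..<Sup i} \<inter> {Inf j<..<Sup j} = {}" if "i \<in> \<D>" "j \<in> \<D>" "i \<noteq> j" for i j
    proof -
      have "interior {Inf i..Sup i} \<inter> interior {Inf j..Sup j} = {}"
        using * that K[of i] K[of j] division_ofD(5)[of \<D> T i j] by simp
      then show ?thesis by (simp only: interior_atLeastAtMost_real)
    qed
    then have "disjoint_intervals S \<D> Inf Sup"
      using * K by (auto simp: division_of_def disjoint_intervals_def)
    then show "(\<Sum>K\<in>\<D>. norm (f (Sup K) - f (Inf K))) < \<epsilon>"
      using * \<delta>[rule_format, of \<D> Inf Sup] by simp
  qed
qed

lemma abs_cont_on_subset: "abs_cont_on f S \<Longrightarrow> T \<subseteq> S \<Longrightarrow> abs_cont_on f T"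
  unfolding abs_cont_on_def by (meson subset_trans)

text \<open>The common source of most closure properties below: increments dominated by those of two
  known functions are small whenever both of these are.\<close>

lemma abs_cont_on_dominated:
  assumes f: "abs_cont_on f S" and g: "abs_cont_on g S"
    and dom: "\<And>s t. s \<in> S \<Longrightarrow> t \<in> S \<Longrightarrow>
      norm (h s - h t) \<le> A * norm (f s - f t) + B * norm (g s - g t)"
  shows "abs_cont_on h S"
proof (rule abs_cont_onI)
  fix \<epsilon> :: real assume "0 < \<epsilon>"
  define \<epsilon>' where "\<epsilon>' = \<epsilon> / (2 * (\<bar>A\<bar> + \<bar>B\<bar> + 1))"
  have "0 < \<epsilon>'" using \<open>0 < \<epsilon>\<close> by (simp add: \<epsilon>'_def add_nonneg_pos)
  from abs_cont_onD[OF f this] obtain \<delta>1 where "0 < \<delta>1" and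
    \<delta>1: "\<forall>(I :: real set set) u v. disjoint_intervals S I u v \<longrightarrow> (\<Sum>i\<in>I. v i - u i) < \<delta>1 \<longrightarrow>
      (\<Sum>i\<in>I. norm (f (v i) - f (u i))) < \<epsilon>'" by (elim exE conjE) (rule that)
  from abs_cont_onD[OF g \<open>0 < \<epsilon>'\<close>] obtain \<delta>2 where "0 < \<delta>2" and
    \<delta>2: "\<forall>(I :: real set set) u v. disjoint_intervals S I u v \<longrightarrow> (\<Sum>i\<in>I. v i - u i) < \<delta>2 \<longrightarrow>
      (\<Sum>i\<in>I. norm (g (v i) - g (u i))) < \<epsilon>'" by (elim exE conjE) (rule that)
  show "\<exists>\<delta>>0. \<forall>(I :: real set set) u v. disjoint_intervals S I u v \<longrightarrow>
    (\<Sum>i\<in>I. v i - u i) < \<delta> \<longrightarrow> (\<Sum>i\<in>I. norm (h (v i) - h (u i))) < \<epsilon>"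
  proof (intro exI[of _ "min \<delta>1 \<delta>2"] conjI allI impI)
    fix I :: "real set set" and u v :: "real set \<Rightarrow> real"
    assume D: "disjoint_intervals S I u v" and "(\<Sum>i\<in>I. v i - u i) < min \<delta>1 \<delta>2"
    then have fg: "(\<Sum>i\<in>I. norm (f (v i) - f (u i))) \<le> \<epsilon>'" "(\<Sum>i\<in>I. norm (g (v i) - g (u i))) \<le> \<epsilon>'"
      using \<delta>1[rule_format, of I u v] \<delta>2[rule_format, of I u v] by (auto intro: less_imp_le)
    have "(\<Sum>i\<in>I. norm (h (v i) - h (u i)))
      \<le> (\<Sum>i\<in>I. \<bar>A\<bar> * norm (f (v i) - f (u i)) + \<bar>B\<bar> * norm (g (v i) - g (u i)))"
    proof (rule sum_mono)
      fix i assume "i \<in> I"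
      then have "norm (h (v i) - h (u i)) \<le> A * norm (f (v i) - f (u i)) + B * norm (g (v i) - g (u i))"
        using disjoint_intervalsD[OF D] by (intro dom) auto
      also have "\<dots> \<le> \<bar>A\<bar> * norm (f (v i) - f (u i)) + \<bar>B\<bar> * norm (g (v i) - g (u i))"
        by (intro add_mono mult_right_mono) auto
      finally show "norm (h (v i) - h (u i)) \<le> \<dots>" .
    qed
    also have "\<dots> = \<bar>A\<bar> * (\<Sum>i\<in>I. norm (f (v i) - f (u i))) + \<bar>B\<bar> * (\<Sum>i\<in>I. norm (g (v i) - g (u i)))"
      by (simp add: sum.distrib sum_distrib_left)
    also have "\<dots> \<le> \<bar>A\<bar> * \<epsilon>' + \<bar>B\<bar> * \<epsilon>'" using fg by (intro add_mono mult_left_mono) auto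
    also have "\<dots> < \<epsilon>"
    proof -
      have "\<epsilon>' * (2 * (\<bar>A\<bar> + \<bar>B\<bar> + 1)) = \<epsilon>"
        using add_nonneg_pos[of "\<bar>A\<bar> + \<bar>B\<bar>" 1] by (simp add: \<epsilon>'_def)
      moreover have "0 \<le> \<bar>A\<bar> * \<epsilon>'" "0 \<le> \<bar>B\<bar> * \<epsilon>'" using \<open>0 < \<epsilon>'\<close> by auto
      moreover have "\<epsilon>' * (2 * (\<bar>A\<bar> + \<bar>B\<bar> + 1)) = 2 * (\<bar>A\<bar> * \<epsilon>') + 2 * (\<bar>B\<bar> * \<epsilon>') + 2 * \<epsilon>'"
        by (simp add: algebra_simps)
      ultimately show ?thesis using \<open>0 < \<epsilon>'\<close> by linarith
    qed
    finally show "(\<Sum>i\<in>I. norm (h (v i) - h (u i))) < \<epsilon>" .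
  qed (use \<open>0 < \<delta>1\<close> \<open>0 < \<delta>2\<close> in auto)
qed

lemma abs_cont_on_cong:
  assumes "\<And>t. t \<in> S \<Longrightarrow> f t = g t" "abs_cont_on f S"
  shows "abs_cont_on g S"
  by (rule abs_cont_on_dominated[OF assms(2) assms(2), of _ 1 0]) (use assms(1) in auto)

lemma abs_cont_on_id: "abs_cont_on (\<lambda>t. t) S"
proof (rule abs_cont_onI)
  fix \<epsilon> :: real assume "0 < \<epsilon>"
  have "(\<Sum>i\<in>I. norm (v i - u i)) = (\<Sum>i\<in>I. v i - u i)" if "disjoint_intervals S I u v"
    for I :: "real set set" and u v
    using disjoint_intervalsD(1)[OF that] by (intro sum.cong) auto
  then show "\<exists>\<delta>>0. \<forall>(I :: real set set) u v. disjoint_intervals S I u v \<longrightarrow>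
    (\<Sum>i\<in>I. v i - u i) < \<delta> \<longrightarrow> (\<Sum>i\<in>I. norm (v i - u i)) < \<epsilon>"
    using \<open>0 < \<epsilon>\<close> by (intro exI[of _ \<epsilon>]) simp
qed

lemma abs_cont_on_lipschitz:
  assumes "C-lipschitz_on S f"
  shows "abs_cont_on f S"
  by (rule abs_cont_on_dominated[OF abs_cont_on_id abs_cont_on_id, of _ _ C 0])
    (use assms in \<open>auto simp: lipschitz_on_def dist_norm\<close>)

lemma abs_cont_on_image:
  assumes "abs_cont_on f S" "\<And>x y. norm (g x - g y) \<le> A * norm (x - y)"
  shows "abs_cont_on (\<lambda>t. g (f t)) S"
  using abs_cont_on_dominated[OF assms(1) assms(1), of "\<lambda>t. g (f t)" A 0] assms(2) by simp

lemma abs_cont_on_Pair: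
  assumes "abs_cont_on f S" "abs_cont_on g S"
  shows "abs_cont_on (\<lambda>t. (f t, g t)) S"
  by (rule abs_cont_on_dominated[OF assms, of _ 1 1]) (simp add: norm_Pair_le)

lemma abs_cont_on_diff:
  assumes "abs_cont_on f S" "abs_cont_on g S"
  shows "abs_cont_on (\<lambda>t. f t - g t) S"
proof (rule abs_cont_on_dominated[OF assms, of _ 1 1])
  fix s t
  have "f s - g s - (f t - g t) = (f s - f t) - (g s - g t)" by simp
  then show "norm (f s - g s - (f t - g t)) \<le> 1 * norm (f s - f t) + 1 * norm (g s - g t)"
    using norm_triangle_ineq4[of "f s - f t" "g s - g t"] by (simp only: mult_1)
qed

lemma abs_cont_on_imp_continuous_on:
  assumes f: "abs_cont_on f S" and "convex S"
  shows "continuous_on S f"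
  unfolding continuous_on_iff
proof (intro ballI allI impI)
  fix x and e :: real assume "x \<in> S" "0 < e"
  from abs_cont_onD[OF f \<open>0 < e\<close>] obtain \<delta> where "0 < \<delta>" and
    \<delta>: "\<forall>(I :: unit set) u v. disjoint_intervals S I u v \<longrightarrow> (\<Sum>i\<in>I. v i - u i) < \<delta> \<longrightarrow>
      (\<Sum>i\<in>I. norm (f (v i) - f (u i))) < e" by (elim exE conjE) (rule that)
  have key: "norm (f b - f a) < e" if "a \<le> b" "a \<in> S" "b \<in> S" "b - a < \<delta>" for a b
  proof -
    have "{a..b} \<subseteq> S" using \<open>convex S\<close> that by (auto simp: is_interval_convex_1 intro: mem_is_interval_1_I)
    then show ?thesis
      using \<delta>[rule_format, of "{()}" "\<lambda>_. a" "\<lambda>_. b"] that by (simp add: disjoint_intervals_def)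
  qed
  have "dist (f y) (f x) < e" if "y \<in> S" "dist y x < \<delta>" for y
    using key[of x y] key[of y x] that \<open>x \<in> S\<close>
    by (cases "x \<le> y") (auto simp: dist_norm norm_minus_commute abs_if split: if_splits)
  then show "\<exists>d>0. \<forall>x'\<in>S. dist x' x < d \<longrightarrow> dist (f x') (f x) < e" using \<open>0 < \<delta>\<close> by blast
qed

text \<open>\<open>p\<close> may collapse intervals but never lengthens them, so it maps admissible
  families to admissible ones. Needed for shifts and for clamping with \<open>min\<close> and
  \<open>max\<close>.\<close>

lemma abs_cont_on_compose_mono:
  assumes f: "abs_cont_on f T" and p: "mono_on S p" "\<And>x y. \<lbrakk>x \<in> S; y \<in> S; x \<le> y\<rbrakk> \<Longrightarrow> p y - p x \<le> y - x"
    and "convex T" "p ` S \<subseteq> T"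
  shows "abs_cont_on (\<lambda>t. f (p t)) S"
proof (rule abs_cont_onI)
  fix \<epsilon> :: real assume "0 < \<epsilon>"
  from abs_cont_onD[OF f this] obtain \<delta> where "0 < \<delta>" and
    \<delta>: "\<forall>(I :: real set set) u v. disjoint_intervals T I u v \<longrightarrow> (\<Sum>i\<in>I. v i - u i) < \<delta> \<longrightarrow>
      (\<Sum>i\<in>I. norm (f (v i) - f (u i))) < \<epsilon>" by (elim exE conjE) (rule that)
  show "\<exists>\<delta>>0. \<forall>(I :: real set set) u v. disjoint_intervals S I u v \<longrightarrow>
    (\<Sum>i\<in>I. v i - u i) < \<delta> \<longrightarrow> (\<Sum>i\<in>I. norm (f (p (v i)) - f (p (u i)))) < \<epsilon>"
  proof (intro exI[of _ \<delta>] conjI allI impI \<open>0 < \<delta>\<close>)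
    fix I :: "real set set" and u v :: "real set \<Rightarrow> real"
    assume D: "disjoint_intervals S I u v" and len: "(\<Sum>i\<in>I. v i - u i) < \<delta>"
    then have I: "finite I" and disj: "\<forall>i\<in>I. \<forall>j\<in>I. i \<noteq> j \<longrightarrow> {u i<..<v i} \<inter> {u j<..<v j} = {}"
      by (auto simp: disjoint_intervals_def)
    have uv: "u i \<in> S" "v i \<in> S" "p (u i) \<le> p (v i)" "u i \<le> v i" if "i \<in> I" for i
    proof -
      show *: "u i \<in> S" "v i \<in> S" "u i \<le> v i" using disjoint_intervalsD[OF D that] by auto
      then show "p (u i) \<le> p (v i)" using p(1) by (simp add: mono_on_def)
    qed
    have "disjoint_intervals T I (\<lambda>i. p (u i)) (\<lambda>i. p (v i))"
      unfolding disjoint_intervals_def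
    proof (intro conjI ballI impI I)
      fix i assume i: "i \<in> I"
      then show "p (u i) \<le> p (v i)" using uv by blast
      show "{p (u i)..p (v i)} \<subseteq> T"
        using uv[OF i] assms(4,5) mem_is_interval_1_I[of T "p (u i)" "p (v i)"]
        by (auto simp: is_interval_convex_1 image_subset_iff)
    next
      fix i j assume ij: "i \<in> I" "j \<in> I" "i \<noteq> j"
      have ord: "v i \<le> u j \<or> v j \<le> u i \<or> u i = v i \<or> u j = v j"
      proof (rule ccontr)
        assume "\<not> ?thesis"
        then have "max (u i) (u j) < min (v i) (v j)" using uv(4)[OF ij(1)] uv(4)[OF ij(2)] by auto
        then obtain m where "max (u i) (u j) < m" "m < min (v i) (v j)" using dense by blast
        then have "m \<in> {u i<..<v i} \<inter> {u j<..<v j}" by auto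
        then show False using disj ij by blast
      qed
      have "p (v i) \<le> p (u j)" if "v i \<le> u j" using that uv ij p(1) by (simp add: mono_on_def)
      moreover have "p (v j) \<le> p (u i)" if "v j \<le> u i" using that uv ij p(1) by (simp add: mono_on_def)
      ultimately show "{p (u i)<..<p (v i)} \<inter> {p (u j)<..<p (v j)} = {}" using ord by fastforce
    qed
    moreover have "(\<Sum>i\<in>I. p (v i) - p (u i)) < \<delta>"
    proof -
      have "(\<Sum>i\<in>I. p (v i) - p (u i)) \<le> (\<Sum>i\<in>I. v i - u i)"
        using uv p(2) by (intro sum_mono) auto
      then show ?thesis using len by simp
    qed
    ultimately show "(\<Sum>i\<in>I. norm (f (p (v i)) - f (p (u i)))) < \<epsilon>"
      using \<delta>[rule_format, of I "\<lambda>i. p (u i)" "\<lambda>i. p (v i)"] by blast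
  qed
qed

text \<open>Up to the constant \<open>f c\<close>, \<open>f\<close> is the sum of its two clamped
  versions, each of which sees only one half of the interval.\<close>

lemma abs_cont_on_join:
  fixes f :: "real \<Rightarrow> 'a::real_normed_vector"
  assumes "abs_cont_on f {a..c}" "abs_cont_on f {c..b}" "a \<le> c" "c \<le> b"
  shows "abs_cont_on f {a..b}"
proof (rule abs_cont_on_dominated)
  show "abs_cont_on (\<lambda>t. f (min t c)) {a..b}"
    by (rule abs_cont_on_compose_mono[OF assms(1)]) (use assms in \<open>auto intro!: mono_onI simp: min_def\<close>)
  show "abs_cont_on (\<lambda>t. f (max t c)) {a..b}"
    by (rule abs_cont_on_compose_mono[OF assms(2)]) (use assms in \<open>auto intro!: mono_onI simp: max_def\<close>)
  show "norm (f s - f t) \<le> 1 * norm (f (min s c) - f (min t c)) + 1 * norm (f (max s c) - f (max t c))" for s t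
  proof -
    have "f s - f t = (f (min s c) - f (min t c)) + (f (max s c) - f (max t c))"
      by (auto simp: min_def max_def)
    then show ?thesis by (metis mult_1 norm_triangle_ineq)
  qed
qed

lemma abs_cont_on_add:
  assumes "abs_cont_on f S" "abs_cont_on g S"
  shows "abs_cont_on (\<lambda>t. f t + g t) S"
proof (rule abs_cont_on_dominated[OF assms, of _ 1 1])
  fix s t
  have "f s + g s - (f t + g t) = (f s - f t) + (g s - g t)" by simp
  then show "norm (f s + g s - (f t + g t)) \<le> 1 * norm (f s - f t) + 1 * norm (g s - g t)"
    using norm_triangle_ineq[of "f s - f t" "g s - g t"] by (simp only: mult_1)
qed

lemma abs_cont_on_const: "abs_cont_on (\<lambda>t. c) S"
  by (rule abs_cont_on_lipschitz[of 0]) (simp add: lipschitz_on_def)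

lemma abs_cont_on_sum:
  assumes "\<And>i. i \<in> I \<Longrightarrow> abs_cont_on (f i) S"
  shows "abs_cont_on (\<lambda>t. \<Sum>i\<in>I. f i t) S"
  using assms by (induction I rule: infinite_finite_induct) (auto intro: abs_cont_on_add abs_cont_on_const)

lemma abs_cont_on_shift:
  assumes "abs_cont_on f {c + a..d + a}"
  shows "abs_cont_on (\<lambda>t. f (t + a)) {c..d}"
  by (rule abs_cont_on_compose_mono[OF assms]) (auto intro!: mono_onI)

section \<open>The mean value inequality along absolutely continuous curves\<close>

text \<open>Calmness: a Lipschitz bound against one base point, with a constant that may depend on
  it. It covers locally Lipschitz functions such as \<open>V\<close> and merely differentiable ones
  such as \<open>ho\<close> alike, and it is stable under sums, products and composition.\<close>

definition calm_at :: "('a::metric_space \<Rightarrow> 'b::metric_space) \<Rightarrow> 'a \<Rightarrow> bool" where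
  "calm_at F x \<longleftrightarrow> (\<exists>K. \<forall>\<^sub>F y in nhds x. dist (F y) (F x) \<le> K * dist y x)"

text \<open>Difference quotients over intervals that straddle \<open>t\<close>: this is what the tags of a fine
  division provide.\<close>

definition upper_drv :: "(real \<Rightarrow> real) \<Rightarrow> real \<Rightarrow> real \<Rightarrow> bool" where
  "upper_drv u t c \<longleftrightarrow> (\<forall>\<delta>>0. \<exists>r>0. \<forall>x y. t - r < x \<longrightarrow> x \<le> t \<longrightarrow> t \<le> y \<longrightarrow> y < t + r \<longrightarrow>
     u y - u x \<le> (c + \<delta>) * (y - x))"

lemma negligible_open_cover:
  fixes N :: "'a::euclidean_space set"
  assumes "negligible N" "0 < e"
  obtains U where "open U" "N \<subseteq> U" "U \<in> lmeasurable" "measure lebesgue U < e"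
proof -
  have N: "N \<in> null_sets lebesgue" using assms negligible_iff_null_sets by blast
  then obtain U where U: "open U" "N \<subseteq> U" "U - N \<in> lmeasurable" "emeasure lebesgue (U - N) < ennreal e"
    using sets_lebesgue_outer_open[of N e] assms by auto
  have "emeasure lebesgue U = emeasure lebesgue (U - N)"
    using N U(1) by (metis emeasure_Diff_null_set lebesgue_openin lborelD sets_completionI_sets sets_lborel borel_open)
  then have "emeasure lebesgue U < ennreal e" using U by simp
  moreover from this have "U \<in> lmeasurable"
    using U(1) by (metis fmeasurableI lborelD borel_open sets_completionI_sets sets_lborel ennreal_less_top order_less_trans infinity_ennreal_def)
  ultimately show ?thesis using that[OF U(1,2)] assms(2)
    by (metis emeasure_eq_measure2 ennreal_less_iff measure_nonneg)
qed

lemma partial_division_length: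
  assumes "p tagged_partial_division_of {a..b}" "\<And>x K. (x, K) \<in> p \<Longrightarrow> K \<subseteq> U" "U \<in> lmeasurable"
  shows "(\<Sum>(x, K)\<in>p. Sup K - Inf K) \<le> measure lebesgue (U :: real set)"
proof -
  have K: "K \<noteq> {} \<and> (\<exists>u v. u \<le> v \<and> K = {u..v})" if "(x, K) \<in> p" for x K
    using assms(1) that unfolding tagged_partial_division_of_def
    by (metis atLeastatMost_empty_iff2 box_real(2) empty_iff)
  have td: "p tagged_division_of \<Union>(snd ` p)" using assms(1) by (rule tagged_partial_division_of_Union_self)
  have "(\<Sum>(x, K)\<in>p. Sup K - Inf K) = (\<Sum>(x, K)\<in>p. measure lebesgue K)"
    by (intro sum.cong refl) (use K in fastforce)
  also have "\<dots> = sum (measure lebesgue) (snd ` p)"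
  proof (rule sum.over_tagged_division_lemma[OF td])
    fix u v :: real assume "box u v = {}"
    then have "v \<le> u" by simp
    then show "measure lebesgue (cbox u v) = 0" by (cases "u = v") auto
  qed
  also have "\<dots> = measure lebesgue (\<Union>(snd ` p))"
    using content_division[OF division_of_tagged_division[OF td]] by simp
  also have "\<dots> \<le> measure lebesgue U"
  proof (rule measure_mono_fmeasurable)
    show "\<Union>(snd ` p) \<in> sets lebesgue"
      using K tagged_division_of_finite[OF td] by (intro sets.finite_Union) fastforce+
  qed (use assms(2,3) in force)+
  finally show ?thesis .
qed

text \<open>\<open>F \<circ> z\<close> is not assumed to be absolutely continuous: in the application to \<open>h\<^sub>o\<close>, which is
  only differentiable, this is part of what has to be shown.  The exceptional null set is split
  into countably many pieces according to the constant in the pointwise Lipschitz condition.\<close>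

lemma abs_cont_curve_le:
  fixes z :: "real \<Rightarrow> 'a::real_normed_vector" and F :: "'a \<Rightarrow> real"
  assumes z: "abs_cont_on z {a..b}" and "a \<le> b"
    and calm: "\<And>t. t \<in> {a..b} \<Longrightarrow> calm_at F (z t)"
    and drv: "AE t in lebesgue. t \<in> {a<..<b} \<longrightarrow> upper_drv (\<lambda>s. F (z s)) t c"
  shows "F (z b) - F (z a) \<le> c * (b - a)"
proof -
  define u where "u = (\<lambda>s. F (z s))"
  have "continuous_on {a..b} z" using z by (rule abs_cont_on_imp_continuous_on) simp
  have "\<exists>k::nat. \<exists>r>0. \<forall>s\<in>{a..b}. \<bar>s - t\<bar> < r \<longrightarrow> \<bar>u s - u t\<bar> \<le> real k * norm (z s - z t)"
    if t: "t \<in> {a..b}" for t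
  proof -
    obtain K where "\<forall>\<^sub>F y in nhds (z t). dist (F y) (F (z t)) \<le> K * dist y (z t)"
      using calm[OF t] by (auto simp: calm_at_def)
    then obtain e where e: "e > 0" "\<And>y. dist y (z t) < e \<Longrightarrow> dist (F y) (F (z t)) \<le> K * dist y (z t)"
      by (auto simp: eventually_nhds_metric)
    obtain r where r: "r > 0" "\<And>s. s \<in> {a..b} \<Longrightarrow> dist s t < r \<Longrightarrow> dist (z s) (z t) < e"
      using \<open>continuous_on {a..b} z\<close> t e(1) unfolding continuous_on_iff by metis
    obtain k :: nat where "K \<le> real k" using real_arch_simple by blast
    show ?thesis
    proof (intro exI[of _ k] exI[of _ r] conjI r(1) ballI impI)
      fix s assume "s \<in> {a..b}" "\<bar>s - t\<bar> < r"
      then have "\<bar>u s - u t\<bar> \<le> K * norm (z s - z t)" using e(2) r(2)[of s] by (simp add: u_def dist_norm)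
      also have "\<dots> \<le> real k * norm (z s - z t)" using \<open>K \<le> real k\<close> by (intro mult_right_mono) auto
      finally show "\<bar>u s - u t\<bar> \<le> real k * norm (z s - z t)" .
    qed
  qed
  then obtain k :: "real \<Rightarrow> nat" and \<rho> where kr: "\<And>t. t \<in> {a..b} \<Longrightarrow> \<rho> t > 0"
    "\<And>t s. \<lbrakk>t \<in> {a..b}; s \<in> {a..b}; \<bar>s - t\<bar> < \<rho> t\<rbrakk> \<Longrightarrow> \<bar>u s - u t\<bar> \<le> real (k t) * norm (z s - z t)"
    by metis
  \<comment> \<open>The end points count as exceptional, since the derivative bound concerns the
    open interval only.\<close>
  define N where "N = {t. t \<in> {a..b} \<and> \<not> (t \<in> {a<..<b} \<and> upper_drv u t c)}"
  have "negligible N"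
  proof -
    have "negligible {t. \<not> (t \<in> {a<..<b} \<longrightarrow> upper_drv u t c)}"
      using drv unfolding u_def[symmetric] by (simp add: eventually_ae_filter negligible_iff_null_sets)
        (meson null_sets_completion_subset completion.complete2)
    moreover have "negligible {a, b}" by auto
    ultimately show ?thesis
      by (rule negligible_subset[OF negligible_Un]) (auto simp: N_def)
  qed
  have bound: "u b - u a \<le> c * (b - a) + \<epsilon> * (b - a) + \<epsilon>" if "0 < \<epsilon>" for \<epsilon>
  proof -
    \<comment> \<open>Intervals tagged at an exceptional \<open>t\<close> with
      \<open>k t = j\<close> cost at most \<open>j\<close> times the variation of \<open>z\<close>
      over them; these weights make the cost summable over all \<open>j\<close>.\<close>
    define \<epsilon>' where "\<epsilon>' j = \<epsilon> / (8 * (real j + 1) * 2 ^ j)" for j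
    have \<epsilon>'_pos: "0 < \<epsilon>' j" for j using that by (simp add: \<epsilon>'_def)
    have "\<exists>\<delta>>0. \<forall>(I :: (real \<times> real set) set) u v. disjoint_intervals {a..b} I u v \<longrightarrow>
      (\<Sum>i\<in>I. v i - u i) < \<delta> \<longrightarrow> (\<Sum>i\<in>I. norm (z (v i) - z (u i))) < \<epsilon>' j" for j
      by (rule abs_cont_onD[OF z \<epsilon>'_pos])
    then have "\<exists>\<delta>. \<forall>j. 0 < \<delta> j \<and> (\<forall>(I :: (real \<times> real set) set) u v. disjoint_intervals {a..b} I u v \<longrightarrow>
      (\<Sum>i\<in>I. v i - u i) < \<delta> j \<longrightarrow> (\<Sum>i\<in>I. norm (z (v i) - z (u i))) < \<epsilon>' j)"
      by (intro choice allI)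
    then obtain \<delta> where "\<forall>j. 0 < \<delta> j \<and> (\<forall>(I :: (real \<times> real set) set) u v. disjoint_intervals {a..b} I u v \<longrightarrow>
      (\<Sum>i\<in>I. v i - u i) < \<delta> j \<longrightarrow> (\<Sum>i\<in>I. norm (z (v i) - z (u i))) < \<epsilon>' j)"
      by (elim exE) (rule that)
    then have \<delta>: "\<And>j. 0 < \<delta> j"
      "\<And>j (I :: (real \<times> real set) set) u v. disjoint_intervals {a..b} I u v \<Longrightarrow>
      (\<Sum>i\<in>I. v i - u i) < \<delta> j \<Longrightarrow> (\<Sum>i\<in>I. norm (z (v i) - z (u i))) < \<epsilon>' j"
      by simp_all
    \<comment> \<open>The second bound pays for the term
      \<open>(c + \<epsilon>) * (Sup K - Inf K)\<close>, which is charged to exceptional intervals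
      as well so that the lengths add up to \<open>b - a\<close>.\<close>
    define \<delta>' where "\<delta>' j = min (\<delta> j) (\<epsilon> / (4 * (\<bar>c + \<epsilon>\<bar> + 1) * 2 ^ j))" for j
    have "0 < \<delta>' j" for j
    proof -
      have "0 < 4 * (\<bar>c + \<epsilon>\<bar> + 1) * 2 ^ j" by (simp add: add_nonneg_pos)
      then show ?thesis using \<delta>(1) that by (simp only: \<delta>'_def min_less_iff_conj) simp
    qed
    then have "\<exists>U. open U \<and> N \<inter> {t. k t = j} \<subseteq> U \<and> U \<in> lmeasurable \<and> measure lebesgue U < \<delta>' j" for j
      by (metis negligible_open_cover[OF negligible_subset[OF \<open>negligible N\<close>]] inf_le1)
    then obtain U where U: "\<And>j. open (U j)" "\<And>j. N \<inter> {t. k t = j} \<subseteq> U j"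
      "\<And>j. U j \<in> lmeasurable" "\<And>j. measure lebesgue (U j) < \<delta>' j" by metis
    have "\<exists>r>0. \<forall>x y. t - r < x \<longrightarrow> x \<le> t \<longrightarrow> t \<le> y \<longrightarrow> y < t + r \<longrightarrow> u y - u x \<le> (c + \<epsilon>) * (y - x)"
      if "t \<in> {a..b} - N" for t
      using that \<open>0 < \<epsilon>\<close> unfolding N_def upper_drv_def by blast
    then obtain \<sigma> where \<sigma>: "\<And>t. t \<in> {a..b} - N \<Longrightarrow> \<sigma> t > 0"
      "\<And>t x y. \<lbrakk>t \<in> {a..b} - N; t - \<sigma> t < x; x \<le> t; t \<le> y; y < t + \<sigma> t\<rbrakk> \<Longrightarrow> u y - u x \<le> (c + \<epsilon>) * (y - x)"
      by metis
    \<comment> \<open>At exceptional tags the gauge confines the interval to the small cover and to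
      the range of the calmness estimate, at the other tags to the range where the difference
      quotient is controlled.\<close>
    define g where "g t = (if t \<in> N then U (k t) \<inter> ball t (\<rho> t) else if t \<in> {a..b} then ball t (\<sigma> t) else UNIV)" for t
    have "N \<subseteq> {a..b}" by (auto simp: N_def)
    have "gauge g"
      unfolding gauge_def g_def
      using U(1,2) kr(1) \<sigma>(1) \<open>N \<subseteq> {a..b}\<close> by (auto intro!: open_Int)
    then obtain p where p: "p tagged_division_of {a..b}" "g fine p"
      by (rule fine_division_exists_real)
    have fin: "finite p" using p(1) by (rule tagged_division_of_finite)
    have mem: "x \<in> {a..b} \<and> x \<in> K \<and> K = {Inf K..Sup K} \<and> Inf K \<le> x \<and> x \<le> Sup K \<and> Inf K \<in> {a..b} \<and> Sup K \<in> {a..b} \<and> K \<subseteq> g x"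
      if "(x, K) \<in> p" for x K
    proof -
      obtain l r where "K = {l..r}" "x \<in> K" "K \<subseteq> {a..b}"
        using p(1) \<open>(x, K) \<in> p\<close> by (metis box_real(2) tagged_division_ofD(2-4))
      then show ?thesis using p(2) that by (auto simp: fine_def)
    qed
    define bad where "bad = {xK \<in> p. fst xK \<in> N}"
    define B where "B = (\<lambda>(x, K). real (k x) * (norm (z (Sup K) - z x) + norm (z x - z (Inf K))) + \<bar>c + \<epsilon>\<bar> * (Sup K - Inf K))"
    have "u b - u a = (\<Sum>(x, K)\<in>p. u (Sup K) - u (Inf K))"
      using additive_tagged_division_1[OF \<open>a \<le> b\<close> p(1), of u] by simp
    also have "\<dots> \<le> (\<Sum>(x, K)\<in>p. (c + \<epsilon>) * (Sup K - Inf K) + (if (x, K) \<in> bad then B (x, K) else 0))"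
    proof (rule sum_mono, clarify)
      fix x K assume xK: "(x, K) \<in> p"
      note m = mem[OF xK]
      show "u (Sup K) - u (Inf K) \<le> (c + \<epsilon>) * (Sup K - Inf K) + (if (x, K) \<in> bad then B (x, K) else 0)"
      proof (cases "x \<in> N")
        case False
        have "K \<subseteq> ball x (\<sigma> x)" using m False by (auto simp: g_def)
        moreover have "Inf K \<in> K" "Sup K \<in> K" using m by (metis atLeastAtMost_iff order.refl order.trans)+
        ultimately have "x - \<sigma> x < Inf K" "Sup K < x + \<sigma> x" using m by (auto simp: dist_real_def subset_iff)
        then have "u (Sup K) - u (Inf K) \<le> (c + \<epsilon>) * (Sup K - Inf K)" using m False by (intro \<sigma>(2)) auto
        then show ?thesis using False by (simp add: bad_def)
      next
        case True
        have "K \<subseteq> ball x (\<rho> x)" using m True by (auto simp: g_def)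
        moreover have "Inf K \<in> K" "Sup K \<in> K" using m by (metis atLeastAtMost_iff order.refl order.trans)+
        ultimately have "\<bar>Inf K - x\<bar> < \<rho> x" "\<bar>Sup K - x\<bar> < \<rho> x" by (auto simp: dist_real_def subset_iff)
        then have "\<bar>u (Sup K) - u x\<bar> \<le> real (k x) * norm (z (Sup K) - z x)"
          "\<bar>u (Inf K) - u x\<bar> \<le> real (k x) * norm (z (Inf K) - z x)" using m by (auto intro: kr(2))
        then have "u (Sup K) - u (Inf K) \<le> real (k x) * (norm (z (Sup K) - z x) + norm (z x - z (Inf K)))"
          by (simp add: norm_minus_commute distrib_left)
        moreover have "0 \<le> (c + \<epsilon>) * (Sup K - Inf K) + \<bar>c + \<epsilon>\<bar> * (Sup K - Inf K)"
          using m by (simp add: distrib_right[symmetric])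
        ultimately show ?thesis using True xK by (simp add: bad_def B_def)
      qed
    qed
    also have "\<dots> = (c + \<epsilon>) * (\<Sum>(x, K)\<in>p. Sup K - Inf K) + sum B bad"
    proof -
      have "(\<Sum>(x, K)\<in>p. if (x, K) \<in> bad then B (x, K) else 0) = sum B bad"
        using fin by (auto simp: bad_def sum.If_cases case_prod_unfold intro!: sum.cong)
      then show ?thesis by (simp add: sum.distrib sum_distrib_left case_prod_unfold)
    qed
    also have "(\<Sum>(x, K)\<in>p. Sup K - Inf K) = b - a"
      using additive_tagged_division_1[OF \<open>a \<le> b\<close> p(1), of "\<lambda>x. x"] by simp
    also have "sum B bad \<le> \<epsilon>"
    proof -
      have "sum B bad = (\<Sum>j\<in>k ` fst ` bad. sum B {xK \<in> bad. k (fst xK) = j})"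
        using fin by (subst image_image, intro sum.group[symmetric]) (auto simp: bad_def)
      also have "\<dots> \<le> (\<Sum>j\<in>k ` fst ` bad. \<epsilon> / 2 * (1 / 2) ^ j)"
      proof (rule sum_mono)
        fix j
        define q where "q = {xK \<in> bad. k (fst xK) = j}"
        have qp: "q \<subseteq> p" by (auto simp: q_def bad_def)
        have finq: "finite q" using fin qp finite_subset by blast
        have qtag: "q tagged_partial_division_of {a..b}"
          using p(1) qp tagged_partial_division_subset tagged_division_of_def by blast
        have len: "(\<Sum>(x, K)\<in>q. Sup K - Inf K) < \<delta>' j"
        proof (rule le_less_trans[OF partial_division_length[OF qtag _ U(3)] U(4)])
          fix x K assume "(x, K) \<in> q"
          then show "K \<subseteq> U j" using mem[of x K] by (auto simp: q_def bad_def g_def)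
        qed
        have memq: "Inf (snd i) \<le> fst i" "fst i \<le> Sup (snd i)" "Inf (snd i) \<in> {a..b}" "Sup (snd i) \<in> {a..b}"
          "fst i \<in> {a..b}" if "i \<in> q" for i using mem[of "fst i" "snd i"] that qp by auto
        have disj: "{Inf (snd i)<..<Sup (snd i)} \<inter> {Inf (snd j)<..<Sup (snd j)} = {}"
          if "i \<in> q" "j \<in> q" "i \<noteq> j" for i j
        proof -
          define x1 K1 x2 K2 where xK: "x1 = fst i" "K1 = snd i" "x2 = fst j" "K2 = snd j"
          then have that: "(x1, K1) \<in> q" "(x2, K2) \<in> q" "(x1, K1) \<noteq> (x2, K2)" using that by auto
          have "interior K1 \<inter> interior K2 = {}"
            using tagged_division_ofD(5)[OF p(1), of x1 K1 x2 K2] that qp by auto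
          moreover have "K1 = {Inf K1..Sup K1}" "K2 = {Inf K2..Sup K2}" using mem that qp by blast+
          ultimately have "interior {Inf K1..Sup K1} \<inter> interior {Inf K2..Sup K2} = {}" by metis
          then show ?thesis unfolding xK by (simp only: interior_atLeastAtMost_real)
        qed
        \<comment> \<open>Calmness compares only with the value at the tag, so the halves to the
          right and to the left of the tags are summed as two separate families.\<close>
        have "disjoint_intervals {a..b} q (\<lambda>i. fst i) (\<lambda>i. Sup (snd i))"
          unfolding disjoint_intervals_def
        proof (intro conjI finq ballI impI)
          fix i assume i: "i \<in> q"
          then show "fst i \<le> Sup (snd i)" "{fst i..Sup (snd i)} \<subseteq> {a..b}" using memq[OF i] by auto
          fix j assume j: "j \<in> q" "i \<noteq> j"
          have "{fst i<..<Sup (snd i)} \<subseteq> {Inf (snd i)<..<Sup (snd i)}" if "i \<in> q" for i using memq[OF that] by auto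
          from this[OF i] this[OF j(1)]
          show "{fst i<..<Sup (snd i)} \<inter> {fst j<..<Sup (snd j)} = {}"
            using disj[of i j] i j by blast
        qed
        moreover have "(\<Sum>i\<in>q. Sup (snd i) - fst i) < \<delta> j"
        proof -
          have "(\<Sum>i\<in>q. Sup (snd i) - fst i) \<le> (\<Sum>i\<in>q. Sup (snd i) - Inf (snd i))"
            using memq by (intro sum_mono) auto
          then show ?thesis using len by (simp add: \<delta>'_def case_prod_unfold)
        qed
        ultimately have v1: "(\<Sum>(x, K)\<in>q. norm (z (Sup K) - z x)) < \<epsilon>' j"
          using \<delta>(2)[of q "\<lambda>i. fst i" "\<lambda>i. Sup (snd i)" j] by (simp add: case_prod_unfold)
        have "disjoint_intervals {a..b} q (\<lambda>i. Inf (snd i)) (\<lambda>i. fst i)"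
          unfolding disjoint_intervals_def
        proof (intro conjI finq ballI impI)
          fix i assume i: "i \<in> q"
          then show "Inf (snd i) \<le> fst i" "{Inf (snd i)..fst i} \<subseteq> {a..b}" using memq[OF i] by auto
          fix j assume j: "j \<in> q" "i \<noteq> j"
          have "{Inf (snd i)<..<fst i} \<subseteq> {Inf (snd i)<..<Sup (snd i)}" if "i \<in> q" for i using memq[OF that] by auto
          from this[OF i] this[OF j(1)]
          show "{Inf (snd i)<..<fst i} \<inter> {Inf (snd j)<..<fst j} = {}"
            using disj[of i j] i j by blast
        qed
        moreover have "(\<Sum>i\<in>q. fst i - Inf (snd i)) < \<delta> j"
        proof -
          have "(\<Sum>i\<in>q. fst i - Inf (snd i)) \<le> (\<Sum>i\<in>q. Sup (snd i) - Inf (snd i))"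
            using memq by (intro sum_mono) auto
          then show ?thesis using len by (simp add: \<delta>'_def case_prod_unfold)
        qed
        ultimately have v2: "(\<Sum>(x, K)\<in>q. norm (z x - z (Inf K))) < \<epsilon>' j"
          using \<delta>(2)[of q "\<lambda>i. Inf (snd i)" "\<lambda>i. fst i" j] by (simp add: case_prod_unfold)
        have "sum B q = (\<Sum>(x, K)\<in>q. real j * (norm (z (Sup K) - z x) + norm (z x - z (Inf K))) + \<bar>c + \<epsilon>\<bar> * (Sup K - Inf K))"
          by (intro sum.cong) (auto simp: B_def q_def)
        also have "\<dots> = real j * ((\<Sum>(x, K)\<in>q. norm (z (Sup K) - z x)) + (\<Sum>(x, K)\<in>q. norm (z x - z (Inf K))))
            + \<bar>c + \<epsilon>\<bar> * (\<Sum>(x, K)\<in>q. Sup K - Inf K)"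
          by (simp add: sum.distrib sum_distrib_left case_prod_unfold distrib_left)
        also have "\<dots> \<le> real j * (\<epsilon>' j + \<epsilon>' j) + \<bar>c + \<epsilon>\<bar> * \<delta>' j"
          using v1 v2 len by (intro add_mono mult_left_mono) auto
        also have "\<dots> \<le> \<epsilon> / 4 * (1 / 2) ^ j + \<epsilon> / 4 * (1 / 2) ^ j"
        proof (rule add_mono)
          have "real j * (\<epsilon>' j + \<epsilon>' j) \<le> (real j + 1) * (2 * \<epsilon>' j)" using \<epsilon>'_pos[of j] by (simp add: algebra_simps)
          also have "\<dots> = \<epsilon> / 4 * (1 / 2) ^ j"
          proof -
            have "real j + 1 \<noteq> 0" by linarith
            then show ?thesis by (simp add: \<epsilon>'_def power_one_over divide_simps)
          qed
          finally show "real j * (\<epsilon>' j + \<epsilon>' j) \<le> \<epsilon> / 4 * (1 / 2) ^ j" .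
          have "\<bar>c + \<epsilon>\<bar> * \<delta>' j \<le> (\<bar>c + \<epsilon>\<bar> + 1) * (\<epsilon> / (4 * (\<bar>c + \<epsilon>\<bar> + 1) * 2 ^ j))"
            using \<open>0 < \<delta>' j\<close> by (intro mult_mono) (auto simp: \<delta>'_def)
          also have "\<dots> = \<epsilon> / 4 * (1 / 2) ^ j"
          proof -
            have "\<bar>c + \<epsilon>\<bar> + 1 \<noteq> 0" by linarith
            then show ?thesis by (simp add: power_one_over divide_simps)
          qed
          finally show "\<bar>c + \<epsilon>\<bar> * \<delta>' j \<le> \<epsilon> / 4 * (1 / 2) ^ j" .
        qed
        finally show "sum B {xK \<in> bad. k (fst xK) = j} \<le> \<epsilon> / 2 * (1 / 2) ^ j" by (simp add: q_def)
      qed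
      also have "\<dots> = \<epsilon> / 2 * (\<Sum>j\<in>k ` fst ` bad. (1 / 2) ^ j)" by (simp add: sum_distrib_left)
      also have "\<dots> \<le> \<epsilon> / 2 * (\<Sum>j. (1 / 2) ^ j)"
        using fin that by (intro mult_left_mono sum_le_suminf) (auto simp: bad_def)
      also have "\<dots> = \<epsilon>" by (simp add: suminf_geometric)
      finally show ?thesis .
    qed
    finally show ?thesis by (simp add: algebra_simps)
  qed
  have "((\<lambda>\<epsilon>. c * (b - a) + \<epsilon> * (b - a) + \<epsilon>) \<longlongrightarrow> c * (b - a) + 0 * (b - a) + 0) (at_right 0)"
    by (intro tendsto_intros)
  then have "u b - u a \<le> c * (b - a) + 0 * (b - a) + 0"
    by (rule tendsto_lowerbound) (auto simp: eventually_at_right_less eventually_at_filter bound intro!: always_eventually)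
  then show ?thesis by (simp add: u_def)
qed

section \<open>Calculus of pointwise Lipschitz functions\<close>

lemma calm_atE:
  assumes "calm_at F x"
  obtains K where "0 < K" "\<forall>\<^sub>F y in nhds x. dist (F y) (F x) \<le> K * dist y x"
proof -
  obtain K where K: "\<forall>\<^sub>F y in nhds x. dist (F y) (F x) \<le> K * dist y x"
    using assms by (auto simp: calm_at_def)
  have "\<forall>\<^sub>F y in nhds x. dist (F y) (F x) \<le> max K 1 * dist y x"
    using K by eventually_elim (erule order_trans, intro mult_right_mono, auto)
  then show ?thesis by (rule that[rotated]) simp
qed

lemma calm_at_imp_tendsto:
  assumes "calm_at F x" shows "(F \<longlongrightarrow> F x) (nhds x)"
proof -
  obtain K where K: "\<forall>\<^sub>F y in nhds x. dist (F y) (F x) \<le> K * dist y x"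
    using assms by (auto simp: calm_at_def)
  have "((\<lambda>y. K * dist y x) \<longlongrightarrow> K * dist x x) (nhds x)"
    by (intro tendsto_intros filterlim_ident)
  then have lim: "((\<lambda>y. K * dist y x) \<longlongrightarrow> 0) (nhds x)" by simp
  have "((\<lambda>y. dist (F y) (F x)) \<longlongrightarrow> 0) (nhds x)"
  proof (rule tendstoI)
    fix e :: real assume "0 < e"
    from order_tendstoD(2)[OF lim this] K
    show "\<forall>\<^sub>F y in nhds x. dist (dist (F y) (F x)) 0 < e" by eventually_elim simp
  qed
  then show ?thesis by (subst tendsto_dist_iff)
qed

lemma calm_at_compose:
  assumes F: "calm_at F (g x)" and g: "calm_at g x"
  shows "calm_at (\<lambda>y. F (g y)) x"
proof -
  obtain K where K: "0 < K" "\<forall>\<^sub>F y in nhds (g x). dist (F y) (F (g x)) \<le> K * dist y (g x)"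
    using F by (rule calm_atE)
  obtain L where L: "0 < L" "\<forall>\<^sub>F y in nhds x. dist (g y) (g x) \<le> L * dist y x"
    using g by (rule calm_atE)
  have "\<forall>\<^sub>F y in nhds x. dist (F (g y)) (F (g x)) \<le> K * dist (g y) (g x)"
    by (rule eventually_compose_filterlim[OF K(2) calm_at_imp_tendsto[OF g]])
  with L(2) have "\<forall>\<^sub>F y in nhds x. dist (F (g y)) (F (g x)) \<le> K * L * dist y x"
  proof eventually_elim
    case (elim y)
    have "K * dist (g y) (g x) \<le> K * (L * dist y x)" using elim(1) K(1) by simp
    then show ?case using elim(2) by simp
  qed
  then show ?thesis by (auto simp: calm_at_def)
qed

lemma calm_at_lipschitz:
  assumes "C-lipschitz_on U F" "open U" "x \<in> U"
  shows "calm_at F x"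
  unfolding calm_at_def
  using assms by (intro exI[of _ C] eventually_mono[OF eventually_nhds_in_open]) (auto simp: lipschitz_on_def)

lemma locally_lipschitzE:
  assumes "locally_lipschitz f"
  obtains u K where "0 < u" "K-lipschitz_on (cball x u) f"
  using assms unfolding locally_lipschitz_def by meson

lemma calm_at_locally_lipschitz:
  assumes "locally_lipschitz F" shows "calm_at F x"
proof -
  obtain u K where "0 < u" "K-lipschitz_on (cball x u) F" using assms by (rule locally_lipschitzE)
  then show ?thesis
    using calm_at_lipschitz[OF lipschitz_on_subset[OF _ ball_subset_cball] open_ball centre_in_ball[THEN iffD2]] by blast
qed

lemma calm_at_has_derivative:
  assumes "(F has_derivative F') (at x)"
  shows "calm_at F x"
proof -
  have bl: "bounded_linear F'" using assms by (rule has_derivative_bounded_linear)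
  obtain K where K: "\<And>h. norm (F' h) \<le> norm h * K" using bounded_linear.bounded[OF bl] by blast
  obtain d where d: "d > 0" "\<And>y. norm (y - x) < d \<Longrightarrow> norm (F y - F x - F' (y - x)) \<le> 1 * norm (y - x)"
    using assms unfolding has_derivative_at_alt by (metis zero_less_one)
  have "dist (F y) (F x) \<le> (K + 1) * dist y x" if "y \<in> ball x d" for y
  proof -
    have "norm (F y - F x) \<le> norm (F y - F x - F' (y - x)) + norm (F' (y - x))"
      by (metis diff_add_cancel norm_triangle_ineq)
    also have "\<dots> \<le> 1 * norm (y - x) + norm (y - x) * K"
      using d(2)[of y] K[of "y - x"] that by (intro add_mono) (auto simp: dist_norm norm_minus_commute)
    finally show ?thesis by (simp add: dist_norm algebra_simps)
  qed
  then show ?thesis unfolding calm_at_def using d(1)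
    by (intro exI[of _ "K + 1"] eventually_mono[OF eventually_nhds_in_open[of "ball x d"]]) auto
qed

lemma calm_at_linear: "bounded_linear F \<Longrightarrow> calm_at F x"
  by (rule calm_at_has_derivative) (rule bounded_linear_imp_has_derivative)

lemma calm_at_const: "calm_at (\<lambda>x. c) x"
  by (auto simp: calm_at_def intro!: exI[of _ 0])

lemma calm_at_add:
  fixes F G :: "'a::metric_space \<Rightarrow> 'b::real_normed_vector"
  assumes "calm_at F x" "calm_at G x"
  shows "calm_at (\<lambda>y. F y + G y) x"
proof -
  obtain K L where "\<forall>\<^sub>F y in nhds x. dist (F y) (F x) \<le> K * dist y x"
    "\<forall>\<^sub>F y in nhds x. dist (G y) (G x) \<le> L * dist y x"
    using assms by (auto simp: calm_at_def)
  then have "\<forall>\<^sub>F y in nhds x. dist (F y + G y) (F x + G x) \<le> (K + L) * dist y x"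
    by eventually_elim (use dist_triangle_add in \<open>fastforce simp: distrib_right intro: order_trans\<close>)
  then show ?thesis by (auto simp: calm_at_def)
qed

lemma calm_at_sum:
  fixes F :: "'i \<Rightarrow> 'a::metric_space \<Rightarrow> 'b::real_normed_vector"
  assumes "\<And>i. i \<in> I \<Longrightarrow> calm_at (F i) x"
  shows "calm_at (\<lambda>y. \<Sum>i\<in>I. F i y) x"
  using assms by (induction I rule: infinite_finite_induct) (auto intro: calm_at_add calm_at_const)

lemma calm_at_mult:
  fixes F G :: "'a::metric_space \<Rightarrow> real"
  assumes "calm_at F x" "calm_at G x"
  shows "calm_at (\<lambda>y. F y * G y) x"
proof -
  obtain K where K: "0 < K" "\<forall>\<^sub>F y in nhds x. dist (F y) (F x) \<le> K * dist y x"
    using assms(1) by (rule calm_atE)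
  obtain L where L: "0 < L" "\<forall>\<^sub>F y in nhds x. dist (G y) (G x) \<le> L * dist y x"
    using assms(2) by (rule calm_atE)
  have "\<forall>\<^sub>F y in nhds x. dist (F y) (F x) < 1"
    using calm_at_imp_tendsto[OF assms(1)] by (rule tendstoD) simp
  with K(2) L(2) have "\<forall>\<^sub>F y in nhds x. dist (F y * G y) (F x * G x) \<le> ((\<bar>F x\<bar> + 1) * L + \<bar>G x\<bar> * K) * dist y x"
  proof eventually_elim
    case (elim y)
    have "F y * G y - F x * G x = F y * (G y - G x) + G x * (F y - F x)" by (simp add: algebra_simps)
    then have "\<bar>F y * G y - F x * G x\<bar> \<le> \<bar>F y\<bar> * \<bar>G y - G x\<bar> + \<bar>G x\<bar> * \<bar>F y - F x\<bar>"
      by (metis abs_mult abs_triangle_ineq)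
    also have "\<dots> \<le> (\<bar>F x\<bar> + 1) * (L * dist y x) + \<bar>G x\<bar> * (K * dist y x)"
      using elim L(1) by (intro add_mono mult_mono) (auto simp: dist_real_def)
    finally show ?case by (simp add: dist_real_def algebra_simps)
  qed
  then show ?thesis unfolding calm_at_def by blast
qed

lemma calm_at_max:
  fixes F :: "'a::metric_space \<Rightarrow> real"
  assumes "calm_at F x"
  shows "calm_at (\<lambda>y. max (F y) c) x"
proof -
  have "1-lipschitz_on UNIV (\<lambda>y::real. max y c)"
    by (auto simp: lipschitz_on_def dist_real_def max_def)
  then have "calm_at (\<lambda>y. max y c) (F x)" by (rule calm_at_lipschitz[OF _ open_UNIV]) simp
  then show ?thesis using assms by (rule calm_at_compose)
qed

section \<open>Calculus of upper derivatives\<close>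

lemma upper_drvD:
  assumes "upper_drv u t c" "0 < \<delta>"
  obtains r where "0 < r" "\<And>x y. \<lbrakk>t - r < x; x \<le> t; t \<le> y; y < t + r\<rbrakk> \<Longrightarrow> u y - u x \<le> (c + \<delta>) * (y - x)"
  using assms unfolding upper_drv_def by meson

lemma upper_drv_mono:
  assumes "upper_drv u t c" "c \<le> c'"
  shows "upper_drv u t c'"
  unfolding upper_drv_def
proof (intro allI impI)
  fix \<delta> :: real assume "0 < \<delta>"
  with assms(1) obtain r where r: "0 < r" "\<And>x y. \<lbrakk>t - r < x; x \<le> t; t \<le> y; y < t + r\<rbrakk> \<Longrightarrow> u y - u x \<le> (c + \<delta>) * (y - x)"
    by (rule upper_drvD) blast
  have "u y - u x \<le> (c' + \<delta>) * (y - x)" if "t - r < x" "x \<le> t" "t \<le> y" "y < t + r" for x y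
    using r(2)[OF that] mult_right_mono[of "c + \<delta>" "c' + \<delta>" "y - x"] that \<open>c \<le> c'\<close> by simp
  then show "\<exists>r>0. \<forall>x y. t - r < x \<longrightarrow> x \<le> t \<longrightarrow> t \<le> y \<longrightarrow> y < t + r \<longrightarrow> u y - u x \<le> (c' + \<delta>) * (y - x)"
    using r(1) by (intro exI[of _ r]) auto
qed

lemma upper_drv_cong:
  assumes "\<forall>\<^sub>F s in nhds t. u s = v s" "upper_drv u t c"
  shows "upper_drv v t c"
proof -
  obtain r0 where r0: "r0 > 0" "\<And>s. dist s t < r0 \<Longrightarrow> u s = v s"
    using assms(1) by (auto simp: eventually_nhds_metric)
  show ?thesis unfolding upper_drv_def
  proof (intro allI impI)
    fix \<delta> :: real assume "0 < \<delta>"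
    then obtain r where r: "r > 0" "\<forall>x y. t - r < x \<longrightarrow> x \<le> t \<longrightarrow> t \<le> y \<longrightarrow> y < t + r \<longrightarrow>
        u y - u x \<le> (c + \<delta>) * (y - x)"
      using assms(2) unfolding upper_drv_def by meson
    have "v y - v x \<le> (c + \<delta>) * (y - x)"
      if "t - min r r0 < x" "x \<le> t" "t \<le> y" "y < t + min r r0" for x y
    proof -
      have "dist x t < r0" "dist y t < r0" "t - r < x" "y < t + r" using that by (auto simp: dist_real_def)
      then show ?thesis using r(2)[rule_format, of x y] r0(2)[of x] r0(2)[of y] that by simp
    qed
    then show "\<exists>r>0. \<forall>x y. t - r < x \<longrightarrow> x \<le> t \<longrightarrow> t \<le> y \<longrightarrow> y < t + r \<longrightarrow> v y - v x \<le> (c + \<delta>) * (y - x)"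
      using r(1) r0(1) by (intro exI[of _ "min r r0"]) auto
  qed
qed

text \<open>As \<open>t\<close> lies between \<open>x\<close> and \<open>y\<close>, the errors
  \<delta>(y - t) and \<delta>(t - x) of the two one-sided expansions add up to exactly \<delta>(y -
  x).\<close>

lemma upper_drv_real_derivative:
  assumes "(u has_real_derivative c) (at t)"
  shows "upper_drv u t c"
  unfolding upper_drv_def
proof (intro allI impI)
  fix \<delta> :: real assume "0 < \<delta>"
  then obtain r where r: "r > 0" "\<And>y. \<bar>y - t\<bar> < r \<Longrightarrow> \<bar>u y - u t - c * (y - t)\<bar> \<le> \<delta> * \<bar>y - t\<bar>"
    using assms unfolding has_field_derivative_def has_derivative_at_alt by (metis real_norm_def)
  have "u y - u x \<le> (c + \<delta>) * (y - x)" if "t - r < x" "x \<le> t" "t \<le> y" "y < t + r" for x y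
  proof -
    have "\<bar>u y - u t - c * (y - t)\<bar> \<le> \<delta> * (y - t)" "\<bar>u x - u t - c * (x - t)\<bar> \<le> \<delta> * (t - x)"
      using r(2)[of y] r(2)[of x] that by auto
    then have "u y - u t - c * (y - t) \<le> \<delta> * (y - t)" "- (u x - u t - c * (x - t)) \<le> \<delta> * (t - x)" by linarith+
    then show ?thesis by (simp add: algebra_simps)
  qed
  then show "\<exists>r>0. \<forall>x y. t - r < x \<longrightarrow> x \<le> t \<longrightarrow> t \<le> y \<longrightarrow> y < t + r \<longrightarrow> u y - u x \<le> (c + \<delta>) * (y - x)"
    using r(1) by (intro exI[of _ r]) auto
qed

lemma upper_drv_add:
  assumes "upper_drv u t a" "upper_drv v t b"
  shows "upper_drv (\<lambda>s. u s + v s) t (a + b)"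
  unfolding upper_drv_def
proof (intro allI impI)
  fix \<delta> :: real assume "0 < \<delta>"
  then have "\<delta> / 2 > 0" by simp
  then obtain r1 r2 where r1: "r1 > 0" "\<forall>x y. t - r1 < x \<longrightarrow> x \<le> t \<longrightarrow> t \<le> y \<longrightarrow> y < t + r1 \<longrightarrow>
        u y - u x \<le> (a + \<delta> / 2) * (y - x)"
    and r2: "r2 > 0" "\<forall>x y. t - r2 < x \<longrightarrow> x \<le> t \<longrightarrow> t \<le> y \<longrightarrow> y < t + r2 \<longrightarrow>
        v y - v x \<le> (b + \<delta> / 2) * (y - x)"
    using assms unfolding upper_drv_def by metis
  have "u y + v y - (u x + v x) \<le> (a + b + \<delta>) * (y - x)"
    if "t - min r1 r2 < x" "x \<le> t" "t \<le> y" "y < t + min r1 r2" for x y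
  proof -
    have "u y - u x \<le> (a + \<delta> / 2) * (y - x)" "v y - v x \<le> (b + \<delta> / 2) * (y - x)"
      using r1(2) r2(2) that by auto
    moreover have "(a + b + \<delta>) * (y - x) = (a + \<delta> / 2) * (y - x) + (b + \<delta> / 2) * (y - x)"
      by (simp add: algebra_simps)
    ultimately show ?thesis by linarith
  qed
  then show "\<exists>r>0. \<forall>x y. t - r < x \<longrightarrow> x \<le> t \<longrightarrow> t \<le> y \<longrightarrow> y < t + r \<longrightarrow>
      u y + v y - (u x + v x) \<le> (a + b + \<delta>) * (y - x)"
    using r1(1) r2(1) by (intro exI[of _ "min r1 r2"]) auto
qed

lemma upper_drv_const: "0 \<le> c \<Longrightarrow> upper_drv (\<lambda>s. k) t c"
  by (rule upper_drv_mono[of _ _ 0]) (auto intro!: upper_drv_real_derivative)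

lemma upper_drv_sum:
  assumes "\<And>i. i \<in> I \<Longrightarrow> upper_drv (u i) t (c i)"
  shows "upper_drv (\<lambda>s. \<Sum>i\<in>I. u i s) t (\<Sum>i\<in>I. c i)"
  using assms by (induction I rule: infinite_finite_induct) (auto intro: upper_drv_add upper_drv_const)

text \<open>Upper bounds on increments may be multiplied by nonnegative factors, so the splitting
  \<open>u y * (v y - v x) + v x * (u y - u x)\<close> preserves them; continuity then replaces
  \<open>u y\<close> and \<open>v x\<close> by the values at \<open>t\<close>.\<close>

lemma upper_drv_mult:
  fixes u v :: "real \<Rightarrow> real"
  assumes u: "upper_drv u t a" and v: "upper_drv v t b"
    and pos: "\<And>s. 0 \<le> u s" "\<And>s. 0 \<le> v s" and cont: "isCont u t" "isCont v t"
  shows "upper_drv (\<lambda>s. u s * v s) t (u t * b + v t * a)"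
  unfolding upper_drv_def
proof (intro allI impI)
  fix \<delta> :: real assume "0 < \<delta>"
  \<comment> \<open>Small enough for the errors \<kappa>(|a| + 1), \<kappa>(|b| + 1) and \<kappa>(u
    t + v t) to add up to at most \<delta>.\<close>
  define \<kappa> where "\<kappa> = min 1 (\<delta> / (\<bar>a\<bar> + \<bar>b\<bar> + u t + v t + 2))"
  have den: "0 < \<bar>a\<bar> + \<bar>b\<bar> + u t + v t + 2" using pos[of t] by linarith
  then have \<kappa>: "0 < \<kappa>" "\<kappa> \<le> 1" using \<open>0 < \<delta>\<close> unfolding \<kappa>_def by simp_all
  have "\<kappa> \<le> \<delta> / (\<bar>a\<bar> + \<bar>b\<bar> + u t + v t + 2)" unfolding \<kappa>_def by (rule min.cobounded2)
  with den have \<kappa>3: "\<kappa> * (\<bar>a\<bar> + \<bar>b\<bar> + u t + v t + 2) \<le> \<delta>" by (simp only: pos_le_divide_eq)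
  obtain r1 r2 where r1: "r1 > 0" "\<forall>x y. t - r1 < x \<longrightarrow> x \<le> t \<longrightarrow> t \<le> y \<longrightarrow> y < t + r1 \<longrightarrow>
        u y - u x \<le> (a + \<kappa>) * (y - x)"
    and r2: "r2 > 0" "\<forall>x y. t - r2 < x \<longrightarrow> x \<le> t \<longrightarrow> t \<le> y \<longrightarrow> y < t + r2 \<longrightarrow>
        v y - v x \<le> (b + \<kappa>) * (y - x)"
    using u v \<kappa>(1) unfolding upper_drv_def by metis
  obtain r3 r4 where r3: "r3 > 0" "\<And>s. dist s t < r3 \<Longrightarrow> dist (u s) (u t) < \<kappa>"
    and r4: "r4 > 0" "\<And>s. dist s t < r4 \<Longrightarrow> dist (v s) (v t) < \<kappa>"
    using cont \<kappa>(1) unfolding continuous_at_eps_delta by metis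
  define r where "r = min (min r1 r2) (min r3 r4)"
  have "u y * v y - u x * v x \<le> (u t * b + v t * a + \<delta>) * (y - x)"
    if "t - r < x" "x \<le> t" "t \<le> y" "y < t + r" for x y
  proof -
    have 1: "u y - u x \<le> (a + \<kappa>) * (y - x)" "v y - v x \<le> (b + \<kappa>) * (y - x)"
      using r1(2) r2(2) that by (auto simp: r_def)
    have 2: "\<bar>u y - u t\<bar> < \<kappa>" "\<bar>v x - v t\<bar> < \<kappa>"
      using r3(2)[of y] r4(2)[of x] that by (auto simp: r_def dist_real_def)
    have "u y * v y - u x * v x = u y * (v y - v x) + v x * (u y - u x)" by (simp add: algebra_simps)
    also have "\<dots> \<le> u y * ((b + \<kappa>) * (y - x)) + v x * ((a + \<kappa>) * (y - x))"
      using 1 pos by (intro add_mono mult_left_mono) auto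
    also have "\<dots> = (u y * (b + \<kappa>) + v x * (a + \<kappa>)) * (y - x)" by (simp add: algebra_simps)
    also have "\<dots> \<le> (u t * b + v t * a + \<delta>) * (y - x)"
    proof (rule mult_right_mono)
      have "(u y - u t) * (b + \<kappa>) \<le> \<kappa> * (\<bar>b\<bar> + 1)"
      proof -
        have "(u y - u t) * (b + \<kappa>) \<le> \<bar>u y - u t\<bar> * \<bar>b + \<kappa>\<bar>" by (metis abs_mult abs_ge_self)
        also have "\<dots> \<le> \<kappa> * (\<bar>b\<bar> + 1)" using 2 \<kappa> by (intro mult_mono) auto
        finally show ?thesis .
      qed
      moreover have "(v x - v t) * (a + \<kappa>) \<le> \<kappa> * (\<bar>a\<bar> + 1)"
      proof -
        have "(v x - v t) * (a + \<kappa>) \<le> \<bar>v x - v t\<bar> * \<bar>a + \<kappa>\<bar>" by (metis abs_mult abs_ge_self)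
        also have "\<dots> \<le> \<kappa> * (\<bar>a\<bar> + 1)" using 2 \<kappa> by (intro mult_mono) auto
        finally show ?thesis .
      qed
      moreover have "u y * (b + \<kappa>) + v x * (a + \<kappa>) =
          u t * b + v t * a + (u y - u t) * (b + \<kappa>) + (v x - v t) * (a + \<kappa>) + \<kappa> * (u t + v t)"
        by (simp add: algebra_simps)
      ultimately show "u y * (b + \<kappa>) + v x * (a + \<kappa>) \<le> u t * b + v t * a + \<delta>"
        using \<kappa>3 by (simp add: algebra_simps)
    qed (use that in simp)
    finally show ?thesis .
  qed
  moreover have "r > 0" using r1(1) r2(1) r3(1) r4(1) by (simp add: r_def)
  ultimately show "\<exists>r>0. \<forall>x y. t - r < x \<longrightarrow> x \<le> t \<longrightarrow> t \<le> y \<longrightarrow> y < t + r \<longrightarrow>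
      u y * v y - u x * v x \<le> (u t * b + v t * a + \<delta>) * (y - x)"
    by blast
qed

text \<open>Away from contact the maximum locally is one of its arguments. At contact it has a kink,
  but if \<open>u\<close> does not grow to first order there, neither does the maximum. This serves
  to cut the Lyapunov function off at a level.\<close>

lemma upper_drv_max:
  assumes u: "upper_drv u t c" and cont: "isCont u t"
    and "M < u t \<Longrightarrow> c \<le> c'" "u t = M \<Longrightarrow> c \<le> 0 \<and> 0 \<le> c'" "u t < M \<Longrightarrow> 0 \<le> c'"
  shows "upper_drv (\<lambda>s. max (u s) M) t c'"
proof -
  have tend: "(u \<longlongrightarrow> u t) (nhds t)" using cont by (simp add: isCont_def tendsto_at_iff_tendsto_nhds)
  consider "M < u t" | "u t = M" | "u t < M" by linarith
  then show ?thesis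
  proof cases
    case 1
    then have "\<forall>\<^sub>F s in nhds t. u s = max (u s) M"
      using order_tendstoD(1)[OF tend, of M] by (auto elim: eventually_mono)
    then show ?thesis by (rule upper_drv_cong) (rule upper_drv_mono[OF u assms(3)[OF 1]])
  next
    case 3
    then have "\<forall>\<^sub>F s in nhds t. M = max (u s) M"
      using order_tendstoD(2)[OF tend, of M] by (auto elim: eventually_mono)
    then show ?thesis by (rule upper_drv_cong) (rule upper_drv_const[OF assms(5)[OF 3]])
  next
    case 2
    have "upper_drv (\<lambda>s. max (u s) M) t 0"
      unfolding upper_drv_def
    proof (intro allI impI)
      fix \<delta> :: real assume "0 < \<delta>"
      then obtain r where r: "r > 0" "\<forall>x y. t - r < x \<longrightarrow> x \<le> t \<longrightarrow> t \<le> y \<longrightarrow> y < t + r \<longrightarrow>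
          u y - u x \<le> (0 + \<delta>) * (y - x)"
        using upper_drv_mono[OF u, of 0] assms(4)[OF 2] unfolding upper_drv_def by metis
      have "max (u y) M - max (u x) M \<le> (0 + \<delta>) * (y - x)"
        if "t - r < x" "x \<le> t" "t \<le> y" "y < t + r" for x y
      proof -
        have "u y - u x \<le> (0 + \<delta>) * (y - x)" "0 \<le> (0 + \<delta>) * (y - x)" using r(2) that \<open>0 < \<delta>\<close> by auto
        then show ?thesis by (auto simp: max_def)
      qed
      then show "\<exists>r>0. \<forall>x y. t - r < x \<longrightarrow> x \<le> t \<longrightarrow> t \<le> y \<longrightarrow> y < t + r \<longrightarrow>
          max (u y) M - max (u x) M \<le> (0 + \<delta>) * (y - x)" using r(1) by blast
    qed
    then show ?thesis using assms(4)[OF 2] upper_drv_mono by blast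
  qed
qed

text \<open>Projecting onto the total increment itself reduces this to the scalar
  inequality.\<close>

lemma abs_cont_curve_norm_le:
  fixes z :: "real \<Rightarrow> 'a::real_normed_vector" and F :: "'a \<Rightarrow> 'b::real_inner"
  assumes z: "abs_cont_on z {a..b}" and "a \<le> b"
    and calm: "\<And>t. t \<in> {a..b} \<Longrightarrow> calm_at F (z t)"
    and drv: "AE t in lebesgue. t \<in> {a<..<b} \<longrightarrow>
      (\<exists>D. ((\<lambda>s. F (z s)) has_vector_derivative D) (at t) \<and> norm D \<le> K)"
  shows "norm (F (z b) - F (z a)) \<le> K * (b - a)"
proof -
  define x where "x = F (z b) - F (z a)"
  have "x \<bullet> F (z b) - x \<bullet> F (z a) \<le> (norm x * K) * (b - a)"
  proof (rule abs_cont_curve_le[OF z \<open>a \<le> b\<close>, where F = "\<lambda>y. x \<bullet> F y"])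
    show "calm_at (\<lambda>y. x \<bullet> F y) (z t)" if "t \<in> {a..b}" for t
      by (rule calm_at_compose[where F = "\<lambda>y. x \<bullet> y", OF calm_at_linear[OF bounded_linear_inner_right] calm[OF that]])
    show "AE t in lebesgue. t \<in> {a<..<b} \<longrightarrow> upper_drv (\<lambda>s. x \<bullet> F (z s)) t (norm x * K)"
      using drv
    proof eventually_elim
      case (elim t)
      show ?case
      proof
        assume "t \<in> {a<..<b}"
        then obtain D where D: "((\<lambda>s. F (z s)) has_vector_derivative D) (at t)" "norm D \<le> K" using elim by blast
        have "((\<lambda>s. x \<bullet> F (z s)) has_real_derivative x \<bullet> D) (at t)"
          using bounded_linear.has_vector_derivative[OF bounded_linear_inner_right D(1)]
          by (simp add: has_real_derivative_iff_has_vector_derivative)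
        moreover have "x \<bullet> D \<le> norm x * K"
          using norm_cauchy_schwarz[of x D] mult_left_mono[OF D(2) norm_ge_zero[of x]] by linarith
        ultimately show "upper_drv (\<lambda>s. x \<bullet> F (z s)) t (norm x * K)"
          by (meson upper_drv_mono upper_drv_real_derivative)
      qed
    qed
  qed
  then have "norm x * norm x \<le> norm x * (K * (b - a))"
    by (simp add: x_def inner_diff_right[symmetric] dot_square_norm power2_eq_square mult.assoc)
  \<comment> \<open>Needed when the increment vanishes. The sign of \<open>K\<close> is read off
    from the derivative bound, which holds at some point because a nonempty open interval is not
    negligible.\<close>
  moreover have "0 \<le> K * (b - a)"
  proof (cases "a < b")
    case True
    have "\<exists>t\<in>{a<..<b}. \<exists>D. norm (D :: 'b) \<le> K"
    proof (rule ccontr)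
      assume no: "\<not> ?thesis"
      have "AE t in lebesgue. t \<notin> {a<..<b}"
        using drv by eventually_elim (use no in blast)
      then have "negligible {a<..<b}"
        by (simp add: AE_iff_null_sets negligible_iff_null_sets)
      then show False
        using True open_not_negligible[of "{a<..<b}"] dense[of a b] by auto
    qed
    then have "0 \<le> K" by (meson norm_ge_zero order_trans)
    then show ?thesis using True by simp
  qed (use \<open>a \<le> b\<close> in simp)
  ultimately show ?thesis unfolding x_def[symmetric]
    by (cases "x = 0") (auto simp: mult_le_cancel_left_pos)
qed

text \<open>Turns an almost everywhere derivative bound into Lipschitz, hence absolute, continuity
  of \<open>F\<close> along the curve; applied to \<open>ho\<close> along observer
  trajectories.\<close>

lemma lipschitz_on_curve:
  fixes z :: "real \<Rightarrow> 'a::real_normed_vector" and F :: "'a \<Rightarrow> 'b::real_inner"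
  assumes z: "abs_cont_on z {a..b}" and "0 \<le> K"
    and calm: "\<And>t. t \<in> {a..b} \<Longrightarrow> calm_at F (z t)"
    and drv: "AE t in lebesgue. t \<in> {a<..<b} \<longrightarrow>
      (\<exists>D. ((\<lambda>s. F (z s)) has_vector_derivative D) (at t) \<and> norm D \<le> K)"
  shows "K-lipschitz_on {a..b} (\<lambda>t. F (z t))"
proof (rule lipschitz_onI[OF _ \<open>0 \<le> K\<close>])
  have le: "norm (F (z t) - F (z s)) \<le> K * (t - s)" if st: "a \<le> s" "s \<le> t" "t \<le> b" for s t
  proof (rule abs_cont_curve_norm_le[OF abs_cont_on_subset[OF z] st(2) calm])
    show "AE r in lebesgue. r \<in> {s<..<t} \<longrightarrow> (\<exists>D. ((\<lambda>s. F (z s)) has_vector_derivative D) (at r) \<and> norm D \<le> K)"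
      using drv by eventually_elim (use st in auto)
  qed (use st in auto)
  fix s t assume "s \<in> {a..b}" "t \<in> {a..b}"
  then show "dist (F (z s)) (F (z t)) \<le> K * dist s t"
    using le[of s t] le[of t s] by (cases "s \<le> t") (auto simp: dist_norm norm_minus_commute)
qed

section \<open>Almost everywhere gradient bounds\<close>

lemma lborel_integral_translation:
  fixes f :: "'a::euclidean_space \<Rightarrow> real"
  assumes "f \<in> borel_measurable borel"
  shows "integral\<^sup>L lborel (\<lambda>x. f (a + x)) = integral\<^sup>L lborel f"
proof -
  have "integral\<^sup>L lborel f = integral\<^sup>L (distr lborel borel ((+) a)) f" by (simp add: lborel_distr_plus)
  also have "\<dots> = integral\<^sup>L lborel (\<lambda>x. f (a + x))"
    using assms by (subst integral_distr) auto
  finally show ?thesis by simp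
qed

lemma lborel_integrable_translation:
  fixes f :: "'a::euclidean_space \<Rightarrow> real"
  assumes "integrable lborel f"
  shows "integrable lborel (\<lambda>x. f (a + x))"
proof -
  have "integrable (distr lborel borel ((+) a)) f" using assms by (simp add: lborel_distr_plus)
  then show ?thesis by (subst (asm) integrable_distr_eq) (use assms in auto)
qed

text \<open>Averaging over small balls replaces the segment, which may lie in the exceptional null set,
  by a bundle of parallel segments.\<close>

lemma increment_le_of_ae_gradient_le:
  fixes V :: "'a::euclidean_space \<Rightarrow> real"
  assumes lip: "K-lipschitz_on (ball e0 r) V" and contV: "continuous_on UNIV V"
    and grad: "AE y in lebesgue. y \<in> ball e0 r \<longrightarrow> (\<exists>D. GDERIV V y :> D \<and> D \<bullet> d \<le> c)"
    and y0: "y0 \<in> ball e0 r" "y0 + h *\<^sub>R d \<in> ball e0 r" and "0 \<le> h"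
  shows "V (y0 + h *\<^sub>R d) - V y0 \<le> h * c"
proof (rule ccontr)
  assume neg: "\<not> ?thesis"
  then have "0 < h" using \<open>0 \<le> h\<close> by (cases "h = 0") auto
  define \<eta> where "\<eta> = (V (y0 + h *\<^sub>R d) - V y0 - h * c) / 2"
  have "0 < \<eta>" using neg by (simp add: \<eta>_def)
  \<comment> \<open>A third of the distance to the sphere: one share for moving the base point, one
    for a single difference step, one to keep the inequalities strict.\<close>
  define s where "s = (r - max (dist e0 y0) (dist e0 (y0 + h *\<^sub>R d))) / 3"
  have s: "0 < s" "dist e0 y0 < r - 2 * s" "dist e0 (y0 + h *\<^sub>R d) < r - 2 * s"
    using y0 by (auto simp: s_def max_def field_simps)
  have contV': "isCont V y" for y using contV by (simp add: continuous_on_eq_continuous_at)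
  have "isCont (\<lambda>y. V (y + h *\<^sub>R d) - V y) y0"
    by (intro continuous_intros isCont_o2[OF _ contV'] contV')
  then obtain s1 where s1: "s1 > 0"
    "\<And>y. dist y y0 < s1 \<Longrightarrow> dist (V (y + h *\<^sub>R d) - V y) (V (y0 + h *\<^sub>R d) - V y0) < \<eta>"
    using \<open>0 < \<eta>\<close> unfolding continuous_at_eps_delta by metis
  define B where "B = ball y0 (min s s1)"
  have B: "h * c + \<eta> \<le> V (y + h *\<^sub>R d) - V y" if "y \<in> B" for y
  proof -
    have "\<bar>V (y + h *\<^sub>R d) - V y - (V (y0 + h *\<^sub>R d) - V y0)\<bar> < \<eta>"
      using s1(2)[of y] that by (simp add: B_def dist_commute dist_real_def)
    then have "V (y0 + h *\<^sub>R d) - V y0 - \<eta> < V (y + h *\<^sub>R d) - V y" by linarith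
    moreover have "V (y0 + h *\<^sub>R d) - V y0 = h * c + 2 * \<eta>" by (simp add: \<eta>_def field_simps)
    ultimately show ?thesis by linarith
  qed
  have tube: "y + t *\<^sub>R d \<in> ball e0 (r - s)" if "y \<in> B" "0 \<le> t" "t \<le> h" for y t
  proof -
    have "y0 + t *\<^sub>R d = (1 - t / h) *\<^sub>R y0 + (t / h) *\<^sub>R (y0 + h *\<^sub>R d)"
      using \<open>0 < h\<close> by (simp add: algebra_simps)
    moreover have "\<dots> \<in> ball e0 (r - 2 * s)"
      using s that \<open>0 < h\<close> by (intro convexD[OF convex_ball]) auto
    ultimately have "dist e0 (y0 + t *\<^sub>R d) < r - 2 * s" by simp
    moreover have "dist (y0 + t *\<^sub>R d) (y + t *\<^sub>R d) < s" using that(1) by (simp add: B_def)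
    ultimately show ?thesis using dist_triangle[of e0 "y + t *\<^sub>R d" "y0 + t *\<^sub>R d"] by simp
  qed
  obtain n0 :: nat where n0: "h * norm d / s < real n0" using reals_Archimedean2 by blast
  define \<delta> where "\<delta> n = h / real (n + n0 + 1)" for n
  have \<delta>: "0 < \<delta> n" "\<delta> n * norm d < s" for n
  proof -
    show "0 < \<delta> n" using \<open>0 < h\<close> by (simp add: \<delta>_def)
    have "h * norm d < real n0 * s" using n0 s(1) by (simp add: field_simps)
    also have "\<dots> \<le> real (n + n0 + 1) * s" using s(1) by (intro mult_right_mono) auto
    finally show "\<delta> n * norm d < s" by (simp add: \<delta>_def field_simps)
  qed
  have \<delta>_lim: "\<delta> \<longlonglongrightarrow> 0"
    unfolding \<delta>_def by (intro real_tendsto_divide_at_top[OF tendsto_const]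
        filterlim_compose[OF filterlim_real_sequentially]) (simp add: filterlim_subseq strict_mono_def)
  \<comment> \<open>The positive excess of the difference quotient in direction \<open>d\<close>
    over \<open>c\<close>. It is bounded by the Lipschitz constant and tends to zero at almost every
    point of the ball, so its integral vanishes in the limit.\<close>
  define q where "q n y = indicator (ball e0 (r - s)) y * max 0 ((V (y + \<delta> n *\<^sub>R d) - V y) / \<delta> n - c)" for n y
  have meas: "q n \<in> borel_measurable borel" for n
  proof -
    have "continuous_on UNIV (\<lambda>y. max 0 ((V (y + \<delta> n *\<^sub>R d) - V y) / \<delta> n - c))"
      using \<delta>(1)[of n] by (intro continuous_intros continuous_on_compose2[OF contV]) auto
    then have "(\<lambda>y. max 0 ((V (y + \<delta> n *\<^sub>R d) - V y) / \<delta> n - c)) \<in> borel_measurable borel"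
      by (rule borel_measurable_continuous_onI)
    then show ?thesis unfolding q_def by (intro borel_measurable_times borel_measurable_indicator) auto
  qed
  have q_bound: "norm (q n y) \<le> indicator (ball e0 (r - s)) y * (K * norm d + \<bar>c\<bar>)" for n y
  proof (cases "y \<in> ball e0 (r - s)")
    case True
    have "dist (y + \<delta> n *\<^sub>R d) y < s" using \<delta>[of n] by (simp add: dist_norm)
    then have "y + \<delta> n *\<^sub>R d \<in> ball e0 r" "y \<in> ball e0 r"
      using True s(1) dist_triangle[of e0 "y + \<delta> n *\<^sub>R d" y] by (auto simp: dist_commute)
    then have "dist (V (y + \<delta> n *\<^sub>R d)) (V y) \<le> K * dist (y + \<delta> n *\<^sub>R d) y"
      using lip by (auto simp: lipschitz_on_def)
    then have "\<bar>V (y + \<delta> n *\<^sub>R d) - V y\<bar> \<le> K * norm d * \<delta> n"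
      using \<delta>(1)[of n] by (simp add: dist_norm algebra_simps)
    then have "\<bar>(V (y + \<delta> n *\<^sub>R d) - V y) / \<delta> n\<bar> \<le> K * norm d"
      using \<delta>(1)[of n] by (simp add: field_simps)
    moreover have "0 \<le> K" using lip by (rule lipschitz_on_nonneg)
    moreover have "(V (y + \<delta> n *\<^sub>R d) - V y) / \<delta> n \<le> \<bar>(V (y + \<delta> n *\<^sub>R d) - V y) / \<delta> n\<bar>" by (rule abs_ge_self)
    ultimately show ?thesis using True by (simp add: q_def del: abs_divide)
  qed (simp add: q_def)
  have q_lim: "AE y in lebesgue. (\<lambda>n. q n y) \<longlonglongrightarrow> 0"
    using grad
  proof eventually_elim
    case (elim y)
    show ?case
    proof (cases "y \<in> ball e0 (r - s)")
      case True
      then have "y \<in> ball e0 r" using s(1) by auto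
      then obtain D where D: "GDERIV V y :> D" "D \<bullet> d \<le> c" using elim by blast
      have "((\<lambda>t. V (y + t *\<^sub>R d)) has_derivative (\<lambda>t. (t *\<^sub>R d) \<bullet> D)) (at 0)"
        using D(1) unfolding gderiv_def
        by (intro has_derivative_compose[of "\<lambda>t. y + t *\<^sub>R d" _ 0 UNIV V]) (auto intro!: derivative_eq_intros)
      then have "((\<lambda>t. V (y + t *\<^sub>R d)) has_real_derivative (d \<bullet> D)) (at 0)"
        unfolding has_field_derivative_def by (simp add: mult_commute_abs)
      then have "((\<lambda>t. (V (y + t *\<^sub>R d) - V y) / t) \<longlongrightarrow> d \<bullet> D) (at 0)"
        by (simp add: has_field_derivative_iff)
      then have "(\<lambda>n. (V (y + \<delta> n *\<^sub>R d) - V y) / \<delta> n) \<longlonglongrightarrow> d \<bullet> D"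
        by (rule filterlim_compose)
          (use \<delta>_lim \<delta>(1) in \<open>auto simp: filterlim_at less_imp_neq[symmetric] intro!: always_eventually\<close>)
      then have "(\<lambda>n. max 0 ((V (y + \<delta> n *\<^sub>R d) - V y) / \<delta> n - c)) \<longlonglongrightarrow> max 0 (d \<bullet> D - c)"
        by (intro tendsto_intros)
      then show ?thesis using True D(2) by (simp add: q_def inner_commute)
    qed (simp add: q_def)
  qed
  have int_bound: "integrable lebesgue (\<lambda>y. indicator (ball e0 (r - s)) y * (K * norm d + \<bar>c\<bar>))"
    using emeasure_bounded_finite[OF bounded_ball, of e0 "r - s"]
    by (intro integrable_mult_left integrable_real_indicator) auto
  have dct: "(\<lambda>n. integral\<^sup>L lebesgue (q n)) \<longlonglongrightarrow> integral\<^sup>L lebesgue (\<lambda>_::'a. 0::real)"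
    by (rule integral_dominated_convergence[OF _ _ int_bound q_lim])
      (use meas q_bound in \<open>auto intro: measurable_completion\<close>)
  have int_q: "integrable lborel (q n)" for n
  proof -
    have "integrable lborel (\<lambda>y. indicator (ball e0 (r - s)) y * (K * norm d + \<bar>c\<bar>))"
      using emeasure_bounded_finite[OF bounded_ball, of e0 "r - s"]
      by (intro integrable_mult_left integrable_real_indicator) auto
    then show ?thesis by (rule Bochner_Integration.integrable_bound) (use meas q_bound[THEN order_trans[OF _ abs_ge_self]] in auto)
  qed
  have "\<eta> * measure lborel B \<le> h * integral\<^sup>L lborel (q n)" for n
  proof -
    define m where "m = n + n0 + 1"
    have m: "real m * \<delta> n = h" by (simp add: m_def \<delta>_def)
    \<comment> \<open>The long increment telescopes into \<open>m\<close> short ones. If it exceeds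
      \<open>h * c\<close> by \<eta>, the excesses collected on the way add up to at least
      \<eta>.\<close>
    have le: "\<eta> * indicator B y \<le> (\<Sum>k<m. \<delta> n * q n ((real k * \<delta> n) *\<^sub>R d + y))" for y
    proof (cases "y \<in> B")
      case True
      have "V (y + h *\<^sub>R d) - V y = (\<Sum>k<m. V (y + (real (Suc k) * \<delta> n) *\<^sub>R d) - V (y + (real k * \<delta> n) *\<^sub>R d))"
        using m by (subst sum_lessThan_telescope) simp
      also have "\<dots> \<le> (\<Sum>k<m. \<delta> n * c + \<delta> n * q n ((real k * \<delta> n) *\<^sub>R d + y))"
      proof (rule sum_mono)
        fix k assume "k \<in> {..<m}"
        then have "real k * \<delta> n \<le> real m * \<delta> n" using \<delta>(1)[of n] by (intro mult_right_mono) auto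
        then have "y + (real k * \<delta> n) *\<^sub>R d \<in> ball e0 (r - s)"
          using \<delta>(1)[of n] True m by (intro tube) auto
        then have "q n (y + (real k * \<delta> n) *\<^sub>R d) \<ge>
            (V (y + (real k * \<delta> n) *\<^sub>R d + \<delta> n *\<^sub>R d) - V (y + (real k * \<delta> n) *\<^sub>R d)) / \<delta> n - c"
          by (simp add: q_def)
        moreover have "y + (real k * \<delta> n) *\<^sub>R d + \<delta> n *\<^sub>R d = y + (real (Suc k) * \<delta> n) *\<^sub>R d"
          by (simp add: algebra_simps)
        ultimately show "V (y + (real (Suc k) * \<delta> n) *\<^sub>R d) - V (y + (real k * \<delta> n) *\<^sub>R d)
            \<le> \<delta> n * c + \<delta> n * q n ((real k * \<delta> n) *\<^sub>R d + y)"
          using \<delta>(1)[of n] by (simp add: field_simps)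
      qed
      also have "\<dots> = h * c + (\<Sum>k<m. \<delta> n * q n ((real k * \<delta> n) *\<^sub>R d + y))"
        using m by (simp add: sum.distrib)
      finally show ?thesis using B[OF True] True by simp
    next
      case False
      have "0 \<le> q n x" for x by (auto simp: q_def indicator_def)
      then show ?thesis using False \<delta>(1)[of n] by (auto intro!: sum_nonneg)
    qed
    have "\<eta> * measure lborel B = integral\<^sup>L lborel (\<lambda>y. \<eta> * indicator B y)"
      by (simp add: B_def)
    also have "\<dots> \<le> integral\<^sup>L lborel (\<lambda>y. \<Sum>k<m. \<delta> n * q n ((real k * \<delta> n) *\<^sub>R d + y))"
      using le emeasure_bounded_finite[OF bounded_ball, of y0 "min s s1"] by (intro integral_mono integrable_mult_right integrable_real_indicator Bochner_Integration.integrable_sum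
          lborel_integrable_translation int_q) (auto simp: B_def)
    \<comment> \<open>By translation invariance all steps contribute the same integral, so refining
      the subdivision leaves the total factor at \<open>h\<close>.\<close>
    also have "\<dots> = (\<Sum>k<m. \<delta> n * integral\<^sup>L lborel (q n))"
      by (subst Bochner_Integration.integral_sum)
        (simp_all add: integrable_mult_right lborel_integrable_translation int_q lborel_integral_translation meas)
    also have "\<dots> = h * integral\<^sup>L lborel (q n)" using m by (simp add: algebra_simps)
    finally show ?thesis .
  qed
  moreover have "integral\<^sup>L lebesgue (q n) = integral\<^sup>L lborel (q n)" for n
    using meas by (intro integral_completion) auto
  ultimately have "\<eta> * measure lborel B \<le> h * 0"
    using dct by (intro LIMSEQ_le_const[OF tendsto_mult_left[of _ 0]]) auto
  moreover have "0 < measure lborel B"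
    using s s1 by (simp add: B_def content_ball_pos)
  ultimately show False using \<open>0 < \<eta>\<close> by (simp add: mult_le_0_iff)
qed

lemma norm_gradient_le:
  fixes V :: "'a::euclidean_space \<Rightarrow> real"
  assumes lip: "K-lipschitz_on U V" and "open U" "y \<in> U" and D: "GDERIV V y :> D"
  shows "norm D \<le> K"
proof (cases "D = 0")
  case True
  then show ?thesis using lip by (simp add: lipschitz_on_nonneg)
next
  case False
  have "((\<lambda>t. V (y + t *\<^sub>R D)) has_derivative (\<lambda>t. (t *\<^sub>R D) \<bullet> D)) (at 0)"
    using D unfolding gderiv_def
    by (intro has_derivative_compose[of "\<lambda>t. y + t *\<^sub>R D" _ 0 UNIV V]) (auto intro!: derivative_eq_intros)
  then have "((\<lambda>t. V (y + t *\<^sub>R D)) has_real_derivative (D \<bullet> D)) (at 0)"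
    unfolding has_field_derivative_def by (simp add: mult_commute_abs)
  then have lim: "((\<lambda>t. (V (y + t *\<^sub>R D) - V y) / t) \<longlongrightarrow> D \<bullet> D) (at 0)"
    by (simp add: has_field_derivative_iff)
  have "((\<lambda>t. y + t *\<^sub>R D) \<longlongrightarrow> y + 0 *\<^sub>R D) (at 0)" by (intro tendsto_intros)
  then have "\<forall>\<^sub>F t in at 0. y + t *\<^sub>R D \<in> U" using assms(2,3) by (auto dest: topological_tendstoD)
  then have "\<forall>\<^sub>F t in at 0. (V (y + t *\<^sub>R D) - V y) / t \<le> K * norm D"
  proof eventually_elim
    case (elim t)
    then have "dist (V (y + t *\<^sub>R D)) (V y) \<le> K * dist (y + t *\<^sub>R D) y"
      using lip \<open>y \<in> U\<close> by (auto simp: lipschitz_on_def)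
    then have "\<bar>(V (y + t *\<^sub>R D) - V y) / t\<bar> \<le> K * norm D" using lipschitz_on_nonneg[OF lip]
      by (cases "t = 0") (auto simp: dist_norm field_simps)
    then show ?case by linarith
  qed
  then have "D \<bullet> D \<le> K * norm D" by (intro tendsto_upperbound[OF lim]) auto
  then show ?thesis using False by (simp add: dot_square_norm power2_eq_square)
qed

lemma locally_lipschitz_imp_continuous: "locally_lipschitz f \<Longrightarrow> continuous_on UNIV f"
  using calm_at_imp_tendsto[OF calm_at_locally_lipschitz]
  by (auto simp: continuous_on_eq_continuous_at isCont_def tendsto_at_iff_tendsto_nhds)

text \<open>Freezes the field at \<open>e0\<close>: the gradient is bounded by the local Lipschitz
  constant, so a continuous field may be replaced by its value at the centre at the cost of
  \<delta>.\<close>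

lemma increment_le_of_ae_gradient_field:
  fixes V :: "'a::euclidean_space \<Rightarrow> real"
  assumes V: "locally_lipschitz V"
    and grad: "AE y in lebesgue. \<exists>D. GDERIV V y :> D \<and> D \<bullet> f y \<le> r y"
    and f: "isCont f e0" and r: "isCont r e0" and "0 < \<delta>"
  shows "\<exists>\<rho>>0. \<forall>y h. 0 \<le> h \<longrightarrow> y \<in> ball e0 \<rho> \<longrightarrow> y + h *\<^sub>R f e0 \<in> ball e0 \<rho> \<longrightarrow>
    V (y + h *\<^sub>R f e0) - V y \<le> h * (r e0 + \<delta>)"
proof -
  obtain u K where u: "u > 0" "K-lipschitz_on (cball e0 u) V"
    using V by (rule locally_lipschitzE)
  have "0 \<le> K" using u(2) by (rule lipschitz_on_nonneg)
  define \<kappa> where "\<kappa> = \<delta> / (2 * (K + 1))"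
  have "0 < \<kappa>" using \<open>0 \<le> K\<close> \<open>0 < \<delta>\<close> by (simp add: \<kappa>_def)
  obtain d1 where d1: "d1 > 0" "\<And>y. dist y e0 < d1 \<Longrightarrow> dist (f y) (f e0) < \<kappa>"
    using f \<open>0 < \<kappa>\<close> unfolding continuous_at_eps_delta by metis
  have "0 < \<delta> / 2" using \<open>0 < \<delta>\<close> by simp
  then obtain d2 where d2: "d2 > 0" "\<And>y. dist y e0 < d2 \<Longrightarrow> dist (r y) (r e0) < \<delta> / 2"
    using r unfolding continuous_at_eps_delta by metis
  define \<rho> where "\<rho> = min u (min d1 d2)"
  have "0 < \<rho>" using u d1 d2 by (simp add: \<rho>_def)
  have lip: "K-lipschitz_on (ball e0 \<rho>) V"
    by (rule lipschitz_on_subset[OF u(2)]) (auto simp: \<rho>_def)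
  have "AE y in lebesgue. y \<in> ball e0 \<rho> \<longrightarrow> (\<exists>D. GDERIV V y :> D \<and> D \<bullet> f e0 \<le> r e0 + \<delta>)"
    using grad
  proof eventually_elim
    case (elim y)
    show ?case
    proof
      assume y: "y \<in> ball e0 \<rho>"
      obtain D where D: "GDERIV V y :> D" "D \<bullet> f y \<le> r y" using elim by blast
      have "norm D \<le> K" using norm_gradient_le[OF lip open_ball y D(1)] .
      have "D \<bullet> f e0 = D \<bullet> f y + D \<bullet> (f e0 - f y)" by (simp add: inner_diff_right)
      also have "D \<bullet> (f e0 - f y) \<le> norm D * norm (f e0 - f y)" by (rule norm_cauchy_schwarz)
      also have "\<dots> \<le> K * \<kappa>"
        using \<open>norm D \<le> K\<close> d1(2)[of y] y \<open>0 \<le> K\<close> by (intro mult_mono) (auto simp: \<rho>_def dist_norm norm_minus_commute)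
      also have "\<dots> \<le> \<delta> / 2" using \<open>0 \<le> K\<close> \<open>0 < \<delta>\<close> by (simp add: \<kappa>_def field_simps)
      finally have "D \<bullet> f e0 \<le> r y + \<delta> / 2" using D(2) by simp
      also have "\<dots> \<le> r e0 + \<delta>"
      proof -
        have "\<bar>r y - r e0\<bar> < \<delta> / 2"
          using d2(2)[of y] y by (simp add: \<rho>_def dist_real_def dist_norm norm_minus_commute)
        then show ?thesis by linarith
      qed
      finally show "\<exists>D. GDERIV V y :> D \<and> D \<bullet> f e0 \<le> r e0 + \<delta>" using D(1) by blast
    qed
  qed
  then show ?thesis
    using increment_le_of_ae_gradient_le[OF lip locally_lipschitz_imp_continuous[OF V]] \<open>0 < \<rho>\<close> by blast
qed

lemma upper_drv_ae_gradient_field: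
  fixes V :: "'a::euclidean_space \<Rightarrow> real"
  assumes V: "locally_lipschitz V"
    and grad: "AE y in lebesgue. \<exists>D. GDERIV V y :> D \<and> D \<bullet> f y \<le> r y"
    and f: "isCont f (e t)" and r: "isCont r (e t)"
    and e: "(e has_vector_derivative f (e t)) (at t)"
  shows "upper_drv (\<lambda>s. V (e s)) t (r (e t))"
  unfolding upper_drv_def
proof (intro allI impI)
  fix \<delta> :: real assume "0 < \<delta>"
  obtain u K where u: "u > 0" "K-lipschitz_on (cball (e t) u) V"
    using V by (rule locally_lipschitzE)
  have "0 \<le> K" using u(2) by (rule lipschitz_on_nonneg)
  define d where "d = f (e t)"
  obtain \<rho> where \<rho>: "\<rho> > 0" "\<And>y h. \<lbrakk>0 \<le> h; y \<in> ball (e t) \<rho>; y + h *\<^sub>R d \<in> ball (e t) \<rho>\<rbrakk> \<Longrightarrow>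
    V (y + h *\<^sub>R d) - V y \<le> h * (r (e t) + \<delta> / 2)"
    using increment_le_of_ae_gradient_field[OF V grad f r, of "\<delta> / 2"] \<open>0 < \<delta>\<close> unfolding d_def by auto
  define \<kappa> where "\<kappa> = \<delta> / (2 * (K + 1))"
  have "0 < \<kappa>" using \<open>0 \<le> K\<close> \<open>0 < \<delta>\<close> by (simp add: \<kappa>_def)
  obtain r1 where r1: "r1 > 0" "\<And>s. \<bar>s - t\<bar> < r1 \<Longrightarrow> norm (e s - e t - (s - t) *\<^sub>R d) \<le> \<kappa> * \<bar>s - t\<bar>"
    using e \<open>0 < \<kappa>\<close> unfolding has_vector_derivative_def has_derivative_at_alt d_def by (metis real_norm_def)
  have "(e \<longlongrightarrow> e t) (nhds t)"
    using has_vector_derivative_continuous[OF e] by (simp add: isCont_def tendsto_at_iff_tendsto_nhds)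
  moreover have "((\<lambda>s. e t + (s - t) *\<^sub>R d) \<longlongrightarrow> e t + (t - t) *\<^sub>R d) (nhds t)"
    by (intro tendsto_intros filterlim_ident)
  ultimately have "\<forall>\<^sub>F s in nhds t. dist (e s) (e t) < min \<rho> u" "\<forall>\<^sub>F s in nhds t. dist (e t + (s - t) *\<^sub>R d) (e t) < min \<rho> u"
    using \<rho>(1) u(1) by (auto dest!: tendstoD[where e = "min \<rho> u"])
  then have "\<forall>\<^sub>F s in nhds t. dist (e s) (e t) < min \<rho> u \<and> dist (e t + (s - t) *\<^sub>R d) (e t) < min \<rho> u"
    by (rule eventually_conj)
  then obtain r2 where r2: "r2 > 0" "\<And>s. \<bar>s - t\<bar> < r2 \<Longrightarrow> dist (e s) (e t) < min \<rho> u \<and> dist (e t + (s - t) *\<^sub>R d) (e t) < min \<rho> u"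
    unfolding eventually_nhds_metric dist_real_def by blast
  have "V (e y) - V (e x) \<le> (r (e t) + \<delta>) * (y - x)"
    if xy: "t - min r1 r2 < x" "x \<le> t" "t \<le> y" "y < t + min r1 r2" for x y
  proof -
    define p where "p s = e t + (s - t) *\<^sub>R d" for s
    have near: "dist (e s) (e t) < min \<rho> u" "dist (p s) (e t) < min \<rho> u" "norm (e s - p s) \<le> \<kappa> * \<bar>s - t\<bar>"
      if "s = x \<or> s = y" for s
      using r2(2)[of s] r1(2)[of s] xy that by (auto simp: p_def algebra_simps)
    have Vp: "\<bar>V (e s) - V (p s)\<bar> \<le> \<delta> / 2 * \<bar>s - t\<bar>" if "s = x \<or> s = y" for s
    proof -
      have "dist (V (e s)) (V (p s)) \<le> K * dist (e s) (p s)"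
        using u(2) near[OF that] by (auto simp: lipschitz_on_def dist_commute)
      also have "\<dots> \<le> K * (\<kappa> * \<bar>s - t\<bar>)"
        using near(3)[OF that] \<open>0 \<le> K\<close> by (intro mult_left_mono) (auto simp: dist_norm)
      also have "\<dots> = (K * \<kappa>) * \<bar>s - t\<bar>" by simp
      also have "\<dots> \<le> \<delta> / 2 * \<bar>s - t\<bar>"
        using \<open>0 \<le> K\<close> \<open>0 < \<delta>\<close> by (intro mult_right_mono) (auto simp: \<kappa>_def field_simps)
      finally show ?thesis by (simp add: dist_real_def)
    qed
    have "p x + (y - x) *\<^sub>R d = p y" by (simp add: p_def algebra_simps)
    then have "V (p y) - V (p x) \<le> (y - x) * (r (e t) + \<delta> / 2)"
      using \<rho>(2)[of "y - x" "p x"] near xy by (auto simp: dist_commute)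
    moreover have "\<bar>V (e x) - V (p x)\<bar> \<le> \<delta> / 2 * (t - x)" "\<bar>V (e y) - V (p y)\<bar> \<le> \<delta> / 2 * (y - t)"
      using Vp[of x] Vp[of y] xy by auto
    moreover have "(r (e t) + \<delta>) * (y - x) = (y - x) * (r (e t) + \<delta> / 2) + \<delta> / 2 * (t - x) + \<delta> / 2 * (y - t)"
      by (simp add: field_simps)
    ultimately show ?thesis by linarith
  qed
  then show "\<exists>r'>0. \<forall>x y. t - r' < x \<longrightarrow> x \<le> t \<longrightarrow> t \<le> y \<longrightarrow> y < t + r' \<longrightarrow>
      V (e y) - V (e x) \<le> (r (e t) + \<delta>) * (y - x)"
    using r1(1) r2(1) by (intro exI[of _ "min r1 r2"]) auto
qed

section \<open>Comparison functions\<close>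

lemma class_K_strict: "class_K f \<Longrightarrow> 0 \<le> x \<Longrightarrow> x < y \<Longrightarrow> f x < f y"
  using strict_mono_onD[of "{0..}" f x y] by (simp add: class_K_def)

lemma class_K_mono: "class_K f \<Longrightarrow> 0 \<le> x \<Longrightarrow> x \<le> y \<Longrightarrow> f x \<le> f y"
  using class_K_strict[of f x y] by (cases "x = y") auto

lemma class_K_zero: "class_K f \<Longrightarrow> f 0 = 0"
  by (simp add: class_K_def)

lemma class_K_nonneg: "class_K f \<Longrightarrow> 0 \<le> x \<Longrightarrow> 0 \<le> f x"
  using class_K_mono[of f 0 x] by (simp add: class_K_zero)

lemma class_K_inf_imp_class_K: "class_K_inf f \<Longrightarrow> class_K f"
  by (simp add: class_K_inf_def)

lemmas class_K_inf_mono = class_K_mono[OF class_K_inf_imp_class_K]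
lemmas class_K_inf_nonneg = class_K_nonneg[OF class_K_inf_imp_class_K]
lemmas class_K_inf_zero = class_K_zero[OF class_K_inf_imp_class_K]

lemma class_K_add:
  assumes "class_K f" "class_K g" shows "class_K (\<lambda>x. f x + g x)"
  using assms unfolding class_K_def strict_mono_on_def
  by (auto intro!: continuous_on_add add_strict_mono)

lemma class_K_inf_add:
  assumes "class_K_inf f" "class_K g" shows "class_K_inf (\<lambda>x. f x + g x)"
  unfolding class_K_inf_def
proof
  show "class_K (\<lambda>x. f x + g x)" using class_K_add[OF class_K_inf_imp_class_K[OF assms(1)] assms(2)] .
  have "\<forall>\<^sub>F x in at_top. f x \<le> f x + g x"
    using eventually_ge_at_top[of 0] by eventually_elim (use class_K_nonneg[OF assms(2)] in simp)
  then show "filterlim (\<lambda>x. f x + g x) at_top at_top"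
    by (rule filterlim_at_top_mono[rotated]) (use assms(1) in \<open>simp add: class_K_inf_def\<close>)
qed

lemma class_K_inf_compose:
  assumes "class_K_inf f" "class_K_inf g" shows "class_K_inf (\<lambda>x. f (g x))"
  unfolding class_K_inf_def class_K_def
proof (intro conjI)
  show "continuous_on {0..} (\<lambda>x. f (g x))"
    using assms class_K_inf_nonneg[OF assms(2)]
    by (intro continuous_on_compose2[of "{0..}" f "{0..}" g]) (auto simp: class_K_inf_def class_K_def)
  show "strict_mono_on {0..} (\<lambda>x. f (g x))"
  proof (rule strict_mono_onI)
    fix r s :: real assume "r \<in> {0..}" "s \<in> {0..}" "r < s"
    then show "f (g r) < f (g s)"
      using class_K_strict[OF class_K_inf_imp_class_K[OF assms(2)], of r s] class_K_inf_nonneg[OF assms(2), of r]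
      by (intro class_K_strict[OF class_K_inf_imp_class_K[OF assms(1)]]) auto
  qed
  show "f (g 0) = 0" using assms by (simp add: class_K_inf_zero)
  show "filterlim (\<lambda>x. f (g x)) at_top at_top"
    using assms by (auto simp: class_K_inf_def intro: filterlim_compose)
qed

lemma class_K_inf_id: "class_K_inf (\<lambda>x. x)"
  by (auto simp: class_K_inf_def class_K_def strict_mono_on_def filterlim_ident)

lemma class_K_inf_scale:
  assumes "0 < c" shows "class_K_inf (\<lambda>x. c * x)"
  using assms unfolding class_K_inf_def class_K_def
  by (auto simp: strict_mono_on_def intro!: continuous_intros filterlim_tendsto_pos_mult_at_top[OF tendsto_const] filterlim_ident)

lemma class_K_inf_sqrt: "class_K_inf sqrt"
  unfolding class_K_inf_def class_K_def
  by (auto simp: strict_mono_on_def intro!: continuous_intros sqrt_at_top)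

lemma class_K_inf_power2: "class_K_inf (\<lambda>x. x\<^sup>2)"
  unfolding class_K_inf_def class_K_def
  by (auto simp: strict_mono_on_def intro!: continuous_intros power_strict_mono filterlim_pow_at_top filterlim_ident)

lemma class_K_inf_sum:
  assumes "finite I" "class_K_inf f" "\<And>i. i \<in> I \<Longrightarrow> class_K (g i)"
  shows "class_K_inf (\<lambda>x. f x + (\<Sum>i\<in>I. g i x))"
  using assms
proof (induction I)
  case (insert i I)
  then have "class_K_inf (\<lambda>x. (f x + (\<Sum>i\<in>I. g i x)) + g i x)" by (intro class_K_inf_add[of "\<lambda>x. f x + (\<Sum>i\<in>I. g i x)"]) auto
  then show ?case using insert by (simp add: algebra_simps)
qed simp

lemma class_K_inf_min:
  assumes "class_K_inf f" "class_K_inf g" shows "class_K_inf (\<lambda>x. min (f x) (g x))"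
  unfolding class_K_inf_def class_K_def
proof (intro conjI)
  show "continuous_on {0..} (\<lambda>x. min (f x) (g x))"
    using assms by (intro continuous_on_min) (auto simp: class_K_inf_def class_K_def)
  show "strict_mono_on {0..} (\<lambda>x. min (f x) (g x))"
    using assms class_K_strict by (intro strict_mono_onI) (fastforce simp: class_K_inf_def min_less_iff_disj)
  show "min (f 0) (g 0) = 0" using assms by (simp add: class_K_inf_zero)
  show "filterlim (\<lambda>x. min (f x) (g x)) at_top at_top"
    using assms unfolding class_K_inf_def filterlim_at_top
    by (auto intro: eventually_conj)
qed

text \<open>The minimum starts with the identity; \<open>b s \<le> s\<close> later merges
  \<open>w + t * b w\<close> into \<open>(1 + t) * b w\<close> from below.\<close>

lemma class_K_inf_lower_bound:
  assumes "finite I" "\<And>i. i \<in> I \<Longrightarrow> class_K_inf (f i)"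
  shows "\<exists>b. class_K_inf b \<and> (\<forall>i\<in>I. \<forall>s. b s \<le> f i s) \<and> (\<forall>s. b s \<le> s)"
  using assms
proof (induction I)
  case empty
  show ?case by (intro exI[of _ "\<lambda>x. x"]) (auto simp: class_K_inf_id)
next
  case (insert i I)
  then obtain b where b: "class_K_inf b" "\<forall>i\<in>I. \<forall>s. b s \<le> f i s" "\<forall>s. b s \<le> s" by auto
  show ?case
    by (rule exI[of _ "\<lambda>x. min (b x) (f i x)"])
      (use b insert class_K_inf_min in \<open>auto simp: min_le_iff_disj\<close>)
qed

lemma class_K_inf_inverse:
  assumes f: "class_K_inf f"
  obtains g where "class_K_inf g" "\<And>x. 0 \<le> x \<Longrightarrow> f (g x) = x" "\<And>x. 0 \<le> x \<Longrightarrow> g (f x) = x"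
proof -
  have K: "class_K f" using f by (rule class_K_inf_imp_class_K)
  \<comment> \<open>Continuing by the identity on the negative axis gives a bijection of the whole
    line; its inverse is monotone and onto, hence continuous.\<close>
  define F where "F x = (if x < 0 then x else f x)" for x
  have F_less: "F x < F y" if "x < y" for x y
    using that class_K_strict[OF K] class_K_nonneg[OF K, of y] by (auto simp: F_def)
  have "\<exists>x. F x = y" for y
  proof (cases "y < 0")
    case True then show ?thesis by (auto simp: F_def)
  next
    case False
    obtain b where "0 \<le> b" "y \<le> f b"
      using f unfolding class_K_inf_def filterlim_at_top eventually_at_top_linorder by (metis nle_le)
    moreover have "continuous_on {0..b} f"
      using K by (auto simp: class_K_def intro: continuous_on_subset)
    ultimately obtain x where "0 \<le> x" "f x = y"
      using IVT'[of f 0 y b] False class_K_zero[OF K] by auto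
    then show ?thesis by (intro exI[of _ x]) (simp add: F_def)
  qed
  then obtain G where FG: "\<And>y. F (G y) = y" by metis
  have GF: "G (F x) = x" for x
    using F_less FG by (metis linorder_neqE_linordered_idom less_irrefl)
  have G_less: "G x < G y" if "x < y" for x y
    using F_less FG that by (metis linorder_neqE_linordered_idom less_asym)
  have "range G = UNIV" using GF by (metis surjI)
  then have contG: "continuous_on UNIV G"
    using G_less by (intro continuous_onI_mono) (auto simp: le_less)
  have G0: "G 0 = 0" using GF[of 0] class_K_zero[OF K] by (simp add: F_def)
  have Gnn: "0 \<le> G x" if "0 \<le> x" for x using G_less[of 0 x] G0 that by (cases "x = 0") auto
  show ?thesis
  proof
    show "class_K_inf G"
      unfolding class_K_inf_def class_K_def
    proof (intro conjI G0)
      show "continuous_on {0..} G" using contG by (rule continuous_on_subset) simp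
      show "strict_mono_on {0..} G" using G_less by (intro strict_mono_onI) auto
      have "\<forall>\<^sub>F x in at_top. Z \<le> G x" for Z
        using eventually_ge_at_top[of "F Z"]
        by eventually_elim (metis GF G_less le_less)
      then show "filterlim G at_top at_top" by (simp add: filterlim_at_top)
    qed
    show "f (G x) = x" if "0 \<le> x" for x using FG[of x] Gnn[OF that] by (simp add: F_def)
    show "G (f x) = x" if "0 \<le> x" for x using GF[of x] that by (simp add: F_def)
  qed
qed

text \<open>The weak triangle inequality: a sum is at most twice its larger term.\<close>

lemma class_K_add_le:
  assumes "class_K f" "0 \<le> x" "0 \<le> y"
  shows "f (x + y) \<le> f (2 * x) + f (2 * y)"
proof (cases "x \<le> y")
  case True
  then have "f (x + y) \<le> f (2 * y)" using assms by (intro class_K_mono[OF assms(1)]) auto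
  then show ?thesis using class_K_nonneg[OF assms(1), of "2 * x"] assms by simp
next
  case False
  then have "f (x + y) \<le> f (2 * x)" using assms by (intro class_K_mono[OF assms(1)]) auto
  then show ?thesis using class_K_nonneg[OF assms(1), of "2 * y"] assms by simp
qed

text \<open>This hyperbolic shape is what the decay estimate \<open>(1 + t) * b w \<le> w0\<close>
  yields after inverting \<open>b\<close>.\<close>

lemma class_KL_of_class_K_inf:
  assumes f: "class_K_inf f" and \<theta>: "class_K_inf \<theta>"
  shows "class_KL (\<lambda>r t. f (\<theta> r / (1 + t)))"
proof -
  have K: "class_K f" "class_K \<theta>" using assms by (auto intro: class_K_inf_imp_class_K)
  have contf: "continuous_on {0..} f" and cont\<theta>: "continuous_on {0..} \<theta>" using K by (auto simp: class_K_def)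
  have nn: "0 \<le> \<theta> r / (1 + t)" if "0 \<le> r" "0 \<le> t" for r t
    using class_K_nonneg[OF K(2)] that by simp
  have lim: "((\<lambda>t. f (\<theta> r / (1 + t))) \<longlongrightarrow> 0) at_top" if "0 \<le> r" for r
  proof -
    have "((\<lambda>t. \<theta> r / (1 + t)) \<longlongrightarrow> 0) at_top"
      by (intro real_tendsto_divide_at_top[OF tendsto_const] filterlim_tendsto_add_at_top[OF tendsto_const] filterlim_ident)
    moreover have "\<forall>\<^sub>F t in at_top. \<theta> r / (1 + t) \<in> {0..}"
      using eventually_ge_at_top[of 0] by eventually_elim (use nn[OF that] in simp)
    ultimately have "((\<lambda>t. f (\<theta> r / (1 + t))) \<longlongrightarrow> f 0) at_top"
      by (intro continuous_on_tendsto_compose[OF contf]) auto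
    then show ?thesis using class_K_zero[OF K(1)] by simp
  qed
  have "continuous_on ({0..} \<times> {0..}) (\<lambda>p. f (\<theta> (fst p) / (1 + snd p)))"
  proof (rule continuous_on_compose2[OF contf])
    have "continuous_on ({0..} \<times> {0::real..}) (\<lambda>p. \<theta> (fst p))"
      by (rule continuous_on_compose2[OF cont\<theta>]) (auto intro: continuous_on_fst)
    then show "continuous_on ({0..} \<times> {0..}) (\<lambda>p. \<theta> (fst p) / (1 + snd p))"
      by (intro continuous_intros) auto
  qed (use nn in auto)
  moreover have "class_K (\<lambda>r. f (\<theta> r / (1 + t)))" if "0 \<le> t" for t
  proof -
    have "class_K_inf (\<lambda>r. f (1 / (1 + t) * \<theta> r))"
      using that by (intro class_K_inf_compose[OF f] class_K_inf_compose[OF class_K_inf_scale \<theta>]) auto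
    then show ?thesis by (intro class_K_inf_imp_class_K) simp
  qed
  moreover have "antimono_on {0..} (\<lambda>t. f (\<theta> r / (1 + t)))" if "0 \<le> r" for r
    using that class_K_nonneg[OF K(2) that] nn
    by (intro monotone_onI class_K_mono[OF K(1)]) (auto intro!: divide_left_mono)
  ultimately show ?thesis using lim by (simp add: class_KL_def case_prod_unfold)
qed

section \<open>Hybrid time domains\<close>

text \<open>Truncating at a point of the domain makes that point the last one, which fixes both the
  number of slices and the final time.\<close>

lemma hybrid_time_domain_prefix:
  assumes "hybrid_time_domain E" "(T, J) \<in> E"
  obtains t where "t 0 = 0" "\<And>j. j \<le> J \<Longrightarrow> t j \<le> t (Suc j)" "t (Suc J) = T"
    "E \<inter> ({0..T} \<times> {0..J}) = (\<Union>j\<le>J. {t j..t (Suc j)} \<times> {j})"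
proof -
  have "compact_hybrid_time_domain (E \<inter> ({0..T} \<times> {0..J}))"
    using assms unfolding hybrid_time_domain_def by blast
  then obtain J' t where t: "t 0 = 0" "\<And>j. j < J' \<Longrightarrow> t j \<le> t (Suc j)"
    and E: "E \<inter> ({0..T} \<times> {0..J}) = (\<Union>j<J'. {t j..t (Suc j)} \<times> {j})"
    unfolding compact_hybrid_time_domain_def by auto
  have "0 \<le> T" using assms unfolding hybrid_time_domain_def by auto
  then have TJ: "(T, J) \<in> (\<Union>j<J'. {t j..t (Suc j)} \<times> {j})" using assms(2) by (subst E[symmetric]) auto
  then have "J < J'" "t J \<le> T" "T \<le> t (Suc J)" by auto
  have sub: "s \<le> T \<and> j \<le> J" if "j < J'" "s \<in> {t j..t (Suc j)}" for s j
  proof -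
    have "(s, j) \<in> E \<inter> ({0..T} \<times> {0..J})" using that by (subst E) auto
    then show ?thesis by auto
  qed
  have "J' = Suc J" using sub[of "J' - 1" "t (J' - 1)"] t(2)[of "J' - 1"] \<open>J < J'\<close> by auto
  moreover have "t (Suc J) = T"
    using sub[of J "t (Suc J)"] t(2)[of J] \<open>J < J'\<close> \<open>T \<le> t (Suc J)\<close> by auto
  ultimately show ?thesis using t E by (intro that[of t]) (auto simp: lessThan_Suc_atMost)
qed

lemma hybrid_time_domain_induct:
  assumes E: "hybrid_time_domain E" and TJ: "(T, J) \<in> E"
    and init: "P 0 0"
    and flow: "\<And>a b j. \<lbrakk>P a j; 0 \<le> a; a \<le> b; b \<le> T; j \<le> J; {a..b} \<subseteq> slice E j\<rbrakk> \<Longrightarrow> P b j"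
    and jump: "\<And>t j. \<lbrakk>P t j; 0 \<le> t; t \<le> T; Suc j \<le> J; (t, j) \<in> jump_times E\<rbrakk> \<Longrightarrow> P t (Suc j)"
  shows "P T J"
proof -
  obtain t where t: "t 0 = 0" "\<And>j. j \<le> J \<Longrightarrow> t j \<le> t (Suc j)" "t (Suc J) = T"
    and EE: "E \<inter> ({0..T} \<times> {0..J}) = (\<Union>j\<le>J. {t j..t (Suc j)} \<times> {j})"
    by (rule hybrid_time_domain_prefix[OF E TJ]) (rule that)
  have inE: "(s, j) \<in> E \<and> 0 \<le> s \<and> s \<le> T" if "j \<le> J" "s \<in> {t j..t (Suc j)}" for s j
  proof -
    have "(s, j) \<in> E \<inter> ({0..T} \<times> {0..J})" using that by (subst EE) auto
    then show ?thesis by auto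
  qed
  have "P (t (Suc j)) j" if "j \<le> J" for j
    using that
  proof (induction j)
    case 0
    show ?case
    proof (rule flow[OF init])
      show "0 \<le> t (Suc 0)" using t(1) t(2)[of 0] by simp
      then have "t (Suc 0) \<in> {t 0..t (Suc 0)}" using t(1) by (simp only: atLeastAtMost_iff order_refl)
      then show "t (Suc 0) \<le> T" using inE[OF le0] by blast
      show "{0..t (Suc 0)} \<subseteq> slice E 0"
        using inE[OF le0] unfolding t(1) slice_def by blast
    qed simp_all
  next
    case (Suc j)
    have tt: "t j \<le> t (Suc j)" "t (Suc j) \<le> t (Suc (Suc j))" using t(2) Suc.prems by auto
    have 1: "P (t (Suc j)) (Suc j)"
      using Suc inE[of j "t (Suc j)"] inE[of "Suc j" "t (Suc j)"] tt
      by (intro jump) (auto simp: jump_times_def)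
    show ?case
      by (rule flow[OF 1]) (use Suc.prems inE[of "Suc j"] tt in \<open>auto simp: slice_def\<close>)
  qed
  from this[of J] show ?thesis using t(3) by simp
qed

text \<open>For a function \<open>h\<close> that is bounded below this limits the number of jumps by
  the elapsed time; it will be applied to the sum of all timers.\<close>

lemma hybrid_decrease:
  fixes h :: "real \<Rightarrow> nat \<Rightarrow> real"
  assumes E: "hybrid_time_domain E" and TJ: "(T, J) \<in> E"
    and flow: "\<And>a b j. \<lbrakk>0 \<le> a; a \<le> b; b \<le> T; j \<le> J; {a..b} \<subseteq> slice E j\<rbrakk> \<Longrightarrow> h b j - h a j \<le> \<kappa> * (b - a)"
    and jump: "\<And>t j. \<lbrakk>0 \<le> t; t \<le> T; Suc j \<le> J; (t, j) \<in> jump_times E\<rbrakk> \<Longrightarrow> h t (Suc j) \<le> h t j - c"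
  shows "h T J \<le> h 0 0 + \<kappa> * T - c * real J"
proof (rule hybrid_time_domain_induct[OF E TJ, where P = "\<lambda>t j. h t j \<le> h 0 0 + \<kappa> * t - c * real j"])
  fix a b j assume "h a j \<le> h 0 0 + \<kappa> * a - c * real j"
    "0 \<le> a" "a \<le> b" "b \<le> T" "j \<le> J" "{a..b} \<subseteq> slice E j"
  then show "h b j \<le> h 0 0 + \<kappa> * b - c * real j"
    using flow[of a b j] by (simp add: algebra_simps)
next
  fix t j assume "h t j \<le> h 0 0 + \<kappa> * t - c * real j"
    "0 \<le> t" "t \<le> T" "Suc j \<le> J" "(t, j) \<in> jump_times E"
  then show "h t (Suc j) \<le> h 0 0 + \<kappa> * t - c * real (Suc j)"
    using jump[of t j] by (simp add: algebra_simps)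
qed simp

lemma hybrid_time_domain_0: "hybrid_time_domain E \<Longrightarrow> (0, 0) \<in> E"
proof -
  assume E: "hybrid_time_domain E"
  then obtain T J where TJ: "(T, J) \<in> E" by (auto simp: hybrid_time_domain_def)
  obtain t where t0: "t 0 = 0" and tS: "\<And>j. j \<le> J \<Longrightarrow> t j \<le> t (Suc j)" and "t (Suc J) = T"
    and EE: "E \<inter> ({0..T} \<times> {0..J}) = (\<Union>j\<le>J. {t j..t (Suc j)} \<times> {j})"
    by (rule hybrid_time_domain_prefix[OF E TJ]) (rule that)
  have "0 \<le> t (Suc 0)" using t0 tS[of 0] by simp
  with t0 have "(0, 0) \<in> (\<Union>j\<le>J. {t j..t (Suc j)} \<times> {j})" by force
  then show ?thesis unfolding EE[symmetric] by blast
qed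

lemma slice_convex:
  assumes E: "hybrid_time_domain E"
  shows "convex (slice E j)"
  unfolding is_interval_convex_1[symmetric] is_interval_1
proof (intro ballI allI impI)
  fix a b x assume ab: "a \<in> slice E j" "b \<in> slice E j" and x: "a \<le> x \<and> x \<le> b"
  have bE: "(b, j) \<in> E" using ab(2) by (simp add: slice_def)
  obtain t where "t 0 = 0" "\<And>i. i \<le> j \<Longrightarrow> t i \<le> t (Suc i)" "t (Suc j) = b"
    and t: "E \<inter> ({0..b} \<times> {0..j}) = (\<Union>i\<le>j. {t i..t (Suc i)} \<times> {i})"
    by (rule hybrid_time_domain_prefix[OF E bE]) (rule that)
  have "0 \<le> a" "0 \<le> b" using ab E by (auto simp: slice_def hybrid_time_domain_def)
  then have "(a, j) \<in> E \<inter> ({0..b} \<times> {0..j})" "(b, j) \<in> E \<inter> ({0..b} \<times> {0..j})"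
    using ab x by (auto simp: slice_def)
  then have "t j \<le> a" "b \<le> t (Suc j)" unfolding t by auto
  then have "(x, j) \<in> (\<Union>i\<le>j. {t i..t (Suc i)} \<times> {i})" using x by auto
  then show "x \<in> slice E j" unfolding t[symmetric] by (simp add: slice_def)
qed

text \<open>A convex set has a negligible frontier, so derivatives within a slice are two-sided
  almost everywhere.\<close>

lemma ae_interior_slice:
  assumes E: "hybrid_time_domain E"
    and ae: "AE t in lebesgue. t \<in> slice E j \<longrightarrow> P t"
  shows "AE t in lebesgue. t \<in> slice E j \<longrightarrow> t \<in> interior (slice E j) \<and> P t"
proof -
  have "negligible (frontier (slice E j))" by (intro negligible_convex_frontier slice_convex E)
  then have "AE t in lebesgue. t \<notin> frontier (slice E j)"
    by (simp add: AE_not_in negligible_iff_null_sets)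
  with ae show ?thesis
    by eventually_elim (use closure_subset in \<open>auto simp: frontier_def\<close>)
qed

text \<open>The infimum is attained: the bounds with slack 1/(k+1) are countably many almost
  everywhere statements and hold simultaneously off one null set.\<close>

lemma hybrid_bound_norm:
  assumes "hybrid_Linf E \<nu>"
  shows "hybrid_bound E \<nu> (hybrid_norm E \<nu>)" "0 \<le> hybrid_norm E \<nu>"
proof -
  define C where "C = {c. 0 \<le> c \<and> hybrid_bound E \<nu> c}"
  have mono: "hybrid_bound E \<nu> c'" if b: "hybrid_bound E \<nu> c" and "c \<le> c'" for c c'
    unfolding hybrid_bound_def
  proof (intro conjI allI)
    fix j
    have "AE t in lebesgue. t \<in> slice E j \<longrightarrow> norm (\<nu> t j) \<le> c" using b by (simp add: hybrid_bound_def)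
    then show "AE t in lebesgue. t \<in> slice E j \<longrightarrow> norm (\<nu> t j) \<le> c'"
      by eventually_elim (use \<open>c \<le> c'\<close> in auto)
  qed (use that in \<open>fastforce simp: hybrid_bound_def\<close>)
  obtain c where "hybrid_bound E \<nu> c" using assms by (auto simp: hybrid_Linf_def)
  then have "max c 0 \<in> C" using mono by (auto simp: C_def)
  then have ne: "C \<noteq> {}" by blast
  have bdd: "bdd_below C" by (auto simp: C_def intro: bdd_belowI)
  have n: "hybrid_norm E \<nu> = Inf C" by (simp add: hybrid_norm_def C_def)
  show "0 \<le> hybrid_norm E \<nu>" unfolding n by (rule cInf_greatest[OF ne]) (simp add: C_def)
  have b: "hybrid_bound E \<nu> (Inf C + 1 / real (Suc k))" for k
  proof -
    have "Inf C < Inf C + 1 / real (Suc k)" by simp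
    then obtain c where "c \<in> C" "c < Inf C + 1 / real (Suc k)" using cInf_less_iff[OF ne bdd] by blast
    then show ?thesis using mono[of c] by (simp add: C_def)
  qed
  have lim: "x \<le> Inf C" if "\<And>k. x \<le> Inf C + 1 / real (Suc k)" for x
  proof -
    have "(\<lambda>k. Inf C + 1 / real (Suc k)) \<longlonglongrightarrow> Inf C + 0"
      by (intro tendsto_intros LIMSEQ_Suc[OF lim_1_over_n])
    then show ?thesis using that by (intro LIMSEQ_le_const[of _ "Inf C"]) auto
  qed
  show "hybrid_bound E \<nu> (hybrid_norm E \<nu>)"
    unfolding n hybrid_bound_def
  proof (intro conjI allI)
    fix j
    have "AE t in lebesgue. \<forall>k. t \<in> slice E j \<longrightarrow> norm (\<nu> t j) \<le> Inf C + 1 / real (Suc k)"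
      unfolding AE_all_countable using b by (simp only: hybrid_bound_def) blast
    then show "AE t in lebesgue. t \<in> slice E j \<longrightarrow> norm (\<nu> t j) \<le> Inf C"
      by eventually_elim (use lim in auto)
  next
    show "\<forall>(t, j)\<in>jump_times E. norm (\<nu> t j) \<le> Inf C"
    proof (clarify intro!: lim)
      fix t j k assume "(t, j) \<in> jump_times E"
      then show "norm (\<nu> t j) \<le> Inf C + 1 / real (Suc k)"
        using b[of k] unfolding hybrid_bound_def by fast
    qed
  qed
qed

section \<open>The estimation scheme\<close>

lemma cont_differentiable_frechet:
  assumes "cont_differentiable f"
  shows "(f has_derivative frechet_derivative f (at x)) (at x)"
  using assms unfolding cont_differentiable_def
  by (metis differentiableI frechet_derivative_works)

lemma cont_differentiable_imp_continuous:
  assumes "cont_differentiable f" shows "continuous_on U f"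
  using cont_differentiable_frechet[OF assms]
  by (meson continuous_at_imp_continuous_on has_derivative_continuous)

lemma continuous_on_frechet_derivative:
  assumes f: "cont_differentiable f" and a: "continuous_on U a" and b: "continuous_on U b"
  shows "continuous_on U (\<lambda>u. frechet_derivative f (at (a u)) (b u))"
proof -
  obtain f' where f': "\<And>x. (f has_derivative blinfun_apply (f' x)) (at x)" "continuous_on UNIV f'"
    using f by (auto simp: cont_differentiable_def)
  have "frechet_derivative f (at x) = blinfun_apply (f' x)" for x
    using frechet_derivative_at[OF f'(1)] by simp
  moreover have "continuous_on U (\<lambda>u. blinfun_apply (f' (a u)) (b u))"
    by (intro continuous_intros b continuous_on_compose2[OF f'(2) a]) auto
  ultimately show ?thesis by simp
qed

abbreviation (input) st_eps :: "('n, 'q, 'm, 'N) state \<Rightarrow> real^'m" where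
  "st_eps \<xi> \<equiv> fst (snd (snd \<xi>))"

abbreviation (input) st_wh :: "('n, 'q, 'm, 'N) state \<Rightarrow> real^'m" where
  "st_wh \<xi> \<equiv> fst (snd (snd (snd \<xi>)))"

abbreviation (input) st_tau :: "('n, 'q, 'm, 'N) state \<Rightarrow> real^'N" where
  "st_tau \<xi> \<equiv> fst (snd (snd (snd (snd \<xi>))))"

abbreviation (input) st_eta :: "('n, 'q, 'm, 'N) state \<Rightarrow> real^'N" where
  "st_eta \<xi> \<equiv> snd (snd (snd (snd (snd \<xi>))))"

locale estimator =
  fixes S :: "('n::finite, 'p::finite, 'q::finite, 'm::finite, 'N::finite) scheme"
    and V :: "real^'n \<Rightarrow> real" and \<alpha> \<alpha>lo \<alpha>hi \<zeta> :: "real \<Rightarrow> real" and \<mu> :: "'N \<Rightarrow> real"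
  assumes plant: "plant_assms S" and observer: "observer_assms S"
    and growth: "growth_assms S" and tuning: "tuning_assms S"
    and rho_gam: "\<And>i. pos_semidef (rho S i) \<and> 0 < gam S i"
    and V_lipschitz: "locally_lipschitz V"
    and comparison: "class_K_inf \<alpha>" "class_K_inf \<alpha>lo" "class_K_inf \<alpha>hi" "class_K_inf \<zeta>"
    and \<mu>_pos: "\<And>i. 0 < \<mu> i"
    and V_bounds: "\<And>e. \<alpha>lo (norm e) \<le> V e" "\<And>e. V e \<le> \<alpha>hi (norm e)"
    and V_decay: "AE e in lebesgue. \<exists>D. GDERIV V e :> D \<and>
           (\<forall>z v w \<epsilon> wh.
              D \<bullet> f_e S z e \<epsilon> wh v \<le> - \<alpha> (norm e) + \<zeta> (norm (v, w)) +
                (\<Sum>i\<in>UNIV. - rho S i (norm (q_i S i z e w)) - (Hf S i z e wh v)\<^sup>2 +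
                   ((gam S i)\<^sup>2 - \<mu> i) * (Wf S i \<epsilon>)\<^sup>2))"
begin

section \<open>Blocks of the output and the data of the scheme\<close>

lemma blk_nth: "blk S i y $ k = (if node S k = i then y $ k else 0)"
  by (simp add: blk_def)

lemma bounded_linear_blk: "bounded_linear (blk S i)"
  by (rule linear_conv_bounded_linear[THEN iffD1], rule linearI) (auto simp: blk_def vec_eq_iff)

lemma blk_diff: "blk S i (x - y) = blk S i x - blk S i y"
  by (simp add: blk_def vec_eq_iff)

lemma blk_add: "blk S i (x + y) = blk S i x + blk S i y"
  by (simp add: blk_def vec_eq_iff)

lemma blk_zero [simp]: "blk S i 0 = 0"
  by (simp add: blk_def vec_eq_iff)

lemma blk_blk [simp]: "blk S i (blk S i y) = blk S i y"
  by (simp add: blk_def vec_eq_iff)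

lemma norm_blk_le: "norm (blk S i y) \<le> norm y"
  by (rule norm_le_componentwise_cart) (simp add: blk_nth)

lemma sum_blk: "(\<Sum>i\<in>UNIV. blk S i y) = y"
  by (simp add: vec_eq_iff blk_nth)

lemma norm_le_sum_blk: "norm y \<le> (\<Sum>i\<in>UNIV. norm (blk S i y))"
  using norm_sum[of "\<lambda>i. blk S i y" UNIV] by (simp add: sum_blk)

lemma hpi_cont_differentiable: "cont_differentiable (hpi S i)"
  using plant by (simp add: plant_assms_def)

lemma hpi_derivative: "(hpi S i has_derivative frechet_derivative (hpi S i) (at x)) (at x)"
  by (rule cont_differentiable_frechet[OF hpi_cont_differentiable])

lemma hp_sum: "hp S = (\<lambda>x. \<Sum>i\<in>UNIV. hpi S i x)"
  by (simp add: hpi_def sum_blk)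

lemma hp_derivative:
  "(hp S has_derivative (\<lambda>h. \<Sum>i\<in>UNIV. frechet_derivative (hpi S i) (at x) h)) (at x)"
  unfolding hp_sum by (intro has_derivative_sum hpi_derivative)

lemma continuous_on_hp:
  assumes "continuous_on U a" shows "continuous_on U (\<lambda>u. hp S (a u))"
proof -
  have "continuous_on UNIV (hp S)"
    using has_derivative_continuous[OF hp_derivative] by (intro continuous_at_imp_continuous_on) auto
  then show ?thesis using assms by (rule continuous_on_compose2) simp
qed

lemma continuous_on_fp:
  assumes "continuous_on U a" "continuous_on U b"
  shows "continuous_on U (\<lambda>u. fp S (a u) (b u))"
proof -
  have "continuous_on UNIV (\<lambda>(x, v). fp S x v)"
    using plant by (auto simp: plant_assms_def intro: cont_differentiable_imp_continuous)
  from continuous_on_compose2[OF this continuous_on_Pair[OF assms]] show ?thesis by simp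
qed

lemma ho_differentiable: "ho S differentiable (at z)"
  using observer by (simp add: observer_assms_def)

lemma ho_derivative: "(ho S has_derivative frechet_derivative (ho S) (at z)) (at z)"
  using ho_differentiable by (simp add: frechet_derivative_works)

lemma continuous_on_ho:
  assumes "continuous_on U a" shows "continuous_on U (\<lambda>u. ho S (a u))"
proof -
  have "continuous_on UNIV (ho S)"
    using has_derivative_continuous[OF ho_derivative] by (intro continuous_at_imp_continuous_on) auto
  then show ?thesis using assms by (rule continuous_on_compose2) simp
qed

text \<open>Projecting \<open>hpi S i\<close> onto its own block changes nothing, so by uniqueness
  of derivatives the Jacobian takes values in that block too.\<close>

lemma blk_g_i: "blk S i (g_i S i z e v) = g_i S i z e v"
proof -
  have "((\<lambda>x. blk S i (hpi S i x)) has_derivative (\<lambda>h. blk S i (frechet_derivative (hpi S i) (at x) h))) (at x)" for x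
    by (rule bounded_linear.has_derivative[OF bounded_linear_blk hpi_derivative])
  moreover have "(\<lambda>x. blk S i (hpi S i x)) = hpi S i" by (rule ext) (simp add: hpi_def)
  ultimately have "(\<lambda>h. blk S i (frechet_derivative (hpi S i) (at x) h)) = frechet_derivative (hpi S i) (at x)" for x
    using frechet_derivative_at by fastforce
  then show ?thesis by (simp add: g_i_def blk_diff fun_eq_iff)
qed

lemma blk_g_all: "blk S i (g_all S z e v) = g_i S i z e v"
proof -
  have "blk S i (g_all S z e v) = blk S i (g_i S i z e v)"
    by (auto simp: vec_eq_iff blk_nth g_all_def)
  then show ?thesis by (simp add: blk_g_i)
qed

lemma g_all_sum: "g_all S z e v = (\<Sum>i\<in>UNIV. g_i S i z e v)"
  using sum_blk[of "g_all S z e v"] by (simp add: blk_g_all)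

lemma W_blk: "Wf S i (blk S i \<epsilon>) = Wf S i \<epsilon>"
  and W_lipschitz: "locally_lipschitz (Wf S i)"
  and W_beta: "0 < beta_lo S i" "0 < beta_hi S i"
  and W_bounds: "0 \<le> Wf S i \<epsilon>" "beta_lo S i * norm (blk S i \<epsilon>) \<le> Wf S i \<epsilon>"
    "Wf S i \<epsilon> \<le> beta_hi S i * norm (blk S i \<epsilon>)"
  and L_nonneg: "0 \<le> Lc S i"
  and H_cont: "continuous_on UNIV (\<lambda>(z, e, wh, v). Hf S i z e wh v)"
  and H_nonneg: "0 \<le> Hf S i z e wh v"
  and W_growth: "AE \<epsilon> in lebesgue. \<exists>D. GDERIV (Wf S i) \<epsilon> :> D \<and>
        (\<forall>z e wh v. D \<bullet> g_i S i z e v \<le> Lc S i * Wf S i \<epsilon> + Hf S i z e wh v)"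
  using growth unfolding growth_assms_def by (metis, blast+)

lemma W_zero [simp]: "Wf S i 0 = 0"
  using W_bounds(1)[of i 0] W_bounds(3)[of i 0] by simp

lemma V_zero: "V 0 = 0"
  using V_bounds[of 0] comparison(2,3) by (simp add: class_K_inf_zero)

lemma rho_nonneg: "0 \<le> rho S j (norm x)"
  using rho_gam[of j] by (simp add: pos_semidef_def)

text \<open>The right-hand side of (A4) decreases in the absence of errors whatever the held noise is, while
  the held noise sets the argument of \<open>f\<^sub>o\<close> to any value.  So the drift of \<open>e\<close> has to vanish at
  \<open>e = 0\<close>: otherwise \<open>V\<close> would decrease from its strict minimum.\<close>

lemma open_loop: "frechet_derivative (ho S) (at z) (fo S z y) = fp S (ho S z) 0"
proof (rule ccontr)
  define b where "b e = frechet_derivative (ho S) (at z) (fo S z y) - fp S (ho S z - e) 0" for e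
  assume "\<not> ?thesis"
  then have b0: "b 0 \<noteq> 0" by (simp add: b_def)
  have grad: "AE e in lebesgue. \<exists>D. GDERIV V e :> D \<and> D \<bullet> b e \<le> 0"
    using V_decay
  proof eventually_elim
    case (elim e)
    then obtain D where D: "GDERIV V e :> D" and le: "\<And>z v w \<epsilon> wh.
              D \<bullet> f_e S z e \<epsilon> wh v \<le> - \<alpha> (norm e) + \<zeta> (norm (v, w)) +
                (\<Sum>i\<in>UNIV. - rho S i (norm (q_i S i z e w)) - (Hf S i z e wh v)\<^sup>2 +
                   ((gam S i)\<^sup>2 - \<mu> i) * (Wf S i \<epsilon>)\<^sup>2)" by blast
    \<comment> \<open>The held noise is chosen depending on \<open>e\<close> so that the observer
      always receives \<open>y\<close>; with all other errors and inputs zero the right-hand side of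
      (A4) is nonpositive.\<close>
    have "b e = f_e S z e 0 (y - hp S (ho S z - e)) 0" by (simp add: b_def f_e_def f_z_def)
    then have "D \<bullet> b e \<le> - \<alpha> (norm e) + \<zeta> 0 +
        (\<Sum>i\<in>UNIV. - rho S i (norm (q_i S i z e 0)) - (Hf S i z e (y - hp S (ho S z - e)) 0)\<^sup>2)"
      using le[of z 0 "y - hp S (ho S z - e)" 0 0] by (simp add: norm_Pair)
    also have "\<dots> \<le> - \<alpha> (norm e) + \<zeta> 0 + (\<Sum>i\<in>(UNIV :: 'N set). 0)"
    proof (intro add_mono order_refl sum_mono)
      fix i
      show "- rho S i (norm (q_i S i z e 0)) - (Hf S i z e (y - hp S (ho S z - e)) 0)\<^sup>2 \<le> 0"
        using rho_nonneg[of i "q_i S i z e 0"] zero_le_power2[of "Hf S i z e (y - hp S (ho S z - e)) 0"]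
        by linarith
    qed
    also have "\<dots> \<le> 0" using comparison by (simp add: class_K_inf_zero class_K_inf_nonneg)
    finally show ?case using D by blast
  qed
  have cont_b: "continuous_on UNIV b"
    unfolding b_def by (intro continuous_intros continuous_on_fp)
  then have "isCont (\<lambda>e. b e \<bullet> b 0) 0"
    by (intro continuous_intros) (simp add: continuous_on_eq_continuous_at)
  moreover have "0 < b 0 \<bullet> b 0 / 2" using b0 by simp
  ultimately obtain r0 where r0: "r0 > 0" "\<And>e. dist e 0 < r0 \<Longrightarrow> dist (b e \<bullet> b 0) (b 0 \<bullet> b 0) < b 0 \<bullet> b 0 / 2"
    unfolding continuous_at_eps_delta by metis
  define r where "r = r0 / 2"
  have "0 < r" using r0 by (simp add: r_def)
  \<comment> \<open>The slope at which the linear tilt reaches at most half of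
    \<open>\<alpha>lo r\<close> on the sphere of radius \<open>r\<close>.\<close>
  define \<eta> where "\<eta> = \<alpha>lo r / (2 * r * norm (b 0))"
  have "0 < \<alpha>lo r"
    using class_K_strict[OF class_K_inf_imp_class_K[OF comparison(2)], of 0 r] \<open>0 < r\<close>
      class_K_inf_zero[OF comparison(2)] by simp
  then have "0 < \<eta>" using \<open>0 < r\<close> b0 by (simp add: \<eta>_def)
  \<comment> \<open>On the sphere \<open>V\<close> exceeds the tilt while \<open>L 0 = 0\<close>, so
    a minimum over the ball is interior. A short move along \<open>b e0\<close> from there raises
    \<open>V\<close> by at most \<open>h * \<delta>\<close> but the tilt by more than
    \<open>2 * h * \<delta>\<close>, which contradicts minimality.\<close>
  define L where "L e = V e - \<eta> * (e \<bullet> b 0)" for e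
  have "continuous_on (cball 0 r) L"
    unfolding L_def
    by (intro continuous_intros continuous_on_subset[OF locally_lipschitz_imp_continuous[OF V_lipschitz]]) auto
  then obtain e0 where e0: "e0 \<in> cball 0 r" "\<And>e. e \<in> cball 0 r \<Longrightarrow> L e0 \<le> L e"
    using continuous_attains_inf[OF compact_cball, of 0 r L] \<open>0 < r\<close> by auto
  have "norm e0 \<noteq> r"
  proof
    assume e0r: "norm e0 = r"
    have "e0 \<bullet> b 0 \<le> r * norm (b 0)" using norm_cauchy_schwarz[of e0 "b 0"] e0r by simp
    then have "\<eta> * (e0 \<bullet> b 0) \<le> \<eta> * (r * norm (b 0))" using \<open>0 < \<eta>\<close> by simp
    also have "\<dots> = \<alpha>lo r / 2" using \<open>0 < r\<close> b0 by (simp add: \<eta>_def)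
    finally have "0 < L e0" using V_bounds(1)[of e0] e0r \<open>0 < \<alpha>lo r\<close> by (simp add: L_def)
    then show False using e0(2)[of 0] \<open>0 < r\<close> by (simp add: L_def V_zero)
  qed
  then have "norm e0 < r" using e0(1) by simp
  define \<delta> where "\<delta> = \<eta> * (b 0 \<bullet> b 0) / 4"
  have "0 < \<delta>" using \<open>0 < \<eta>\<close> b0 by (simp add: \<delta>_def)
  have "isCont b e0" using cont_b by (simp add: continuous_on_eq_continuous_at)
  from increment_le_of_ae_gradient_field[OF V_lipschitz grad this continuous_const \<open>0 < \<delta>\<close>]
  obtain \<rho> where \<rho>: "\<rho> > 0" "\<And>y h. \<lbrakk>0 \<le> h; y \<in> ball e0 \<rho>; y + h *\<^sub>R b e0 \<in> ball e0 \<rho>\<rbrakk> \<Longrightarrow>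
    V (y + h *\<^sub>R b e0) - V y \<le> h * (0 + \<delta>)" by blast
  define h where "h = min \<rho> (r - norm e0) / (2 * (norm (b e0) + 1))"
  have "0 < h" using \<rho>(1) \<open>norm e0 < r\<close> by (simp add: h_def add_nonneg_pos)
  have "h * norm (b e0) \<le> h * (norm (b e0) + 1)" using \<open>0 < h\<close> by simp
  also have "\<dots> = min \<rho> (r - norm e0) / 2"
  proof -
    define X where "X = norm (b e0) + 1"
    have "X \<noteq> 0" using norm_ge_zero[of "b e0"] unfolding X_def by linarith
    then show ?thesis unfolding h_def X_def[symmetric] by simp
  qed
  also have "\<dots> < min \<rho> (r - norm e0)" using \<rho>(1) \<open>norm e0 < r\<close> by auto
  finally have hb: "h * norm (b e0) < \<rho>" "h * norm (b e0) < r - norm e0" by auto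
  have "e0 + h *\<^sub>R b e0 \<in> cball 0 r"
    using norm_triangle_ineq[of e0 "h *\<^sub>R b e0"] hb(2) \<open>0 < h\<close> by simp
  then have "L e0 \<le> L (e0 + h *\<^sub>R b e0)" by (rule e0(2))
  also have "\<dots> = V (e0 + h *\<^sub>R b e0) - \<eta> * (e0 \<bullet> b 0) - \<eta> * h * (b e0 \<bullet> b 0)"
    by (simp add: L_def inner_add_left algebra_simps)
  also have "\<dots> \<le> V e0 + h * \<delta> - \<eta> * (e0 \<bullet> b 0) - \<eta> * h * (b e0 \<bullet> b 0)"
    using \<rho>(2)[of h e0] \<open>0 < h\<close> \<rho>(1) hb(1) by (simp add: dist_norm)
  finally have "\<eta> * h * (b e0 \<bullet> b 0) \<le> h * \<delta>" by (simp add: L_def)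
  moreover have "b 0 \<bullet> b 0 / 2 < b e0 \<bullet> b 0"
  proof -
    have "\<bar>b e0 \<bullet> b 0 - b 0 \<bullet> b 0\<bar> < b 0 \<bullet> b 0 / 2"
      using r0(2)[of e0] \<open>norm e0 < r\<close> \<open>0 < r\<close> by (simp only: r_def dist_real_def dist_0_norm dist_commute)
    then show ?thesis by linarith
  qed
  then have "\<eta> * h * (b 0 \<bullet> b 0 / 2) < \<eta> * h * (b e0 \<bullet> b 0)" using \<open>0 < \<eta>\<close> \<open>0 < h\<close> by simp
  ultimately have "\<eta> * h * (b 0 \<bullet> b 0 / 2) < h * (\<eta> * (b 0 \<bullet> b 0) / 4)"
    unfolding \<delta>_def by linarith
  then have "(\<eta> * h * (b 0 \<bullet> b 0)) / 2 < (\<eta> * h * (b 0 \<bullet> b 0)) / 4" by (simp add: ac_simps)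
  moreover have "0 \<le> \<eta> * h * (b 0 \<bullet> b 0)" using \<open>0 < \<eta>\<close> \<open>0 < h\<close> by simp
  ultimately show False by linarith
qed

lemma f_e_open_loop: "f_e S z e \<epsilon> wh v = fp S (ho S z) 0 - fp S (ho S z - e) v"
  by (simp add: f_e_def f_z_def open_loop)

text \<open>The functions \<open>\<rho>\<^sub>i\<close> are not assumed continuous; a single point of differentiability of \<open>V\<close>
  and the freedom in \<open>w\<close> give local boundedness.\<close>

lemma rho_bounded:
  "\<exists>C. \<forall>y. norm (blk S i y) \<le> R \<longrightarrow> rho S i (norm (blk S i y)) \<le> C"
proof -
  obtain e D where le: "\<And>z v w \<epsilon> wh.
              D \<bullet> f_e S z e \<epsilon> wh v \<le> - \<alpha> (norm e) + \<zeta> (norm (v, w)) +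
                (\<Sum>i\<in>UNIV. - rho S i (norm (q_i S i z e w)) - (Hf S i z e wh v)\<^sup>2 +
                   ((gam S i)\<^sup>2 - \<mu> i) * (Wf S i \<epsilon>)\<^sup>2)"
  proof -
    obtain N where N: "N \<in> null_sets (lebesgue :: (real^'n) measure)"
      and good: "\<And>e. e \<in> space lebesgue - N \<Longrightarrow> \<exists>D. GDERIV V e :> D \<and>
           (\<forall>z v w \<epsilon> wh.
              D \<bullet> f_e S z e \<epsilon> wh v \<le> - \<alpha> (norm e) + \<zeta> (norm (v, w)) +
                (\<Sum>i\<in>UNIV. - rho S i (norm (q_i S i z e w)) - (Hf S i z e wh v)\<^sup>2 +
                   ((gam S i)\<^sup>2 - \<mu> i) * (Wf S i \<epsilon>)\<^sup>2))"
      using V_decay by (rule AE_E3) (rule that)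
    have "N \<noteq> UNIV"
      using N open_not_negligible[of "UNIV :: (real^'n) set"] by (auto simp: negligible_iff_null_sets)
    then obtain e where "e \<in> space lebesgue - N" by auto
    from good[OF this] show ?thesis using that by blast
  qed
  define \<Delta> where "\<Delta> = hp S (ho S 0) - hp S (ho S 0 - e)"
  have "rho S i (norm (blk S i y)) \<le> \<zeta> (norm \<Delta> + \<bar>R\<bar>) + \<bar>D \<bullet> f_e S 0 e 0 0 0\<bar>"
    if y: "norm (blk S i y) \<le> R" for y
  proof -
    \<comment> \<open>This noise turns the argument of \<open>rho S i\<close> into the prescribed
      vector while \<open>z\<close> and \<open>e\<close> stay fixed, so only the \<zeta>-term of
      (A4) depends on \<open>R\<close>.\<close>
    define w where "w = \<Delta> - blk S i y"
    have q: "q_i S i 0 e w = blk S i y" by (simp add: q_i_def w_def \<Delta>_def hpi_def blk_diff)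
    have "rho S i (norm (blk S i y)) \<le> (\<Sum>j\<in>UNIV. rho S j (norm (q_i S j 0 e w)))"
      unfolding q[symmetric] by (rule member_le_sum) (auto intro: rho_nonneg)
    also have "\<dots> \<le> (\<Sum>j\<in>UNIV. rho S j (norm (q_i S j 0 e w)) + (Hf S j 0 e 0 0)\<^sup>2)"
      by (intro sum_mono) simp
    also have "\<dots> \<le> - \<alpha> (norm e) + \<zeta> (norm w) - D \<bullet> f_e S 0 e 0 0 0"
      using le[of 0 0 0 0 w] by (simp add: norm_Pair sum_negf sum_subtractf sum.distrib)
    also have "\<dots> \<le> \<zeta> (norm w) + \<bar>D \<bullet> f_e S 0 e 0 0 0\<bar>"
      using class_K_inf_nonneg[OF comparison(1), of "norm e"] by simp
    also have "\<zeta> (norm w) \<le> \<zeta> (norm \<Delta> + \<bar>R\<bar>)"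
      using norm_triangle_ineq4[of \<Delta> "blk S i y"] y by (intro class_K_inf_mono[OF comparison(4)]) (auto simp: w_def)
    finally show ?thesis by simp
  qed
  then show ?thesis by blast
qed

text \<open>(A3) pairs the gradient with \<open>g_i\<close> alone, whereas \<epsilon> moves with
  \<open>g_all\<close>. As \<open>Wf S i\<close> sees only its block, the curve is first projected
  to that block, which does move with \<open>g_i\<close>.\<close>

lemma W_upper_drv:
  assumes "(\<epsilon> has_vector_derivative g_all S z e v) (at t)"
  shows "upper_drv (\<lambda>s. Wf S i (\<epsilon> s)) t (Lc S i * Wf S i (\<epsilon> t) + Hf S i z e wh v)"
proof -
  have "AE y in lebesgue. \<exists>D. GDERIV (Wf S i) y :> D \<and>
      D \<bullet> g_i S i z e v \<le> Lc S i * Wf S i y + Hf S i z e wh v"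
    using W_growth by (rule AE_mp) (rule AE_I2, blast)
  moreover have "((\<lambda>s. blk S i (\<epsilon> s)) has_vector_derivative g_i S i z e v) (at t)"
    using bounded_linear.has_vector_derivative[OF bounded_linear_blk assms] by (simp add: blk_g_all)
  moreover have "isCont (\<lambda>y. Lc S i * Wf S i y + Hf S i z e wh v) (blk S i (\<epsilon> t))"
    using locally_lipschitz_imp_continuous[OF W_lipschitz]
    by (intro continuous_intros) (simp add: continuous_on_eq_continuous_at)
  ultimately have "upper_drv (\<lambda>s. Wf S i (blk S i (\<epsilon> s))) t
      (Lc S i * Wf S i (blk S i (\<epsilon> t)) + Hf S i z e wh v)"
    by (intro upper_drv_ae_gradient_field[OF W_lipschitz, where f = "\<lambda>_. g_i S i z e v"
          and r = "\<lambda>y. Lc S i * Wf S i y + Hf S i z e wh v" and e = "\<lambda>s. blk S i (\<epsilon> s)"]) auto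
  then show ?thesis by (simp add: W_blk)
qed

text \<open>The noise argument follows \<open>e\<close> in such a way that the arguments of the (possibly
  discontinuous) functions \<open>\<rho>\<^sub>i\<close> do not change.\<close>

lemma V_upper_drv:
  assumes "(e has_vector_derivative f_e S z (e t) \<epsilon> wh v) (at t)"
  shows "upper_drv (\<lambda>s. V (e s)) t (- \<alpha> (norm (e t)) + \<zeta> (norm (v, w)) +
      (\<Sum>i\<in>UNIV. - rho S i (norm (q_i S i z (e t) w)) - (Hf S i z (e t) wh v)\<^sup>2 +
        ((gam S i)\<^sup>2 - \<mu> i) * (Wf S i \<epsilon>)\<^sup>2))"
proof -
  define e0 where "e0 = e t"
  define w' where "w' y = w + hp S (ho S z - e0) - hp S (ho S z - y)" for y
  define r where "r y = - \<alpha> (norm y) + \<zeta> (norm (v, w' y)) +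
      (\<Sum>i\<in>UNIV. - rho S i (norm (q_i S i z e0 w)) - (Hf S i z y wh v)\<^sup>2 +
        ((gam S i)\<^sup>2 - \<mu> i) * (Wf S i \<epsilon>)\<^sup>2)" for y
  have q: "q_i S i z y (w' y) = q_i S i z e0 w" for i y
    by (simp add: q_i_def w'_def hpi_def blk_diff blk_add)
  have grad: "AE y in lebesgue. \<exists>D. GDERIV V y :> D \<and> D \<bullet> f_e S z y \<epsilon> wh v \<le> r y"
    using V_decay
  proof eventually_elim
    case (elim y)
    then obtain D where "GDERIV V y :> D" "D \<bullet> f_e S z y \<epsilon> wh v \<le> - \<alpha> (norm y) + \<zeta> (norm (v, w' y)) +
                (\<Sum>i\<in>UNIV. - rho S i (norm (q_i S i z y (w' y))) - (Hf S i z y wh v)\<^sup>2 +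
                   ((gam S i)\<^sup>2 - \<mu> i) * (Wf S i \<epsilon>)\<^sup>2)" by blast
    then show ?case unfolding q by (auto simp: r_def)
  qed
  have contK: "continuous_on UNIV (\<lambda>y. f (norm (a y)))" if f: "class_K_inf f" and a: "continuous_on UNIV a"
    for f and a :: "real^'n \<Rightarrow> 'x::real_normed_vector"
  proof (rule continuous_on_compose2[of "{0..}" f UNIV "\<lambda>y. norm (a y)"])
    show "continuous_on {0..} f" using f by (simp add: class_K_inf_def class_K_def)
    show "continuous_on UNIV (\<lambda>y. norm (a y))" using a by (rule continuous_on_norm)
  qed auto
  have contH: "continuous_on UNIV (\<lambda>y. Hf S i z y wh v)" for i
  proof -
    have "continuous_on UNIV (\<lambda>y. (z, y, wh, v))" by (intro continuous_intros)
    from continuous_on_compose2[OF H_cont[of i] this] show ?thesis by simp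
  qed
  have "continuous_on UNIV r"
    unfolding r_def w'_def
    by (intro continuous_intros contK comparison contH continuous_on_hp)
  then have "isCont r (e t)" by (simp add: continuous_on_eq_continuous_at)
  \<comment> \<open>In the open loop form the drift contains only \<open>fp\<close>, so it is
    continuous in \<open>y\<close> whatever \<open>fo\<close> is like.\<close>
  moreover have "continuous_on UNIV (\<lambda>y. f_e S z y \<epsilon> wh v)"
    unfolding f_e_open_loop by (intro continuous_intros continuous_on_fp)
  then have "isCont (\<lambda>y. f_e S z y \<epsilon> wh v) (e t)" by (simp add: continuous_on_eq_continuous_at)
  ultimately have "upper_drv (\<lambda>s. V (e s)) t (r (e t))"
    using upper_drv_ae_gradient_field[OF V_lipschitz grad _ _ assms] by blast
  then show ?thesis by (simp add: r_def e0_def w'_def)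
qed

end

section \<open>The Lyapunov function\<close>

text \<open>The right-hand side is negative wherever \<phi> is nonnegative, so \<phi> decreases as
  long as it is positive. It is positive throughout because otherwise it would have to climb back to
  its positive final value.\<close>

lemma riccati_bounds:
  fixes \<phi> :: "real \<Rightarrow> real"
  assumes "0 \<le> L" "0 < \<gamma>" "0 < \<phi> T"
    and der: "\<And>t. t \<in> {0..T} \<Longrightarrow>
      (\<phi> has_real_derivative (- 2 * L * \<phi> t - \<gamma> * ((\<phi> t)\<^sup>2 + 1))) (at t within {0..T})"
    and t: "t \<in> {0..T}"
  shows "\<phi> T \<le> \<phi> t" "\<phi> t \<le> \<phi> 0"
proof -
  define f where "f x = - 2 * L * \<phi> x - \<gamma> * ((\<phi> x)\<^sup>2 + 1)" for x
  have mvt: "\<exists>x\<in>{a<..<b}. \<phi> b - \<phi> a = f x * (b - a)" if "0 \<le> a" "a < b" "b \<le> T" for a b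
  proof (rule mvt_simple[OF \<open>a < b\<close>, of \<phi> "\<lambda>x h. f x * h"])
    fix x assume "a \<le> x" "x \<le> b"
    then have "(\<phi> has_real_derivative f x) (at x within {a..b})"
      using that unfolding f_def by (intro DERIV_subset[OF der]) auto
    then show "(\<phi> has_derivative (*) (f x)) (at x within {a..b})" by (simp add: has_field_derivative_def)
  qed
  have f_neg: "f x < 0" if "0 \<le> \<phi> x" for x
  proof -
    have "0 \<le> 2 * L * \<phi> x" using assms(1) that by simp
    moreover have "0 < \<gamma> * ((\<phi> x)\<^sup>2 + 1)" using assms(2) by (simp add: add_nonneg_pos)
    ultimately show ?thesis by (simp add: f_def)
  qed
  have cont: "continuous_on {0..T} \<phi>"
    by (rule DERIV_continuous_on) (rule der)
  have pos: "0 < \<phi> s" if s: "s \<in> {0..T}" for s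
  proof (rule ccontr)
    assume "\<not> 0 < \<phi> s"
    \<comment> \<open>Its supremum is the last time with a nonpositive value; from then on \<phi> is
      positive, hence decreasing, and cannot end at a positive value.\<close>
    define A where "A = {x \<in> {s..T}. \<phi> x \<le> 0}"
    have "s \<in> A" using \<open>\<not> 0 < \<phi> s\<close> s by (simp add: A_def)
    have "closed A"
      unfolding A_def using s by (intro continuous_on_closed_Collect_le continuous_on_subset[OF cont] continuous_on_const) auto
    moreover have "bounded A" by (rule bounded_subset[of "{s..T}"]) (auto simp: A_def)
    ultimately have "Sup A \<in> A"
      using \<open>s \<in> A\<close> by (intro closed_contains_Sup) (auto dest: bounded_imp_bdd_above)
    then have SA: "s \<le> Sup A" "Sup A \<le> T" "\<phi> (Sup A) \<le> 0" by (auto simp: A_def)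
    then have "Sup A < T" using assms(3) by (cases "Sup A = T") auto
    then obtain x where x: "x \<in> {Sup A<..<T}" "\<phi> T - \<phi> (Sup A) = f x * (T - Sup A)"
      using mvt[of "Sup A" T] SA s by auto
    have "x \<notin> A" using x(1) cSup_upper[of x A] bounded_imp_bdd_above[OF \<open>bounded A\<close>] by force
    then have "0 < \<phi> x" using x(1) SA by (auto simp: A_def)
    then have "f x * (T - Sup A) < 0" using f_neg[of x] x(1) by (intro mult_neg_pos) auto
    then show False using x(2) SA(3) assms(3) by linarith
  qed
  have mono: "\<phi> b \<le> \<phi> a" if "0 \<le> a" "a \<le> b" "b \<le> T" for a b
  proof (cases "a < b")
    case True
    have "\<exists>x\<in>{a<..<b}. \<phi> b - \<phi> a = f x * (b - a)" by (rule mvt[OF that(1) True that(3)])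
    then obtain x where x: "x \<in> {a<..<b}" "\<phi> b - \<phi> a = f x * (b - a)" by blast
    moreover have "f x * (b - a) \<le> 0"
      using f_neg[of x] pos[of x] x(1) that by (intro mult_nonpos_nonneg) (auto intro: less_imp_le)
    ultimately show ?thesis by linarith
  qed (use that in simp)
  show "\<phi> T \<le> \<phi> t" "\<phi> t \<le> \<phi> 0" using mono[of t T] mono[of 0 t] t by auto
qed

context estimator
begin

lemma tuningD:
  "0 < lam S i" "lam S i < 1" "0 < tau_miet S i" "0 < tau_lo S i" "tau_lo S i \<le> tau_miet S i"
  "class_K_inf (sig S i)" "0 \<le> space_reg S i"
  "\<exists>\<phi>. \<phi> 0 = 1 / lam S i \<and> \<phi> (tau_miet S i) = lam S i \<and>
        (\<forall>t\<in>{0..tau_miet S i}.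
           (\<phi> has_real_derivative
              (- 2 * Lc S i * \<phi> t - gam S i * ((\<phi> t)\<^sup>2 + 1))) (at t within {0..tau_miet S i}))"
  using tuning unfolding tuning_assms_def by blast+

text \<open>The differential conditions leave out the arguments 0 and \<open>tau_miet\<close>, where
  the extended solution has kinks; calmness everywhere is what the mean value inequality asks for at
  such points.\<close>

definition timer_weight :: "'N \<Rightarrow> (real \<Rightarrow> real) \<Rightarrow> bool" where
  "timer_weight i \<phi> \<longleftrightarrow> (\<forall>r. lam S i \<le> \<phi> r \<and> \<phi> r \<le> 1 / lam S i) \<and> (\<forall>r. calm_at \<phi> r) \<and>
     (\<forall>r. 0 < r \<longrightarrow> r < tau_miet S i \<longrightarrow>
        (\<phi> has_real_derivative (- 2 * Lc S i * \<phi> r - gam S i * ((\<phi> r)\<^sup>2 + 1))) (at r)) \<and>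
     (\<forall>r > tau_miet S i. \<phi> r = lam S i \<and> (\<phi> has_real_derivative 0) (at r))"

lemma ex_timer_weight: "\<exists>\<phi>. timer_weight i \<phi>"
proof -
  define T where "T = tau_miet S i"
  have "0 < T" using tuningD(3) by (simp add: T_def)
  obtain \<phi> where \<phi>: "\<phi> 0 = 1 / lam S i" "\<phi> T = lam S i" and
    der: "\<And>t. t \<in> {0..T} \<Longrightarrow>
      (\<phi> has_real_derivative (- 2 * Lc S i * \<phi> t - gam S i * ((\<phi> t)\<^sup>2 + 1))) (at t within {0..T})"
    using tuningD(8)[of i] unfolding T_def by blast
  have gam: "0 < gam S i" using rho_gam by blast
  have lam: "0 < lam S i" by (rule tuningD)
  have bounds: "lam S i \<le> \<phi> t" "\<phi> t \<le> 1 / lam S i" if "t \<in> {0..T}" for t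
    using riccati_bounds[OF L_nonneg[of i] gam, of \<phi> T t] der that \<phi> lam by auto
  \<comment> \<open>The size of the Riccati right-hand side at its largest admissible argument
    \<phi> = 1/\<lambda>; it serves as a Lipschitz constant.\<close>
  define C where "C = 2 * Lc S i * (1 / lam S i) + gam S i * ((1 / lam S i)\<^sup>2 + 1)"
  have "norm (- 2 * Lc S i * \<phi> t - gam S i * ((\<phi> t)\<^sup>2 + 1)) \<le> C" if t: "t \<in> {0..T}" for t
  proof -
    have "0 \<le> \<phi> t" using bounds[OF t] lam by linarith
    then have "0 \<le> 2 * Lc S i * \<phi> t" "2 * Lc S i * \<phi> t \<le> 2 * Lc S i * (1 / lam S i)"
      "0 \<le> gam S i * ((\<phi> t)\<^sup>2 + 1)" "gam S i * ((\<phi> t)\<^sup>2 + 1) \<le> gam S i * ((1 / lam S i)\<^sup>2 + 1)"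
      using bounds[OF t] L_nonneg[of i] gam
      by (auto simp del: power_divide times_divide_eq_right mult_1_right intro!: mult_left_mono power_mono add_nonneg_nonneg mult_nonneg_nonneg)
    then show ?thesis unfolding C_def real_norm_def by linarith
  qed
  then have lip: "\<bar>\<phi> x - \<phi> y\<bar> \<le> C * \<bar>x - y\<bar>" if "x \<in> {0..T}" "y \<in> {0..T}" for x y
    using field_differentiable_bound[of "{0..T}" \<phi> "\<lambda>t. - 2 * Lc S i * \<phi> t - gam S i * ((\<phi> t)\<^sup>2 + 1)" C x y] der that
    by (simp add: norm_minus_commute)
  \<comment> \<open>Clamping the argument continues \<phi> by its end values 1/\<lambda> and
    \<lambda> and keeps the Lipschitz constant.\<close>
  define cl where "cl r = max 0 (min r T)" for r
  have cl: "cl r \<in> {0..T}" for r using \<open>0 < T\<close> by (auto simp: cl_def)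
  have "0 \<le> C" using L_nonneg[of i] gam lam by (simp add: C_def add_nonneg_nonneg)
  have "C-lipschitz_on UNIV (\<lambda>r. \<phi> (cl r))"
  proof (rule lipschitz_onI[OF _ \<open>0 \<le> C\<close>])
    fix x y
    have "\<bar>\<phi> (cl x) - \<phi> (cl y)\<bar> \<le> C * \<bar>cl x - cl y\<bar>" by (rule lip[OF cl cl])
    also have "\<dots> \<le> C * \<bar>x - y\<bar>" using \<open>0 \<le> C\<close> by (intro mult_left_mono) (auto simp: cl_def)
    finally show "dist (\<phi> (cl x)) (\<phi> (cl y)) \<le> C * dist x y" by (simp add: dist_real_def)
  qed
  then have calm: "calm_at (\<lambda>r. \<phi> (cl r)) r" for r by (rule calm_at_lipschitz) auto
  have der1: "((\<lambda>r. \<phi> (cl r)) has_real_derivative (- 2 * Lc S i * \<phi> (cl r) - gam S i * ((\<phi> (cl r))\<^sup>2 + 1))) (at r)"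
    if "0 < r" "r < T" for r
  proof -
    have "cl r = r" using that by (simp add: cl_def)
    have "(\<phi> has_real_derivative (- 2 * Lc S i * \<phi> r - gam S i * ((\<phi> r)\<^sup>2 + 1))) (at r)"
      using der[of r] that by (simp add: at_within_Icc_at)
    moreover have "\<forall>\<^sub>F s in nhds r. s \<in> {0<..<T}" using that by (intro eventually_nhds_in_open) auto
    then have "\<forall>\<^sub>F s in nhds r. \<phi> s = \<phi> (cl s)" by eventually_elim (auto simp: cl_def)
    ultimately show ?thesis unfolding \<open>cl r = r\<close> by (subst (asm) DERIV_cong_ev[OF refl _ refl])
  qed
  have der2: "\<phi> (cl r) = lam S i" "((\<lambda>r. \<phi> (cl r)) has_real_derivative 0) (at r)" if "T < r" for r
  proof -
    show "\<phi> (cl r) = lam S i" using that \<open>0 < T\<close> \<phi>(2) by (simp add: cl_def)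
    have "\<forall>\<^sub>F s in nhds r. s \<in> {T<..}" using that by (intro eventually_nhds_in_open) auto
    then have "\<forall>\<^sub>F s in nhds r. \<phi> (cl s) = lam S i" by eventually_elim (use \<open>0 < T\<close> \<phi>(2) in \<open>auto simp: cl_def\<close>)
    then show "((\<lambda>r. \<phi> (cl r)) has_real_derivative 0) (at r)"
      by (subst DERIV_cong_ev[OF refl _ refl]) auto
  qed
  show ?thesis
    unfolding timer_weight_def T_def[symmetric]
    by (intro exI[of _ "\<lambda>r. \<phi> (cl r)"] conjI allI impI bounds cl calm der1 der2)
qed

definition Phi :: "'N \<Rightarrow> real \<Rightarrow> real" where
  "Phi i = (SOME \<phi>. timer_weight i \<phi>)"

lemma timer_weight_Phi: "timer_weight i (Phi i)"
  unfolding Phi_def using ex_timer_weight by (rule someI_ex)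

lemma Phi_bounds: "lam S i \<le> Phi i r" "Phi i r \<le> 1 / lam S i" "0 < Phi i r"
proof -
  show 1: "lam S i \<le> Phi i r" "Phi i r \<le> 1 / lam S i"
    using timer_weight_Phi[of i] by (auto simp: timer_weight_def)
  show "0 < Phi i r" using 1(1) tuningD(1)[of i] by linarith
qed

lemma gam_pos: "0 < gam S i"
  using rho_gam by blast

text \<open>With the weight \<gamma>\<phi> the cross term is 2\<gamma>\<phi>WH, which costs one H^2,
  the amount that (A4) provides; with weight one on \<eta> the terms \<open>rho\<close>
  cancel.\<close>

definition lyap :: "('n, 'q, 'm, 'N) state \<Rightarrow> real" where
  "lyap \<xi> = V (fst (snd \<xi>)) +
     (\<Sum>i\<in>UNIV. gam S i * Phi i (st_tau \<xi> $ i) * (Wf S i (st_eps \<xi>)) ^ 2) +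
     (\<Sum>i\<in>UNIV. st_eta \<xi> $ i)"

lemma calm_lyap: "calm_at lyap \<xi>"
proof -
  have 1: "calm_at (\<lambda>\<xi> :: ('n, 'q, 'm, 'N) state. V (fst (snd \<xi>))) \<xi>"
    by (rule calm_at_compose[OF calm_at_locally_lipschitz[OF V_lipschitz]])
      (intro calm_at_linear bounded_linear_fst_comp bounded_linear_snd)
  have 2: "calm_at (\<lambda>\<xi> :: ('n, 'q, 'm, 'N) state. Phi i (st_tau \<xi> $ i)) \<xi>" for i
    by (rule calm_at_compose[of "Phi i"])
      (use timer_weight_Phi[of i] in \<open>auto simp: timer_weight_def
        intro!: calm_at_linear bounded_linear_vec_nth[THEN bounded_linear_compose] bounded_linear_fst_comp bounded_linear_snd_comp bounded_linear_snd\<close>)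
  have 3: "calm_at (\<lambda>\<xi> :: ('n, 'q, 'm, 'N) state. Wf S i (st_eps \<xi>)) \<xi>" for i
    by (rule calm_at_compose[OF calm_at_locally_lipschitz[OF W_lipschitz]])
      (intro calm_at_linear bounded_linear_fst_comp bounded_linear_snd_comp bounded_linear_snd)
  have 4: "calm_at (\<lambda>\<xi> :: ('n, 'q, 'm, 'N) state. st_eta \<xi> $ i) \<xi>" for i
    by (intro calm_at_linear bounded_linear_vec_nth[THEN bounded_linear_compose] bounded_linear_snd_comp bounded_linear_snd)
  show ?thesis
    unfolding lyap_def[abs_def] power2_eq_square
    by (intro calm_at_add calm_at_sum calm_at_mult calm_at_const 1 2 3 4)
qed

text \<open>The origin of \<open>beta_coeff\<close>: the mismatch wh - w has norm at most 2n in each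
  block, and (x + y)^2 \<le> 2x^2 + 2y^2 gives the factor 2 as well as 8 = 2 * 2^2. The quotient of
  \<open>beta_hi\<close> and \<open>beta_lo\<close> accounts for passing from W to norms and
  back.\<close>

lemma trigger_bound:
  assumes "norm (blk S i wh) \<le> n" "norm w \<le> n"
  shows "(Wf S i \<epsilon>)\<^sup>2 - 8 * (beta_hi S i)\<^sup>2 * n\<^sup>2 \<le> beta_coeff S i * (Wf S i (\<epsilon> + wh - w))\<^sup>2"
proof -
  define x where "x = norm (blk S i (\<epsilon> + wh - w))"
  define y where "y = norm (blk S i (wh - w))"
  have y: "y \<le> 2 * n" "0 \<le> y"
    using assms norm_blk_le[of i w] norm_triangle_ineq4[of "blk S i wh" "blk S i w"] by (auto simp: y_def blk_diff)
  have "blk S i \<epsilon> = blk S i (\<epsilon> + wh - w) - blk S i (wh - w)" by (simp add: blk_diff blk_add)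
  then have "norm (blk S i \<epsilon>) \<le> x + y" using norm_triangle_ineq4 unfolding x_def y_def by metis
  then have "Wf S i \<epsilon> \<le> beta_hi S i * (x + y)"
    using W_bounds(3)[of i \<epsilon>] W_beta(2)[of i] by (meson mult_le_cancel_left_pos order_trans)
  then have "(Wf S i \<epsilon>)\<^sup>2 \<le> (beta_hi S i * (x + y))\<^sup>2" using W_bounds(1) by (intro power_mono) auto
  also have "\<dots> = (beta_hi S i)\<^sup>2 * (x + y)\<^sup>2" by (rule power_mult_distrib)
  also have "\<dots> \<le> (beta_hi S i)\<^sup>2 * (2 * x\<^sup>2 + 2 * y\<^sup>2)"
    using sum_squares_bound[of x y] by (intro mult_left_mono) (auto simp: power2_sum)
  also have "\<dots> \<le> (beta_hi S i)\<^sup>2 * (2 * x\<^sup>2 + 8 * n\<^sup>2)"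
    using power_mono[OF y, of 2] by (intro mult_left_mono) (auto simp: power_mult_distrib)
  finally have 1: "(Wf S i \<epsilon>)\<^sup>2 \<le> 2 * (beta_hi S i)\<^sup>2 * x\<^sup>2 + 8 * (beta_hi S i)\<^sup>2 * n\<^sup>2" by (simp add: algebra_simps)
  have "(beta_lo S i * x)\<^sup>2 \<le> (Wf S i (\<epsilon> + wh - w))\<^sup>2"
    using W_bounds(2)[of i "\<epsilon> + wh - w"] W_beta(1)[of i] unfolding x_def
    by (intro power_mono) (auto simp: less_imp_le)
  then have "beta_coeff S i * (beta_lo S i * x)\<^sup>2 \<le> beta_coeff S i * (Wf S i (\<epsilon> + wh - w))\<^sup>2"
    by (intro mult_left_mono) (auto simp: beta_coeff_def)
  moreover have "beta_coeff S i * (beta_lo S i * x)\<^sup>2 = 2 * (beta_hi S i)\<^sup>2 * x\<^sup>2"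
    using W_beta(1)[of i] by (simp add: beta_coeff_def power_mult_distrib)
  ultimately show ?thesis using 1 by linarith
qed

lemma flow_F_iff:
  "d \<in> flow_F S (z, e, \<epsilon>, wh, \<tau>, \<eta>) (v, w) \<longleftrightarrow>
    (\<exists>\<psi>. d = (f_z S z e \<epsilon> wh, f_e S z e \<epsilon> wh v, g_all S z e v, 0, 1, \<psi>) \<and>
      (\<forall>i. \<exists>o\<^sub>i\<in>omega S i (\<tau> $ i). \<psi> $ i = rho S i (norm (q_i S i z e w))
        - o\<^sub>i * gam_bar S i * beta_coeff S i * (Wf S i (\<epsilon> + wh - w))\<^sup>2
        - sig S i (\<eta> $ i) + space_reg S i))"
  unfolding flow_F_def Psi_def by (simp add: Bex_def conj_commute)

lemma gam_bar_nonneg: "0 \<le> gam_bar S i"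
  using gam_pos[of i] tuningD(1)[of i] L_nonneg[of i] by (simp add: gam_bar_def)

text \<open>The first term comes from (A4), the second from the sampled noise that falsifies the
  error seen by the triggers.\<close>

definition lyap_gain :: "real \<Rightarrow> real" where
  "lyap_gain n = \<zeta> n + (\<Sum>i\<in>UNIV. gam_bar S i * (8 * (beta_hi S i)\<^sup>2)) * n\<^sup>2"

text \<open>Three cancellations: \<open>rho\<close> between V and \<eta>; H^2 and \<gamma>^2 W^2
  between V and the weighted W^2; the growth \<open>c i\<close> of the weighted W^2 after
  \<open>tau_miet\<close> against the trigger, up to noise. The assumptions on \<tau> avoid the
  kinks of \<open>Phi\<close> and the multivalued point of \<open>omega\<close>.\<close>

lemma lyap_upper_drv:
  fixes \<xi> :: "real \<Rightarrow> ('n, 'q, 'm, 'N) state"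
  assumes d: "d \<in> flow_F S (\<xi> t) (v, w)" and der: "(\<xi> has_vector_derivative d) (at t)"
    and \<xi>t: "\<xi> t = (z, e, \<epsilon>, wh, \<tau>, \<eta>)"
    and \<tau>: "\<And>i. 0 < \<tau> $ i" "\<And>i. \<tau> $ i \<noteq> tau_miet S i"
    and wh: "\<And>i. norm (blk S i wh) \<le> n" and vw: "norm (v, w) \<le> n"
  shows "upper_drv (\<lambda>s. lyap (\<xi> s)) t
    (- (\<alpha> (norm e) + (\<Sum>i\<in>UNIV. \<mu> i * (Wf S i \<epsilon>)\<^sup>2) + (\<Sum>i\<in>UNIV. sig S i (\<eta> $ i)))
      + (\<Sum>i\<in>UNIV. space_reg S i) + lyap_gain n)"
proof -
  obtain \<psi> where d_eq: "d = (f_z S z e \<epsilon> wh, f_e S z e \<epsilon> wh v, g_all S z e v, 0, 1, \<psi>)"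
    and \<psi>: "\<forall>i. \<exists>o\<^sub>i\<in>omega S i (\<tau> $ i). \<psi> $ i = rho S i (norm (q_i S i z e w))
        - o\<^sub>i * gam_bar S i * beta_coeff S i * (Wf S i (\<epsilon> + wh - w))\<^sup>2
        - sig S i (\<eta> $ i) + space_reg S i"
    using d unfolding \<xi>t flow_F_iff by blast
  have "norm w \<le> n" using vw norm_snd_le[of w v] by simp
  have proj: "((\<lambda>s. f (\<xi> s)) has_vector_derivative f d) (at t)" if "bounded_linear f" for f :: "('n, 'q, 'm, 'N) state \<Rightarrow> 'z::real_normed_vector"
    using bounded_linear.has_vector_derivative[OF that der] .
  have e: "((\<lambda>s. fst (snd (\<xi> s))) has_vector_derivative f_e S z e \<epsilon> wh v) (at t)"
    using proj[of "\<lambda>\<xi>. fst (snd \<xi>)"] by (simp add: d_eq bounded_linear_fst_comp bounded_linear_snd)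
  have eps: "((\<lambda>s. st_eps (\<xi> s)) has_vector_derivative g_all S z e v) (at t)"
    using proj[of "\<lambda>\<xi>. st_eps \<xi>"]
    by (simp add: d_eq bounded_linear_fst_comp bounded_linear_snd_comp bounded_linear_snd)
  have tau: "((\<lambda>s. st_tau (\<xi> s) $ i) has_real_derivative 1) (at t)" for i
    using proj[OF bounded_linear_compose[OF bounded_linear_vec_nth[of i]
          bounded_linear_fst_comp[OF bounded_linear_snd_comp[OF bounded_linear_snd_comp[OF bounded_linear_snd_comp[OF bounded_linear_snd]]]]]]
    by (simp add: d_eq has_real_derivative_iff_has_vector_derivative)
  have eta: "((\<lambda>s. st_eta (\<xi> s) $ i) has_real_derivative \<psi> $ i) (at t)" for i
    using proj[OF bounded_linear_compose[OF bounded_linear_vec_nth[of i]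
          bounded_linear_snd_comp[OF bounded_linear_snd_comp[OF bounded_linear_snd_comp[OF bounded_linear_snd_comp[OF bounded_linear_snd]]]]]]
    by (simp add: d_eq has_real_derivative_iff_has_vector_derivative)
  have dV: "upper_drv (\<lambda>s. V (fst (snd (\<xi> s)))) t (- \<alpha> (norm e) + \<zeta> (norm (v, w)) +
      (\<Sum>i\<in>UNIV. - rho S i (norm (q_i S i z e w)) - (Hf S i z e wh v)\<^sup>2 +
        ((gam S i)\<^sup>2 - \<mu> i) * (Wf S i \<epsilon>)\<^sup>2))"
    using V_upper_drv[of "\<lambda>s. fst (snd (\<xi> s))" z t \<epsilon> wh v w] e by (simp add: \<xi>t)
  \<comment> \<open>The growth of the weighted W^2 that is left over for the trigger: none while the
    Riccati equation runs, \<open>gam_bar\<close> once \<phi> rests.\<close>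
  define c where "c i = (if \<tau> $ i < tau_miet S i then 0 else gam_bar S i)" for i
  have dW: "upper_drv (\<lambda>s. gam S i * Phi i (st_tau (\<xi> s) $ i) * (Wf S i (st_eps (\<xi> s)))\<^sup>2) t
      ((Hf S i z e wh v)\<^sup>2 - (gam S i)\<^sup>2 * (Wf S i \<epsilon>)\<^sup>2 + c i * (Wf S i \<epsilon>)\<^sup>2)" for i
  proof -
    define p where "p = (\<lambda>s. gam S i * Phi i (st_tau (\<xi> s) $ i))"
    define W where "W = (\<lambda>s. Wf S i (st_eps (\<xi> s)))"
    define \<phi> where "\<phi> = Phi i (\<tau> $ i)"
    define \<phi>' where "\<phi>' = (if \<tau> $ i < tau_miet S i then - 2 * Lc S i * \<phi> - gam S i * (\<phi>\<^sup>2 + 1) else 0)"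
    have "(Phi i has_real_derivative \<phi>') (at (\<tau> $ i))"
      using timer_weight_Phi[of i] \<tau>(1)[of i] \<tau>(2)[of i] unfolding timer_weight_def \<phi>'_def \<phi>_def by auto
    then have "((\<lambda>s. Phi i (st_tau (\<xi> s) $ i)) has_real_derivative \<phi>' * 1) (at t)"
      by (intro DERIV_chain2[OF _ tau]) (simp add: \<xi>t)
    then have p': "(p has_real_derivative gam S i * \<phi>') (at t)"
      unfolding p_def using DERIV_cmult[of "\<lambda>s. Phi i (st_tau (\<xi> s) $ i)" "\<phi>'" t UNIV "gam S i"] by simp
    have W': "upper_drv W t (Lc S i * W t + Hf S i z e wh v)"
      unfolding W_def by (rule W_upper_drv[OF eps])
    have W_cont: "isCont W t"
      unfolding W_def using locally_lipschitz_imp_continuous[OF W_lipschitz]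
      by (intro isCont_o2[OF has_vector_derivative_continuous[OF eps]]) (simp add: continuous_on_eq_continuous_at)
    have W_nn: "0 \<le> W s" for s by (simp add: W_def W_bounds)
    have p_nn: "0 \<le> p s" for s using gam_pos[of i] Phi_bounds(3)[of i] by (simp add: p_def less_imp_le)
    have W2: "upper_drv (\<lambda>s. W s * W s) t (W t * (Lc S i * W t + Hf S i z e wh v) + W t * (Lc S i * W t + Hf S i z e wh v))"
      by (rule upper_drv_mult[OF W' W' W_nn W_nn W_cont W_cont])
    have "upper_drv (\<lambda>s. p s * (W s * W s)) t
      (p t * (W t * (Lc S i * W t + Hf S i z e wh v) + W t * (Lc S i * W t + Hf S i z e wh v)) + (W t * W t) * (gam S i * \<phi>'))"
      by (rule upper_drv_mult[OF upper_drv_real_derivative[OF p'] W2 p_nn _ DERIV_isCont[OF p']])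
        (use W_nn W_cont in \<open>auto intro: continuous_intros\<close>)
    moreover have "p t * (W t * (Lc S i * W t + Hf S i z e wh v) + W t * (Lc S i * W t + Hf S i z e wh v)) + (W t * W t) * (gam S i * \<phi>')
      \<le> (Hf S i z e wh v)\<^sup>2 - (gam S i)\<^sup>2 * (Wf S i \<epsilon>)\<^sup>2 + c i * (Wf S i \<epsilon>)\<^sup>2"
    proof -
      define g L H w where "g = gam S i" "L = Lc S i" "H = Hf S i z e wh v" "w = Wf S i \<epsilon>"
      have Wt: "W t = w" "p t = g * \<phi>" by (auto simp: W_def p_def \<xi>t \<phi>_def g_L_H_w_def)
      \<comment> \<open>Completing the square replaces 2\<gamma>\<phi>wH by H^2 +
        (\<gamma>\<phi>w)^2. Before \<open>tau_miet\<close> the Riccati terms remove that square and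
        the L-term; afterwards \<open>gam_bar\<close> contains both, and its remaining \<gamma>^2
        offsets the -\<gamma>^2 w^2 reserved for (A4).\<close>
      have sq: "0 \<le> (g * \<phi> * w - H)\<^sup>2" by simp
      show ?thesis
      proof (cases "\<tau> $ i < tau_miet S i")
        case True
        have "g * \<phi> * (w * (L * w + H) + w * (L * w + H)) + (w * w) * (g * (- 2 * L * \<phi> - g * (\<phi>\<^sup>2 + 1)))
          = H\<^sup>2 - g\<^sup>2 * w\<^sup>2 - (g * \<phi> * w - H)\<^sup>2" by (simp add: algebra_simps power2_eq_square)
        then show ?thesis unfolding Wt g_L_H_w_def[symmetric] \<phi>'_def c_def using True sq by (simp only: if_True)
      next
        case False
        then have "\<phi> = lam S i"
          using timer_weight_Phi[of i] \<tau>(2)[of i] unfolding timer_weight_def \<phi>_def by (metis linorder_neqE_linordered_idom)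
        then have "gam_bar S i = 2 * g * \<phi> * L + g\<^sup>2 * (1 + \<phi>\<^sup>2)" by (simp add: gam_bar_def g_L_H_w_def)
        then have "g * \<phi> * (w * (L * w + H) + w * (L * w + H)) + (w * w) * (g * 0)
          = H\<^sup>2 - g\<^sup>2 * w\<^sup>2 + gam_bar S i * w\<^sup>2 - (g * \<phi> * w - H)\<^sup>2" by (simp add: algebra_simps power2_eq_square)
        then show ?thesis unfolding Wt g_L_H_w_def[symmetric] \<phi>'_def c_def using False sq by (simp only: if_False)
      qed
    qed
    ultimately show ?thesis by (auto simp: p_def W_def power2_eq_square intro: upper_drv_mono)
  qed
  have d\<eta>: "upper_drv (\<lambda>s. st_eta (\<xi> s) $ i) t
      (rho S i (norm (q_i S i z e w)) - c i * (Wf S i \<epsilon>)\<^sup>2 + gam_bar S i * (8 * (beta_hi S i)\<^sup>2) * n\<^sup>2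
        - sig S i (\<eta> $ i) + space_reg S i)" for i
  proof (rule upper_drv_mono[OF upper_drv_real_derivative[OF eta]])
    obtain o\<^sub>i where o: "o\<^sub>i\<in>omega S i (\<tau> $ i)" "\<psi> $ i = rho S i (norm (q_i S i z e w))
        - o\<^sub>i * gam_bar S i * beta_coeff S i * (Wf S i (\<epsilon> + wh - w))\<^sup>2
        - sig S i (\<eta> $ i) + space_reg S i" using \<psi> by blast
    have nn: "0 \<le> gam_bar S i * (8 * (beta_hi S i)\<^sup>2) * n\<^sup>2" using gam_bar_nonneg[of i] by simp
    have "c i * (Wf S i \<epsilon>)\<^sup>2 - gam_bar S i * (8 * (beta_hi S i)\<^sup>2) * n\<^sup>2
        \<le> o\<^sub>i * gam_bar S i * beta_coeff S i * (Wf S i (\<epsilon> + wh - w))\<^sup>2"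
    proof (cases "\<tau> $ i < tau_miet S i")
      case True
      then show ?thesis using o(1) nn by (simp add: omega_def c_def)
    next
      case False
      then have "o\<^sub>i = 1" using o(1) \<tau>(2)[of i] by (simp add: omega_def)
      moreover have "gam_bar S i * ((Wf S i \<epsilon>)\<^sup>2 - 8 * (beta_hi S i)\<^sup>2 * n\<^sup>2)
          \<le> gam_bar S i * (beta_coeff S i * (Wf S i (\<epsilon> + wh - w))\<^sup>2)"
        by (intro mult_left_mono trigger_bound wh \<open>norm w \<le> n\<close> gam_bar_nonneg)
      ultimately show ?thesis using False by (simp add: c_def algebra_simps)
    qed
    then show "\<psi> $ i \<le> rho S i (norm (q_i S i z e w)) - c i * (Wf S i \<epsilon>)\<^sup>2 + gam_bar S i * (8 * (beta_hi S i)\<^sup>2) * n\<^sup>2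
        - sig S i (\<eta> $ i) + space_reg S i" unfolding o(2) by linarith
  qed
  have drv: "upper_drv (\<lambda>s. lyap (\<xi> s)) t
    ((- \<alpha> (norm e) + \<zeta> (norm (v, w)) +
      (\<Sum>i\<in>UNIV. - rho S i (norm (q_i S i z e w)) - (Hf S i z e wh v)\<^sup>2 +
        ((gam S i)\<^sup>2 - \<mu> i) * (Wf S i \<epsilon>)\<^sup>2)) +
     (\<Sum>i\<in>UNIV. (Hf S i z e wh v)\<^sup>2 - (gam S i)\<^sup>2 * (Wf S i \<epsilon>)\<^sup>2 + c i * (Wf S i \<epsilon>)\<^sup>2) +
     (\<Sum>i\<in>UNIV. rho S i (norm (q_i S i z e w)) - c i * (Wf S i \<epsilon>)\<^sup>2 + gam_bar S i * (8 * (beta_hi S i)\<^sup>2) * n\<^sup>2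
        - sig S i (\<eta> $ i) + space_reg S i))"
    unfolding lyap_def by (intro upper_drv_add upper_drv_sum dV dW d\<eta>)
  have "\<zeta> (norm (v, w)) \<le> \<zeta> n"
    using vw by (intro class_K_inf_mono[OF comparison(4)]) auto
  moreover have "lyap_gain n = \<zeta> n + (\<Sum>i\<in>UNIV. gam_bar S i * (8 * (beta_hi S i)\<^sup>2) * n\<^sup>2)"
    by (simp add: lyap_gain_def sum_distrib_right)
  ultimately show ?thesis
    by (intro upper_drv_mono[OF drv]) (simp add: sum.distrib sum_subtractf sum_negf algebra_simps)
qed

end

context estimator
begin

section \<open>Dissipation rate of the Lyapunov function and its comparison with the
  distance\<close>

lemma lyap_nonneg:
  assumes "\<And>i. 0 \<le> \<eta> $ i" shows "0 \<le> lyap (z, e, \<epsilon>, wh, \<tau>, \<eta>)"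
proof -
  have "0 \<le> V e" using V_bounds(1)[of e] class_K_inf_nonneg[OF comparison(2), of "norm e"] by simp
  then show ?thesis
    using assms gam_pos Phi_bounds(3) unfolding lyap_def
    by (auto intro!: add_nonneg_nonneg sum_nonneg mult_nonneg_nonneg simp: less_imp_le)
qed

text \<open>The factor 2 leaves one half of the dissipation to pay for input and space
  regularisation above a suitable level and the other half for decay.\<close>

definition decay_rate :: "(real \<Rightarrow> real) \<Rightarrow> bool" where
  "decay_rate b \<longleftrightarrow> class_K_inf b \<and> (\<forall>s. b s \<le> s) \<and>
     (\<forall>z e \<epsilon> wh \<tau> \<eta>. (\<forall>i. 0 \<le> \<eta> $ i) \<longrightarrow> 2 * b (lyap (z, e, \<epsilon>, wh, \<tau>, \<eta>)) \<le>
       \<alpha> (norm e) + (\<Sum>i\<in>UNIV. \<mu> i * (Wf S i \<epsilon>)\<^sup>2) + (\<Sum>i\<in>UNIV. sig S i (\<eta> $ i)))"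

text \<open>Pigeonhole: one of the 2N + 1 summands of \<open>lyap\<close> carries at least the
  fraction 1/m of it, and the dissipation term belonging to that summand is bounded below by a class
  K-infinity function of its size. The minimum over all cases serves as \<open>b\<close>.\<close>

lemma ex_decay_rate: "\<exists>b. decay_rate b"
proof -
  obtain g where g: "class_K_inf g" "\<And>x. 0 \<le> x \<Longrightarrow> g (\<alpha>hi x) = x"
    using class_K_inf_inverse[OF comparison(3)] by metis
  define m where "m = 2 * real CARD('N) + 1"
  have "0 < m" by (simp add: m_def)
  \<comment> \<open>One candidate for each weighted W^2, each \<eta> and for V; the halves
    anticipate the factor 2 in \<open>decay_rate\<close>, and for W the weight is bounded by
    \<gamma>/\<lambda>.\<close>
  define f where "f = case_sum (\<lambda>i s. \<mu> i * lam S i / (2 * gam S i * m) * s)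
    (case_sum (\<lambda>i s. 1 / 2 * sig S i (1 / m * s)) (\<lambda>_::unit. \<lambda>s. 1 / 2 * \<alpha> (g (1 / m * s))))"
  have "class_K_inf (f j)" for j
  proof -
    have 1: "class_K_inf (\<lambda>s. \<mu> i * lam S i / (2 * gam S i * m) * s)" for i
      using \<mu>_pos[of i] tuningD(1)[of i] gam_pos[of i] \<open>0 < m\<close> by (intro class_K_inf_scale) auto
    have scale: "class_K_inf (\<lambda>s. 1 / m * s)" using \<open>0 < m\<close> by (intro class_K_inf_scale) auto
    have 2: "class_K_inf (\<lambda>s. 1 / 2 * sig S i (1 / m * s))" for i
      using class_K_inf_compose[OF class_K_inf_scale[of "1 / 2"] class_K_inf_compose[OF tuningD(6)[of i] scale]] by simp
    have 3: "class_K_inf (\<lambda>s. 1 / 2 * \<alpha> (g (1 / m * s)))"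
      using class_K_inf_compose[OF class_K_inf_scale[of "1 / 2"]
          class_K_inf_compose[OF comparison(1) class_K_inf_compose[OF g(1) scale]]] by simp
    show ?thesis using 1 2 3 by (auto simp: f_def split: sum.splits)
  qed
  then obtain b where b: "class_K_inf b" "\<And>j s. b s \<le> f j s" "\<And>s. b s \<le> s"
    using class_K_inf_lower_bound[of UNIV f] by auto
  have "2 * b (lyap (z, e, \<epsilon>, wh, \<tau>, \<eta>)) \<le>
      \<alpha> (norm e) + (\<Sum>i\<in>UNIV. \<mu> i * (Wf S i \<epsilon>)\<^sup>2) + (\<Sum>i\<in>UNIV. sig S i (\<eta> $ i))"
    if \<eta>: "\<And>i. 0 \<le> \<eta> $ i" for z e \<epsilon> wh \<tau> \<eta>
  proof -
    define s where "s = lyap (z, e, \<epsilon>, wh, \<tau>, \<eta>)"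
    have "0 \<le> s" unfolding s_def using \<eta> by (rule lyap_nonneg)
    define u where "u = 1 / m * s"
    have "0 \<le> u" "m * u = s" using \<open>0 \<le> s\<close> \<open>0 < m\<close> by (auto simp: u_def)
    have nn1: "0 \<le> \<alpha> (norm e)" by (rule class_K_inf_nonneg[OF comparison(1)]) simp
    have nn2: "0 \<le> \<mu> i * (Wf S i \<epsilon>)\<^sup>2" for i using \<mu>_pos[of i] by simp
    have nn3: "0 \<le> sig S i (\<eta> $ i)" for i by (rule class_K_inf_nonneg[OF tuningD(6) \<eta>])
    have S1: "\<mu> i * (Wf S i \<epsilon>)\<^sup>2 \<le> (\<Sum>i\<in>UNIV. \<mu> i * (Wf S i \<epsilon>)\<^sup>2)" for i
      by (rule member_le_sum) (use nn2 in auto)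
    have S2: "sig S i (\<eta> $ i) \<le> (\<Sum>i\<in>UNIV. sig S i (\<eta> $ i))" for i
      by (rule member_le_sum) (use nn3 in auto)
    have S12: "0 \<le> (\<Sum>i\<in>UNIV. \<mu> i * (Wf S i \<epsilon>)\<^sup>2)" "0 \<le> (\<Sum>i\<in>UNIV. sig S i (\<eta> $ i))"
      by (intro sum_nonneg nn2 nn3)+
    have "u \<le> \<alpha>hi (norm e) \<or> (\<exists>i. u \<le> gam S i * Phi i (\<tau> $ i) * (Wf S i \<epsilon>)\<^sup>2) \<or> (\<exists>i. u \<le> \<eta> $ i)"
    proof (rule ccontr)
      assume neg: "\<not> ?thesis"
      then have "V e < u" using V_bounds(2)[of e] by linarith
      moreover have "(\<Sum>i\<in>UNIV. gam S i * Phi i (\<tau> $ i) * (Wf S i \<epsilon>)\<^sup>2) \<le> (\<Sum>i\<in>(UNIV::'N set). u)"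
        using neg by (intro sum_mono) (simp add: not_le less_imp_le)
      moreover have "(\<Sum>i\<in>UNIV. \<eta> $ i) \<le> (\<Sum>i\<in>(UNIV::'N set). u)"
        using neg by (intro sum_mono) (simp add: not_le less_imp_le)
      ultimately have "s < u + real CARD('N) * u + real CARD('N) * u"
        by (simp add: s_def lyap_def algebra_simps)
      also have "\<dots> = m * u" by (simp add: m_def algebra_simps)
      finally show False using \<open>m * u = s\<close> by simp
    qed
    then consider "u \<le> \<alpha>hi (norm e)" | i where "u \<le> gam S i * Phi i (\<tau> $ i) * (Wf S i \<epsilon>)\<^sup>2" | i where "u \<le> \<eta> $ i"
      by blast
    then have "2 * b s \<le> \<alpha> (norm e) + (\<Sum>i\<in>UNIV. \<mu> i * (Wf S i \<epsilon>)\<^sup>2) + (\<Sum>i\<in>UNIV. sig S i (\<eta> $ i))"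
    proof cases
      case 1
      have "2 * b s \<le> \<alpha> (g u)" using b(2)[of s "Inr (Inr ())"] by (simp add: f_def u_def)
      also have "\<dots> \<le> \<alpha> (norm e)"
        using class_K_inf_mono[OF g(1) \<open>0 \<le> u\<close> 1] g(2)[of "norm e"] class_K_inf_nonneg[OF g(1) \<open>0 \<le> u\<close>]
        by (intro class_K_inf_mono[OF comparison(1)]) auto
      finally show ?thesis using S12 by linarith
    next
      case (2 i)
      have "u \<le> gam S i * (1 / lam S i) * (Wf S i \<epsilon>)\<^sup>2"
        using Phi_bounds(2)[of i "\<tau> $ i"] gam_pos[of i]
        by (intro order_trans[OF 2] mult_right_mono mult_left_mono) auto
      then have "lam S i / gam S i * u \<le> (Wf S i \<epsilon>)\<^sup>2"
        using gam_pos[of i] tuningD(1)[of i] by (simp add: field_simps)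
      then have "\<mu> i * (lam S i / gam S i * u) \<le> \<mu> i * (Wf S i \<epsilon>)\<^sup>2"
        using \<mu>_pos[of i] by (intro mult_left_mono) auto
      moreover have "2 * b s \<le> \<mu> i * (lam S i / gam S i * u)"
      proof -
        have "2 * b s \<le> 2 * (\<mu> i * lam S i / (2 * gam S i * m) * s)" using b(2)[of s "Inl i"] by (simp add: f_def)
        also have "\<dots> = \<mu> i * (lam S i / gam S i * u)" using gam_pos[of i] \<open>0 < m\<close> by (simp add: u_def)
        finally show ?thesis .
      qed
      ultimately show ?thesis using S1[of i] S12 nn1 by linarith
    next
      case (3 i)
      have "2 * b s \<le> sig S i u" using b(2)[of s "Inr (Inl i)"] by (simp add: f_def u_def)
      also have "\<dots> \<le> sig S i (\<eta> $ i)" by (rule class_K_inf_mono[OF tuningD(6) \<open>0 \<le> u\<close> 3])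
      finally show ?thesis using S2[of i] S12 nn1 by linarith
    qed
    then show ?thesis by (simp add: s_def)
  qed
  with b(1,3) show ?thesis unfolding decay_rate_def by blast
qed

lemma zero_in_target: "(0, 0, 0, 0, 0, 0) \<in> (target_set :: ('n, 'q, 'm, 'N) state set)"
  by (simp add: target_set_def state_space_def)

lemma ex_infdist_le_lyap:
  obtains \<psi> where "class_K_inf \<psi>"
    "\<And>\<xi>. \<xi> \<in> state_space \<Longrightarrow> infdist \<xi> target_set \<le> \<psi> (lyap \<xi>)"
proof -
  obtain g where g: "class_K_inf g" "\<And>x. 0 \<le> x \<Longrightarrow> g (\<alpha>lo x) = x"
    using class_K_inf_inverse[OF comparison(2)] by metis
  define \<psi> where "\<psi> s = (g s + s) + (\<Sum>i\<in>(UNIV::'N set). 1 / beta_lo S i * sqrt (1 / (gam S i * lam S i) * s))" for s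
  have "class_K_inf \<psi>"
    unfolding \<psi>_def
  proof (intro class_K_inf_sum finite class_K_inf_add g(1) class_K_inf_imp_class_K[OF class_K_inf_id])
    fix i
    show "class_K (\<lambda>x. 1 / beta_lo S i * sqrt (1 / (gam S i * lam S i) * x))"
      using W_beta(1)[of i] gam_pos[of i] tuningD(1)[of i]
      by (intro class_K_inf_imp_class_K class_K_inf_compose[OF class_K_inf_scale
            class_K_inf_compose[OF class_K_inf_sqrt class_K_inf_scale]]) auto
  qed
  moreover have "infdist \<xi> target_set \<le> \<psi> (lyap \<xi>)" if \<xi>: "\<xi> \<in> state_space" for \<xi>
  proof -
    obtain z e \<epsilon> wh \<tau> \<eta> where eq: "\<xi> = (z, e, \<epsilon>, wh, \<tau>, \<eta>)" by (metis prod.exhaust)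
    have nn: "\<And>i. 0 \<le> \<tau> $ i" "\<And>i. 0 \<le> \<eta> $ i" using \<xi> by (auto simp: eq state_space_def)
    define s where "s = lyap \<xi>"
    have "0 \<le> V e" using V_bounds(1)[of e] class_K_inf_nonneg[OF comparison(2), of "norm e"] by simp
    have term_nn: "0 \<le> gam S i * Phi i (\<tau> $ i) * (Wf S i \<epsilon>)\<^sup>2" for i
      using gam_pos[of i] Phi_bounds(3)[of i] by (simp add: less_imp_le)
    have sums: "0 \<le> (\<Sum>i\<in>UNIV. gam S i * Phi i (\<tau> $ i) * (Wf S i \<epsilon>)\<^sup>2)" "0 \<le> (\<Sum>i\<in>UNIV. \<eta> $ i)"
      by (intro sum_nonneg term_nn nn)+
    have s_eq: "s = V e + (\<Sum>i\<in>UNIV. gam S i * Phi i (\<tau> $ i) * (Wf S i \<epsilon>)\<^sup>2) + (\<Sum>i\<in>UNIV. \<eta> $ i)"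
      by (simp add: s_def eq lyap_def)
    have "\<alpha>lo (norm e) \<le> s" using V_bounds(1)[of e] sums unfolding s_eq by linarith
    then have e: "norm e \<le> g s"
      using class_K_inf_mono[OF g(1), of "\<alpha>lo (norm e)" s] g(2)[of "norm e"]
        class_K_inf_nonneg[OF comparison(2), of "norm e"] by simp
    have "norm \<eta> \<le> (\<Sum>i\<in>UNIV. \<bar>\<eta> $ i\<bar>)" by (rule norm_le_l1_cart)
    then have \<eta>: "norm \<eta> \<le> s" using nn(2) sums(1) \<open>0 \<le> V e\<close> by (simp add: s_eq)
    have "norm (blk S i \<epsilon>) \<le> 1 / beta_lo S i * sqrt (1 / (gam S i * lam S i) * s)" for i
    proof -
      have "gam S i * lam S i * (Wf S i \<epsilon>)\<^sup>2 \<le> gam S i * Phi i (\<tau> $ i) * (Wf S i \<epsilon>)\<^sup>2"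
        using gam_pos[of i] Phi_bounds(1)[of i] by (intro mult_right_mono mult_left_mono) auto
      also have "\<dots> \<le> (\<Sum>i\<in>UNIV. gam S i * Phi i (\<tau> $ i) * (Wf S i \<epsilon>)\<^sup>2)"
        by (rule member_le_sum) (use term_nn in auto)
      also have "\<dots> \<le> s" using sums(2) \<open>0 \<le> V e\<close> by (simp add: s_eq)
      finally have "(Wf S i \<epsilon>)\<^sup>2 \<le> 1 / (gam S i * lam S i) * s"
        using gam_pos[of i] tuningD(1)[of i] by (simp add: field_simps)
      then have "Wf S i \<epsilon> \<le> sqrt (1 / (gam S i * lam S i) * s)" by (rule real_le_rsqrt)
      then show ?thesis using W_bounds(2)[of i \<epsilon>] W_beta(1)[of i] by (simp add: field_simps)
    qed
    then have "(\<Sum>i\<in>UNIV. norm (blk S i \<epsilon>)) \<le> (\<Sum>i\<in>UNIV. 1 / beta_lo S i * sqrt (1 / (gam S i * lam S i) * s))"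
      by (intro sum_mono)
    then have \<epsilon>: "norm \<epsilon> \<le> (\<Sum>i\<in>UNIV. 1 / beta_lo S i * sqrt (1 / (gam S i * lam S i) * s))"
      using norm_le_sum_blk[of \<epsilon>] by linarith
    \<comment> \<open>The target set leaves \<open>z\<close>, \<open>wh\<close> and \<tau> free, so
      only the other three components count for the distance.\<close>
    have "(z, 0, 0, wh, \<tau>, 0) \<in> target_set" using nn by (simp add: target_set_def state_space_def)
    then have "infdist \<xi> target_set \<le> dist \<xi> (z, 0, 0, wh, \<tau>, 0)" by (rule infdist_le)
    also have "\<dots> = norm ((0::real^'q), e, \<epsilon>, (0::real^'m), (0::real^'N), \<eta>)" by (simp add: eq dist_norm)
    also have "\<dots> \<le> norm e + norm (\<epsilon>, (0::real^'m), (0::real^'N), \<eta>)"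
      using norm_Pair_le[of "0::real^'q" "(e, \<epsilon>, (0::real^'m), (0::real^'N), \<eta>)"]
        norm_Pair_le[of e "(\<epsilon>, (0::real^'m), (0::real^'N), \<eta>)"] by simp
    also have "norm (\<epsilon>, (0::real^'m), (0::real^'N), \<eta>) \<le> norm \<epsilon> + norm ((0::real^'m), (0::real^'N), \<eta>)"
      by (rule norm_Pair_le)
    also have "norm ((0::real^'m), (0::real^'N), \<eta>) = norm \<eta>" by (simp add: norm_Pair)
    finally show ?thesis using e \<eta> \<epsilon> by (simp add: \<psi>_def s_def)
  qed
  ultimately show ?thesis by (rule that)
qed

text \<open>The components e, \<epsilon>, \<eta> vanish at every target point, so each of them is
  bounded by the distance; the factor 1/\<lambda> is the largest value of
  \<open>Phi\<close>.\<close>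

lemma ex_lyap_le_infdist:
  obtains \<theta> where "class_K_inf \<theta>"
    "\<And>\<xi>. \<xi> \<in> state_space \<Longrightarrow> lyap \<xi> \<le> \<theta> (infdist \<xi> target_set)"
proof -
  define \<theta> where "\<theta> r = \<alpha>hi r + (\<Sum>i\<in>(UNIV::'N set). gam S i / lam S i * (beta_hi S i)\<^sup>2 * r\<^sup>2 + r)" for r
  have "class_K_inf \<theta>"
    unfolding \<theta>_def
  proof (intro class_K_inf_sum finite comparison(3) class_K_add class_K_inf_imp_class_K[OF class_K_inf_id])
    fix i
    show "class_K (\<lambda>x. gam S i / lam S i * (beta_hi S i)\<^sup>2 * x\<^sup>2)"
      using W_beta(2)[of i] gam_pos[of i] tuningD(1)[of i]
      by (intro class_K_inf_imp_class_K class_K_inf_compose[OF class_K_inf_scale class_K_inf_power2]) auto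
  qed
  moreover have "lyap \<xi> \<le> \<theta> (infdist \<xi> target_set)" if \<xi>: "\<xi> \<in> state_space" for \<xi>
  proof -
    obtain z e \<epsilon> wh \<tau> \<eta> where eq: "\<xi> = (z, e, \<epsilon>, wh, \<tau>, \<eta>)" by (metis prod.exhaust)
    define r where "r = infdist \<xi> target_set"
    have ne: "(target_set :: ('n, 'q, 'm, 'N) state set) \<noteq> {}" using zero_in_target by blast
    have ge: "x \<le> r" if "\<And>y. y \<in> target_set \<Longrightarrow> x \<le> dist \<xi> y" for x
      unfolding r_def infdist_def using ne that by (auto intro: cINF_greatest)
    have low: "norm e \<le> dist \<xi> y \<and> norm \<epsilon> \<le> dist \<xi> y \<and> norm \<eta> \<le> dist \<xi> y"
      if y_target: "y \<in> target_set" for y :: "('n, 'q, 'm, 'N) state"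
    proof -
      obtain z' wh' \<tau>' where y: "y = (z', 0, 0, wh', \<tau>', 0)" using y_target by (auto simp: target_set_def)
      have 1: "dist (snd \<xi>) (snd y) \<le> dist \<xi> y" by (rule dist_snd_le)
      have 2: "dist (snd (snd \<xi>)) (snd (snd y)) \<le> dist (snd \<xi>) (snd y)" by (rule dist_snd_le)
      have 3: "dist (snd (snd (snd \<xi>))) (snd (snd (snd y))) \<le> dist (snd (snd \<xi>)) (snd (snd y))" by (rule dist_snd_le)
      have 4: "dist (snd (snd (snd (snd \<xi>)))) (snd (snd (snd (snd y)))) \<le> dist (snd (snd (snd \<xi>))) (snd (snd (snd y)))"
        by (rule dist_snd_le)
      have "norm e \<le> dist (snd \<xi>) (snd y)" using dist_fst_le[of "snd \<xi>" "snd y"] by (simp add: eq y)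
      moreover have "norm \<epsilon> \<le> dist (snd (snd \<xi>)) (snd (snd y))"
        using dist_fst_le[of "snd (snd \<xi>)" "snd (snd y)"] by (simp add: eq y)
      moreover have "norm \<eta> \<le> dist (snd (snd (snd (snd \<xi>)))) (snd (snd (snd (snd y))))"
        using dist_snd_le[of "snd (snd (snd (snd \<xi>)))" "snd (snd (snd (snd y)))"] by (simp add: eq y)
      ultimately show ?thesis using 1 2 3 4 by linarith
    qed
    have r: "norm e \<le> r" "norm \<epsilon> \<le> r" "norm \<eta> \<le> r" using low by (auto intro!: ge)
    have "V e \<le> \<alpha>hi r"
      using V_bounds(2)[of e] class_K_inf_mono[OF comparison(3) norm_ge_zero r(1)] by linarith
    moreover have "gam S i * Phi i (\<tau> $ i) * (Wf S i \<epsilon>)\<^sup>2 \<le> gam S i / lam S i * (beta_hi S i)\<^sup>2 * r\<^sup>2" for i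
    proof -
      have "Wf S i \<epsilon> \<le> beta_hi S i * r"
        using W_bounds(3)[of i \<epsilon>] norm_blk_le[of i \<epsilon>] r(2) W_beta(2)[of i]
        by (meson mult_left_mono less_imp_le order_trans)
      then have "(Wf S i \<epsilon>)\<^sup>2 \<le> (beta_hi S i * r)\<^sup>2" using W_bounds(1) by (intro power_mono) auto
      then have "gam S i * Phi i (\<tau> $ i) * (Wf S i \<epsilon>)\<^sup>2 \<le> gam S i * (1 / lam S i) * (beta_hi S i * r)\<^sup>2"
        using gam_pos[of i] Phi_bounds[of i "\<tau> $ i"] tuningD(1)[of i]
        by (intro mult_mono) (auto simp: less_imp_le)
      then show ?thesis by (simp add: power_mult_distrib mult.assoc)
    qed
    moreover have "\<eta> $ i \<le> r" for i using component_le_norm_cart[of \<eta> i] r(3) by linarith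
    ultimately have "lyap \<xi> \<le> \<alpha>hi r + (\<Sum>i\<in>(UNIV::'N set). gam S i / lam S i * (beta_hi S i)\<^sup>2 * r\<^sup>2) + (\<Sum>i\<in>(UNIV::'N set). r)"
      unfolding eq lyap_def fst_conv snd_conv by (intro add_mono sum_mono)
    then show ?thesis by (simp add: \<theta>_def sum.distrib r_def)
  qed
  ultimately show ?thesis by (rule that)
qed

end

section \<open>Solutions\<close>

lemma closed_state_space: "closed (state_space :: ('n::finite, 'q::finite, 'm::finite, 'N::finite) state set)"
proof -
  have "state_space = {\<xi> :: ('n, 'q, 'm, 'N) state. (\<forall>i. 0 \<le> st_tau \<xi> $ i) \<and>
      (\<forall>i. 0 \<le> st_eta \<xi> $ i)}"
    by (auto simp: state_space_def)
  also have "closed \<dots>"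
    by (intro closed_Collect_conj closed_Collect_all closed_Collect_le continuous_intros)
  finally show ?thesis .
qed

lemma closed_target_set: "closed (target_set :: ('n::finite, 'q::finite, 'm::finite, 'N::finite) state set)"
proof -
  have "target_set = state_space \<inter> {\<xi> :: ('n, 'q, 'm, 'N) state. fst (snd \<xi>) = 0 \<and> st_eps \<xi> = 0 \<and>
      st_eta \<xi> = 0}"
    by (auto simp: target_set_def)
  also have "closed \<dots>"
    by (intro closed_Int closed_state_space closed_Collect_conj closed_Collect_eq continuous_intros)
  finally show ?thesis .
qed

lemma flow_set_hybrid_model: "flow_set (hybrid_model S \<eta>0) = state_space"
  by (auto simp: hybrid_model_def flow_C_i_def state_space_def)

lemma jump_D_i_subset: "jump_D_i S i \<subseteq> state_space"
  by (auto simp: jump_D_i_def)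

locale solution = estimator S V \<alpha> \<alpha>lo \<alpha>hi \<zeta> \<mu>
  for S :: "('n::finite, 'p::finite, 'q::finite, 'm::finite, 'N::finite) scheme"
    and V \<alpha> \<alpha>lo \<alpha>hi \<zeta> \<mu> +
  fixes E :: "(real \<times> nat) set" and \<xi> :: "('n, 'q, 'm, 'N) state hsignal" and \<nu> :: "('p, 'm) input hsignal"
  assumes sol: "solution_pair (hybrid_model S (\<lambda>i. 0)) E \<xi> \<nu>" and Linf: "hybrid_Linf E \<nu>"
begin

lemma domain: "hybrid_time_domain E"
  using sol by (simp add: solution_pair_def hybrid_arc_def)

lemma nonneg: "(t, j) \<in> E \<Longrightarrow> 0 \<le> t"
  using domain by (auto simp: hybrid_time_domain_def)

lemma abs_cont: "{a..b} \<subseteq> slice E j \<Longrightarrow> abs_cont_on (\<lambda>t. \<xi> t j) {a..b}"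
  using sol by (simp add: solution_pair_def hybrid_arc_def locally_abs_cont_on_def)

lemma continuous: "{a..b} \<subseteq> slice E j \<Longrightarrow> continuous_on {a..b} (\<lambda>t. \<xi> t j)"
  by (rule abs_cont_on_imp_continuous_on[OF abs_cont]) auto

lemma flow:
  "AE t in lebesgue. t \<in> slice E j \<longrightarrow>
     (\<exists>d\<in>flow_F S (\<xi> t j) (\<nu> t j). ((\<lambda>s. \<xi> s j) has_vector_derivative d) (at t)) \<and>
     norm (\<nu> t j) \<le> hybrid_norm E \<nu>"
proof -
  have "AE t in lebesgue. t \<in> slice E j \<longrightarrow>
      (\<exists>d\<in>flow_F S (\<xi> t j) (\<nu> t j). ((\<lambda>s. \<xi> s j) has_vector_derivative d) (at t within slice E j))"
    using sol by (simp add: solution_pair_def hybrid_model_def)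
  moreover have "AE t in lebesgue. t \<in> slice E j \<longrightarrow> norm (\<nu> t j) \<le> hybrid_norm E \<nu>"
    using hybrid_bound_norm(1)[OF Linf] by (simp add: hybrid_bound_def)
  ultimately have "AE t in lebesgue. t \<in> slice E j \<longrightarrow>
      (\<exists>d\<in>flow_F S (\<xi> t j) (\<nu> t j). ((\<lambda>s. \<xi> s j) has_vector_derivative d) (at t within slice E j)) \<and>
      norm (\<nu> t j) \<le> hybrid_norm E \<nu>"
    by eventually_elim blast
  from ae_interior_slice[OF domain this] show ?thesis
    by eventually_elim (use at_within_interior in fastforce)
qed

lemma jump:
  assumes "(t, j) \<in> jump_times E"
  obtains i where "\<xi> t j \<in> jump_D_i S i" "\<xi> t (Suc j) = jump_G_i S (\<lambda>i. 0) i (\<xi> t j) (\<nu> t j)"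
    "norm (\<nu> t j) \<le> hybrid_norm E \<nu>"
proof -
  have "\<xi> t (Suc j) \<in> jump_map (hybrid_model S (\<lambda>i. 0)) (\<xi> t j) (\<nu> t j)"
    using sol assms by (auto simp: solution_pair_def)
  moreover have "norm (\<nu> t j) \<le> hybrid_norm E \<nu>"
    using hybrid_bound_norm(1)[OF Linf] assms by (auto simp: hybrid_bound_def)
  ultimately show ?thesis using that by (auto simp: hybrid_model_def)
qed

text \<open>A solution pair constrains only the interior of each slice; closedness of the state
  space and continuity carry the constraint to the end points, and jumps merely reset timers and
  \<eta> to zero.\<close>

lemma in_state_space: "(t, j) \<in> E \<Longrightarrow> \<xi> t j \<in> state_space"
proof (rule hybrid_time_domain_induct[OF domain, where P = "\<lambda>t j. \<xi> t j \<in> state_space"], assumption)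
  have "\<xi> 0 0 \<in> closure state_space \<union> (\<Union>i. jump_D_i S i)"
    using sol by (simp add: solution_pair_def flow_set_hybrid_model) (simp add: hybrid_model_def)
  then show "\<xi> 0 0 \<in> state_space"
    using jump_D_i_subset by (auto simp: closure_closed[OF closed_state_space])
next
  fix a b j assume a: "\<xi> a j \<in> state_space" and ab: "a \<le> b" "{a..b} \<subseteq> slice E j"
  show "\<xi> b j \<in> state_space"
  proof (cases "a = b")
    case False
    then have "a < b" using ab by simp
    have "{a<..<b} \<subseteq> interior (slice E j)"
      using ab(2) by (intro interior_maximal) auto
    then have "\<And>t. t \<in> {a<..<b} \<Longrightarrow> \<xi> t j \<in> state_space"
      using sol by (auto simp: solution_pair_def flow_set_hybrid_model)
    then have "(\<lambda>t. \<xi> t j) ` closure {a<..<b} \<subseteq> state_space"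
      using continuous[OF ab(2)] \<open>a < b\<close> by (intro image_closure_subset closed_state_space) auto
    then show ?thesis using \<open>a < b\<close> by auto
  qed (use a in simp)
next
  fix t j assume "(t, j) \<in> jump_times E"
  then obtain i where "\<xi> t j \<in> jump_D_i S i" "\<xi> t (Suc j) = jump_G_i S (\<lambda>i. 0) i (\<xi> t j) (\<nu> t j)"
    by (rule jump)
  then show "\<xi> t (Suc j) \<in> state_space"
    by (auto simp: jump_D_i_def jump_G_i_def state_space_def upd_def split: prod.splits)
qed

lemma flow_Icc:
  assumes "{a..b} \<subseteq> slice E j"
  shows "AE t in lebesgue. t \<in> {a<..<b} \<longrightarrow>
     (\<exists>d\<in>flow_F S (\<xi> t j) (\<nu> t j). ((\<lambda>s. \<xi> s j) has_vector_derivative d) (at t)) \<and>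
     norm (\<nu> t j) \<le> hybrid_norm E \<nu>"
  using flow[of j]
proof eventually_elim
  case (elim t)
  then show ?case using assms less_imp_le by (auto simp: subset_iff)
qed

section \<open>Held noise, timers and Lyapunov function along a solution\<close>

lemma wh_flow:
  assumes ab: "{a..b} \<subseteq> slice E j" "a \<le> b"
  shows "st_wh (\<xi> b j) = st_wh (\<xi> a j)"
proof -
  have bl: "bounded_linear (\<lambda>\<xi> :: ('n, 'q, 'm, 'N) state. st_wh \<xi>)"
    by (intro bounded_linear_fst_comp bounded_linear_snd_comp bounded_linear_snd)
  have "norm (st_wh (\<xi> b j) - st_wh (\<xi> a j)) \<le> 0 * (b - a)"
  proof (rule abs_cont_curve_norm_le[OF abs_cont[OF ab(1)] ab(2), where F = "\<lambda>\<xi>. st_wh \<xi>"])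
    show "AE t in lebesgue. t \<in> {a<..<b} \<longrightarrow>
      (\<exists>D. ((\<lambda>s. st_wh (\<xi> s j)) has_vector_derivative D) (at t) \<and> norm D \<le> 0)"
      using flow_Icc[OF ab(1)]
    proof eventually_elim
      case (elim t)
      show ?case
      proof
        assume "t \<in> {a<..<b}"
        then obtain d where d: "d \<in> flow_F S (\<xi> t j) (\<nu> t j)" "((\<lambda>s. \<xi> s j) has_vector_derivative d) (at t)"
          using elim by blast
        have "st_wh d = 0" using d(1) by (auto simp: flow_F_def split: prod.splits)
        then show "\<exists>D. ((\<lambda>s. st_wh (\<xi> s j)) has_vector_derivative D) (at t) \<and> norm D \<le> 0"
          using bounded_linear.has_vector_derivative[OF bl d(2)] by auto
      qed
    qed
  qed (rule calm_at_linear[OF bl])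
  then show ?thesis by simp
qed

lemma tau_flow:
  assumes ab: "{a..b} \<subseteq> slice E j" "a \<le> b"
  shows "st_tau (\<xi> b j) $ i = st_tau (\<xi> a j) $ i + (b - a)"
proof -
  define F where "F = (\<lambda>\<xi> :: ('n, 'q, 'm, 'N) state. st_tau \<xi> $ i)"
  have bl: "bounded_linear F"
    unfolding F_def by (intro bounded_linear_compose[OF bounded_linear_vec_nth]
        bounded_linear_fst_comp bounded_linear_snd_comp bounded_linear_snd)
  have der: "AE t in lebesgue. t \<in> {a<..<b} \<longrightarrow> ((\<lambda>s. F (\<xi> s j)) has_real_derivative 1) (at t)"
    using flow_Icc[OF ab(1)]
  proof eventually_elim
    case (elim t)
    show ?case
    proof
      assume "t \<in> {a<..<b}"
      then obtain d where d: "d \<in> flow_F S (\<xi> t j) (\<nu> t j)" "((\<lambda>s. \<xi> s j) has_vector_derivative d) (at t)"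
        using elim by blast
      have "F d = 1" using d(1) by (auto simp: flow_F_def F_def split: prod.splits)
      then show "((\<lambda>s. F (\<xi> s j)) has_real_derivative 1) (at t)"
        using bounded_linear.has_vector_derivative[OF bl d(2)]
        by (simp add: has_real_derivative_iff_has_vector_derivative)
    qed
  qed
  have "F (\<xi> b j) - F (\<xi> a j) \<le> 1 * (b - a)"
    by (rule abs_cont_curve_le[OF abs_cont[OF ab(1)] ab(2) calm_at_linear[OF bl] AE_mp[OF der]])
      (auto intro!: AE_I2 upper_drv_real_derivative)
  moreover have "- F (\<xi> b j) - - F (\<xi> a j) \<le> - 1 * (b - a)"
  proof (rule abs_cont_curve_le[OF abs_cont[OF ab(1)] ab(2), where F = "\<lambda>x. - F x"])
    show "calm_at (\<lambda>x. - F x) x" for x using bl by (intro calm_at_linear bounded_linear_minus)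
    show "AE t in lebesgue. t \<in> {a<..<b} \<longrightarrow> upper_drv (\<lambda>s. - F (\<xi> s j)) t (- 1)"
      using der by eventually_elim (auto intro!: upper_drv_real_derivative DERIV_minus)
  qed
  ultimately show ?thesis by (simp add: F_def)
qed

text \<open>A jump replaces one block by a current noise sample, which the norm controls because it
  includes the values at jumps. The bound is blockwise since different blocks are sampled at
  different times.\<close>

lemma wh_bounded:
  assumes init: "held_noise_sampled S E \<xi> \<nu>" and "(t, j) \<in> E"
  shows "norm (blk S i (st_wh (\<xi> t j))) \<le> hybrid_norm E \<nu>"
proof -
  have "\<forall>i. norm (blk S i (st_wh (\<xi> t j))) \<le> hybrid_norm E \<nu>"
  proof (rule hybrid_time_domain_induct[OF domain assms(2),
        where P = "\<lambda>t j. \<forall>i. norm (blk S i (st_wh (\<xi> t j))) \<le> hybrid_norm E \<nu>"])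
    show "\<forall>i. norm (blk S i (st_wh (\<xi> 0 0))) \<le> hybrid_norm E \<nu>"
      using init by (simp add: held_noise_sampled_def split: prod.splits)
  next
    fix a b j assume "\<forall>i. norm (blk S i (st_wh (\<xi> a j))) \<le> hybrid_norm E \<nu>"
      "a \<le> b" "{a..b} \<subseteq> slice E j"
    then show "\<forall>i. norm (blk S i (st_wh (\<xi> b j))) \<le> hybrid_norm E \<nu>"
      using wh_flow by simp
  next
    fix t j assume IH: "\<forall>i. norm (blk S i (st_wh (\<xi> t j))) \<le> hybrid_norm E \<nu>"
      and "(t, j) \<in> jump_times E"
    then obtain i where i: "\<xi> t (Suc j) = jump_G_i S (\<lambda>i. 0) i (\<xi> t j) (\<nu> t j)" "norm (\<nu> t j) \<le> hybrid_norm E \<nu>"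
      by (rule_tac jump) auto
    obtain z e \<epsilon> wh \<tau> \<eta> where eq: "\<xi> t j = (z, e, \<epsilon>, wh, \<tau>, \<eta>)" by (metis prod.exhaust)
    obtain v w where vw: "\<nu> t j = (v, w)" by fastforce
    have new: "st_wh (\<xi> t (Suc j)) = (\<chi> k. if node S k = i then w $ k else wh $ k)"
      by (simp add: i(1) eq vw jump_G_i_def)
    have "blk S k (st_wh (\<xi> t (Suc j))) = (if k = i then blk S k w else blk S k wh)" for k
      unfolding new by (auto simp: blk_def vec_eq_iff)
    moreover have "norm (blk S i w) \<le> hybrid_norm E \<nu>"
      using norm_blk_le[of i w] norm_snd_le[of w v] i(2) vw by simp
    ultimately show "\<forall>k. norm (blk S k (st_wh (\<xi> t (Suc j))))  \<le> hybrid_norm E \<nu>"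
      using IH by (simp add: eq)
  qed
  then show ?thesis by blast
qed

text \<open>Resetting a timer may raise its weight up to 1/\<lambda>, but that weight then
  multiplies W(0) = 0.\<close>

lemma lyap_jump:
  assumes "(t, j) \<in> jump_times E"
  shows "lyap (\<xi> t (Suc j)) \<le> lyap (\<xi> t j)"
proof -
  obtain i where i: "\<xi> t j \<in> jump_D_i S i" "\<xi> t (Suc j) = jump_G_i S (\<lambda>i. 0) i (\<xi> t j) (\<nu> t j)"
    using assms by (rule jump)
  obtain z e \<epsilon> wh \<tau> \<eta> where eq: "\<xi> t j = (z, e, \<epsilon>, wh, \<tau>, \<eta>)" by (metis prod.exhaust)
  obtain v w where vw: "\<nu> t j = (v, w)" by fastforce
  have \<eta>: "0 \<le> \<eta> $ k" for k using i(1) by (simp add: eq jump_D_i_def state_space_def)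
  define \<epsilon>' where "\<epsilon>' = (\<chi> k. if node S k = i then 0 else \<epsilon> $ k)"
  have "blk S k \<epsilon>' = (if k = i then 0 else blk S k \<epsilon>)" for k
    by (auto simp: \<epsilon>'_def blk_def vec_eq_iff)
  then have W: "Wf S k \<epsilon>' = (if k = i then 0 else Wf S k \<epsilon>)" for k
    using W_blk[of k \<epsilon>'] W_blk[of k \<epsilon>] by auto
  have "gam S k * Phi k (upd \<tau> i 0 $ k) * (Wf S k \<epsilon>')\<^sup>2 \<le> gam S k * Phi k (\<tau> $ k) * (Wf S k \<epsilon>)\<^sup>2" for k
    using gam_pos[of k] Phi_bounds(3)[of k "\<tau> $ k"] by (auto simp: W upd_def)
  moreover have "upd \<eta> i 0 $ k \<le> \<eta> $ k" for k using \<eta> by (simp add: upd_def)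
  ultimately show ?thesis
    unfolding i(2) eq vw
    by (simp add: jump_G_i_def lyap_def flip: \<epsilon>'_def) (intro add_mono sum_mono)
qed

end

text \<open>Above the level \<open>M\<close> the Lyapunov function dissipates at a rate of at least \<open>b\<close>.  Integrating
  this only with the final value of the rate already gives \<open>(1 + t) b(w) \<le> w\<^sub>0\<close>, so no
  comparison ODE has to be solved.\<close>

locale stable_solution = solution +
  fixes b :: "real \<Rightarrow> real" and M :: real
  assumes sampled: "held_noise_sampled S E \<xi> \<nu>"
    and rate: "decay_rate b"
    and M: "0 \<le> M" "(\<Sum>i\<in>UNIV. space_reg S i) + lyap_gain (hybrid_norm E \<nu>) \<le> b M"
begin

lemma rateD: "class_K_inf b" "b s \<le> s"
  "(\<And>i. 0 \<le> \<eta> $ i) \<Longrightarrow> 2 * b (lyap (z, e, \<epsilon>, wh, \<tau>, \<eta>)) \<le>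
      \<alpha> (norm e) + (\<Sum>i\<in>UNIV. \<mu> i * (Wf S i \<epsilon>)\<^sup>2) + (\<Sum>i\<in>UNIV. sig S i (\<eta> $ i))"
  using rate unfolding decay_rate_def by blast+

text \<open>Cutting off at \<open>M\<close> hides the region without guaranteed decay, so that
  \<open>w\<close> never increases, neither along flows nor at jumps.\<close>

definition w :: "real \<Rightarrow> nat \<Rightarrow> real" where
  "w t j = max (lyap (\<xi> t j)) M"

text \<open>The rate \<kappa> = 0 is always admissible and gives monotonicity; a negative rate
  requires staying above the level \<open>M\<close>.\<close>

lemma w_flow:
  assumes ab: "{a..c} \<subseteq> slice E j" "a \<le> c"
    and \<kappa>: "\<kappa> \<le> 0" "\<And>s. s \<in> {a<..<c} \<Longrightarrow> (M < lyap (\<xi> s j) \<and> - b (lyap (\<xi> s j)) \<le> \<kappa>) \<or> \<kappa> = 0"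
  shows "w c j - w a j \<le> \<kappa> * (c - a)"
  unfolding w_def
proof (rule abs_cont_curve_le[OF abs_cont[OF ab(1)] ab(2), where F = "\<lambda>\<xi>. max (lyap \<xi>) M"])
  show "calm_at (\<lambda>\<xi>. max (lyap \<xi>) M) x" for x by (rule calm_at_max[OF calm_lyap])
  \<comment> \<open>Timers run at unit speed, so each one passes \<open>tau_miet\<close> at most
    once during the flow; the exceptional times form a finite set.\<close>
  have tau_null: "AE t in lebesgue. t \<notin> (\<lambda>i. a + (tau_miet S i - st_tau (\<xi> a j) $ i)) ` UNIV"
    by (intro AE_not_in) (auto simp: negligible_iff_null_sets[symmetric] intro!: negligible_finite)
  show "AE t in lebesgue. t \<in> {a<..<c} \<longrightarrow> upper_drv (\<lambda>s. max (lyap (\<xi> s j)) M) t \<kappa>"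
    using flow_Icc[OF ab(1)] tau_null
  proof eventually_elim
    case (elim t)
    show ?case
    proof
      assume t: "t \<in> {a<..<c}"
      then obtain d where d: "d \<in> flow_F S (\<xi> t j) (\<nu> t j)" "((\<lambda>s. \<xi> s j) has_vector_derivative d) (at t)"
        and \<nu>: "norm (\<nu> t j) \<le> hybrid_norm E \<nu>"
        using elim(1) by blast
      have at: "{a..t} \<subseteq> slice E j" "a \<le> t" using ab t by auto
      have tE: "(t, j) \<in> E" "(a, j) \<in> E" using at by (auto simp: slice_def)
      obtain z e \<epsilon> wh \<tau> \<eta> where eq: "\<xi> t j = (z, e, \<epsilon>, wh, \<tau>, \<eta>)" by (metis prod.exhaust)
      obtain v w where vw: "\<nu> t j = (v, w)" by fastforce
      have \<tau>a: "0 \<le> st_tau (\<xi> a j) $ i" for i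
        using in_state_space[OF tE(2)] by (auto simp: state_space_def)
      have \<tau>t: "\<tau> $ i = st_tau (\<xi> a j) $ i + (t - a)" for i
        using tau_flow[OF at, of i] by (simp add: eq)
      have \<tau>: "0 < \<tau> $ i" "\<tau> $ i \<noteq> tau_miet S i" for i
        using \<tau>a[of i] \<tau>t[of i] t elim(2) by (auto simp: image_iff) (metis add.commute add_diff_cancel_left' diff_add_cancel)
      have \<eta>: "0 \<le> \<eta> $ i" for i using in_state_space[OF tE(1)] by (simp add: eq state_space_def)
      have "upper_drv (\<lambda>s. lyap (\<xi> s j)) t
        (- (\<alpha> (norm e) + (\<Sum>i\<in>UNIV. \<mu> i * (Wf S i \<epsilon>)\<^sup>2) + (\<Sum>i\<in>UNIV. sig S i (\<eta> $ i)))
          + (\<Sum>i\<in>UNIV. space_reg S i) + lyap_gain (hybrid_norm E \<nu>))"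
        using d \<nu> wh_bounded[OF sampled tE(1)]
        by (intro lyap_upper_drv[where \<xi> = "\<lambda>s. \<xi> s j", OF _ _ eq \<tau>]) (auto simp: vw eq)
      then have drv: "upper_drv (\<lambda>s. lyap (\<xi> s j)) t (- 2 * b (lyap (\<xi> t j)) + b M)"
        by (rule upper_drv_mono) (use rateD(3)[OF \<eta>, of z e \<epsilon> wh \<tau>] M(2) eq in simp)
      have cont: "isCont (\<lambda>s. lyap (\<xi> s j)) t"
        by (rule isCont_o2[OF has_vector_derivative_continuous[OF d(2)]])
          (use calm_at_imp_tendsto[OF calm_lyap] in \<open>simp add: isCont_def tendsto_at_iff_tendsto_nhds\<close>)
      have bM: "b M \<le> b x" if "M \<le> x" for x using class_K_inf_mono[OF rateD(1) M(1) that] .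
      show "upper_drv (\<lambda>s. max (lyap (\<xi> s j)) M) t \<kappa>"
        using \<kappa>(2)[OF t] \<kappa>(1) bM[of "lyap (\<xi> t j)"] class_K_inf_nonneg[OF rateD(1) M(1)]
        by (intro upper_drv_max[OF drv cont]) auto
    qed
  qed
qed

lemma w_jump: "(t, j) \<in> jump_times E \<Longrightarrow> w t (Suc j) \<le> w t j"
  using lyap_jump[of t j] by (simp add: w_def max_def)

text \<open>The quantity w + t b(w) is nondecreasing in w, hence not raised by jumps. Along a flow
  from a to c, w drops by at least (c - a) b(w(c)), since b(w) is smallest at the end; this turns c
  b(w(c)) into a b(w(c)), which is at most a b(w(a)).\<close>

lemma w_decay:
  assumes "(T, J) \<in> E"
  shows "w T J \<le> M \<or> w T J + T * b (w T J) \<le> w 0 0"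
proof (rule hybrid_time_domain_induct[OF domain assms, where P = "\<lambda>t j. w t j \<le> M \<or> w t j + t * b (w t j) \<le> w 0 0"])
  fix a c j assume IH: "w a j \<le> M \<or> w a j + a * b (w a j) \<le> w 0 0" and "0 \<le> a" and ac: "a \<le> c" "{a..c} \<subseteq> slice E j"
  show "w c j \<le> M \<or> w c j + c * b (w c j) \<le> w 0 0"
  proof (cases "w c j \<le> M")
    case False
    have mono: "w c j \<le> w s j" if "a \<le> s" "s \<le> c" for s
    proof -
      have "{s..c} \<subseteq> slice E j" using that ac by auto
      from w_flow[OF this that(2), of 0] show ?thesis by simp
    qed
    have "w c j - w a j \<le> - b (w c j) * (c - a)"
    proof (rule w_flow[OF ac(2,1)])
      show "- b (w c j) \<le> 0" using class_K_inf_nonneg[OF rateD(1)] False M(1) by auto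
      fix s assume s: "s \<in> {a<..<c}"
      then have "w c j \<le> w s j" using mono by auto
      moreover from this have "M < w s j" using False by linarith
      then have "M < lyap (\<xi> s j)" "w s j = lyap (\<xi> s j)" by (auto simp: w_def max_def split: if_splits)
      ultimately show "(M < lyap (\<xi> s j) \<and> - b (lyap (\<xi> s j)) \<le> - b (w c j)) \<or> - b (w c j) = 0"
        using class_K_inf_mono[OF rateD(1), of "w c j" "w s j"] False M(1) by auto
    qed
    moreover have "a * b (w c j) \<le> a * b (w a j)"
      using mono[of a] ac(1) \<open>0 \<le> a\<close> False M(1) by (intro mult_left_mono class_K_inf_mono[OF rateD(1)]) auto
    moreover have "w a j + a * b (w a j) \<le> w 0 0" using IH mono[of a] ac(1) False by auto
    ultimately show ?thesis by (simp add: algebra_simps)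
  qed simp
next
  fix t j assume IH: "w t j \<le> M \<or> w t j + t * b (w t j) \<le> w 0 0" and "0 \<le> t" and "(t, j) \<in> jump_times E"
  then have le: "w t (Suc j) \<le> w t j" by (simp add: w_jump)
  show "w t (Suc j) \<le> M \<or> w t (Suc j) + t * b (w t (Suc j)) \<le> w 0 0"
  proof (cases "w t (Suc j) \<le> M")
    case False
    then have "t * b (w t (Suc j)) \<le> t * b (w t j)"
      using le \<open>0 \<le> t\<close> M(1) by (intro mult_left_mono class_K_inf_mono[OF rateD(1)]) auto
    then show ?thesis using IH le False by linarith
  qed simp
qed simp

lemma lyap_bound:
  assumes "(T, J) \<in> E" and g: "class_K_inf g" "\<And>x. 0 \<le> x \<Longrightarrow> g (b x) = x"
  shows "lyap (\<xi> T J) \<le> M + g (lyap (\<xi> 0 0) / (1 + T))"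
proof -
  have "0 \<le> T" using assms(1) by (rule nonneg)
  have lyap_nn: "0 \<le> lyap (\<xi> t j)" if "(t, j) \<in> E" for t j
    using in_state_space[OF that] lyap_nonneg by (auto simp: state_space_def)
  have nn: "0 \<le> lyap (\<xi> 0 0)" by (rule lyap_nn[OF hybrid_time_domain_0[OF domain]])
  then have gnn: "0 \<le> g (lyap (\<xi> 0 0) / (1 + T))" using \<open>0 \<le> T\<close> by (intro class_K_inf_nonneg[OF g(1)]) auto
  show ?thesis
  proof (cases "w T J \<le> M")
    case True
    then show ?thesis using gnn by (simp add: w_def)
  next
    case False
    then have "w T J + T * b (w T J) \<le> w 0 0" using w_decay[OF assms(1)] by blast
    moreover have "0 \<le> T * b (w T J)" using \<open>0 \<le> T\<close> False M(1) by (auto intro!: mult_nonneg_nonneg class_K_inf_nonneg[OF rateD(1)])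
    \<comment> \<open>A final value above \<open>M\<close> forces \<open>w 0 0\<close> above
      \<open>M\<close>, so the cut-off is inactive at the initial time.\<close>
    ultimately have "w 0 0 = lyap (\<xi> 0 0)" using False by (auto simp: w_def max_def split: if_splits)
    \<comment> \<open>\<open>b s \<le> s\<close> bounds the first summand of
      \<open>w + T * b w\<close> from below.\<close>
    moreover have "(1 + T) * b (w T J) \<le> w T J + T * b (w T J)" using rateD(2)[of "w T J"] by (simp add: algebra_simps)
    ultimately have "b (w T J) \<le> lyap (\<xi> 0 0) / (1 + T)"
      using \<open>w T J + T * b (w T J) \<le> w 0 0\<close> \<open>0 \<le> T\<close> by (simp add: pos_le_divide_eq mult.commute)
    then have "g (b (w T J)) \<le> g (lyap (\<xi> 0 0) / (1 + T))"
      using False M(1) by (intro class_K_inf_mono[OF g(1)] class_K_inf_nonneg[OF rateD(1)]) auto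
    then show ?thesis using g(2)[of "w T J"] False M(1) by (simp add: w_def)
  qed
qed

end

context estimator
begin

section \<open>From the decay of the Lyapunov function to ISpS\<close>

lemma class_K_inf_lyap_gain: "class_K_inf lyap_gain"
proof -
  have pos: "0 < (\<Sum>i\<in>(UNIV :: 'N set). gam_bar S i * (8 * (beta_hi S i)\<^sup>2))"
  proof (rule sum_pos)
    fix i
    have "0 < (gam S i)\<^sup>2 * (1 + (lam S i)\<^sup>2)" using gam_pos[of i] by (simp add: add_pos_nonneg)
    moreover have "0 \<le> 2 * gam S i * lam S i * Lc S i"
      using gam_pos[of i] tuningD(1)[of i] L_nonneg[of i] by simp
    ultimately have "0 < gam_bar S i" unfolding gam_bar_def by linarith
    then show "0 < gam_bar S i * (8 * (beta_hi S i)\<^sup>2)" using W_beta(2)[of i] by simp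
  qed auto
  show ?thesis
    unfolding lyap_gain_def[abs_def]
    by (intro class_K_inf_add comparison(4) class_K_inf_imp_class_K class_K_inf_compose[OF class_K_inf_scale[OF pos] class_K_inf_power2])
qed

text \<open>ISS is ISpS with offset zero, so a single estimate serves both claims provided the
  offset vanishes together with all \<open>space_reg\<close>.\<close>

lemma ISpS_with_space_reg:
  "\<exists>d\<ge>0. ((\<forall>i. space_reg S i = 0) \<longrightarrow> d = 0) \<and>
    ISpS_with d (hybrid_model S (\<lambda>i. 0)) (held_noise_sampled S) target_set"
proof -
  obtain b where rate: "decay_rate b" using ex_decay_rate by blast
  then have b: "class_K_inf b" by (simp add: decay_rate_def)
  obtain g where g: "class_K_inf g" "\<And>x. 0 \<le> x \<Longrightarrow> b (g x) = x" "\<And>x. 0 \<le> x \<Longrightarrow> g (b x) = x"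
    by (rule class_K_inf_inverse[OF b]) (rule that)
  obtain \<psi> where \<psi>: "class_K_inf \<psi>" "\<And>\<xi>. \<xi> \<in> state_space \<Longrightarrow> infdist \<xi> target_set \<le> \<psi> (lyap \<xi>)"
    by (rule ex_infdist_le_lyap) (rule that)
  obtain \<theta> where \<theta>: "class_K_inf \<theta>" "\<And>\<xi>. \<xi> \<in> state_space \<Longrightarrow> lyap \<xi> \<le> \<theta> (infdist \<xi> target_set)"
    by (rule ex_lyap_le_infdist) (rule that)
  define s0 where "s0 = (\<Sum>i\<in>UNIV. space_reg S i)"
  have "0 \<le> s0" unfolding s0_def by (intro sum_nonneg tuningD(7))
  \<comment> \<open>The inner 2 comes from splitting \<open>s0 + lyap_gain n\<close> under
    \<open>g\<close>, the 4 from two successive splittings under \<psi>.\<close>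
  define k where "k x = \<psi> (4 * g (2 * x))" for x
  have k: "class_K_inf k"
    unfolding k_def
    by (rule class_K_inf_compose[OF \<psi>(1) class_K_inf_compose[OF class_K_inf_scale[of 4]
          class_K_inf_compose[OF g(1) class_K_inf_scale[of 2]]]]) simp_all
  define d where "d = k s0"
  have "0 \<le> d" using class_K_inf_nonneg[OF k \<open>0 \<le> s0\<close>] by (simp add: d_def)
  moreover have "d = 0" if "\<forall>i. space_reg S i = 0"
    using that k by (simp add: d_def s0_def class_K_inf_zero)
  moreover have "ISpS_with d (hybrid_model S (\<lambda>i. 0)) (held_noise_sampled S) target_set"
    unfolding ISpS_with_def
  proof (intro conjI closed_target_set exI[of _ "\<lambda>n. k (lyap_gain n)"] exI[of _ "\<lambda>r t. \<psi> (2 * g (\<theta> r / (1 + t)))"] allI impI)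
    show "(target_set :: ('n, 'q, 'm, 'N) state set) \<noteq> {}" using zero_in_target by blast
    show "class_K (\<lambda>n. k (lyap_gain n))"
      by (intro class_K_inf_imp_class_K class_K_inf_compose[OF k class_K_inf_lyap_gain])
    show "class_KL (\<lambda>r t. \<psi> (2 * g (\<theta> r / (1 + t))))"
      by (rule class_KL_of_class_K_inf[OF class_K_inf_compose[OF \<psi>(1)
              class_K_inf_compose[OF class_K_inf_scale[of 2] g(1)]] \<theta>(1)]) simp
    fix E \<xi> \<nu>
    assume *: "solution_pair (hybrid_model S (\<lambda>i. 0)) E \<xi> \<nu> \<and> hybrid_Linf E \<nu> \<and> held_noise_sampled S E \<xi> \<nu>"
    interpret solution S V \<alpha> \<alpha>lo \<alpha>hi \<zeta> \<mu> E \<xi> \<nu> by unfold_locales (use * in auto)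
    define n where "n = hybrid_norm E \<nu>"
    have "0 \<le> n" using hybrid_bound_norm(2)[OF Linf] by (simp add: n_def)
    have gain_nn: "0 \<le> lyap_gain n" by (rule class_K_inf_nonneg[OF class_K_inf_lyap_gain \<open>0 \<le> n\<close>])
    \<comment> \<open>The level at which one half of the dissipation balances input and space
      regularisation exactly.\<close>
    define M where "M = g (s0 + lyap_gain n)"
    have "0 \<le> M" using class_K_inf_nonneg[OF g(1)] \<open>0 \<le> s0\<close> gain_nn by (simp add: M_def)
    have "b M = s0 + lyap_gain n" using g(2) \<open>0 \<le> s0\<close> gain_nn by (simp add: M_def)
    interpret stable_solution S V \<alpha> \<alpha>lo \<alpha>hi \<zeta> \<mu> E \<xi> \<nu> b M
      by unfold_locales (use * rate \<open>0 \<le> M\<close> \<open>b M = s0 + lyap_gain n\<close> in \<open>auto simp: s0_def n_def\<close>)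
    have K\<psi>: "class_K \<psi>" and Kg: "class_K g" using \<psi>(1) g(1) by (auto intro: class_K_inf_imp_class_K)
    have "infdist (\<xi> T J) target_set \<le> \<psi> (2 * g (\<theta> (infdist (\<xi> 0 0) target_set) / (1 + T))) + k (lyap_gain n) + d"
      if TJ: "(T, J) \<in> E" for T J
    proof -
      have "0 \<le> T" using TJ by (rule nonneg)
      have ss: "\<xi> T J \<in> state_space" "\<xi> 0 0 \<in> state_space"
        using in_state_space TJ hybrid_time_domain_0[OF domain] by auto
      define x where "x = g (\<theta> (infdist (\<xi> 0 0) target_set) / (1 + T))"
      have l0: "0 \<le> lyap (\<xi> 0 0)" using ss(2) lyap_nonneg by (auto simp: state_space_def)
      have "g (lyap (\<xi> 0 0) / (1 + T)) \<le> x"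
        unfolding x_def using \<theta>(2)[OF ss(2)] l0 \<open>0 \<le> T\<close>
        by (intro class_K_mono[OF Kg] divide_right_mono) auto
      then have "lyap (\<xi> T J) \<le> x + M" using lyap_bound[OF TJ g(1,3)] by simp
      moreover have "0 \<le> lyap (\<xi> T J)" using ss(1) lyap_nonneg by (auto simp: state_space_def)
      ultimately have "\<psi> (lyap (\<xi> T J)) \<le> \<psi> (x + M)" by (intro class_K_mono[OF K\<psi>])
      also have "0 \<le> x" unfolding x_def using class_K_inf_nonneg[OF \<theta>(1) infdist_nonneg[of "\<xi> 0 0" target_set]] \<open>0 \<le> T\<close>
        by (intro class_K_nonneg[OF Kg]) auto
      then have "\<psi> (x + M) \<le> \<psi> (2 * x) + \<psi> (2 * M)" using \<open>0 \<le> M\<close> by (intro class_K_add_le[OF K\<psi>])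
      also have "2 * M \<le> 2 * g (2 * s0) + 2 * g (2 * lyap_gain n)"
        using class_K_add_le[OF Kg \<open>0 \<le> s0\<close> gain_nn] by (simp add: M_def)
      then have "\<psi> (2 * M) \<le> \<psi> (2 * g (2 * s0) + 2 * g (2 * lyap_gain n))"
        using \<open>0 \<le> M\<close> by (intro class_K_mono[OF K\<psi>]) auto
      also have "\<dots> \<le> k s0 + k (lyap_gain n)"
        using class_K_add_le[OF K\<psi>, of "2 * g (2 * s0)" "2 * g (2 * lyap_gain n)"]
          class_K_nonneg[OF Kg, of "2 * s0"] class_K_nonneg[OF Kg, of "2 * lyap_gain n"] \<open>0 \<le> s0\<close> gain_nn
        by (simp add: k_def)
      finally show ?thesis using \<psi>(2)[OF ss(1)] by (simp add: x_def d_def)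
    qed
    then show "\<forall>(t, j)\<in>E. infdist (\<xi> t j) target_set
        \<le> \<psi> (2 * g (\<theta> (infdist (\<xi> 0 0) target_set) / (1 + t))) + k (lyap_gain (hybrid_norm E \<nu>)) + d"
      by (auto simp: n_def)
  qed
  ultimately show ?thesis by blast
qed

end

section \<open>Extending solutions\<close>

lemma scalar_decay_ode:
  assumes \<sigma>: "class_K_inf \<sigma>" and "0 \<le> c" "0 \<le> y0"
  shows "\<exists>\<delta>>0. \<exists>y. y 0 = y0 \<and> (\<forall>t\<in>{0..\<delta>}. 0 \<le> y t) \<and> abs_cont_on y {0..\<delta>} \<and>
    (\<forall>t\<in>{0<..<\<delta>}. (y has_real_derivative c - \<sigma> (y t)) (at t))"
proof -
  define h where "h u = c - \<sigma> (max 0 u)" for u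
  have cont_h: "continuous_on UNIV h"
  proof -
    have "continuous_on {0..} \<sigma>" using \<sigma> by (simp add: class_K_inf_def class_K_def)
    then have "continuous_on UNIV (\<lambda>u. \<sigma> (max 0 u))"
      by (rule continuous_on_compose2[of _ _ _ "\<lambda>u. max 0 u"]) (auto intro!: continuous_intros)
    then show ?thesis unfolding h_def by (intro continuous_intros)
  qed
  show ?thesis
  proof (cases "h y0 = 0")
    case True
    then have "c - \<sigma> y0 = 0" using assms(3) by (simp add: h_def)
    moreover have "abs_cont_on (\<lambda>t::real. y0) {0..1}" by (rule abs_cont_on_lipschitz[of 0]) (simp add: lipschitz_on_def)
    ultimately show ?thesis using assms(3)
      by (intro exI[of _ 1] conjI exI[of _ "\<lambda>t. y0"]) auto
  next
    case False
    have "isCont h y0" using cont_h by (simp add: continuous_on_eq_continuous_at)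
    moreover have "0 < \<bar>h y0\<bar> / 2" using False by simp
    ultimately obtain r0 where r0: "r0 > 0" "\<And>u. dist u y0 < r0 \<Longrightarrow> dist (h u) (h y0) < \<bar>h y0\<bar> / 2"
      unfolding continuous_at_eps_delta by metis
    \<comment> \<open>A positive \<open>y0\<close> keeps the whole interval in the nonnegative
      half-line; for \<open>y0 = 0\<close> the interval extends below zero, where \<open>h\<close>
      is continued by a constant.\<close>
    define r where "r = (if y0 = 0 then r0 / 2 else min (r0 / 2) y0)"
    have r: "0 < r" "r < r0" "y0 \<noteq> 0 \<Longrightarrow> r \<le> y0" using r0(1) assms(3) by (auto simp: r_def)
    define J where "J = {y0 - r..y0 + r}"
    have sign: "0 < h u * h y0" if "u \<in> J" for u
    proof -
      have "\<bar>h u - h y0\<bar> < \<bar>h y0\<bar> / 2" using r0(2)[of u] that r by (auto simp: J_def dist_real_def)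
      then show ?thesis using False by (auto simp: zero_less_mult_iff abs_if split: if_splits)
    qed
    then have h_nz: "h u \<noteq> 0" if "u \<in> J" for u using that by force
    \<comment> \<open>The signed time of travel from \<open>y0\<close> to \<open>u\<close>; the
      solution is its inverse function.\<close>
    define f where "f u = integral {y0 - r..u} (\<lambda>x. 1 / h x) - integral {y0 - r..y0} (\<lambda>x. 1 / h x)" for u
    have cont_inv: "continuous_on J (\<lambda>x. 1 / h x)"
      using h_nz by (intro continuous_intros continuous_on_subset[OF cont_h]) auto
    have f': "(f has_real_derivative 1 / h u) (at u within J)" if "u \<in> J" for u
      using integral_has_real_derivative[OF cont_inv[unfolded J_def], of u] that unfolding J_def f_def
      by (auto intro!: derivative_eq_intros)
    have mvt: "\<exists>x\<in>J. f v - f u = (v - u) / h x" if "u \<in> J" "v \<in> J" "u < v" for u v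
    proof -
      have "\<exists>x\<in>{u<..<v}. f v - f u = (\<lambda>d. 1 / h x * d) (v - u)"
      proof (rule mvt_simple[OF \<open>u < v\<close>, of f "\<lambda>x d. 1 / h x * d"])
        fix x assume "u \<le> x" "x \<le> v"
        then have "(f has_real_derivative 1 / h x) (at x within {u..v})"
          using that by (intro DERIV_subset[OF f']) (auto simp: J_def)
        then show "(f has_derivative (*) (1 / h x)) (at x within {u..v})" by (simp add: has_field_derivative_def)
      qed
      then show ?thesis using that by (auto simp: J_def)
    qed
    have f0: "f y0 = 0" by (simp add: f_def)
    have y0J: "y0 \<in> J" "y0 - r \<in> J" "y0 + r \<in> J" using r by (auto simp: J_def)
    have f_sign: "0 < f u * (u - y0) * h y0" if u: "u \<in> J" "u \<noteq> y0" for u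
    proof -
      have "\<exists>x\<in>J. f u = (u - y0) / h x"
      proof (cases "u < y0")
        case True
        then obtain x where "x \<in> J" "f y0 - f u = (y0 - u) / h x" using mvt[OF u(1) y0J(1)] by blast
        then show ?thesis using f0 by (intro bexI[of _ x]) (auto simp: diff_divide_distrib)
      next
        case False
        then show ?thesis using mvt[OF y0J(1) u(1)] u(2) f0 by auto
      qed
      then obtain x where x: "x \<in> J" "f u = (u - y0) / h x" by blast
      have "f u * (u - y0) * h y0 = (u - y0)\<^sup>2 * (h x * h y0) / (h x)\<^sup>2"
        using h_nz[OF x(1)] unfolding x(2) by (simp add: power2_eq_square)
      moreover have "0 < (u - y0)\<^sup>2 * (h x * h y0) / (h x)\<^sup>2"
        using sign[OF x(1)] u(2) h_nz[OF x(1)] by (intro divide_pos_pos mult_pos_pos[OF _ sign[OF x(1)]]) auto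
      ultimately show ?thesis by simp
    qed
    have inj: "inj_on f J"
    proof (rule linorder_inj_onI)
      fix u v assume "u < v" "u \<in> J" "v \<in> J"
      then obtain x where x: "x \<in> J" "f v - f u = (v - u) / h x" using mvt by blast
      then show "f u \<noteq> f v" using h_nz[OF x(1)] \<open>u < v\<close> by auto
    qed (auto simp: J_def)
    have cont_f: "continuous_on J f" by (rule DERIV_continuous_on[OF f'])
    define g where "g = inv_into J f"
    have gf: "g (f u) = u" if "u \<in> J" for u using inj that by (simp add: g_def)
    have cont_g: "continuous_on (f ` J) g"
      by (rule continuous_on_inv[OF cont_f]) (auto simp: J_def gf[unfolded J_def])
    \<comment> \<open>Which end is reached forward in time depends on the sign of
      \<open>h y0\<close>; a symmetric range of times serves both cases.\<close>
    define m where "m = min \<bar>f (y0 - r)\<bar> \<bar>f (y0 + r)\<bar>"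
    have ends: "0 < f (y0 + r) * h y0" "f (y0 - r) * h y0 < 0"
      using f_sign[OF y0J(3)] f_sign[OF y0J(2)] r(1) by (auto simp: mult.assoc zero_less_mult_iff mult_less_0_iff)
    then have "0 < m" by (auto simp: m_def)
    have img: "{-m..m} \<subseteq> f ` J"
    proof
      fix t assume t: "t \<in> {-m..m}"
      have "(f (y0 - r) \<le> t \<and> t \<le> f (y0 + r)) \<or> (f (y0 + r) \<le> t \<and> t \<le> f (y0 - r))"
        using ends t by (cases "0 < h y0") (auto simp: m_def zero_less_mult_iff mult_less_0_iff abs_if split: if_splits)
      then have "\<exists>x. y0 - r \<le> x \<and> x \<le> y0 + r \<and> f x = t"
        using IVT'[of f "y0 - r" t "y0 + r"] IVT2'[of f "y0 + r" t "y0 - r"] cont_f r(1) by (auto simp: J_def)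
      then show "t \<in> f ` J" by (auto simp: J_def)
    qed
    have fg: "f (g t) = t" "g t \<in> J" if "t \<in> {-m..m}" for t
      using img that by (auto simp: g_def f_inv_into_f inv_into_into subset_iff)
    have g': "(g has_real_derivative h (g t)) (at t)" if t: "t \<in> {-m<..<m}" for t
    proof -
      have "isCont g t"
        using continuous_on_interior[OF continuous_on_subset[OF cont_g img], of t] t by simp
      have tI: "t \<in> {-m..m}" using t by auto
      have "g t \<noteq> y0 - r" "g t \<noteq> y0 + r"
        using fg(1)[OF tI] t by (auto simp: m_def min_def abs_if split: if_splits)
      then have "g t \<in> {y0 - r<..<y0 + r}" using fg(2)[OF tI] by (auto simp: J_def)
      then have "(f has_real_derivative 1 / h (g t)) (at (g t))"
        using f'[OF fg(2)[OF tI]] by (simp add: J_def at_within_Icc_at)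
      then have "(g has_real_derivative inverse (1 / h (g t))) (at t)"
        using h_nz[OF fg(2)[OF tI]] t fg(1) \<open>isCont g t\<close>
        by (intro DERIV_inverse_function[where a = "-m" and b = m and f = f]) auto
      then show ?thesis by simp
    qed
    \<comment> \<open>Only a start at zero could lead below it, but there \<open>h y0 = c\<close> is
      positive, so the solution moves upwards.\<close>
    have g_nn: "0 \<le> g t" if t: "t \<in> {0..m / 2}" for t
    proof (rule ccontr)
      assume neg: "\<not> 0 \<le> g t"
      have tm: "t \<in> {-m..m}" using t \<open>0 < m\<close> by auto
      have "y0 = 0" using fg(2)[OF tm] neg r(3) by (cases "y0 = 0") (auto simp: J_def)
      then have "0 < h y0" using False class_K_inf_zero[OF \<sigma>] \<open>0 \<le> c\<close> by (simp add: h_def)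
      then have "0 < f (g t) * g t" using f_sign[OF fg(2)[OF tm]] neg \<open>y0 = 0\<close> by (simp add: zero_less_mult_iff)
      then show False using fg(1)[OF tm] t neg by (simp add: zero_less_mult_iff)
    qed
    have gh: "h (g t) = c - \<sigma> (g t)" if "t \<in> {0..m / 2}" for t using g_nn[OF that] by (simp add: h_def)
    have "compact (h ` J)" using cont_h by (intro compact_continuous_image) (auto simp: J_def intro: continuous_on_subset)
    then obtain B where B: "\<And>u. u \<in> J \<Longrightarrow> \<bar>h u\<bar> \<le> B" using compact_imp_bounded bounded_real by (metis imageI)
    have "\<bar>g s - g t\<bar> \<le> B * \<bar>s - t\<bar>" if "s \<in> {0..m / 2}" "t \<in> {0..m / 2}" for s t
      using field_differentiable_bound[of "{-m<..<m}" g "\<lambda>t. h (g t)" B s t] that g' B[OF fg(2)] \<open>0 < m\<close>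
      by (auto simp: abs_minus_commute has_field_derivative_at_within)
    moreover have "0 \<le> B" using B[OF y0J(1)] by linarith
    ultimately have "abs_cont_on g {0..m / 2}"
      by (intro abs_cont_on_lipschitz[of B]) (auto simp: lipschitz_on_def dist_real_def)
    moreover have "g 0 = y0" using gf[OF y0J(1)] by (simp add: f0)
    ultimately show ?thesis
      using g_nn gh g' \<open>0 < m\<close> by (intro exI[of _ "m / 2"] conjI exI[of _ g]) (auto simp flip: gh)
  qed
qed

lemma slice_Un: "slice (E \<union> I \<times> {k}) i = (if i = k then slice E i \<union> I else slice E i)"
  by (auto simp: slice_def)

text \<open>A hybrid time domain in the sense of the definition can branch: apart from one slice that goes
  on, it may contain points \<open>(t, k)\<close> of further slices at a single instant \<open>t\<close>.  So the slice to
  be extended need not be the last one.\<close>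

lemma extension_hybrid_time_domain:
  assumes E: "hybrid_time_domain E" and ne: "slice E k \<noteq> {}"
    and later: "\<And>s t i. s \<in> I \<Longrightarrow> (t, i) \<in> E \<Longrightarrow> t < s"
    and un: "slice E k \<union> I = {a..b}"
  shows "hybrid_time_domain (E \<union> I \<times> {k})"
proof -
  obtain x0 where x0: "(x0, k) \<in> E" using ne by (auto simp: slice_def)
  then have "x0 \<in> {a..b}" using un by (auto simp: slice_def)
  then have "a \<in> slice E k \<union> I" using un by auto
  then have aE: "(a, k) \<in> E" using later[OF _ x0, of a] \<open>x0 \<in> {a..b}\<close> by (auto simp: slice_def)
  have Epos: "0 \<le> t" if "(t, i) \<in> E" for t i using E that by (auto simp: hybrid_time_domain_def)
  have Ipos: "0 \<le> s" if "s \<in> I" for s using later[OF that aE] Epos[OF aE] by simp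
  have "compact_hybrid_time_domain ((E \<union> I \<times> {k}) \<inter> ({0..T} \<times> {0..J}))" if "(T, J) \<in> E \<union> I \<times> {k}" for T J
  proof (cases "(T, J) \<in> E")
    case True
    then have "(E \<union> I \<times> {k}) \<inter> ({0..T} \<times> {0..J}) = E \<inter> ({0..T} \<times> {0..J})"
      using later by fastforce
    then show ?thesis using E True by (auto simp: hybrid_time_domain_def)
  next
    case False
    then have TI: "T \<in> I" "J = k" using that by auto
    then have Tb: "a \<le> T" "T \<le> b" using un by auto
    obtain t where t: "t 0 = 0" "\<And>j. j \<le> k \<Longrightarrow> t j \<le> t (Suc j)" "t (Suc k) = a"
      and Ea: "E \<inter> ({0..a} \<times> {0..k}) = (\<Union>j\<le>k. {t j..t (Suc j)} \<times> {j})"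
      by (rule hybrid_time_domain_prefix[OF E aE]) (rule that)
    have tk: "t k = a"
    proof -
      have "t k \<le> a" using t(2)[of k] t(3) by simp
      then have "(t k, k) \<in> E \<inter> ({0..a} \<times> {0..k})" using t(2)[of k] by (subst Ea) auto
      then have "t k \<in> slice E k \<union> I" by (simp add: slice_def)
      then have "t k \<in> {a..b}" by (simp only: un)
      then show ?thesis using \<open>t k \<le> a\<close> by simp
    qed
    have early: "x \<le> a" if "(x, i) \<in> E" "i < k" for x i
    proof (rule ccontr)
      assume "\<not> x \<le> a"
      moreover have "x < T" using later[OF TI(1) that(1)] .
      ultimately have "x \<in> {a..b}" using Tb by auto
      then have "x \<in> slice E k \<union> I" by (simp only: un)
      moreover have "x \<notin> I" using later[OF _ that(1)] by auto
      ultimately have xE: "(x, k) \<in> E" by (simp add: slice_def)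
      obtain u where u: "u 0 = 0" "\<And>j. j \<le> k \<Longrightarrow> u j \<le> u (Suc j)" "u (Suc k) = x"
        and Ex: "E \<inter> ({0..x} \<times> {0..k}) = (\<Union>j\<le>k. {u j..u (Suc j)} \<times> {j})"
        by (rule hybrid_time_domain_prefix[OF E xE]) (rule that)
      have "(a, k) \<in> E \<inter> ({0..x} \<times> {0..k})" "(x, i) \<in> E \<inter> ({0..x} \<times> {0..k})"
        using aE Epos[OF aE] Epos[OF that(1)] \<open>\<not> x \<le> a\<close> that by auto
      then have "u k \<le> a" "x \<le> u (Suc i)" unfolding Ex by auto
      moreover have "u (Suc i) \<le> u k"
        using \<open>i < k\<close> u(2) by (intro inc_induct[of "Suc i" k "\<lambda>n. u n \<le> u k"]) (auto intro: order_trans[OF u(2)])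
      ultimately show False using \<open>\<not> x \<le> a\<close> by linarith
    qed
    define t' where "t' = t(Suc k := T)"
    have "(E \<union> I \<times> {k}) \<inter> ({0..T} \<times> {0..J}) = (\<Union>j<Suc k. {t' j..t' (Suc j)} \<times> {j})"
    proof (intro equalityI subsetI)
      fix p assume p: "p \<in> (E \<union> I \<times> {k}) \<inter> ({0..T} \<times> {0..J})"
      obtain x i where xi: "p = (x, i)" by fastforce
      show "p \<in> (\<Union>j<Suc k. {t' j..t' (Suc j)} \<times> {j})"
      proof (cases "i = k")
        case True
        then have "x \<in> {a..b}" using p un xi by (auto simp: slice_def)
        then show ?thesis using p xi True tk by (auto simp: t'_def)
      next
        case False
        then have "(x, i) \<in> E" "i < k" using p xi TI by auto
        then have "(x, i) \<in> E \<inter> ({0..a} \<times> {0..k})" using early Epos by auto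
        then have "x \<in> {t i..t (Suc i)}" unfolding Ea by auto
        then show ?thesis using \<open>i < k\<close> xi by (auto simp: t'_def)
      qed
    next
      fix p assume "p \<in> (\<Union>j<Suc k. {t' j..t' (Suc j)} \<times> {j})"
      then obtain x i where xi: "p = (x, i)" "i \<le> k" "x \<in> {t' i..t' (Suc i)}" by auto
      show "p \<in> (E \<union> I \<times> {k}) \<inter> ({0..T} \<times> {0..J})"
      proof (cases "i = k")
        case True
        then have "x \<in> {a..T}" using xi tk by (auto simp: t'_def)
        moreover from this have "x \<in> slice E k \<union> I" using un Tb by auto
        ultimately show ?thesis using xi True TI Epos[OF aE] by (auto simp: slice_def)
      next
        case False
        then have "(x, i) \<in> (\<Union>j\<le>k. {t j..t (Suc j)} \<times> {j})" using xi by (auto simp: t'_def)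
        then have "(x, i) \<in> E \<inter> ({0..a} \<times> {0..k})" by (simp only: Ea)
        then show ?thesis using xi(1) Tb TI by auto
      qed
    qed
    moreover have "t' 0 = 0" "\<forall>j<Suc k. t' j \<le> t' (Suc j)"
      using t(1,2) tk Tb by (auto simp: t'_def less_Suc_eq)
    ultimately show ?thesis unfolding compact_hybrid_time_domain_def by blast
  qed
  moreover have "E \<union> I \<times> {k} \<noteq> {}" using x0 by auto
  moreover have "E \<union> I \<times> {k} \<subseteq> {0..} \<times> UNIV" using Epos Ipos by auto
  ultimately show ?thesis by (auto simp: hybrid_time_domain_def)
qed

text \<open>The added points are later than the whole domain and lie in one slice, so they create no
  new jump. A singleton \<open>I\<close> adds a missing end point; a half-open interval prolongs an
  attained one.\<close>

lemma extension_not_maximal: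
  fixes \<H> :: "('x::real_normed_vector, 'u::euclidean_space) hybrid_system"
  assumes sol: "solution_pair \<H> E \<xi> \<nu>" and ne: "slice E k \<noteq> {}" "I \<noteq> {}"
    and later: "\<And>s t i. s \<in> I \<Longrightarrow> (t, i) \<in> E \<Longrightarrow> t < s"
    and un: "slice E k \<union> I = {a..b}"
    and X: "\<And>t. t \<in> slice E k \<Longrightarrow> X t = \<xi> t k" "abs_cont_on X {a..b}" "\<And>t. t \<in> {a<..<b} \<Longrightarrow> X t \<in> flow_set \<H>"
    and U: "\<And>t. t \<in> slice E k \<Longrightarrow> U t = \<nu> t k" "U \<in> borel_measurable (lebesgue_on {a..b})"
      "AE t in lebesgue. t \<in> {a..b} \<longrightarrow> norm (U t) \<le> c"
    and flow: "AE t in lebesgue. t \<in> {a<..<b} \<longrightarrow>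
      (\<exists>d\<in>flow_map \<H> (X t) (U t). (X has_vector_derivative d) (at t))"
  shows "\<not> maximal_solution_pair \<H> E \<xi> \<nu>"
proof -
  define E' where "E' = E \<union> I \<times> {k}"
  define \<xi>' where "\<xi>' t i = (if i = k then X t else \<xi> t i)" for t i
  define \<nu>' where "\<nu>' t i = (if i = k then U t else \<nu> t i)" for t i
  have E: "hybrid_time_domain E" using sol by (simp add: solution_pair_def hybrid_arc_def)
  have dom: "hybrid_time_domain E'" unfolding E'_def by (rule extension_hybrid_time_domain[OF E ne(1) later un])
  have slice_k: "slice E' k = {a..b}" using un by (simp add: E'_def slice_Un)
  have slice_i: "slice E' i = slice E i" if "i \<noteq> k" for i using that by (simp add: E'_def slice_Un)
  have agree: "\<xi>' t i = \<xi> t i" "\<nu>' t i = \<nu> t i" if "(t, i) \<in> E" for t i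
    using that X(1) U(1) by (auto simp: \<xi>'_def \<nu>'_def slice_def)
  have jumps: "jump_times E' = jump_times E"
    using later by (auto simp: jump_times_def E'_def)
  have arc: "hybrid_arc E' \<xi>'"
    unfolding hybrid_arc_def
  proof (intro conjI dom allI)
    fix i
    show "locally_abs_cont_on (\<lambda>t. \<xi>' t i) (slice E' i)"
    proof (cases "i = k")
      case True
      then show ?thesis
        using abs_cont_on_subset[OF X(2)] by (simp add: slice_k locally_abs_cont_on_def \<xi>'_def)
    next
      case False
      then show ?thesis using sol by (simp add: slice_i \<xi>'_def solution_pair_def hybrid_arc_def)
    qed
  qed
  have inp: "hybrid_input E' \<nu>'"
    unfolding hybrid_input_def
  proof (intro conjI dom allI impI)
    fix i
    show "(\<lambda>t. \<nu>' t i) \<in> borel_measurable (lebesgue_on (slice E' i))"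
    proof (cases "i = k")
      case True
      then show ?thesis using U(2) by (simp add: slice_k \<nu>'_def)
    next
      case False
      then show ?thesis using sol by (simp add: slice_i \<nu>'_def solution_pair_def hybrid_input_def)
    qed
    fix a' b' assume sub: "{a'..b'} \<subseteq> slice E' i"
    show "\<exists>c. AE t in lebesgue. t \<in> {a'..b'} \<longrightarrow> norm (\<nu>' t i) \<le> c"
    proof (cases "i = k")
      case True
      have "AE t in lebesgue. t \<in> {a'..b'} \<longrightarrow> norm (\<nu>' t i) \<le> c"
        using U(3) by eventually_elim (use sub True in \<open>auto simp: slice_k \<nu>'_def\<close>)
      then show ?thesis by blast
    next
      case False
      then show ?thesis using sol sub by (simp add: slice_i \<nu>'_def solution_pair_def hybrid_input_def)
    qed
  qed
  have "solution_pair \<H> E' \<xi>' \<nu>'"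
    unfolding solution_pair_def
  proof (intro conjI arc inp allI ballI)
    show "\<xi>' 0 0 \<in> closure (flow_set \<H>) \<union> jump_set \<H>"
      using sol agree[OF hybrid_time_domain_0[OF E]] by (simp add: solution_pair_def)
  next
    fix i t assume t: "t \<in> interior (slice E' i)"
    show "\<xi>' t i \<in> flow_set \<H>"
    proof (cases "i = k")
      case True
      then show ?thesis using t X(3) by (simp add: slice_k \<xi>'_def)
    next
      case False
      then show ?thesis using t sol by (simp add: slice_i \<xi>'_def solution_pair_def)
    qed
  next
    fix i
    show "AE t in lebesgue. t \<in> slice E' i \<longrightarrow>
             (\<exists>d \<in> flow_map \<H> (\<xi>' t i) (\<nu>' t i).
                ((\<lambda>s. \<xi>' s i) has_vector_derivative d) (at t within slice E' i))"
    proof (cases "i = k")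
      case True
      have "AE t in lebesgue. t \<notin> {a, b}"
        by (intro AE_not_in) (auto simp: negligible_iff_null_sets[symmetric])
      with flow show ?thesis
      proof eventually_elim
        case (elim t)
        then show ?case using True
          by (auto simp: slice_k \<xi>'_def \<nu>'_def intro: has_vector_derivative_at_within)
      qed
    next
      case False
      then show ?thesis using sol by (simp add: slice_i \<xi>'_def \<nu>'_def solution_pair_def)
    qed
  next
    fix p assume p: "p \<in> jump_times E'"
    obtain t i where ti: "p = (t, i)" by fastforce
    then have "(t, i) \<in> E" "(t, Suc i) \<in> E" "(t, i) \<in> jump_times E" using p unfolding jumps by (auto simp: jump_times_def)
    then show "case p of (t, j) \<Rightarrow> \<xi>' t j \<in> jump_set \<H> \<and> \<xi>' t (Suc j) \<in> jump_map \<H> (\<xi>' t j) (\<nu>' t j)"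
      using sol agree ti by (auto simp: solution_pair_def)
  qed
  moreover have "E \<subset> E'" using ne(2) later by (auto simp: E'_def)
  moreover have "\<forall>(t, j)\<in>E. \<xi>' t j = \<xi> t j \<and> \<nu>' t j = \<nu> t j" using agree by auto
  ultimately have "\<exists>E' \<xi>' \<nu>'. solution_pair \<H> E' \<xi>' \<nu>' \<and> E \<subset> E' \<and>
      (\<forall>(t, j)\<in>E. \<xi>' t j = \<xi> t j \<and> \<nu>' t j = \<nu> t j)"
    by (intro exI conjI)
  then show ?thesis by (simp only: maximal_solution_pair_def not_not simp_thms)
qed

section \<open>Shifting and comparing Caratheodory solutions\<close>

lemma norm_fst_diff_le: "norm (fst x - fst y) \<le> norm (x - y)"
  by (metis dist_fst_le dist_norm)

lemma norm_snd_diff_le: "norm (snd x - snd y) \<le> norm (x - y)"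
  by (metis dist_snd_le dist_norm)

lemma has_vector_derivative_compose_differentiable:
  assumes "(f has_vector_derivative d) (at t)" "(F has_derivative F') (at (f t))"
  shows "((\<lambda>s. F (f s)) has_vector_derivative F' d) (at t)"
proof -
  have "((\<lambda>s. F (f s)) has_derivative (\<lambda>h. F' (h *\<^sub>R d))) (at t)"
    using has_derivative_compose[OF assms(1)[unfolded has_vector_derivative_def] assms(2)] .
  moreover have "linear F'" using assms(2) by (rule has_derivative_linear)
  ultimately show ?thesis by (simp add: has_vector_derivative_def linear_cmul)
qed

lemma ae_shift:
  assumes "AE t in lebesgue. P (t :: real)"
  shows "AE t in lebesgue. P (t + a)"
proof -
  obtain N where N: "N \<in> null_sets lebesgue" "\<And>t. t \<in> space lebesgue - N \<Longrightarrow> P t"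
    using assms by (rule AE_E3) (rule that)
  have "(\<lambda>t. - a + t) ` N \<in> null_sets lebesgue"
    using N(1) negligible_translation[of N "- a"] by (simp add: negligible_iff_null_sets)
  then have "AE t in lebesgue. t \<notin> (\<lambda>t. - a + t) ` N" by (rule AE_not_in)
  then show ?thesis
  proof eventually_elim
    case (elim t)
    then have "t + a \<notin> N" by (force simp: image_iff)
    then show ?case using N(2) by auto
  qed
qed

text \<open>Forward completeness speaks of signals on the whole half-line; a signal on
  \<open>{a..<R}\<close> is moved to start at 0 and continued by zero.\<close>

lemma measurable_shift:
  fixes f :: "real \<Rightarrow> 'a::euclidean_space"
  assumes "f \<in> borel_measurable (lebesgue_on {a..<R})"
  shows "(\<lambda>s. if s < R - a then f (s + a) else 0) \<in> borel_measurable (lebesgue_on {0..})"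
proof -
  define g where "g t = (if t \<in> {a..<R} then f t else 0)" for t
  have g: "g \<in> borel_measurable lebesgue"
    unfolding g_def using assms by (subst borel_measurable_if) auto
  have "(\<lambda>s. s + a) \<in> lebesgue \<rightarrow>\<^sub>M lebesgue"
  proof (rule measurableI)
    fix A :: "real set" assume "A \<in> sets lebesgue"
    then have "(+) (- a) ` A \<in> sets lebesgue" by (rule lebesgue_sets_translation)
    moreover have "(\<lambda>s. s + a) -` A = (+) (- a) ` A"
      by (auto simp: image_iff) (metis add.commute add_diff_cancel)
    ultimately show "(\<lambda>s. s + a) -` A \<inter> space lebesgue \<in> sets lebesgue" by simp
  qed simp
  from measurable_compose[OF this g] have "(\<lambda>s. g (s + a)) \<in> borel_measurable (lebesgue_on {0..})"
    by (rule measurable_restrict_space1)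
  moreover have "(\<lambda>s. g (s + a)) \<in> borel_measurable (lebesgue_on {0..}) \<longleftrightarrow>
      (\<lambda>s. if s < R - a then f (s + a) else 0) \<in> borel_measurable (lebesgue_on {0..})"
    by (rule measurable_cong) (auto simp: g_def)
  ultimately show ?thesis by simp
qed

text \<open>The uniqueness clause in the form that slices of a solution deliver: absolute continuity
  on compact initial intervals and two-sided derivatives in the open interval.\<close>

lemma unique_global_solutionE:
  fixes f :: "real \<Rightarrow> 'a::real_normed_vector \<Rightarrow> 'a"
  assumes "unique_global_solution f x0"
  obtains x where "x 0 = x0" "\<And>b. abs_cont_on x {0..b}"
    "AE t in lebesgue. 0 < t \<longrightarrow> (x has_vector_derivative f t (x t)) (at t)"
    "\<And>T y t. \<lbrakk>y 0 = x0; \<And>c. c < T \<Longrightarrow> abs_cont_on y {0..c};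
       AE t in lebesgue. t \<in> {0<..<T} \<longrightarrow> (y has_vector_derivative f t (y t)) (at t); 0 \<le> t; t < T\<rbrakk>
       \<Longrightarrow> y t = x t"
proof -
  obtain x where x: "ode_solution f {0..} x" "x 0 = x0"
    "\<forall>T>0. \<forall>y. ode_solution f {0..<T} y \<and> y 0 = x0 \<longrightarrow> (\<forall>t\<in>{0..<T}. y t = x t)"
    using assms unfolding unique_global_solution_def by (elim exE conjE) (rule that)
  show ?thesis
  proof (rule that[of x])
    show "x 0 = x0" by (rule x)
    show "abs_cont_on x {0..b}" for b
      using x(1) by (auto simp: ode_solution_def locally_abs_cont_on_def)
    have "AE t in lebesgue. t \<in> {0..} \<longrightarrow> (x has_vector_derivative f t (x t)) (at t within {0..})"
      using x(1) by (simp add: ode_solution_def)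
    then show "AE t in lebesgue. 0 < t \<longrightarrow> (x has_vector_derivative f t (x t)) (at t)"
    proof eventually_elim
      case (elim t)
      have "at t within {0..} = at t" if "0 < t"
        using that by (intro at_within_open_subset[of t "{0<..}" "{0..}"]) auto
      then show ?case using elim by auto
    qed
    fix T y t
    assume y: "y 0 = x0" "\<And>c. c < T \<Longrightarrow> abs_cont_on y {0..c}" "0 \<le> t" "t < T"
      and ae: "AE t in lebesgue. t \<in> {0<..<T} \<longrightarrow> (y has_vector_derivative f t (y t)) (at t)"
    have "locally_abs_cont_on y {0..<T}"
      unfolding locally_abs_cont_on_def
    proof (intro allI impI)
      fix a b assume ab: "{a..b} \<subseteq> {0..<T}"
      show "abs_cont_on y {a..b}"
      proof (cases "a \<le> b")
        case True
        then have "0 \<le> a" "b < T" using ab by auto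
        then show ?thesis by (intro abs_cont_on_subset[OF y(2)[of b]]) auto
      next
        case False
        then show ?thesis by (intro abs_cont_on_subset[OF y(2)[of t]] y) auto
      qed
    qed
    moreover have "AE t in lebesgue. t \<notin> {0}" by (intro AE_not_in) (simp add: negligible_iff_null_sets[symmetric])
    with ae have "AE t in lebesgue. t \<in> {0..<T} \<longrightarrow> (y has_vector_derivative f t (y t)) (at t within {0..<T})"
      by eventually_elim (auto intro: has_vector_derivative_at_within)
    ultimately have "ode_solution f {0..<T} y" by (simp add: ode_solution_def)
    moreover have "0 < T" "t \<in> {0..<T}" using y(3,4) by auto
    ultimately show "y t = x t" using x(3) y(1) by blast
  qed
qed

lemma continuous_on_atLeast_0:
  fixes f :: "real \<Rightarrow> 'a::topological_space"
  assumes "\<And>b. continuous_on {0..b} f"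
  shows "continuous_on {0..} f"
  unfolding continuous_on_eq_continuous_within
proof
  fix t :: real assume t: "t \<in> {0..}"
  have "continuous (at t within {0..t + 1}) f"
    using assms[of "t + 1"] t by (auto simp: continuous_on_eq_continuous_within)
  moreover have "at t within {0..} = at t within {0..t + 1}"
    by (rule at_within_nhd[of t "{..<t + 1}"]) auto
  ultimately show "continuous (at t within {0..}) f" by simp
qed

lemma bounded_on_Icc:
  fixes f :: "real \<Rightarrow> 'a::real_normed_vector"
  assumes "continuous_on {a..b} f"
  obtains K where "0 \<le> K" "\<And>t. t \<in> {a..b} \<Longrightarrow> norm (f t) \<le> K"
proof -
  have "bounded (f ` {a..b})" using assms by (intro compact_imp_bounded compact_continuous_image) auto
  then obtain K where "0 < K" "\<forall>x\<in>f ` {a..b}. norm x \<le> K" by (auto simp: bounded_pos)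
  then show ?thesis using that[of K] by auto
qed

context estimator
begin

text \<open>By \<open>open_loop\<close> the derivative of \<open>ho S (z t)\<close> does not depend
  on \<open>fo\<close> or \<open>y\<close>, hence is bounded on compact intervals; calmness of
  \<open>ho\<close> upgrades this to a Lipschitz bound, which the chain rule almost everywhere alone
  would not give.\<close>

lemma ho_curve:
  assumes z: "abs_cont_on z {a..b}"
    and drv: "AE t in lebesgue. t \<in> {a<..<b} \<longrightarrow> (z has_vector_derivative fo S (z t) (y t)) (at t)"
  shows "abs_cont_on (\<lambda>t. ho S (z t)) {a..b}"
    "AE t in lebesgue. t \<in> {a<..<b} \<longrightarrow> ((\<lambda>t. ho S (z t)) has_vector_derivative fp S (ho S (z t)) 0) (at t)"
proof -
  show ae: "AE t in lebesgue. t \<in> {a<..<b} \<longrightarrow> ((\<lambda>t. ho S (z t)) has_vector_derivative fp S (ho S (z t)) 0) (at t)"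
    using drv by eventually_elim
      (use has_vector_derivative_compose_differentiable[OF _ ho_derivative] in \<open>fastforce simp: open_loop\<close>)
  have "continuous_on {a..b} z" using z by (rule abs_cont_on_imp_continuous_on) simp
  then have "continuous_on {a..b} (\<lambda>t. fp S (ho S (z t)) 0)"
    by (intro continuous_on_fp continuous_on_ho continuous_on_const)
  then obtain K where K: "0 \<le> K" "\<And>t. t \<in> {a..b} \<Longrightarrow> norm (fp S (ho S (z t)) 0) \<le> K" by (rule bounded_on_Icc) (rule that)
  have "K-lipschitz_on {a..b} (\<lambda>t. ho S (z t))"
  proof (rule lipschitz_on_curve[OF z K(1) calm_at_has_derivative[OF ho_derivative]])
    show "AE t in lebesgue. t \<in> {a<..<b} \<longrightarrow>
      (\<exists>D. ((\<lambda>s. ho S (z s)) has_vector_derivative D) (at t) \<and> norm D \<le> K)"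
      using ae by eventually_elim (use K(2) in force)
  qed
  then show "abs_cont_on (\<lambda>t. ho S (z t)) {a..b}" by (rule abs_cont_on_lipschitz)
qed

text \<open>The Lie derivative of the whole output along the plant; \<open>g_all\<close> is its
  difference between the estimate and the true state.\<close>

definition hp_rate :: "real^'n \<Rightarrow> real^'p \<Rightarrow> real^'m" where
  "hp_rate x v = (\<Sum>i\<in>UNIV. frechet_derivative (hpi S i) (at x) (fp S x v))"

lemma continuous_on_hp_rate:
  "continuous_on U a \<Longrightarrow> continuous_on U b \<Longrightarrow> continuous_on U (\<lambda>u. hp_rate (a u) (b u))"
  unfolding hp_rate_def
  by (intro continuous_on_sum continuous_on_frechet_derivative hpi_cont_differentiable continuous_on_fp)

lemma g_all_hp_rate: "g_all S z e v = hp_rate (ho S z) 0 - hp_rate (ho S z - e) v"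
  by (simp add: g_all_sum g_i_def hp_rate_def sum_subtractf)

lemma hp_curve:
  assumes x: "abs_cont_on x {a..b}"
    and drv: "AE t in lebesgue. t \<in> {a<..<b} \<longrightarrow> (x has_vector_derivative fp S (x t) 0) (at t)"
  shows "abs_cont_on (\<lambda>t. hp S (x t)) {a..b}"
    "AE t in lebesgue. t \<in> {a<..<b} \<longrightarrow> ((\<lambda>t. hp S (x t)) has_vector_derivative hp_rate (x t) 0) (at t)"
proof -
  show ae: "AE t in lebesgue. t \<in> {a<..<b} \<longrightarrow> ((\<lambda>t. hp S (x t)) has_vector_derivative hp_rate (x t) 0) (at t)"
    using drv by eventually_elim
      (use has_vector_derivative_compose_differentiable[OF _ hp_derivative] in \<open>fastforce simp: hp_rate_def\<close>)
  have "continuous_on {a..b} x" using x by (rule abs_cont_on_imp_continuous_on) simp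
  then have "continuous_on {a..b} (\<lambda>t. hp_rate (x t) 0)"
    by (intro continuous_on_hp_rate continuous_on_const)
  then obtain K where K: "0 \<le> K" "\<And>t. t \<in> {a..b} \<Longrightarrow> norm (hp_rate (x t) 0) \<le> K" by (rule bounded_on_Icc) (rule that)
  have "K-lipschitz_on {a..b} (\<lambda>t. hp S (x t))"
  proof (rule lipschitz_on_curve[OF x K(1) calm_at_has_derivative[OF hp_derivative]])
    show "AE t in lebesgue. t \<in> {a<..<b} \<longrightarrow>
      (\<exists>D. ((\<lambda>s. hp S (x s)) has_vector_derivative D) (at t) \<and> norm D \<le> K)"
      using ae by eventually_elim (use K(2) in force)
  qed
  then show "abs_cont_on (\<lambda>t. hp S (x t)) {a..b}" by (rule abs_cont_on_lipschitz)
qed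

lemma plant_unique:
  assumes "v \<in> borel_measurable (lebesgue_on {0..})" "AE t in lebesgue. t \<in> {0..} \<longrightarrow> norm (v t) \<le> c"
  shows "unique_global_solution (\<lambda>t x. fp S x (v t)) x0"
  using plant assms unfolding plant_assms_def by blast

lemma observer_unique:
  assumes "y \<in> borel_measurable (lebesgue_on {0..})"
  shows "unique_global_solution (\<lambda>t z. fo S z (y t)) z0"
  using observer assms unfolding observer_assms_def by blast

lemma plant_unique_0: "unique_global_solution (\<lambda>t x. fp S x 0) x0"
  by (rule plant_unique[of "\<lambda>_. 0" 0]) auto

text \<open>Since the estimate \<open>h\<^sub>o(z)\<close> evolves like the undisturbed plant, so does the held output; with
  \<open>v = 0\<close> and \<open>w = \<epsilon> + wh\<close> the trigger sees no error and its input \<open>q\<close> is constant.\<close>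

lemma flow_exists:
  assumes \<xi>0: "\<xi>0 \<in> (state_space :: ('n, 'q, 'm, 'N) state set)"
  obtains \<delta> X U where "0 < \<delta>" "X 0 = \<xi>0" "abs_cont_on X {0..\<delta>}" "\<And>t. t \<in> {0..\<delta>} \<Longrightarrow> X t \<in> state_space"
    "continuous_on {0..\<delta>} U"
    "AE t in lebesgue. t \<in> {0<..<\<delta>} \<longrightarrow> (\<exists>d\<in>flow_F S (X t) (U t). (X has_vector_derivative d) (at t))"
proof -
  obtain z0 e0 \<epsilon>0 wh0 \<tau>0 \<eta>0 where eq: "\<xi>0 = (z0, e0, \<epsilon>0, wh0, \<tau>0, \<eta>0)" by (metis prod.exhaust)
  have nn: "\<And>i. 0 \<le> \<tau>0 $ i" "\<And>i. 0 \<le> \<eta>0 $ i" using \<xi>0 by (auto simp: eq state_space_def)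
  define c0 where "c0 = ho S z0"
  \<comment> \<open>The initial argument of the \<open>rho\<close> terms for the noise w =
    \<epsilon> + wh; the flow constructed below keeps it constant.\<close>
  define q0 where "q0 = hp S c0 - (hp S (c0 - e0) + \<epsilon>0 + wh0)"
  obtain C where C: "C 0 = c0" "\<And>b. abs_cont_on C {0..b}"
    "AE t in lebesgue. 0 < t \<longrightarrow> (C has_vector_derivative fp S (C t) 0) (at t)"
    and C_unique: "\<And>T y t. \<lbrakk>y 0 = c0; \<And>c. c < T \<Longrightarrow> abs_cont_on y {0..c};
       AE t in lebesgue. t \<in> {0<..<T} \<longrightarrow> (y has_vector_derivative fp S (y t) 0) (at t); 0 \<le> t; t < T\<rbrakk>
       \<Longrightarrow> y t = C t"
    by (rule unique_global_solutionE[OF plant_unique_0[of c0]]) blast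
  obtain P where P: "P 0 = c0 - e0" "\<And>b. abs_cont_on P {0..b}"
    "AE t in lebesgue. 0 < t \<longrightarrow> (P has_vector_derivative fp S (P t) 0) (at t)"
    by (rule unique_global_solutionE[OF plant_unique_0[of "c0 - e0"]]) (rule that)
  have cont_C: "continuous_on {0..} C" and cont_P: "continuous_on {0..} P"
    by (intro continuous_on_atLeast_0 abs_cont_on_imp_continuous_on[OF C(2)] abs_cont_on_imp_continuous_on[OF P(2)]; simp)+
  \<comment> \<open>The output that the observer is to receive, prescribed in advance. It moves with
    the output of the estimate, as a held prediction should.\<close>
  define y where "y t = hp S (C t) - q0" for t
  have cont_y: "continuous_on {0..} y"
    unfolding y_def by (intro continuous_intros continuous_on_hp cont_C)
  then have "y \<in> borel_measurable (lebesgue_on {0..})"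
    by (rule continuous_imp_measurable_on_sets_lebesgue) simp
  then obtain Z where Z: "Z 0 = z0" "\<And>b. abs_cont_on Z {0..b}"
    "AE t in lebesgue. 0 < t \<longrightarrow> (Z has_vector_derivative fo S (Z t) (y t)) (at t)"
    by (rule unique_global_solutionE[OF observer_unique[of y z0]]) (rule that)
  \<comment> \<open>Both sides solve the undisturbed plant equation from the same initial
    value.\<close>
  have hoZ: "ho S (Z t) = C t" if "0 \<le> t" for t
  proof (rule C_unique[of "\<lambda>t. ho S (Z t)" "t + 1"])
    have drv: "AE t in lebesgue. t \<in> {0<..<b} \<longrightarrow> (Z has_vector_derivative fo S (Z t) (y t)) (at t)" for b
      using Z(3) by eventually_elim auto
    show "abs_cont_on (\<lambda>t. ho S (Z t)) {0..c}" for c by (rule ho_curve(1)[OF Z(2) drv])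
    show "AE s in lebesgue. s \<in> {0<..<t + 1} \<longrightarrow> ((\<lambda>t. ho S (Z t)) has_vector_derivative fp S (ho S (Z s)) 0) (at s)"
      by (rule ho_curve(2)[OF Z(2) drv])
  qed (use that Z(1) in \<open>auto simp: c0_def\<close>)
  have "\<exists>\<delta>>0. \<exists>h. h 0 = \<eta>0 $ i \<and> (\<forall>t\<in>{0..\<delta>}. 0 \<le> h t) \<and> abs_cont_on h {0..\<delta>} \<and>
    (\<forall>t\<in>{0<..<\<delta>}. (h has_real_derivative rho S i (norm (blk S i q0)) + space_reg S i - sig S i (h t)) (at t))" for i
    using rho_nonneg[of i "blk S i q0"] by (intro scalar_decay_ode tuningD(6) nn add_nonneg_nonneg tuningD(7))
  then obtain \<delta>i h where h: "\<And>i. 0 < \<delta>i i" "\<And>i. h i 0 = \<eta>0 $ i" "\<And>i t. t \<in> {0..\<delta>i i} \<Longrightarrow> 0 \<le> h i t"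
    "\<And>i. abs_cont_on (h i) {0..\<delta>i i}"
    "\<And>i t. t \<in> {0<..<\<delta>i i} \<Longrightarrow> (h i has_real_derivative rho S i (norm (blk S i q0)) + space_reg S i - sig S i (h i t)) (at t)"
    by metis
  define \<delta> where "\<delta> = Min (range \<delta>i)"
  have "0 < \<delta>" using h(1) by (auto simp: \<delta>_def)
  have \<delta>_le: "\<delta> \<le> \<delta>i i" for i by (simp add: \<delta>_def)
  define Hv where "Hv t = (\<Sum>i\<in>UNIV. h i t *\<^sub>R (axis i 1 :: real^'N))" for t
  have Hv_nth: "Hv t $ i = h i t" for t i
    by (simp add: Hv_def sum_component axis_def if_distrib cong: if_cong)
  \<comment> \<open>The component \<epsilon> is solved from hp(P) + \<epsilon> + wh = y, so that the
    observer is indeed driven by \<open>y\<close>.\<close>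
  define X where "X t = (Z t, C t - P t, y t - hp S (P t) - wh0, wh0, \<tau>0 + t *\<^sub>R 1, Hv t)" for t
  define U where "U t = (0 :: real^'p, y t - hp S (P t))" for t
  show ?thesis
  proof (rule that[of \<delta> X U])
    show "0 < \<delta>" by fact
    show "X 0 = \<xi>0"
    proof -
      have "Hv 0 = \<eta>0" by (simp add: vec_eq_iff Hv_nth h(2))
      moreover have "y 0 - hp S (P 0) - wh0 = \<epsilon>0" by (simp add: y_def q0_def C(1) P(1))
      ultimately show ?thesis by (simp add: X_def eq C(1) P(1) Z(1))
    qed
    have drvC: "AE t in lebesgue. t \<in> {0<..<\<delta>} \<longrightarrow> (C has_vector_derivative fp S (C t) 0) (at t)"
      using C(3) by eventually_elim auto
    have drvP: "AE t in lebesgue. t \<in> {0<..<\<delta>} \<longrightarrow> (P has_vector_derivative fp S (P t) 0) (at t)"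
      using P(3) by eventually_elim auto
    note hpC = hp_curve[OF C(2) drvC] and hpP = hp_curve[OF P(2) drvP]
    have acH: "abs_cont_on Hv {0..\<delta>}"
      unfolding Hv_def
    proof (intro abs_cont_on_sum)
      fix i
      have "abs_cont_on (h i) {0..\<delta>}" using \<delta>_le[of i] by (intro abs_cont_on_subset[OF h(4)]) auto
      then show "abs_cont_on (\<lambda>t. h i t *\<^sub>R (axis i 1 :: real^'N)) {0..\<delta>}"
        by (rule abs_cont_on_image[where g = "\<lambda>x. x *\<^sub>R (axis i 1 :: real^'N)" and A = 1]) (simp add: scaleR_diff_left[symmetric])
    qed
    have "abs_cont_on (\<lambda>t. t *\<^sub>R (1 :: real^'N)) {0..\<delta>}"
      by (rule abs_cont_on_image[OF abs_cont_on_id, where g = "\<lambda>x. x *\<^sub>R (1 :: real^'N)" and A = "norm (1 :: real^'N)"])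
        (simp add: scaleR_diff_left[symmetric] mult.commute)
    then show "abs_cont_on X {0..\<delta>}"
      unfolding X_def y_def
      by (intro abs_cont_on_Pair Z(2) abs_cont_on_diff C(2) P(2) hpC(1) hpP(1) abs_cont_on_const abs_cont_on_add acH)
    show "X t \<in> state_space" if t: "t \<in> {0..\<delta>}" for t
    proof -
      have "0 \<le> h i t" for i using t \<delta>_le[of i] by (intro h(3)) auto
      then show ?thesis using nn t by (auto simp: X_def state_space_def Hv_nth)
    qed
    show "continuous_on {0..\<delta>} U"
      unfolding U_def
      by (intro continuous_intros continuous_on_hp continuous_on_subset[OF cont_y] continuous_on_subset[OF cont_P]) auto
    show "AE t in lebesgue. t \<in> {0<..<\<delta>} \<longrightarrow> (\<exists>d\<in>flow_F S (X t) (U t). (X has_vector_derivative d) (at t))"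
      using Z(3) drvC drvP hpC(2) hpP(2)
    proof eventually_elim
      case (elim t)
      show ?case
      proof
        assume t: "t \<in> {0<..<\<delta>}"
        then have "0 < t" by simp
        have hoZt: "ho S (Z t) = C t" using hoZ \<open>0 < t\<close> by simp
        define e \<epsilon> w where "e = C t - P t" "\<epsilon> = y t - hp S (P t) - wh0" "w = y t - hp S (P t)"
        note defs = e_\<epsilon>_w_def
        have CP: "ho S (Z t) - e = P t" by (simp add: hoZt defs)
        define \<psi> where "\<psi> = (\<chi> i. rho S i (norm (blk S i q0)) + space_reg S i - sig S i (h i t))"
        define d where "d = (fo S (Z t) (y t), fp S (C t) 0 - fp S (P t) 0, hp_rate (C t) 0 - hp_rate (P t) 0, (0::real^'m), (1::real^'N), \<psi>)"
        have "(Hv has_vector_derivative (\<Sum>i\<in>UNIV. (rho S i (norm (blk S i q0)) + space_reg S i - sig S i (h i t)) *\<^sub>R (axis i 1 :: real^'N))) (at t)"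
          unfolding Hv_def
        proof (intro has_vector_derivative_sum)
          fix i
          have "t \<in> {0<..<\<delta>i i}" using t \<delta>_le[of i] by auto
          from h(5)[OF this] show "((\<lambda>t. h i t *\<^sub>R (axis i 1 :: real^'N)) has_vector_derivative
              (rho S i (norm (blk S i q0)) + space_reg S i - sig S i (h i t)) *\<^sub>R axis i 1) (at t)"
            by (intro bounded_linear.has_vector_derivative[OF bounded_linear_scaleR_left])
              (simp add: has_real_derivative_iff_has_vector_derivative)
        qed
        moreover have "(\<Sum>i\<in>UNIV. (rho S i (norm (blk S i q0)) + space_reg S i - sig S i (h i t)) *\<^sub>R (axis i 1 :: real^'N)) = \<psi>"
          by (simp add: vec_eq_iff \<psi>_def sum_component axis_def if_distrib cong: if_cong)
        ultimately have "(Hv has_vector_derivative \<psi>) (at t)" by simp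
        moreover have "((\<lambda>s. \<tau>0 + s *\<^sub>R 1) has_vector_derivative (1 :: real^'N)) (at t)"
          by (auto intro!: derivative_eq_intros)
        moreover have "((\<lambda>s. y s - hp S (P s) - wh0) has_vector_derivative hp_rate (C t) 0 - hp_rate (P t) 0) (at t)"
          unfolding y_def using elim(4,5) t by (auto intro!: derivative_eq_intros)
        moreover have "((\<lambda>s. C s - P s) has_vector_derivative fp S (C t) 0 - fp S (P t) 0) (at t)"
          using elim(2,3) t by (intro has_vector_derivative_diff) auto
        moreover have "(Z has_vector_derivative fo S (Z t) (y t)) (at t)" using elim(1) \<open>0 < t\<close> by simp
        ultimately have der: "(X has_vector_derivative d) (at t)"
          unfolding X_def d_def by (intro has_vector_derivative_Pair has_vector_derivative_const)
        have q: "q_i S i (Z t) e w = blk S i q0" for i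
          unfolding q_i_def CP by (simp add: hpi_def hoZt blk_diff[symmetric] defs y_def)
        have noerr: "\<epsilon> + wh0 - w = 0" by (simp add: defs)
        have XU: "X t = (Z t, e, \<epsilon>, wh0, \<tau>0 + t *\<^sub>R 1, Hv t)" "U t = (0, w)"
          by (simp_all add: X_def U_def defs)
        have "d \<in> flow_F S (X t) (U t)"
          unfolding XU flow_F_iff
        proof (intro exI[of _ \<psi>] conjI allI)
          have "f_z S (Z t) e \<epsilon> wh0 = fo S (Z t) (y t)" unfolding f_z_def CP by (simp add: defs)
          moreover have "f_e S (Z t) e \<epsilon> wh0 0 = fp S (C t) 0 - fp S (P t) 0"
            unfolding f_e_open_loop CP by (simp add: hoZt)
          moreover have "g_all S (Z t) e 0 = hp_rate (C t) 0 - hp_rate (P t) 0"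
            unfolding g_all_hp_rate CP by (simp add: hoZt)
          ultimately show "d = (f_z S (Z t) e \<epsilon> wh0, f_e S (Z t) e \<epsilon> wh0 0, g_all S (Z t) e 0, 0, 1, \<psi>)"
            by (simp add: d_def)
          fix i
          \<comment> \<open>Any selection will do, since it multiplies W(0)^2 = 0.\<close>
          have "omega S i r \<noteq> {}" for r by (simp add: omega_def)
          then obtain o\<^sub>i where "o\<^sub>i \<in> omega S i ((\<tau>0 + t *\<^sub>R 1) $ i)" by blast
          then show "\<exists>o\<^sub>i\<in>omega S i ((\<tau>0 + t *\<^sub>R 1) $ i). \<psi> $ i = rho S i (norm (q_i S i (Z t) e w))
              - o\<^sub>i * gam_bar S i * beta_coeff S i * (Wf S i (\<epsilon> + wh0 - w))\<^sup>2 - sig S i (Hv t $ i) + space_reg S i"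
            by (intro bexI[of _ o\<^sub>i]) (simp_all add: \<psi>_def q noerr Hv_nth)
        qed
        then show "\<exists>d\<in>flow_F S (X t) (U t). (X has_vector_derivative d) (at t)" using der by blast
      qed
    qed
  qed
qed

end

context solution
begin

text \<open>Flowing is possible from every point of the state space, inside the jump set too, so a
  flow can be appended to whichever slice contains the last time. That slice may consist of a single
  instant.\<close>

lemma not_maximal_of_last_time_attained:
  assumes R: "(R, k) \<in> E" and last: "\<And>t i. (t, i) \<in> E \<Longrightarrow> t \<le> R"
  shows "\<not> maximal_solution_pair (hybrid_model S (\<lambda>i. 0)) E \<xi> \<nu>"
proof -
  obtain t where t: "t 0 = 0" "\<And>j. j \<le> k \<Longrightarrow> t j \<le> t (Suc j)" "t (Suc k) = R"
    and ER: "E \<inter> ({0..R} \<times> {0..k}) = (\<Union>j\<le>k. {t j..t (Suc j)} \<times> {j})"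
    by (rule hybrid_time_domain_prefix[OF domain R]) (rule that)
  define a where "a = t k"
  have "a \<le> R" using t(2)[of k] t(3) by (simp add: a_def)
  have iff: "(s, k) \<in> E \<longleftrightarrow> (s, k) \<in> E \<inter> ({0..R} \<times> {0..k})" for s
    using nonneg last by auto
  have "(s, k) \<in> E \<longleftrightarrow> (s, k) \<in> (\<Union>j\<le>k. {t j..t (Suc j)} \<times> {j})" for s
    unfolding ER[symmetric] by (rule iff)
  then have "s \<in> slice E k \<longleftrightarrow> s \<in> {a..R}" for s
    unfolding slice_def mem_Collect_eq a_def t(3)[symmetric] by simp
  then have slice_k: "slice E k = {a..R}" by blast
  have "a \<in> slice E k" unfolding slice_k using \<open>a \<le> R\<close> by simp
  then have "0 \<le> a" using nonneg by (simp add: slice_def)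
  obtain \<delta> X U where X: "0 < \<delta>" "X 0 = \<xi> R k" "abs_cont_on X {0..\<delta>}" "\<And>t. t \<in> {0..\<delta>} \<Longrightarrow> X t \<in> state_space"
    "continuous_on {0..\<delta>} U"
    "AE t in lebesgue. t \<in> {0<..<\<delta>} \<longrightarrow> (\<exists>d\<in>flow_F S (X t) (U t). (X has_vector_derivative d) (at t))"
    by (rule flow_exists[OF in_state_space[OF R]]) (rule that)
  define X' where "X' t = (if t \<le> R then \<xi> t k else X (t + - R))" for t
  \<comment> \<open>At \<open>R\<close> the given input is kept: an extension has to agree with the
    pair on its domain, and \<open>R\<close> belongs to it.\<close>
  define U' where "U' t = (if t \<le> R then \<nu> t k else U (t + - R))" for t
  have near_lt: "(X' has_vector_derivative d) (at t)"
    if "((\<lambda>s. \<xi> s k) has_vector_derivative d) (at t)" "t < R" for t d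
  proof (rule has_vector_derivative_transform_within_open[OF that(1), of "{..<R}"])
    show "\<xi> s k = X' s" if "s \<in> {..<R}" for s using that by (simp add: X'_def)
  qed (use that in auto)
  have near_gt: "(X' has_vector_derivative d) (at t)"
    if "(X has_vector_derivative d) (at (t + - R))" "R < t" for t d
  proof (rule has_vector_derivative_transform_within_open[of "\<lambda>s. X (s + - R)" _ _ "{R<..}"])
    have "((\<lambda>s. s + - R) has_vector_derivative 1) (at t)" by (auto intro!: derivative_eq_intros)
    from vector_diff_chain_at[OF this, of X d] that(1)
    show "((\<lambda>s. X (s + - R)) has_vector_derivative d) (at t)" by (simp add: o_def)
    show "X (s + - R) = X' s" if "s \<in> {R<..}" for s using that by (simp add: X'_def)
  qed (use that in auto)
  obtain B where B: "0 \<le> B" "\<And>t. t \<in> {0..\<delta>} \<Longrightarrow> norm (U t) \<le> B" by (rule bounded_on_Icc[OF X(5)]) (rule that)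
  show ?thesis
  proof (rule extension_not_maximal[OF sol, where k = k and I = "{R<..R + \<delta>}" and a = a and b = "R + \<delta>"
        and X = X' and U = U' and c = "max B (hybrid_norm E \<nu>)"])
    show "slice E k \<noteq> {}" unfolding slice_k using \<open>a \<le> R\<close> by simp
    show "{R<..R + \<delta>} \<noteq> {}" using X(1) by simp
    show "t < s" if "s \<in> {R<..R + \<delta>}" "(t, i) \<in> E" for s t i using last[OF that(2)] that(1) by simp
    show "slice E k \<union> {R<..R + \<delta>} = {a..R + \<delta>}" unfolding slice_k using \<open>a \<le> R\<close> X(1) by auto
    show "X' t = \<xi> t k" "U' t = \<nu> t k" if "t \<in> slice E k" for t using that unfolding slice_k by (auto simp: X'_def U'_def)
    show "abs_cont_on X' {a..R + \<delta>}"
    proof (rule abs_cont_on_join)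
      have "abs_cont_on (\<lambda>t. \<xi> t k) {a..R}" by (intro abs_cont) (simp add: slice_k)
      then show "abs_cont_on X' {a..R}" by (rule abs_cont_on_cong[rotated]) (simp add: X'_def)
      have "abs_cont_on (\<lambda>t. X (t + - R)) {R..R + \<delta>}" by (rule abs_cont_on_shift) (use X(3) in simp)
      then show "abs_cont_on X' {R..R + \<delta>}" by (rule abs_cont_on_cong[rotated]) (auto simp: X'_def X(2))
    qed (use \<open>a \<le> R\<close> X(1) in auto)
    show "X' t \<in> flow_set (hybrid_model S (\<lambda>i. 0))" if "t \<in> {a<..<R + \<delta>}" for t
    proof (cases "t \<le> R")
      case True
      then have "t \<in> slice E k" unfolding slice_k using that by simp
      then have "(t, k) \<in> E" by (simp add: slice_def)
      then show ?thesis using True in_state_space by (simp add: flow_set_hybrid_model X'_def)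
    next
      case False
      then show ?thesis using that X(4)[of "t + - R"] by (simp add: flow_set_hybrid_model X'_def)
    qed
    have "(\<lambda>t. \<nu> t k) \<in> borel_measurable (lebesgue_on {a..R})"
      using sol unfolding slice_k[symmetric] by (simp add: solution_pair_def hybrid_input_def)
    then have m1: "(\<lambda>t. if t \<in> {a..R} then \<nu> t k else 0) \<in> borel_measurable lebesgue"
      by (subst borel_measurable_if) auto
    have contU: "continuous_on {R..R + \<delta>} (\<lambda>t. U (t + - R))"
      by (rule continuous_on_compose2[OF X(5)]) (auto intro!: continuous_intros)
    then have "(\<lambda>t. U (t + - R)) \<in> borel_measurable (lebesgue_on {R<..R + \<delta>})"
      by (intro continuous_imp_measurable_on_sets_lebesgue continuous_on_subset[OF contU]) auto
    then have m2: "(\<lambda>t. if t \<in> {R<..R + \<delta>} then U (t + - R) else 0) \<in> borel_measurable lebesgue"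
      by (subst borel_measurable_if) auto
    have "(\<lambda>t. (if t \<in> {a..R} then \<nu> t k else 0) + (if t \<in> {R<..R + \<delta>} then U (t + - R) else 0))
        \<in> borel_measurable (lebesgue_on {a..R + \<delta>})"
      by (intro measurable_restrict_space1 borel_measurable_add m1 m2)
    moreover have "(\<lambda>t. (if t \<in> {a..R} then \<nu> t k else 0) + (if t \<in> {R<..R + \<delta>} then U (t + - R) else 0))
        \<in> borel_measurable (lebesgue_on {a..R + \<delta>}) \<longleftrightarrow> U' \<in> borel_measurable (lebesgue_on {a..R + \<delta>})"
      by (rule measurable_cong) (auto simp: U'_def)
    ultimately show "U' \<in> borel_measurable (lebesgue_on {a..R + \<delta>})" by blast
    show "AE t in lebesgue. t \<in> {a..R + \<delta>} \<longrightarrow> norm (U' t) \<le> max B (hybrid_norm E \<nu>)"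
      using flow[of k]
    proof eventually_elim
      case (elim t)
      show ?case
      proof
        assume t: "t \<in> {a..R + \<delta>}"
        show "norm (U' t) \<le> max B (hybrid_norm E \<nu>)"
        proof (cases "t \<le> R")
          case True
          then have "t \<in> slice E k" unfolding slice_k using t by simp
          then show ?thesis using elim True by (auto simp: U'_def)
        next
          case False
          then show ?thesis using B(2)[of "t + - R"] t by (auto simp: U'_def intro: max.coboundedI1)
        qed
      qed
    qed
    \<comment> \<open>The old and the new part need not have a common derivative where they
      meet.\<close>
    have "AE t in lebesgue. t \<noteq> R"
      using AE_not_in[of "{R}" lebesgue] by (simp add: negligible_iff_null_sets[symmetric])
    then show "AE t in lebesgue. t \<in> {a<..<R + \<delta>} \<longrightarrow>
        (\<exists>d\<in>flow_map (hybrid_model S (\<lambda>i. 0)) (X' t) (U' t). (X' has_vector_derivative d) (at t))"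
      using flow[of k] ae_shift[OF X(6), of "- R"]
    proof eventually_elim
      case (elim t)
      show ?case
      proof
        assume t: "t \<in> {a<..<R + \<delta>}"
        consider "t < R" | "R < t" using elim(1) by linarith
        then show "\<exists>d\<in>flow_map (hybrid_model S (\<lambda>i. 0)) (X' t) (U' t). (X' has_vector_derivative d) (at t)"
        proof cases
          case 1
          then have "t \<in> slice E k" unfolding slice_k using t by simp
          then obtain d where d: "d \<in> flow_F S (\<xi> t k) (\<nu> t k)" "((\<lambda>s. \<xi> s k) has_vector_derivative d) (at t)"
            using elim(2) by blast
          show ?thesis
            by (rule bexI[of _ d]) (use d(1) near_lt[OF d(2) 1] 1 in \<open>auto simp: hybrid_model_def X'_def U'_def\<close>)
        next
          case 2
          then have "t + - R \<in> {0<..<\<delta>}" using t by auto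
          then obtain d where d: "d \<in> flow_F S (X (t + - R)) (U (t + - R))" "(X has_vector_derivative d) (at (t + - R))"
            using elim(3) by blast
          show ?thesis
            by (rule bexI[of _ d]) (use d(1) near_gt[OF d(2) 2] 2 in \<open>auto simp: hybrid_model_def X'_def U'_def\<close>)
        qed
      qed
    qed
  qed
qed

text \<open>The sum of all timers is a nonnegative potential that grows at rate N and loses at least
  the smallest \<open>tau_lo\<close> at each jump.\<close>

lemma finitely_many_jumps:
  obtains B where "\<And>t j. (t, j) \<in> E \<Longrightarrow> t \<le> T \<Longrightarrow> j \<le> B"
proof -
  define h where "h t j = (\<Sum>i\<in>UNIV. st_tau (\<xi> t j) $ i)" for t j
  define c where "c = Min (range (tau_lo S))"
  have "0 < c" using tuningD(4) by (auto simp: c_def)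
  have c_le: "c \<le> tau_lo S i" for i by (simp add: c_def)
  define B where "B = nat \<lceil>(h 0 0 + real CARD('N) * T) / c\<rceil>"
  have "j \<le> B" if tj: "(t, j) \<in> E" "t \<le> T" for t j
  proof -
    have "h t j \<le> h 0 0 + real CARD('N) * t - c * real j"
    proof (rule hybrid_decrease[OF domain tj(1)])
      fix a b i assume "{a..b} \<subseteq> slice E i" "a \<le> b"
      then have "h b i = (\<Sum>k\<in>UNIV. st_tau (\<xi> a i) $ k + (b - a))"
        unfolding h_def by (intro sum.cong refl tau_flow)
      then show "h b i - h a i \<le> real CARD('N) * (b - a)" by (simp add: h_def sum.distrib)
    next
      fix s i assume "(s, i) \<in> jump_times E"
      then obtain k where k: "\<xi> s i \<in> jump_D_i S k" "\<xi> s (Suc i) = jump_G_i S (\<lambda>i. 0) k (\<xi> s i) (\<nu> s i)"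
        by (rule jump)
      obtain z e \<epsilon> wh \<tau> \<eta> where eq: "\<xi> s i = (z, e, \<epsilon>, wh, \<tau>, \<eta>)" by (metis prod.exhaust)
      have "tau_lo S k \<le> \<tau> $ k" using k(1) by (simp add: eq jump_D_i_def)
      moreover have "h s (Suc i) = (\<Sum>l\<in>UNIV. if l = k then 0 else \<tau> $ l)"
        unfolding h_def k(2) eq by (simp add: jump_G_i_def upd_def split: prod.splits)
      moreover have "(\<Sum>l\<in>UNIV. if l = k then 0 else \<tau> $ l) = (\<Sum>l\<in>UNIV. \<tau> $ l) - \<tau> $ k"
        by (simp add: sum.remove[of UNIV k] if_distrib cong: sum.cong) (auto intro: sum.cong)
      ultimately show "h s (Suc i) \<le> h s i - c" using c_le[of k] by (simp add: h_def eq)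
    qed
    moreover have "0 \<le> h t j"
      unfolding h_def using in_state_space[OF tj(1)] by (intro sum_nonneg) (auto simp: state_space_def)
    moreover have "real CARD('N) * t \<le> real CARD('N) * T" using tj(2) by (intro mult_left_mono) auto
    ultimately have "c * real j \<le> h 0 0 + real CARD('N) * T" by linarith
    then have "real j \<le> (h 0 0 + real CARD('N) * T) / c" using \<open>0 < c\<close> by (simp add: field_simps)
    then show ?thesis unfolding B_def by linarith
  qed
  then show ?thesis by (rule that)
qed

lemma not_maximal_of_last_time_missing:
  assumes slice_k: "slice E k = {a..<R}" and "a < R" and last: "\<And>t i. (t, i) \<in> E \<Longrightarrow> t < R"
  shows "\<not> maximal_solution_pair (hybrid_model S (\<lambda>i. 0)) E \<xi> \<nu>"
proof -
  define n where "n = hybrid_norm E \<nu>"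
  define z where "z t = fst (\<xi> t k)" for t
  define e where "e t = fst (snd (\<xi> t k))" for t
  define \<epsilon> where "\<epsilon> t = st_eps (\<xi> t k)" for t
  define wh where "wh t = st_wh (\<xi> t k)" for t
  define \<tau> where "\<tau> t = st_tau (\<xi> t k)" for t
  define \<eta> where "\<eta> t = st_eta (\<xi> t k)" for t
  define v where "v t = fst (\<nu> t k)" for t
  define w where "w t = snd (\<nu> t k)" for t
  have \<xi>_eq: "\<xi> t k = (z t, e t, \<epsilon> t, wh t, \<tau> t, \<eta> t)" for t
    by (simp add: z_def e_def \<epsilon>_def wh_def \<tau>_def \<eta>_def)
  have \<nu>_eq: "\<nu> t k = (v t, w t)" for t by (simp add: v_def w_def)
  have "a \<in> slice E k" unfolding slice_k using \<open>a < R\<close> by simp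
  then have "0 \<le> a" using nonneg by (simp add: slice_def)
  have sub: "{a..c} \<subseteq> slice E k" if "c < R" for c
    unfolding slice_k using that by auto
  have ac: "abs_cont_on (\<lambda>t. \<xi> t k) {a..c}" if "c < R" for c by (rule abs_cont[OF sub[OF that]])
  have ae: "AE t in lebesgue. t \<in> {a<..<R} \<longrightarrow>
      (\<exists>\<psi>. ((\<lambda>s. \<xi> s k) has_vector_derivative
          (f_z S (z t) (e t) (\<epsilon> t) (wh t), fp S (ho S (z t)) 0 - fp S (ho S (z t) - e t) (v t),
           hp_rate (ho S (z t)) 0 - hp_rate (ho S (z t) - e t) (v t), 0, 1, \<psi>)) (at t) \<and>
        (\<forall>i. \<exists>o\<^sub>i\<in>omega S i (\<tau> t $ i). \<psi> $ i = rho S i (norm (q_i S i (z t) (e t) (w t)))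
          - o\<^sub>i * gam_bar S i * beta_coeff S i * (Wf S i (\<epsilon> t + wh t - w t))\<^sup>2
          - sig S i (\<eta> t $ i) + space_reg S i)) \<and> norm (v t) \<le> n \<and> norm (w t) \<le> n"
    using flow[of k]
  proof eventually_elim
    case (elim t)
    show ?case
    proof
      assume t: "t \<in> {a<..<R}"
      then obtain d where d: "d \<in> flow_F S (z t, e t, \<epsilon> t, wh t, \<tau> t, \<eta> t) (v t, w t)"
        "((\<lambda>s. \<xi> s k) has_vector_derivative d) (at t)" and bd: "norm (v t, w t) \<le> n"
        using elim[unfolded \<xi>_eq[of t] \<nu>_eq n_def[symmetric] slice_k] by auto
      have "norm (v t) \<le> n" "norm (w t) \<le> n"
        using bd norm_fst_le[of "v t" "w t"] norm_snd_le[of "w t" "v t"] by simp_all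
      then show "(\<exists>\<psi>. ((\<lambda>s. \<xi> s k) has_vector_derivative
          (f_z S (z t) (e t) (\<epsilon> t) (wh t), fp S (ho S (z t)) 0 - fp S (ho S (z t) - e t) (v t),
           hp_rate (ho S (z t)) 0 - hp_rate (ho S (z t) - e t) (v t), 0, 1, \<psi>)) (at t) \<and>
        (\<forall>i. \<exists>o\<^sub>i\<in>omega S i (\<tau> t $ i). \<psi> $ i = rho S i (norm (q_i S i (z t) (e t) (w t)))
          - o\<^sub>i * gam_bar S i * beta_coeff S i * (Wf S i (\<epsilon> t + wh t - w t))\<^sup>2
          - sig S i (\<eta> t $ i) + space_reg S i)) \<and> norm (v t) \<le> n \<and> norm (w t) \<le> n"
        using d unfolding flow_F_iff f_e_open_loop g_all_hp_rate by blast
    qed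
  qed
  have proj: "((\<lambda>s. f (\<xi> s k)) has_vector_derivative f d) (at t)"
    if "((\<lambda>s. \<xi> s k) has_vector_derivative d) (at t)" "bounded_linear f"
    for f :: "('n, 'q, 'm, 'N) state \<Rightarrow> 'z::real_normed_vector" and d t
    using bounded_linear.has_vector_derivative[OF that(2,1)] .
  have ac_z: "abs_cont_on z {a..c}" and ac_e: "abs_cont_on e {a..c}" if "c < R" for c
  proof -
    have "norm (fst x - fst y) \<le> 1 * norm (x - y)" for x y :: "('n, 'q, 'm, 'N) state"
      by (simp add: norm_fst_diff_le)
    then show "abs_cont_on z {a..c}" unfolding z_def by (rule abs_cont_on_image[OF ac[OF that]])
    have "norm (fst (snd x) - fst (snd y)) \<le> 1 * norm (x - y)" for x y :: "('n, 'q, 'm, 'N) state"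
      using norm_fst_diff_le[of "snd x" "snd y"] norm_snd_diff_le[of x y] by simp
    then show "abs_cont_on e {a..c}" unfolding e_def by (rule abs_cont_on_image[OF ac[OF that], where g = "\<lambda>x. fst (snd x)"])
  qed
  define y where "y t = hp S (ho S (z t) - e t) + \<epsilon> t + wh t" for t
  define x where "x t = ho S (z t) - e t" for t
  have drv_z: "AE t in lebesgue. t \<in> {a<..<R} \<longrightarrow> (z has_vector_derivative fo S (z t) (y t)) (at t)"
    using ae
  proof eventually_elim
    case (elim t)
    show ?case using elim proj[OF _ bounded_linear_fst] unfolding z_def[symmetric] f_z_def y_def by fastforce
  qed
  then have drv_z': "AE t in lebesgue. t \<in> {a<..<c} \<longrightarrow> (z has_vector_derivative fo S (z t) (y t)) (at t)"
    if "c < R" for c using that by (elim eventually_mono) auto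
  have drv_ho: "AE t in lebesgue. t \<in> {a<..<R} \<longrightarrow> ((\<lambda>t. ho S (z t)) has_vector_derivative fp S (ho S (z t)) 0) (at t)"
    using drv_z by eventually_elim
      (use has_vector_derivative_compose_differentiable[OF _ ho_derivative] in \<open>fastforce simp: open_loop\<close>)
  have ac_ho: "abs_cont_on (\<lambda>t. ho S (z t)) {a..c}" if "c < R" for c
    by (rule ho_curve(1)[OF ac_z[OF that] drv_z'[OF that]])
  have drv_e: "AE t in lebesgue. t \<in> {a<..<R} \<longrightarrow> (e has_vector_derivative fp S (ho S (z t)) 0 - fp S (x t) (v t)) (at t)"
    using ae
  proof eventually_elim
    case (elim t)
    show ?case using elim proj[OF _ bounded_linear_fst_comp[OF bounded_linear_snd]] unfolding e_def[symmetric] x_def by fastforce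
  qed
  have drv_x: "AE t in lebesgue. t \<in> {a<..<R} \<longrightarrow> (x has_vector_derivative fp S (x t) (v t)) (at t)"
    using drv_ho drv_e
  proof eventually_elim
    case (elim t)
    show ?case
    proof
      assume "t \<in> {a<..<R}"
      then have "((\<lambda>t. ho S (z t) - e t) has_vector_derivative fp S (ho S (z t)) 0 - (fp S (ho S (z t)) 0 - fp S (x t) (v t))) (at t)"
        using elim by (intro has_vector_derivative_diff) auto
      then show "(x has_vector_derivative fp S (x t) (v t)) (at t)" unfolding x_def by simp
    qed
  qed
  have ac_x: "abs_cont_on x {a..c}" if "c < R" for c
    unfolding x_def by (rule abs_cont_on_diff[OF ac_ho[OF that] ac_e[OF that]])
  define T where "T = R - a"
  have "0 < T" using \<open>a < R\<close> by (simp add: T_def)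
  have shift: "AE s in lebesgue. s \<in> {0<..<T} \<longrightarrow> ((\<lambda>s. f (s + a)) has_vector_derivative D (s + a)) (at s)"
    if "AE t in lebesgue. t \<in> {a<..<R} \<longrightarrow> (f has_vector_derivative D t) (at t)"
    for f D :: "real \<Rightarrow> 'z::real_normed_vector"
    using ae_shift[OF that, of a]
  proof eventually_elim
    case (elim s)
    show ?case
    proof
      assume "s \<in> {0<..<T}"
      then have "(f has_vector_derivative D (s + a)) (at (s + a))" using elim by (auto simp: T_def)
      moreover have "((\<lambda>s. s + a) has_vector_derivative 1) (at s)" by (auto intro!: derivative_eq_intros)
      ultimately show "((\<lambda>s. f (s + a)) has_vector_derivative D (s + a)) (at s)"
        using vector_diff_chain_at[of "\<lambda>s. s + a" 1 s f "D (s + a)"] by (simp add: o_def)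
    qed
  qed
  have ac_shift: "abs_cont_on (\<lambda>s. f (s + a)) {0..c}" if "\<And>c. c < R \<Longrightarrow> abs_cont_on f {a..c}" "c < T"
    for f :: "real \<Rightarrow> 'z::real_normed_vector" and c
    by (rule abs_cont_on_shift) (use that(1)[of "c + a"] that(2) in \<open>simp add: T_def\<close>)
  \<comment> \<open>The comparison solution exists beyond the missing end point, so it bounds
    \<open>ho S z\<close> uniformly on the half-open interval.\<close>
  obtain C where C: "\<And>b. abs_cont_on C {0..b}" "\<And>s. 0 \<le> s \<Longrightarrow> s < T \<Longrightarrow> ho S (z (s + a)) = C s"
  proof -
    obtain C where C: "C 0 = ho S (z a)" "\<And>b. abs_cont_on C {0..b}"
      "AE t in lebesgue. 0 < t \<longrightarrow> (C has_vector_derivative fp S (C t) 0) (at t)"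
      and uniq: "\<And>T y t. \<lbrakk>y 0 = ho S (z a); \<And>c. c < T \<Longrightarrow> abs_cont_on y {0..c};
         AE t in lebesgue. t \<in> {0<..<T} \<longrightarrow> (y has_vector_derivative fp S (y t) 0) (at t); 0 \<le> t; t < T\<rbrakk>
         \<Longrightarrow> y t = C t"
      by (rule unique_global_solutionE[OF plant_unique_0[of "ho S (z a)"]]) blast
    have "ho S (z (s + a)) = C s" if "0 \<le> s" "s < T" for s
      by (rule uniq[of "\<lambda>s. ho S (z (s + a))", OF _ ac_shift[OF ac_ho] shift[OF drv_ho] that]) auto
    then show ?thesis using C(2) that by blast
  qed
  have meas_\<nu>: "(\<lambda>t. \<nu> t k) \<in> borel_measurable (lebesgue_on {a..<R})"
    using sol unfolding slice_k[symmetric] by (simp add: solution_pair_def hybrid_input_def)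
  obtain P where P: "\<And>b. abs_cont_on P {0..b}" "\<And>s. 0 \<le> s \<Longrightarrow> s < T \<Longrightarrow> x (s + a) = P s"
  proof -
    \<comment> \<open>Beyond the slice the disturbance is continued by zero; uniqueness is invoked
      only before that time.\<close>
    define v' where "v' s = (if s < R - a then v (s + a) else 0)" for s
    have "v \<in> borel_measurable (lebesgue_on {a..<R})"
      unfolding v_def using meas_\<nu> by (intro borel_measurable_continuous_on[OF continuous_on_fst[OF continuous_on_id]]) 
    then have 1: "v' \<in> borel_measurable (lebesgue_on {0..})" unfolding v'_def by (rule measurable_shift)
    have "AE t in lebesgue. t \<in> slice E k \<longrightarrow> norm (v t) \<le> n"
      using flow[of k] by eventually_elim (use norm_fst_le in \<open>fastforce simp: \<nu>_eq n_def intro: order_trans\<close>)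
    from ae_shift[OF this, of a] have 2: "AE s in lebesgue. s \<in> {0..} \<longrightarrow> norm (v' s) \<le> max n 0"
      by eventually_elim (auto simp: slice_k v'_def intro: max.coboundedI1)
    obtain P where P: "P 0 = x a" "\<And>b. abs_cont_on P {0..b}"
      "AE t in lebesgue. 0 < t \<longrightarrow> (P has_vector_derivative fp S (P t) (v' t)) (at t)"
      and uniq: "\<And>T y t. \<lbrakk>y 0 = x a; \<And>c. c < T \<Longrightarrow> abs_cont_on y {0..c};
         AE t in lebesgue. t \<in> {0<..<T} \<longrightarrow> (y has_vector_derivative fp S (y t) (v' t)) (at t); 0 \<le> t; t < T\<rbrakk>
         \<Longrightarrow> y t = P t"
      by (rule unique_global_solutionE[OF plant_unique[OF 1 2, of "x a"]]) blast
    have "AE s in lebesgue. s \<in> {0<..<T} \<longrightarrow> ((\<lambda>s. x (s + a)) has_vector_derivative fp S (x (s + a)) (v' s)) (at s)"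
      using shift[OF drv_x] by eventually_elim (auto simp: v'_def T_def)
    then have "x (s + a) = P s" if "0 \<le> s" "s < T" for s
      using uniq[of "\<lambda>s. x (s + a)", OF _ ac_shift[OF ac_x] _ that] by auto
    then show ?thesis using P(2) that by blast
  qed
  obtain Z where Z: "\<And>b. abs_cont_on Z {0..b}" "\<And>s. 0 \<le> s \<Longrightarrow> s < T \<Longrightarrow> z (s + a) = Z s"
  proof -
    define y' where "y' s = (if s < R - a then y (s + a) else 0)" for s
    have "continuous_on {a..<R} (\<lambda>t. \<xi> t k)"
      unfolding continuous_on_eq_continuous_within
    proof
      fix t assume t: "t \<in> {a..<R}"
      define c where "c = (t + R) / 2"
      have c: "t < c" "c < R" using t by (auto simp: c_def)
      have "continuous (at t within {a..c}) (\<lambda>t. \<xi> t k)"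
        using continuous[OF sub[OF c(2)]] t c(1) by (auto simp: continuous_on_eq_continuous_within)
      moreover have "at t within {a..<R} = at t within {a..c}"
        using c t by (intro at_within_nhd[of t "{..<c}"]) auto
      ultimately show "continuous (at t within {a..<R}) (\<lambda>t. \<xi> t k)" by simp
    qed
    then have "continuous_on {a..<R} y"
      unfolding y_def z_def e_def \<epsilon>_def wh_def
      by (intro continuous_intros continuous_on_hp continuous_on_ho)
    then have "y \<in> borel_measurable (lebesgue_on {a..<R})"
      by (rule continuous_imp_measurable_on_sets_lebesgue) simp
    then have 1: "y' \<in> borel_measurable (lebesgue_on {0..})" unfolding y'_def by (rule measurable_shift)
    obtain Z where Z: "Z 0 = z a" "\<And>b. abs_cont_on Z {0..b}"
      "AE t in lebesgue. 0 < t \<longrightarrow> (Z has_vector_derivative fo S (Z t) (y' t)) (at t)"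
      and uniq: "\<And>T u t. \<lbrakk>u 0 = z a; \<And>c. c < T \<Longrightarrow> abs_cont_on u {0..c};
         AE t in lebesgue. t \<in> {0<..<T} \<longrightarrow> (u has_vector_derivative fo S (u t) (y' t)) (at t); 0 \<le> t; t < T\<rbrakk>
         \<Longrightarrow> u t = Z t"
      by (rule unique_global_solutionE[OF observer_unique[OF 1, of "z a"]]) blast
    have "AE s in lebesgue. s \<in> {0<..<T} \<longrightarrow> ((\<lambda>s. z (s + a)) has_vector_derivative fo S (z (s + a)) (y' s)) (at s)"
      using shift[OF drv_z] by eventually_elim (auto simp: y'_def T_def)
    then have "z (s + a) = Z s" if "0 \<le> s" "s < T" for s
      using uniq[of "\<lambda>s. z (s + a)", OF _ ac_shift[OF ac_z] _ that] by auto
    then show ?thesis using Z(2) that by blast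
  qed
  have Icc: "{0..T} \<subseteq> {0..}" by auto
  obtain Kc where Kc: "0 \<le> Kc" "\<And>t. t \<in> {a..<R} \<Longrightarrow> norm (ho S (z t)) \<le> Kc"
  proof -
    have "continuous_on {0..T} C" by (rule abs_cont_on_imp_continuous_on[OF C(1)]) simp
    then obtain K where "0 \<le> K" "\<And>s. s \<in> {0..T} \<Longrightarrow> norm (C s) \<le> K" by (rule bounded_on_Icc) (rule that)
    then show ?thesis using C(2)[of "t - a" for t] by (intro that[of K]) (auto simp: T_def)
  qed
  obtain Kx where Kx: "0 \<le> Kx" "\<And>t. t \<in> {a..<R} \<Longrightarrow> norm (x t) \<le> Kx"
  proof -
    have "continuous_on {0..T} P" by (rule abs_cont_on_imp_continuous_on[OF P(1)]) simp
    then obtain K where "0 \<le> K" "\<And>s. s \<in> {0..T} \<Longrightarrow> norm (P s) \<le> K" by (rule bounded_on_Icc) (rule that)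
    then show ?thesis using P(2)[of "t - a" for t] by (intro that[of K]) (auto simp: T_def)
  qed
  \<comment> \<open>A compact box for the estimate, the plant state and the disturbance, which
    together determine the rates of e and \<epsilon>.\<close>
  define Q where "Q = cball (0::real^'n) Kc \<times> cball (0::real^'n) Kx \<times> cball (0::real^'p) n"
  have "compact Q" unfolding Q_def by (intro compact_Times compact_cball)
  have bdd: "\<exists>M\<ge>0. \<forall>q\<in>Q. norm (f q) \<le> M" if "continuous_on Q f" for f :: "_ \<Rightarrow> 'z::real_normed_vector"
  proof -
    have "bounded (f ` Q)" using \<open>compact Q\<close> that by (intro compact_imp_bounded compact_continuous_image)
    then obtain M where "0 < M" "\<forall>y\<in>f ` Q. norm y \<le> M" by (auto simp: bounded_pos)
    then show ?thesis by (intro exI[of _ M]) auto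
  qed
  have "continuous_on Q (\<lambda>q. fp S (fst q) 0 - fp S (fst (snd q)) (snd (snd q)))"
    by (intro continuous_intros continuous_on_fp)
  from bdd[OF this] obtain Me where Me: "0 \<le> Me"
    "\<And>c x v. \<lbrakk>norm c \<le> Kc; norm x \<le> Kx; norm v \<le> n\<rbrakk> \<Longrightarrow> norm (fp S c 0 - fp S x v) \<le> Me"
    by (auto simp: Q_def)
  have "continuous_on Q (\<lambda>q. hp_rate (fst q) 0 - hp_rate (fst (snd q)) (snd (snd q)))"
    by (intro continuous_intros continuous_on_hp_rate)
  from bdd[OF this] obtain M\<epsilon> where M\<epsilon>: "0 \<le> M\<epsilon>"
    "\<And>c x v. \<lbrakk>norm c \<le> Kc; norm x \<le> Kx; norm v \<le> n\<rbrakk> \<Longrightarrow> norm (hp_rate c 0 - hp_rate x v) \<le> M\<epsilon>"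
    by (auto simp: Q_def)
  have "continuous_on Q (\<lambda>q. hp S (fst q) - hp S (fst (snd q)))"
    by (intro continuous_intros continuous_on_hp)
  from bdd[OF this] obtain Mq where "\<forall>q\<in>Q. norm (hp S (fst q) - hp S (fst (snd q))) \<le> Mq" by blast
  then have Mq: "norm (hp S c - hp S x) \<le> Mq" if "norm c \<le> Kc" "norm x \<le> Kx" "norm v \<le> n" for c x and v :: "real^'p"
    using that by (auto simp: Q_def dest!: bspec[of _ _ "(c, x, v)"])
  have "0 \<le> n" unfolding n_def by (rule hybrid_bound_norm(2)[OF Linf])
  have wh: "wh t = wh a" if "t \<in> {a..<R}" for t
    using wh_flow[of a t k] sub[of t] that by (simp add: wh_def)
  \<comment> \<open>The error \<epsilon> has to be bounded before \<eta>'s rate, since it enters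
    there through the trigger.\<close>
  define K\<epsilon> where "K\<epsilon> = norm (\<epsilon> a) + M\<epsilon> * T"
  have K\<epsilon>: "norm (\<epsilon> t) \<le> K\<epsilon>" if t: "t \<in> {a..<R}" for t
  proof -
    have "norm (\<epsilon> t - \<epsilon> a) \<le> M\<epsilon> * (t - a)"
      unfolding \<epsilon>_def
    proof (rule abs_cont_curve_norm_le[OF ac, where F = "\<lambda>\<xi>. st_eps \<xi>"])
      have bl: "bounded_linear (\<lambda>\<xi> :: ('n, 'q, 'm, 'N) state. st_eps \<xi>)"
        by (intro bounded_linear_fst_comp bounded_linear_snd_comp bounded_linear_snd)
      then show "calm_at (\<lambda>\<xi> :: ('n, 'q, 'm, 'N) state. st_eps \<xi>) p" for p by (rule calm_at_linear)
      show "AE s in lebesgue. s \<in> {a<..<t} \<longrightarrow>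
        (\<exists>D. ((\<lambda>s. st_eps (\<xi> s k)) has_vector_derivative D) (at s) \<and> norm D \<le> M\<epsilon>)"
        using ae
      proof eventually_elim
        case (elim s)
        show ?case
        proof
          assume s: "s \<in> {a<..<t}"
          then have "s \<in> {a<..<R}" "s \<in> {a..<R}" using t by auto
          then show "\<exists>D. ((\<lambda>s. st_eps (\<xi> s k)) has_vector_derivative D) (at s) \<and> norm D \<le> M\<epsilon>"
            using elim proj[OF _ bl, of _ s] M\<epsilon>(2)[OF Kc(2) Kx(2), of s s "v s"] unfolding x_def by fastforce
        qed
      qed
    qed (use t in auto)
    also have "\<dots> \<le> M\<epsilon> * T" using t M\<epsilon>(1) by (intro mult_left_mono) (auto simp: T_def)
    finally show ?thesis using norm_triangle_ineq2[of "\<epsilon> t" "\<epsilon> a"] by (simp add: K\<epsilon>_def)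
  qed
  have "\<exists>C. \<forall>y. norm (blk S i y) \<le> Mq + n \<longrightarrow> rho S i (norm (blk S i y)) \<le> C" for i by (rule rho_bounded)
  then obtain C\<rho> where C\<rho>: "\<And>i y. norm (blk S i y) \<le> Mq + n \<Longrightarrow> rho S i (norm (blk S i y)) \<le> C\<rho> i" by metis
  have rho_le: "rho S i (norm (q_i S i (z t) (e t) (w t))) \<le> C\<rho> i" if "t \<in> {a..<R}" "norm (v t) \<le> n" "norm (w t) \<le> n" for i t
  proof -
    have q: "q_i S i (z t) (e t) (w t) = blk S i (hp S (ho S (z t)) - hp S (x t) - w t)"
      by (simp add: q_i_def hpi_def blk_diff x_def)
    have "norm (hp S (ho S (z t)) - hp S (x t) - w t) \<le> Mq + n"
      using Mq[OF Kc(2)[OF that(1)] Kx(2)[OF that(1)] that(2)] that(3)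
        norm_triangle_ineq4[of "hp S (ho S (z t)) - hp S (x t)" "w t"] by linarith
    then show ?thesis unfolding q using norm_blk_le order_trans by (intro C\<rho>) blast
  qed
  have C\<rho>_nn: "0 \<le> C\<rho> i" for i
  proof -
    have "norm (hp S 0 - hp S 0) \<le> Mq" by (rule Mq[of 0 0 0]) (use Kc(1) Kx(1) \<open>0 \<le> n\<close> in auto)
    then have "0 \<le> Mq" by simp
    then show ?thesis using C\<rho>[of i 0] rho_nonneg[of i "0::real^'m"] \<open>0 \<le> n\<close> by simp
  qed
  have \<eta>_nn: "0 \<le> \<eta> t $ i" if "t \<in> {a..<R}" for t i
  proof -
    have "(t, k) \<in> E" using that slice_k by (auto simp: slice_def)
    then show ?thesis using in_state_space[of t k] by (simp add: \<xi>_eq state_space_def)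
  qed
  \<comment> \<open>Only \<open>rho\<close> and \<open>space_reg\<close> push \<eta> upwards, so an
    upper bound follows before the full rate is known; with it \<sigma>(\<eta>) becomes bounded and
    the rate of \<eta> as well.\<close>
  define K\<eta> where "K\<eta> i = \<eta> a $ i + (C\<rho> i + space_reg S i) * T" for i
  have omega01: "0 \<le> o\<^sub>i \<and> o\<^sub>i \<le> 1" if "o\<^sub>i \<in> omega S i r" for o\<^sub>i i r
    using that by (auto simp: omega_def split: if_splits)
  have trig_nn: "0 \<le> o\<^sub>i * gam_bar S i * beta_coeff S i * X\<^sup>2" if "0 \<le> o\<^sub>i" for o\<^sub>i i X
    using that gam_bar_nonneg[of i] by (simp add: beta_coeff_def)
  have K\<eta>: "\<eta> t $ i \<le> K\<eta> i" if t: "t \<in> {a..<R}" for t i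
  proof -
    have bl: "bounded_linear (\<lambda>\<xi> :: ('n, 'q, 'm, 'N) state. st_eta \<xi> $ i)"
      by (intro bounded_linear_compose[OF bounded_linear_vec_nth] bounded_linear_snd_comp bounded_linear_snd)
    have "\<eta> t $ i - \<eta> a $ i \<le> (C\<rho> i + space_reg S i) * (t - a)"
      unfolding \<eta>_def
    proof (rule abs_cont_curve_le[OF ac, where F = "\<lambda>\<xi>. st_eta \<xi> $ i"])
      show "calm_at (\<lambda>\<xi> :: ('n, 'q, 'm, 'N) state. st_eta \<xi> $ i) p" for p
        by (rule calm_at_linear[OF bl])
      show "AE s in lebesgue. s \<in> {a<..<t} \<longrightarrow>
          upper_drv (\<lambda>s. st_eta (\<xi> s k) $ i) s (C\<rho> i + space_reg S i)"
        using ae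
      proof eventually_elim
        case (elim s)
        show ?case
        proof
          assume "s \<in> {a<..<t}"
          then have s: "s \<in> {a<..<R}" "s \<in> {a..<R}" using t by auto
          then obtain \<psi> o\<^sub>i where der: "((\<lambda>s. \<xi> s k) has_vector_derivative
              (f_z S (z s) (e s) (\<epsilon> s) (wh s), fp S (ho S (z s)) 0 - fp S (ho S (z s) - e s) (v s),
               hp_rate (ho S (z s)) 0 - hp_rate (ho S (z s) - e s) (v s), 0, 1, \<psi>)) (at s)"
            and o: "o\<^sub>i\<in>omega S i (\<tau> s $ i)" and \<psi>: "\<psi> $ i = rho S i (norm (q_i S i (z s) (e s) (w s)))
              - o\<^sub>i * gam_bar S i * beta_coeff S i * (Wf S i (\<epsilon> s + wh s - w s))\<^sup>2
              - sig S i (\<eta> s $ i) + space_reg S i"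
            and vw: "norm (v s) \<le> n" "norm (w s) \<le> n"
            using elim by blast
          have "((\<lambda>s. st_eta (\<xi> s k) $ i) has_real_derivative \<psi> $ i) (at s)"
            using proj[OF der bl] by (simp add: has_real_derivative_iff_has_vector_derivative)
          moreover have "\<psi> $ i \<le> C\<rho> i + space_reg S i"
            using \<psi> rho_le[OF s(2) vw, of i] trig_nn[of o\<^sub>i i "Wf S i (\<epsilon> s + wh s - w s)"] omega01[OF o]
              class_K_inf_nonneg[OF tuningD(6) \<eta>_nn[OF s(2)], of i i] by linarith
          ultimately show "upper_drv (\<lambda>s. st_eta (\<xi> s k) $ i) s (C\<rho> i + space_reg S i)"
            by (meson upper_drv_mono upper_drv_real_derivative)
        qed
      qed
    qed (use t in auto)
    also have "\<dots> \<le> (C\<rho> i + space_reg S i) * T"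
      using t C\<rho>_nn[of i] tuningD(7)[of i] by (intro mult_left_mono) (auto simp: T_def)
    finally show ?thesis by (simp add: K\<eta>_def)
  qed
  \<comment> \<open>Adds the bounds of all four terms of the \<eta>-dynamics, since the rate has to
    be controlled from both sides.\<close>
  define m where "m i = C\<rho> i + gam_bar S i * beta_coeff S i * (beta_hi S i * (K\<epsilon> + norm (wh a) + n))\<^sup>2
    + sig S i (K\<eta> i) + space_reg S i" for i
  define K where "K = Me + (M\<epsilon> + (norm (1::real^'N) + (\<Sum>i\<in>UNIV. m i)))"
  have bl_snd: "bounded_linear (snd :: ('n, 'q, 'm, 'N) state \<Rightarrow> _)" by (rule bounded_linear_snd)
  have drv_snd: "AE s in lebesgue. s \<in> {a<..<R} \<longrightarrow>
      (\<exists>D. ((\<lambda>s. snd (\<xi> s k)) has_vector_derivative D) (at s) \<and> norm D \<le> K)"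
    using ae
  proof eventually_elim
    case (elim s)
    show ?case
    proof
      assume "s \<in> {a<..<R}"
      then have s: "s \<in> {a<..<R}" "s \<in> {a..<R}" by auto
      then obtain \<psi> where der: "((\<lambda>s. \<xi> s k) has_vector_derivative
          (f_z S (z s) (e s) (\<epsilon> s) (wh s), fp S (ho S (z s)) 0 - fp S (x s) (v s),
           hp_rate (ho S (z s)) 0 - hp_rate (x s) (v s), 0, 1, \<psi>)) (at s)"
        and \<psi>: "\<forall>i. \<exists>o\<^sub>i\<in>omega S i (\<tau> s $ i). \<psi> $ i = rho S i (norm (q_i S i (z s) (e s) (w s)))
          - o\<^sub>i * gam_bar S i * beta_coeff S i * (Wf S i (\<epsilon> s + wh s - w s))\<^sup>2
          - sig S i (\<eta> s $ i) + space_reg S i"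
        and vw: "norm (v s) \<le> n" "norm (w s) \<le> n"
        using elim unfolding x_def by blast
      have "\<bar>\<psi> $ i\<bar> \<le> m i" for i
      proof -
        obtain o\<^sub>i where o: "o\<^sub>i\<in>omega S i (\<tau> s $ i)" and \<psi>i: "\<psi> $ i = rho S i (norm (q_i S i (z s) (e s) (w s)))
          - o\<^sub>i * gam_bar S i * beta_coeff S i * (Wf S i (\<epsilon> s + wh s - w s))\<^sup>2
          - sig S i (\<eta> s $ i) + space_reg S i" using \<psi> by blast
        have "norm (blk S i (\<epsilon> s + wh s - w s)) \<le> K\<epsilon> + norm (wh a) + n"
          using norm_blk_le[of i "\<epsilon> s + wh s - w s"] norm_triangle_ineq4[of "\<epsilon> s + wh s" "w s"]
            norm_triangle_ineq[of "\<epsilon> s" "wh s"] K\<epsilon>[OF s(2)] arg_cong[of _ _ norm, OF wh[OF s(2)]] vw(2) by linarith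
        then have "Wf S i (\<epsilon> s + wh s - w s) \<le> beta_hi S i * (K\<epsilon> + norm (wh a) + n)"
          using W_bounds(3)[of i "\<epsilon> s + wh s - w s"] W_beta(2)[of i]
          by (meson mult_left_mono less_imp_le order_trans)
        then have "(Wf S i (\<epsilon> s + wh s - w s))\<^sup>2 \<le> (beta_hi S i * (K\<epsilon> + norm (wh a) + n))\<^sup>2"
          using W_bounds(1) by (intro power_mono) auto
        moreover have beta_nn: "0 \<le> beta_coeff S i" by (simp add: beta_coeff_def)
        moreover have "o\<^sub>i * gam_bar S i * beta_coeff S i \<le> 1 * gam_bar S i * beta_coeff S i"
          using omega01[OF o] gam_bar_nonneg[of i] beta_nn by (intro mult_right_mono) auto
        ultimately have "o\<^sub>i * gam_bar S i * beta_coeff S i * (Wf S i (\<epsilon> s + wh s - w s))\<^sup>2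
            \<le> gam_bar S i * beta_coeff S i * (beta_hi S i * (K\<epsilon> + norm (wh a) + n))\<^sup>2"
          by - (rule mult_mono, simp_all add: gam_bar_nonneg)
        moreover have "sig S i (\<eta> s $ i) \<le> sig S i (K\<eta> i)"
          by (rule class_K_inf_mono[OF tuningD(6) \<eta>_nn[OF s(2)] K\<eta>[OF s(2)]])
        moreover have "0 \<le> sig S i (\<eta> s $ i)" by (rule class_K_inf_nonneg[OF tuningD(6) \<eta>_nn[OF s(2)]])
        moreover have "0 \<le> o\<^sub>i * gam_bar S i * beta_coeff S i * (Wf S i (\<epsilon> s + wh s - w s))\<^sup>2"
          by (rule trig_nn) (use omega01[OF o] in simp)
        ultimately show ?thesis
          using \<psi>i rho_le[OF s(2) vw, of i] rho_nonneg[of i "q_i S i (z s) (e s) (w s)"] tuningD(7)[of i]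
          unfolding m_def abs_le_iff by linarith
      qed
      then have "norm \<psi> \<le> (\<Sum>i\<in>UNIV. m i)"
        by (intro order_trans[OF norm_le_l1_cart] sum_mono)
      moreover define A B where "A = fp S (ho S (z s)) 0 - fp S (x s) (v s)"
        and "B = hp_rate (ho S (z s)) 0 - hp_rate (x s) (v s)"
      moreover have "norm A \<le> Me" "norm B \<le> M\<epsilon>"
        unfolding A_def B_def by (intro Me(2) M\<epsilon>(2) Kc(2) Kx(2) s vw)+
      moreover have "norm (A, B, (0::real^'m), (1::real^'N), \<psi>) \<le> norm A + (norm B + (norm (1::real^'N) + norm \<psi>))"
        using norm_Pair_le[of A "(B, (0::real^'m), (1::real^'N), \<psi>)"] norm_Pair_le[of B "((0::real^'m), (1::real^'N), \<psi>)"]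
          norm_Pair_le[of "0::real^'m" "((1::real^'N), \<psi>)"] norm_Pair_le[of "1::real^'N" \<psi>] by simp
      ultimately have "norm (A, B, (0::real^'m), (1::real^'N), \<psi>) \<le> K" unfolding K_def by linarith
      then have "norm (fp S (ho S (z s)) 0 - fp S (x s) (v s), hp_rate (ho S (z s)) 0 - hp_rate (x s) (v s), (0::real^'m), (1::real^'N), \<psi>) \<le> K"
        by (simp only: A_def B_def)
      then show "\<exists>D. ((\<lambda>s. snd (\<xi> s k)) has_vector_derivative D) (at s) \<and> norm D \<le> K"
        using proj[OF der bl_snd] by (intro exI conjI) (simp_all only: snd_conv)
    qed
  qed
  have m_nn: "0 \<le> m i" for i
  proof -
    have "0 \<le> K\<eta> i" using \<eta>_nn[of a i] K\<eta>[of a i] \<open>a < R\<close> by simp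
    then show ?thesis
      unfolding m_def using C\<rho>_nn[of i] gam_bar_nonneg[of i] tuningD(7)[of i]
      by (intro add_nonneg_nonneg mult_nonneg_nonneg class_K_inf_nonneg[OF tuningD(6)]) (auto simp: beta_coeff_def)
  qed
  then have "0 \<le> K" unfolding K_def using Me(1) M\<epsilon>(1) by (intro add_nonneg_nonneg sum_nonneg) auto
  have lip: "K-lipschitz_on {a..<R} (\<lambda>t. snd (\<xi> t k))"
  proof (rule lipschitz_onI[OF _ \<open>0 \<le> K\<close>])
    fix s t assume st: "s \<in> {a..<R}" "t \<in> {a..<R}"
    define c where "c = max s t"
    have "c < R" using st by (simp add: c_def)
    have "K-lipschitz_on {a..c} (\<lambda>t. snd (\<xi> t k))"
    proof (rule lipschitz_on_curve[OF ac[OF \<open>c < R\<close>] \<open>0 \<le> K\<close> calm_at_linear[OF bl_snd]])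
      show "AE s in lebesgue. s \<in> {a<..<c} \<longrightarrow> (\<exists>D. ((\<lambda>s. snd (\<xi> s k)) has_vector_derivative D) (at s) \<and> norm D \<le> K)"
        using drv_snd by eventually_elim (use \<open>c < R\<close> in auto)
    qed
    then show "dist (snd (\<xi> s k)) (snd (\<xi> t k)) \<le> K * dist s t"
      using st by (auto simp: lipschitz_on_def c_def)
  qed
  have "closure {a..<R} = {a..R}" using \<open>a < R\<close> by simp
  then obtain G where G: "K-lipschitz_on {a..R} G" "\<And>t. t \<in> {a..<R} \<Longrightarrow> G t = snd (\<xi> t k)"
    using lipschitz_extend_closure[OF lip] by auto
  \<comment> \<open>The observer state is continued by the comparison solution, all other components
    by the Lipschitz extension to the closure.\<close>
  define X where "X t = (Z (t + - a), G t)" for t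
  define U where "U t = (if t \<in> {a..<R} then \<nu> t k else 0)" for t
  have X_eq: "X t = \<xi> t k" if "t \<in> {a..<R}" for t
    using Z(2)[of "t + - a"] G(2)[OF that] that by (simp add: X_def T_def z_def prod_eq_iff)
  show ?thesis
  proof (rule extension_not_maximal[OF sol, where k = k and I = "{R}" and a = a and b = R and X = X and U = U and c = n])
    show "slice E k \<noteq> {}" unfolding slice_k using \<open>a < R\<close> by simp
    show "{R} \<noteq> {}" by simp
    show "t < s" if "s \<in> {R}" "(t, i) \<in> E" for s t i using last[OF that(2)] that(1) by simp
    show "slice E k \<union> {R} = {a..R}" unfolding slice_k using \<open>a < R\<close> by auto
    show "X t = \<xi> t k" "U t = \<nu> t k" if "t \<in> slice E k" for t
      using that unfolding slice_k by (simp_all add: X_eq U_def)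
    have "abs_cont_on (\<lambda>t. Z (t + - a)) {a..R}" by (rule abs_cont_on_shift) (use Z(1)[of "R + - a"] in simp)
    then show "abs_cont_on X {a..R}"
      unfolding X_def by (intro abs_cont_on_Pair abs_cont_on_lipschitz[OF G(1)])
    show "X t \<in> flow_set (hybrid_model S (\<lambda>i. 0))" if "t \<in> {a<..<R}" for t
    proof -
      have "t \<in> {a..<R}" using that by auto
      then have "t \<in> slice E k" unfolding slice_k .
      then have "(t, k) \<in> E" by (simp add: slice_def)
      then show ?thesis using X_eq[OF \<open>t \<in> {a..<R}\<close>] in_state_space by (simp add: flow_set_hybrid_model)
    qed
    have "U \<in> borel_measurable lebesgue" unfolding U_def using meas_\<nu> by (subst borel_measurable_if) auto
    then show "U \<in> borel_measurable (lebesgue_on {a..R})" by (rule measurable_restrict_space1)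
    show "AE t in lebesgue. t \<in> {a..R} \<longrightarrow> norm (U t) \<le> n"
      using flow[of k] by eventually_elim (use \<open>0 \<le> n\<close> in \<open>auto simp: U_def slice_k n_def\<close>)
    show "AE t in lebesgue. t \<in> {a<..<R} \<longrightarrow>
        (\<exists>d\<in>flow_map (hybrid_model S (\<lambda>i. 0)) (X t) (U t). (X has_vector_derivative d) (at t))"
      using flow[of k]
    proof eventually_elim
      case (elim t)
      show ?case
      proof
        assume t: "t \<in> {a<..<R}"
        then have t': "t \<in> {a..<R}" by auto
        then have "t \<in> slice E k" unfolding slice_k .
        then obtain d where d: "d \<in> flow_F S (\<xi> t k) (\<nu> t k)" "((\<lambda>s. \<xi> s k) has_vector_derivative d) (at t)"
          using elim by blast
        have "(X has_vector_derivative d) (at t)"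
          by (rule has_vector_derivative_transform_within_open[OF d(2), of "{a<..<R}"]) (use t X_eq in auto)
        then show "\<exists>d\<in>flow_map (hybrid_model S (\<lambda>i. 0)) (X t) (U t). (X has_vector_derivative d) (at t)"
          using d(1) t' by (auto simp: hybrid_model_def X_eq U_def)
      qed
    qed
  qed
qed

lemma maximal_imp_unbounded:
  assumes max: "maximal_solution_pair (hybrid_model S (\<lambda>i. 0)) E \<xi> \<nu>"
  shows "\<not> bdd_above (fst ` E)"
proof
  assume bdd: "bdd_above (fst ` E)"
  define R where "R = Sup (fst ` E)"
  have ne: "fst ` E \<noteq> {}" using hybrid_time_domain_0[OF domain] by blast
  have le: "t \<le> R" if "(t, i) \<in> E" for t i
    unfolding R_def using bdd that by (intro cSup_upper) (auto intro: rev_image_eqI)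
  have not_attained: "(R, i) \<notin> E" for i
  proof
    assume "(R, i) \<in> E"
    from not_maximal_of_last_time_attained[OF this] le max show False by blast
  qed
  have less: "t < R" if "(t, i) \<in> E" for t i
    using le[OF that] not_attained[of i] that by (cases "t = R") auto
  obtain B where B: "\<And>t j. (t, j) \<in> E \<Longrightarrow> t \<le> R \<Longrightarrow> j \<le> B" by (rule finitely_many_jumps) (rule that)
  \<comment> \<open>Only finitely many slices exist up to \<open>R\<close>. If each of them stayed
    away from \<open>R\<close>, so would the whole domain; hence one slice approaches
    \<open>R\<close>, although it need not be the one with the largest index.\<close>
  have "\<exists>k. \<forall>r<R. \<exists>t. (t, k) \<in> E \<and> r < t"
  proof (rule ccontr)
    assume "\<not> ?thesis"
    then obtain r where r: "\<And>k. r k < R" "\<And>k t. (t, k) \<in> E \<Longrightarrow> t \<le> r k"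
      by (metis not_le)
    define r' where "r' = Max (r ` {..B})"
    have "r' < R" using r(1) by (simp add: r'_def)
    moreover have "R \<le> r'"
      unfolding R_def
    proof (rule cSup_least[OF ne])
      fix s assume "s \<in> fst ` E"
      then obtain k where k: "(s, k) \<in> E" by auto
      then have "k \<le> B" using B le by blast
      then have "r k \<le> r'" by (simp add: r'_def)
      then show "s \<le> r'" using r(2)[OF k] by simp
    qed
    ultimately show False by simp
  qed
  then obtain k where k: "\<And>r. r < R \<Longrightarrow> \<exists>t. (t, k) \<in> E \<and> r < t" by blast
  obtain x where x: "(x, k) \<in> E" using k[of "R - 1"] by auto
  obtain t where t: "t 0 = 0" "\<And>j. j \<le> k \<Longrightarrow> t j \<le> t (Suc j)" "t (Suc k) = x"
    and Ex: "E \<inter> ({0..x} \<times> {0..k}) = (\<Union>j\<le>k. {t j..t (Suc j)} \<times> {j})"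
    by (rule hybrid_time_domain_prefix[OF domain x]) (rule that)
  define a where "a = t k"
  have "(a, k) \<in> (\<Union>j\<le>k. {t j..t (Suc j)} \<times> {j})" using t(2)[of k] by (auto simp: a_def)
  then have a: "(a, k) \<in> E" unfolding Ex[symmetric] by blast
  have "slice E k = {a..<R}"
  proof (intro equalityI subsetI)
    fix s assume s: "s \<in> slice E k"
    then have sE: "(s, k) \<in> E" by (simp add: slice_def)
    have "a \<le> s"
    proof (cases "s \<le> x")
      case True
      then have "(s, k) \<in> E \<inter> ({0..x} \<times> {0..k})" using sE nonneg by auto
      then show ?thesis unfolding Ex by (auto simp: a_def)
    next
      case False
      then show ?thesis using t(2)[of k] t(3) by (simp add: a_def)
    qed
    then show "s \<in> {a..<R}" using less[OF sE] by simp
  next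
    fix s assume s: "s \<in> {a..<R}"
    then obtain u where u: "(u, k) \<in> E" "s < u" using k[of s] by auto
    have "a \<in> slice E k" "u \<in> slice E k" using a u(1) by (auto simp: slice_def)
    then show "s \<in> slice E k"
      using slice_convex[OF domain, of k] s u(2) mem_is_interval_1_I[of "slice E k" a u s]
      by (simp add: is_interval_convex_1)
  qed
  then have "\<not> maximal_solution_pair (hybrid_model S (\<lambda>i. 0)) E \<xi> \<nu>"
    by (rule not_maximal_of_last_time_missing[OF _ less[OF a]]) (rule less)
  then show False using max by blast
qed

end

theorem theorem5:
  fixes S :: "('n::finite, 'p::finite, 'q::finite, 'm::finite, 'N::finite) scheme"
  assumes "plant_assms S"
    and "observer_assms S"
    and "growth_assms S"
    and "dissipation_assms S"
    and "tuning_assms S"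
  defines "\<H> \<equiv> hybrid_model S (\<lambda>i. 0)"
  shows "persistently_flowing \<H> \<and>
    ((\<forall>i. space_reg S i = 0) \<longrightarrow> ISS \<H> (held_noise_sampled S) target_set) \<and>
    ((\<exists>i. space_reg S i > 0) \<longrightarrow> ISpS \<H> (held_noise_sampled S) target_set)"
proof -
  obtain V \<alpha> \<alpha>lo \<alpha>hi \<zeta> \<mu> where "estimator S V \<alpha> \<alpha>lo \<alpha>hi \<zeta> \<mu>"
    using assms(1-5) unfolding dissipation_assms_def estimator_def by blast
  then interpret estimator S V \<alpha> \<alpha>lo \<alpha>hi \<zeta> \<mu> .
  have "persistently_flowing \<H>"
    unfolding persistently_flowing_def
  proof (intro allI impI)
    fix E \<xi> \<nu> assume *: "maximal_solution_pair \<H> E \<xi> \<nu> \<and> hybrid_Linf E \<nu>"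
    interpret solution S V \<alpha> \<alpha>lo \<alpha>hi \<zeta> \<mu> E \<xi> \<nu>
      by unfold_locales (use * in \<open>auto simp: \<H>_def maximal_solution_pair_def\<close>)
    show "\<not> bdd_above (fst ` E)" using * by (intro maximal_imp_unbounded) (simp add: \<H>_def)
  qed
  moreover obtain d where "0 \<le> d" "(\<forall>i. space_reg S i = 0) \<longrightarrow> d = 0"
    "ISpS_with d \<H> (held_noise_sampled S) target_set"
    using ISpS_with_space_reg unfolding \<H>_def by blast
  ultimately show ?thesis unfolding ISS_def ISpS_def by auto
qed

end
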